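(* Let $A$ be a finite dimensional symmetric algebra over a field $k$, and $P\in K^{\mathrm b}(\mathrm{proj}\,A)$ a partial tilting complex of length $r+1$. Then the following are equivalent. 1. $H^i(\Delta_r(P,A))=0$ for all $i>0$. 2. $\Theta_n(P,A)$ is a tilting complex for any $n\ge r$.
   Context: $A$ is symmetric if $A\cong\mathrm{Hom}_k(A,k)$ as $A$-bimodules. Modules are right modules; $D(A)$ is the derived category of $\mathrm{Mod}\,A$, $K(A)$ the homotopy category of complexes of $A$-modules, $K^{\mathrm b}(\mathrm{proj}\,A)$ the bounded homotopy category of finitely generated projectives, and $\mathrm{add}\,M$ consists of summands of finite direct sums of copies of $M$. A partial tilting complex is a perfect complex $P$ with $\mathrm{Hom}_{D(A)}(P,P[n])=0$ for $n\neq0$; it is a tilting complex if moreover $\mathrm{add}\,P$ generates $K^{\mathrm b}(\mathrm{proj}\,A)$ as a triangulated category. The length of a complex $X$ is $l(X)=\max\{n:H^n(X)\ne0\}-\min\{n:H^n(X)\neq0\}+1$. Construction: let $M$ be a finitely generated $A$-module and $P: P^{s-r}\to\cdots\to P^{s-1}\to P^s$ a partial tilting complex in $K^{\mathrm b}(\mathrm{proj}\,A)$ of length $r+1$. Put $\Delta_0(P,M)=M$. For $n\geq1$ define inductively $\Delta_n(P,M)$ by a triangle \[ P_n[n+s-r-1]\xrightarrow{g_n}\Delta_{n-1}(P,M)\xrightarrow{h_n}\Delta_n(P,M)\to P_n[n+s-r]: \] if $\mathrm{Hom}_{K(A)}(P,\Delta_{n-1}(P,M)[r-s-n+1])=0$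 put $P_n=0$; otherwise take $P_n\in\mathrm{add}\,P$ and $g_n':P_n\to\Delta_{n-1}(P,M)[r-s-n+1]$ such that $\mathrm{Hom}_{K(A)}(P,g_n')$ is a projective cover of $\mathrm{End}_{D(A)}(P)$-modules, and $g_n=g_n'[n+s-r-1]$. Put $\Theta_n(P,M)=\Delta_n(P,M)\oplus P[n+s-r]$. *)

theory Defs
  imports "HOL-Algebra.Module" "HOL-Algebra.AbelCoset"
begin

section \<open>Algebras\<close>

text \<open>The library locale \<open>algebra\<close> is for commutative algebras only.\<close>

definition fin_dim_algebra :: "('k, 'kx) ring_scheme \<Rightarrow> ('k, 'a, 'ax) module_scheme \<Rightarrow> bool" where
  "fin_dim_algebra K A \<longleftrightarrow>
     field K \<and> ring A \<and> module K A \<and>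
     (\<forall>c\<in>carrier K. \<forall>x\<in>carrier A. \<forall>y\<in>carrier A.
        (c \<odot>\<^bsub>A\<^esub> x) \<otimes>\<^bsub>A\<^esub> y = c \<odot>\<^bsub>A\<^esub> (x \<otimes>\<^bsub>A\<^esub> y) \<and>
        x \<otimes>\<^bsub>A\<^esub> (c \<odot>\<^bsub>A\<^esub> y) = c \<odot>\<^bsub>A\<^esub> (x \<otimes>\<^bsub>A\<^esub> y)) \<and>
     (\<exists>B. finite B \<and> B \<subseteq> carrier A \<and>
        (\<forall>x\<in>carrier A. \<exists>c\<in>B \<rightarrow> carrier K. x = (\<Oplus>\<^bsub>A\<^esub>b\<in>B. c b \<odot>\<^bsub>A\<^esub> b)))"

definition linear_forms :: "('k, 'kx) ring_scheme \<Rightarrow> ('k, 'a, 'ax) module_scheme \<Rightarrow> ('a \<Rightarrow> 'k) set" where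
  "linear_forms K A =
     {f \<in> carrier A \<rightarrow>\<^sub>E carrier K.
        (\<forall>x\<in>carrier A. \<forall>y\<in>carrier A. f (x \<oplus>\<^bsub>A\<^esub> y) = f x \<oplus>\<^bsub>K\<^esub> f y) \<and>
        (\<forall>c\<in>carrier K. \<forall>x\<in>carrier A. f (c \<odot>\<^bsub>A\<^esub> x) = c \<otimes>\<^bsub>K\<^esub> f x)}"

text \<open>\<open>A\<close> is isomorphic to \<open>Hom\<^sub>k(A,k)\<close> as an \<open>A\<close>-bimodule, where the bimodule
  structure on the dual is \<open>(a f b)(y) = f(b y a)\<close>.\<close>

definition symmetric_algebra :: "('k, 'kx) ring_scheme \<Rightarrow> ('k, 'a, 'ax) module_scheme \<Rightarrow> bool" where
  "symmetric_algebra K A \<longleftrightarrow>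
     (\<exists>\<phi>. bij_betw \<phi> (carrier A) (linear_forms K A) \<and>
        (\<forall>x\<in>carrier A. \<forall>y\<in>carrier A. \<forall>z\<in>carrier A.
           \<phi> (x \<oplus>\<^bsub>A\<^esub> y) z = \<phi> x z \<oplus>\<^bsub>K\<^esub> \<phi> y z) \<and>
        (\<forall>a\<in>carrier A. \<forall>x\<in>carrier A. \<forall>b\<in>carrier A. \<forall>y\<in>carrier A.
           \<phi> (a \<otimes>\<^bsub>A\<^esub> x \<otimes>\<^bsub>A\<^esub> b) y = \<phi> x (b \<otimes>\<^bsub>A\<^esub> y \<otimes>\<^bsub>A\<^esub> a)))"

section \<open>Right modules\<close>

text \<open>The library locale \<open>module\<close> is for commutative rings only.  We use its record type
  for right modules over an arbitrary ring: \<open>r \<odot>\<^bsub>M\<^esub> x\<close> stands for \<open>x r\<close>.  The fields \<open>mult\<close>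
  and \<open>one\<close> of a module record carry no meaning.\<close>

locale right_module = R?: ring R + M?: abelian_group M
  for R (structure) and M :: "('r, 'm, 'mx) module_scheme" (structure) +
  assumes rsmult_closed: "\<lbrakk>a \<in> carrier R; x \<in> carrier M\<rbrakk> \<Longrightarrow> a \<odot>\<^bsub>M\<^esub> x \<in> carrier M"
    and rsmult_l_distr: "\<lbrakk>a \<in> carrier R; b \<in> carrier R; x \<in> carrier M\<rbrakk> \<Longrightarrow>
      (a \<oplus>\<^bsub>R\<^esub> b) \<odot>\<^bsub>M\<^esub> x = a \<odot>\<^bsub>M\<^esub> x \<oplus>\<^bsub>M\<^esub> b \<odot>\<^bsub>M\<^esub> x"
    and rsmult_r_distr: "\<lbrakk>a \<in> carrier R; x \<in> carrier M; y \<in> carrier M\<rbrakk> \<Longrightarrow>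
      a \<odot>\<^bsub>M\<^esub> (x \<oplus>\<^bsub>M\<^esub> y) = a \<odot>\<^bsub>M\<^esub> x \<oplus>\<^bsub>M\<^esub> a \<odot>\<^bsub>M\<^esub> y"
    and rsmult_assoc: "\<lbrakk>a \<in> carrier R; b \<in> carrier R; x \<in> carrier M\<rbrakk> \<Longrightarrow>
      (a \<otimes>\<^bsub>R\<^esub> b) \<odot>\<^bsub>M\<^esub> x = b \<odot>\<^bsub>M\<^esub> (a \<odot>\<^bsub>M\<^esub> x)"
    and rsmult_one: "x \<in> carrier M \<Longrightarrow> \<one>\<^bsub>R\<^esub> \<odot>\<^bsub>M\<^esub> x = x"

definition rm_hom ::
  "('r, 'rx) ring_scheme \<Rightarrow> ('r, 'm) module \<Rightarrow> ('r, 'n) module \<Rightarrow> ('m \<Rightarrow> 'n) set" where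
  "rm_hom R M N =
     {f \<in> carrier M \<rightarrow> carrier N.
        (\<forall>x\<in>carrier M. \<forall>y\<in>carrier M. f (x \<oplus>\<^bsub>M\<^esub> y) = f x \<oplus>\<^bsub>N\<^esub> f y) \<and>
        (\<forall>r\<in>carrier R. \<forall>x\<in>carrier M. f (r \<odot>\<^bsub>M\<^esub> x) = r \<odot>\<^bsub>N\<^esub> f x)}"

definition regular_module :: "('r, 'rx) ring_scheme \<Rightarrow> ('r, 'r) module" where
  "regular_module R =
     \<lparr>carrier = carrier R, mult = mult R, one = one R, zero = zero R, add = add R,
      smult = (\<lambda>r x. x \<otimes>\<^bsub>R\<^esub> r)\<rparr>"

definition zero_module :: "('r, 'm) module \<Rightarrow> ('r, 'm) module" where
  "zero_module M = M\<lparr>carrier := {\<zero>\<^bsub>M\<^esub>}\<rparr>"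

definition mod_dsum :: "('r, 'm) module \<Rightarrow> ('r, 'n) module \<Rightarrow> ('r, 'm \<times> 'n) module" where
  "mod_dsum M N =
     \<lparr>carrier = carrier M \<times> carrier N, mult = undefined, one = undefined,
      zero = (\<zero>\<^bsub>M\<^esub>, \<zero>\<^bsub>N\<^esub>),
      add = (\<lambda>(x, y) (x', y'). (x \<oplus>\<^bsub>M\<^esub> x', y \<oplus>\<^bsub>N\<^esub> y')),
      smult = (\<lambda>r (x, y). (r \<odot>\<^bsub>M\<^esub> x, r \<odot>\<^bsub>N\<^esub> y))\<rparr>"

definition mod_power :: "('r, 'm) module \<Rightarrow> nat \<Rightarrow> ('r, nat \<Rightarrow> 'm) module" where
  "mod_power M n =
     \<lparr>carrier = {..<n} \<rightarrow>\<^sub>E carrier M, mult = undefined, one = undefined,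
      zero = (\<lambda>i\<in>{..<n}. \<zero>\<^bsub>M\<^esub>),
      add = (\<lambda>u v. \<lambda>i\<in>{..<n}. u i \<oplus>\<^bsub>M\<^esub> v i),
      smult = (\<lambda>r u. \<lambda>i\<in>{..<n}. r \<odot>\<^bsub>M\<^esub> u i)\<rparr>"

text \<open>Finitely generated projective: a direct summand of a free module of finite rank.\<close>

definition fg_projective :: "('r, 'rx) ring_scheme \<Rightarrow> ('r, 'm) module \<Rightarrow> bool" where
  "fg_projective R M \<longleftrightarrow>
     right_module R M \<and>
     (\<exists>n. \<exists>i \<in> rm_hom R M (mod_power (regular_module R) n).
          \<exists>p \<in> rm_hom R (mod_power (regular_module R) n) M.
            \<forall>x\<in>carrier M. p (i x) = x)"

text \<open>Projective covers are only used for finitely generated modules; the source of a projective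
  cover of a finitely generated module is again finitely generated.\<close>

definition projective_cover ::
  "('r, 'rx) ring_scheme \<Rightarrow> ('r, 'm) module \<Rightarrow> ('r, 'n) module \<Rightarrow> ('m \<Rightarrow> 'n) \<Rightarrow> bool" where
  "projective_cover R Q M \<pi> \<longleftrightarrow>
     fg_projective R Q \<and> right_module R M \<and>
     \<pi> \<in> rm_hom R Q M \<and> \<pi> ` carrier Q = carrier M \<and>
     (\<forall>N. submodule N R Q \<and> N <+>\<^bsub>Q\<^esub> a_kernel Q M \<pi> = carrier Q \<longrightarrow> N = carrier Q)"

section \<open>Complexes and the homotopy category\<close>

record ('a, 'm) cplx =
  Ob :: "int \<Rightarrow> ('a, 'm) module"
  Diff :: "int \<Rightarrow> 'm \<Rightarrow> 'm"

definition is_complex :: "('a, 'ax) ring_scheme \<Rightarrow> ('a, 'm) cplx \<Rightarrow> bool" where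
  "is_complex A X \<longleftrightarrow>
     (\<forall>n. right_module A (Ob X n) \<and>
          Diff X n \<in> rm_hom A (Ob X n) (Ob X (n + 1)) \<and>
          (\<forall>x\<in>carrier (Ob X n). Diff X (n + 1) (Diff X n x) = \<zero>\<^bsub>Ob X (n + 1 + 1)\<^esub>))"

definition chain_map ::
  "('a, 'ax) ring_scheme \<Rightarrow> ('a, 'm) cplx \<Rightarrow> ('a, 'n) cplx \<Rightarrow> (int \<Rightarrow> 'm \<Rightarrow> 'n) set" where
  "chain_map A X Y =
     {f. \<forall>n. f n \<in> rm_hom A (Ob X n) (Ob Y n) \<and>
             (\<forall>x\<in>carrier (Ob X n). f (n + 1) (Diff X n x) = Diff Y n (f n x))}"

definition id_map :: "int \<Rightarrow> 'm \<Rightarrow> 'm" where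
  "id_map = (\<lambda>n x. x)"

definition zero_map :: "('a, 'n) cplx \<Rightarrow> int \<Rightarrow> 'm \<Rightarrow> 'n" where
  "zero_map Y = (\<lambda>n x. \<zero>\<^bsub>Ob Y n\<^esub>)"

definition add_map ::
  "('a, 'n) cplx \<Rightarrow> (int \<Rightarrow> 'm \<Rightarrow> 'n) \<Rightarrow> (int \<Rightarrow> 'm \<Rightarrow> 'n) \<Rightarrow> int \<Rightarrow> 'm \<Rightarrow> 'n" where
  "add_map Y f g = (\<lambda>n x. f n x \<oplus>\<^bsub>Ob Y n\<^esub> g n x)"

definition comp_map :: "(int \<Rightarrow> 'n \<Rightarrow> 'l) \<Rightarrow> (int \<Rightarrow> 'm \<Rightarrow> 'n) \<Rightarrow> int \<Rightarrow> 'm \<Rightarrow> 'l" where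
  "comp_map g f = (\<lambda>n x. g n (f n x))"

definition homotopic ::
  "('a, 'ax) ring_scheme \<Rightarrow> ('a, 'm) cplx \<Rightarrow> ('a, 'n) cplx \<Rightarrow>
   (int \<Rightarrow> 'm \<Rightarrow> 'n) \<Rightarrow> (int \<Rightarrow> 'm \<Rightarrow> 'n) \<Rightarrow> bool" where
  "homotopic A X Y f g \<longleftrightarrow>
     (\<exists>h. \<forall>n. h n \<in> rm_hom A (Ob X n) (Ob Y (n - 1)) \<and>
        (\<forall>x\<in>carrier (Ob X n).
           f n x = g n x \<oplus>\<^bsub>Ob Y n\<^esub> (Diff Y (n - 1) (h n x) \<oplus>\<^bsub>Ob Y n\<^esub> h (n + 1) (Diff X n x))))"

definition homotopy_class ::
  "('a, 'ax) ring_scheme \<Rightarrow> ('a, 'm) cplx \<Rightarrow> ('a, 'n) cplx \<Rightarrow>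
   (int \<Rightarrow> 'm \<Rightarrow> 'n) \<Rightarrow> (int \<Rightarrow> 'm \<Rightarrow> 'n) set" where
  "homotopy_class A X Y f = {g \<in> chain_map A X Y. homotopic A X Y f g}"

text \<open>\<open>End\<^bsub>K(A)\<^esub>(P)\<close> and the right \<open>End\<^bsub>K(A)\<^esub>(P)\<close>-module \<open>Hom\<^bsub>K(A)\<^esub>(P,Y)\<close>, on which
  endomorphisms act by precomposition.  The unions below are over representatives of classes, and
  all their members coincide.  For \<open>P\<close> in \<open>K\<^sup>b(proj A)\<close> the ring \<open>End\<^bsub>K(A)\<^esub>(P)\<close> is
  \<open>End\<^bsub>D(A)\<^esub>(P)\<close>, through which \<open>Hom\<^bsub>K(A)\<^esub>(P,Y)\<close> is an \<open>End\<^bsub>D(A)\<^esub>(P)\<close>-module.\<close>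

definition end_ring ::
  "('a, 'ax) ring_scheme \<Rightarrow> ('a, 'm) cplx \<Rightarrow> (int \<Rightarrow> 'm \<Rightarrow> 'm) set ring" where
  "end_ring A P =
     \<lparr>carrier = homotopy_class A P P ` chain_map A P P,
      mult = (\<lambda>C D. \<Union>f\<in>C. \<Union>g\<in>D. homotopy_class A P P (comp_map f g)),
      one = homotopy_class A P P id_map,
      zero = homotopy_class A P P (zero_map P),
      add = (\<lambda>C D. \<Union>f\<in>C. \<Union>g\<in>D. homotopy_class A P P (add_map P f g))\<rparr>"

definition homK_module ::
  "('a, 'ax) ring_scheme \<Rightarrow> ('a, 'm) cplx \<Rightarrow> ('a, 'n) cplx \<Rightarrow>
   ((int \<Rightarrow> 'm \<Rightarrow> 'm) set, (int \<Rightarrow> 'm \<Rightarrow> 'n) set) module" where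
  "homK_module A P Y =
     \<lparr>carrier = homotopy_class A P Y ` chain_map A P Y,
      mult = undefined, one = undefined,
      zero = homotopy_class A P Y (zero_map Y),
      add = (\<lambda>C D. \<Union>f\<in>C. \<Union>g\<in>D. homotopy_class A P Y (add_map Y f g)),
      smult = (\<lambda>E C. \<Union>e\<in>E. \<Union>f\<in>C. homotopy_class A P Y (comp_map f e))\<rparr>"

text \<open>\<open>Hom\<^bsub>K(A)\<^esub>(P,g)\<close> for a chain map \<open>g\<close> with target \<open>Z\<close>.\<close>

definition homK_map ::
  "('a, 'ax) ring_scheme \<Rightarrow> ('a, 'm) cplx \<Rightarrow> ('a, 'l) cplx \<Rightarrow> (int \<Rightarrow> 'n \<Rightarrow> 'l) \<Rightarrow>
   (int \<Rightarrow> 'm \<Rightarrow> 'n) set \<Rightarrow> (int \<Rightarrow> 'm \<Rightarrow> 'l) set" where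
  "homK_map A P Z g = (\<lambda>C. \<Union>f\<in>C. homotopy_class A P Z (comp_map g f))"

definition stalk :: "('a, 'm) module \<Rightarrow> ('a, 'm) cplx" where
  "stalk M =
     \<lparr>Ob = (\<lambda>n. if n = 0 then M else zero_module M), Diff = (\<lambda>n x. \<zero>\<^bsub>M\<^esub>)\<rparr>"

definition zero_complex :: "('a, 'm) cplx \<Rightarrow> bool" where
  "zero_complex X \<longleftrightarrow> (\<forall>n. carrier (Ob X n) = {\<zero>\<^bsub>Ob X n\<^esub>})"

definition shift :: "int \<Rightarrow> ('a, 'm) cplx \<Rightarrow> ('a, 'm) cplx" where
  "shift k X =
     \<lparr>Ob = (\<lambda>n. Ob X (n + k)),
      Diff = (\<lambda>n x. if even k then Diff X (n + k) x
                    else \<ominus>\<^bsub>Ob X (n + 1 + k)\<^esub> Diff X (n + k) x)\<rparr>"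

definition shift_map :: "int \<Rightarrow> (int \<Rightarrow> 'm \<Rightarrow> 'n) \<Rightarrow> int \<Rightarrow> 'm \<Rightarrow> 'n" where
  "shift_map k f = (\<lambda>n. f (n + k))"

definition dsum :: "('a, 'm) cplx \<Rightarrow> ('a, 'n) cplx \<Rightarrow> ('a, 'm \<times> 'n) cplx" where
  "dsum X Y =
     \<lparr>Ob = (\<lambda>n. mod_dsum (Ob X n) (Ob Y n)),
      Diff = (\<lambda>n (x, y). (Diff X n x, Diff Y n y))\<rparr>"

definition cpower :: "('a, 'm) cplx \<Rightarrow> nat \<Rightarrow> ('a, nat \<Rightarrow> 'm) cplx" where
  "cpower X m =
     \<lparr>Ob = (\<lambda>n. mod_power (Ob X n) m),
      Diff = (\<lambda>n u. \<lambda>i\<in>{..<m}. Diff X n (u i))\<rparr>"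

definition cone ::
  "('a, 'm) cplx \<Rightarrow> ('a, 'n) cplx \<Rightarrow> (int \<Rightarrow> 'm \<Rightarrow> 'n) \<Rightarrow> ('a, 'm \<times> 'n) cplx" where
  "cone X Y f =
     \<lparr>Ob = (\<lambda>n. mod_dsum (Ob X (n + 1)) (Ob Y n)),
      Diff = (\<lambda>n (x, y). (\<ominus>\<^bsub>Ob X (n + 1 + 1)\<^esub> Diff X (n + 1) x,
                          f (n + 1) x \<oplus>\<^bsub>Ob Y (n + 1)\<^esub> Diff Y n y))\<rparr>"

section \<open>Cohomology and the derived category\<close>

definition cocycles :: "('a, 'm) cplx \<Rightarrow> int \<Rightarrow> 'm set" where
  "cocycles X n = a_kernel (Ob X n) (Ob X (n + 1)) (Diff X n)"

definition coboundaries :: "('a, 'm) cplx \<Rightarrow> int \<Rightarrow> 'm set" where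
  "coboundaries X n = Diff X (n - 1) ` carrier (Ob X (n - 1))"

definition cohomology :: "('a, 'm) cplx \<Rightarrow> int \<Rightarrow> 'm set set" where
  "cohomology X n = (\<lambda>x. coboundaries X n +>\<^bsub>Ob X n\<^esub> x) ` cocycles X n"

text \<open>\<open>H\<^sup>n(X) = 0\<close>: the only coset is the zero coset.\<close>

definition cohomology_zero :: "('a, 'm) cplx \<Rightarrow> int \<Rightarrow> bool" where
  "cohomology_zero X n \<longleftrightarrow> cohomology X n = {coboundaries X n}"

definition cohomology_map ::
  "('a, 'n) cplx \<Rightarrow> (int \<Rightarrow> 'm \<Rightarrow> 'n) \<Rightarrow> int \<Rightarrow> 'm set \<Rightarrow> 'n set" where
  "cohomology_map Y f n = (\<lambda>C. \<Union>x\<in>C. coboundaries Y n +>\<^bsub>Ob Y n\<^esub> f n x)"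

definition quasi_iso ::
  "('a, 'ax) ring_scheme \<Rightarrow> ('a, 'm) cplx \<Rightarrow> ('a, 'n) cplx \<Rightarrow> (int \<Rightarrow> 'm \<Rightarrow> 'n) \<Rightarrow> bool" where
  "quasi_iso A X Y f \<longleftrightarrow>
     f \<in> chain_map A X Y \<and>
     (\<forall>n. bij_betw (cohomology_map Y f n) (cohomology X n) (cohomology Y n))"

text \<open>Morphisms \<open>X \<rightarrow> Y\<close> in \<open>D(A)\<close> are roofs \<open>X \<leftarrow> Z \<rightarrow> Y\<close>, with left leg a quasi-isomorphism,
  modulo equivalence.  The apex \<open>Z\<close> ranges over complexes of modules on the element type of
  \<open>X\<close>.  This computes the morphisms of the derived category as soon as that type
  contains a copy of \<open>\<nat> \<times> A\<close>: it is then infinite and at least as large as \<open>A\<close>, so every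
  complex on it has a K-projective resolution on it.\<close>

type_synonym ('a, 'm, 'n) roof =
  "('a, 'm) cplx \<times> (int \<Rightarrow> 'm \<Rightarrow> 'm) \<times> (int \<Rightarrow> 'm \<Rightarrow> 'n)"

definition roofs ::
  "('a, 'ax) ring_scheme \<Rightarrow> ('a, 'm) cplx \<Rightarrow> ('a, 'n) cplx \<Rightarrow> ('a, 'm, 'n) roof set" where
  "roofs A X Y =
     {(Z, s, f). is_complex A Z \<and> quasi_iso A Z X s \<and> f \<in> chain_map A Z Y}"

definition roof_equiv ::
  "('a, 'ax) ring_scheme \<Rightarrow> ('a, 'm) cplx \<Rightarrow> ('a, 'n) cplx \<Rightarrow>
   ('a, 'm, 'n) roof \<Rightarrow> ('a, 'm, 'n) roof \<Rightarrow> bool" where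
  "roof_equiv A X Y = (\<lambda>(Z, s, f) (Z', s', f').
     \<exists>(W :: ('a, 'm) cplx) u u'.
        is_complex A W \<and> u \<in> chain_map A W Z \<and> u' \<in> chain_map A W Z' \<and>
        quasi_iso A W X (comp_map s u) \<and>
        homotopic A W X (comp_map s u) (comp_map s' u') \<and>
        homotopic A W Y (comp_map f u) (comp_map f' u'))"

definition homD_zero ::
  "('a, 'ax) ring_scheme \<Rightarrow> ('a, 'm) cplx \<Rightarrow> ('a, 'n) cplx \<Rightarrow> bool" where
  "homD_zero A X Y \<longleftrightarrow>
     (\<forall>\<rho> \<in> roofs A X Y. roof_equiv A X Y \<rho> (X, id_map, zero_map Y))"

text \<open>A roof is invertible in \<open>D(A)\<close> iff its right leg is a quasi-isomorphism as well.\<close>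

definition derived_iso ::
  "('a, 'ax) ring_scheme \<Rightarrow> ('a, 'm) cplx \<Rightarrow> ('a, 'n) cplx \<Rightarrow> bool" where
  "derived_iso A X Y \<longleftrightarrow> (\<exists>(Z, s, f) \<in> roofs A X Y. quasi_iso A Z Y f)"

section \<open>Perfect and tilting complexes\<close>

definition in_Kb_proj :: "('a, 'ax) ring_scheme \<Rightarrow> ('a, 'm) cplx \<Rightarrow> bool" where
  "in_Kb_proj A X \<longleftrightarrow>
     is_complex A X \<and> (\<forall>n. fg_projective A (Ob X n)) \<and>
     finite {n. carrier (Ob X n) \<noteq> {\<zero>\<^bsub>Ob X n\<^esub>}}"

definition perfect :: "('a, 'ax) ring_scheme \<Rightarrow> ('a, 'm) cplx \<Rightarrow> bool" where
  "perfect A X \<longleftrightarrow>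
     is_complex A X \<and> (\<exists>Q :: ('a, 'm) cplx. in_Kb_proj A Q \<and> derived_iso A Q X)"

definition in_add :: "('a, 'ax) ring_scheme \<Rightarrow> ('a, 'n) cplx \<Rightarrow> ('a, 'm) cplx \<Rightarrow> bool" where
  "in_add A Y X \<longleftrightarrow>
     is_complex A X \<and>
     (\<exists>m. \<exists>X' :: ('a, 'm) cplx. is_complex A X' \<and> derived_iso A (dsum X X') (cpower Y m))"

text \<open>The smallest strictly full triangulated subcategory of \<open>D(A)\<close> containing the objects
  in \<open>S\<close>.\<close>

inductive tri_generated ::
  "('a, 'ax) ring_scheme \<Rightarrow> (('a, 'm) cplx \<Rightarrow> bool) \<Rightarrow> ('a, 'm) cplx \<Rightarrow> bool"
  for A S where
  base: "S X \<Longrightarrow> is_complex A X \<Longrightarrow> tri_generated A S X"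
| iso: "tri_generated A S X \<Longrightarrow> is_complex A Y \<Longrightarrow> derived_iso A X Y \<Longrightarrow> tri_generated A S Y"
| shift: "tri_generated A S X \<Longrightarrow> tri_generated A S (shift k X)"
| cone: "tri_generated A S X \<Longrightarrow> tri_generated A S Y \<Longrightarrow> f \<in> chain_map A X Y \<Longrightarrow>
         is_complex A Z \<Longrightarrow> derived_iso A Z (cone X Y f) \<Longrightarrow> tri_generated A S Z"

definition partial_tilting :: "('a, 'ax) ring_scheme \<Rightarrow> ('a, 'm) cplx \<Rightarrow> bool" where
  "partial_tilting A P \<longleftrightarrow> perfect A P \<and> (\<forall>n. n \<noteq> 0 \<longrightarrow> homD_zero A P (shift n P))"

text \<open>\<open>add P\<close> generates \<open>K\<^sup>b(proj A)\<close>: the triangulated subcategory it generates contains all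
  perfect complexes; as \<open>P\<close> is perfect, it contains nothing else.\<close>

definition tilting :: "('a, 'ax) ring_scheme \<Rightarrow> ('a, 'm) cplx \<Rightarrow> bool" where
  "tilting A P \<longleftrightarrow>
     partial_tilting A P \<and>
     (\<forall>X :: ('a, 'm) cplx. perfect A X \<longrightarrow> tri_generated A (in_add A P) X)"

definition cohomological_support :: "('a, 'm) cplx \<Rightarrow> int set" where
  "cohomological_support X = {n. \<not> cohomology_zero X n}"

definition has_length :: "('a, 'm) cplx \<Rightarrow> int \<Rightarrow> bool" where
  "has_length X l \<longleftrightarrow>
     finite (cohomological_support X) \<and> cohomological_support X \<noteq> {} \<and>
     l = Max (cohomological_support X) - Min (cohomological_support X) + 1"

section \<open>The complexes \<open>\<Delta>\<^sub>n\<close> and \<open>\<Theta>\<^sub>n\<close>\<close>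

text \<open>\<open>(\<Delta>, Q, g)\<close> is one run of the construction: \<open>\<Delta> n\<close>, \<open>Q n\<close> and \<open>g n\<close> are choices of
  \<open>\<Delta>\<^sub>n(P,M)\<close>, \<open>P\<^sub>n\<close> and \<open>g\<^sub>n'\<close>.  A triangle with first morphism \<open>g\<^sub>n\<close> exists on \<open>\<Delta> n\<close>
  iff \<open>\<Delta> n\<close> is isomorphic in \<open>D(A)\<close> to the mapping cone of \<open>g\<^sub>n\<close>.  All objects of \<open>D(A)\<close>
  are only specified up to isomorphism in \<open>D(A)\<close>, including \<open>\<Delta>\<^sub>0(P,M) = M\<close>.\<close>

definition Delta_construction ::
  "('a, 'ax) ring_scheme \<Rightarrow> ('a, 'm) cplx \<Rightarrow> nat \<Rightarrow> int \<Rightarrow> ('a, 'v) module \<Rightarrow>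
   (nat \<Rightarrow> ('a, 'm) cplx) \<Rightarrow> (nat \<Rightarrow> ('a, 'm) cplx) \<Rightarrow> (nat \<Rightarrow> int \<Rightarrow> 'm \<Rightarrow> 'm) \<Rightarrow> bool" where
  "Delta_construction A P r s M \<Delta> Q g \<longleftrightarrow>
     is_complex A (\<Delta> 0) \<and> derived_iso A (\<Delta> 0) (stalk M) \<and>
     (\<forall>n\<ge>1.
        let T = shift (int r - s - int n + 1) (\<Delta> (n - 1)) in
          in_Kb_proj A (Q n) \<and>
          g n \<in> chain_map A (Q n) T \<and>
          (if carrier (homK_module A P T) = {\<zero>\<^bsub>homK_module A P T\<^esub>}
           then zero_complex (Q n)
           else in_add A P (Q n) \<and>
                projective_cover (end_ring A P) (homK_module A P (Q n)) (homK_module A P T)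
                  (homK_map A P T (g n))) \<and>
          is_complex A (\<Delta> n) \<and>
          derived_iso A (\<Delta> n)
            (cone (shift (int n + s - int r - 1) (Q n)) (\<Delta> (n - 1))
                  (shift_map (int n + s - int r - 1) (g n))))"

definition Theta ::
  "('a, 'm) cplx \<Rightarrow> nat \<Rightarrow> int \<Rightarrow> (nat \<Rightarrow> ('a, 'm) cplx) \<Rightarrow> nat \<Rightarrow> ('a, 'm \<times> 'm) cplx" where
  "Theta P r s \<Delta> n = dsum (\<Delta> n) (shift (int n + s - int r) P)"

end

theory Submission
  imports Defs
begin

text \<open>In \<open>K\<^sup>b(proj A)\<close> the form of \<open>A\<close> gives a trace pairing under which \<open>Hom(X,Y) = 0\<close> implies
  \<open>Hom(Y,X) = 0\<close>.  Since \<open>P\<close> is partial tilting, each triangle kills one more degree of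
  \<open>Hom(P, \<Delta>\<^sub>n[i])\<close>, until for \<open>n \<ge> r\<close> only the degree \<open>i = r-s-n\<close> is left.  By duality the
  same holds for \<open>Hom(\<Delta>\<^sub>n, P[i])\<close> and \<open>i = n+s-r\<close>, so for \<open>i > 0\<close> the triangles reduce
  \<open>Hom(\<Delta>\<^sub>n, \<Delta>\<^sub>n[-i])\<close> to \<open>Hom(\<Delta>\<^sub>n, A[-i])\<close>, which is dual to \<open>Hom(A, \<Delta>\<^sub>n[i]) = H\<^sup>i(\<Delta>\<^sub>n)\<close>.
  For generation, an object of \<open>add (\<Delta>\<^sub>n \<oplus> P[n+s-r])\<close> is an extension of an object of
  \<open>add (\<Delta>\<^sub>n\<^sub>+\<^sub>1 \<oplus> P[n+1+s-r])\<close> by one of \<open>add P[n+s-r]\<close>; perfect complexes are iterated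
  extensions of shifts of objects of \<open>add A\<close>, and \<open>\<Delta>\<^sub>0 = A\<close>.\<close>

section \<open>Modules\<close>

text \<open>Two obstacles shape the development. The data are given in D(A), by roofs and up to
  isomorphism, while the trace pairing lives on bounded complexes of projectives. So a run of the
  construction is replayed in K^b(proj A): maps out of such complexes lift uniquely, up to homotopy,
  along quasi-isomorphisms, and this turns the maps \<open>g n\<close> into a sequence of models
  \<open>R n\<close> over the given \<open>\<Delta> n\<close>. The projective covers enter it as a
  lifting property for maps from shifts of \<open>P\<close>. The other obstacle is that a complex
  carries its element type: cones and sums change that type, whereas sequences, complements and
  generated subcategories stay on one type. Hence the injections \<open>J\<close>,
  \<open>J'\<close>, \<open>E0\<close> and the transport \<open>push\<close>. Hom groups enter
  through their vanishing, which makes every exact sequence a few implications. Membership in an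
  additive closure is expressed by factorizations of the identity, so that direct sum decompositions
  are chosen only at the end, where \<open>in_add\<close> asks for them.\<close>

locale complexes_over =
  fixes A :: "('a, 'ax) ring_scheme"
  assumes ring_A: "ring A"
begin

abbreviation rmod :: "('a, 'm) module \<Rightarrow> bool" where "rmod M \<equiv> right_module A M"
abbreviation hom :: "('a, 'm) module \<Rightarrow> ('a, 'n) module \<Rightarrow> ('m \<Rightarrow> 'n) set" where
  "hom M N \<equiv> rm_hom A M N"

lemma ring_A_closed [simp]:
  "\<zero>\<^bsub>A\<^esub> \<in> carrier A" "\<one>\<^bsub>A\<^esub> \<in> carrier A"
  "a \<in> carrier A \<Longrightarrow> b \<in> carrier A \<Longrightarrow> a \<oplus>\<^bsub>A\<^esub> b \<in> carrier A"
  "a \<in> carrier A \<Longrightarrow> b \<in> carrier A \<Longrightarrow> a \<otimes>\<^bsub>A\<^esub> b \<in> carrier A"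
  using ring.ring_simprules[OF ring_A] by auto

lemma rmod_ab: "rmod M \<Longrightarrow> abelian_group M"
  by (simp add: right_module_def)

lemma rmod_simps [simp]:
  assumes "rmod M"
  shows "\<zero>\<^bsub>M\<^esub> \<in> carrier M"
    and "x \<in> carrier M \<Longrightarrow> y \<in> carrier M \<Longrightarrow> x \<oplus>\<^bsub>M\<^esub> y \<in> carrier M"
    and "x \<in> carrier M \<Longrightarrow> \<ominus>\<^bsub>M\<^esub> x \<in> carrier M"
    and "x \<in> carrier M \<Longrightarrow> \<zero>\<^bsub>M\<^esub> \<oplus>\<^bsub>M\<^esub> x = x"
    and "x \<in> carrier M \<Longrightarrow> x \<oplus>\<^bsub>M\<^esub> \<zero>\<^bsub>M\<^esub> = x"
    and "x \<in> carrier M \<Longrightarrow> x \<oplus>\<^bsub>M\<^esub> \<ominus>\<^bsub>M\<^esub> x = \<zero>\<^bsub>M\<^esub>"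
    and "x \<in> carrier M \<Longrightarrow> \<ominus>\<^bsub>M\<^esub> x \<oplus>\<^bsub>M\<^esub> x = \<zero>\<^bsub>M\<^esub>"
    and "x \<in> carrier M \<Longrightarrow> \<ominus>\<^bsub>M\<^esub> (\<ominus>\<^bsub>M\<^esub> x) = x"
    and "\<ominus>\<^bsub>M\<^esub> \<zero>\<^bsub>M\<^esub> = \<zero>\<^bsub>M\<^esub>"
    and "a \<in> carrier A \<Longrightarrow> x \<in> carrier M \<Longrightarrow> a \<odot>\<^bsub>M\<^esub> x \<in> carrier M"
proof -
  interpret abelian_group M using assms by (rule rmod_ab)
  show "\<zero>\<^bsub>M\<^esub> \<in> carrier M"
    and "x \<in> carrier M \<Longrightarrow> y \<in> carrier M \<Longrightarrow> x \<oplus>\<^bsub>M\<^esub> y \<in> carrier M"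
    and "x \<in> carrier M \<Longrightarrow> \<ominus>\<^bsub>M\<^esub> x \<in> carrier M"
    and "x \<in> carrier M \<Longrightarrow> \<zero>\<^bsub>M\<^esub> \<oplus>\<^bsub>M\<^esub> x = x"
    and "x \<in> carrier M \<Longrightarrow> x \<oplus>\<^bsub>M\<^esub> \<zero>\<^bsub>M\<^esub> = x"
    and "x \<in> carrier M \<Longrightarrow> x \<oplus>\<^bsub>M\<^esub> \<ominus>\<^bsub>M\<^esub> x = \<zero>\<^bsub>M\<^esub>"
    and "x \<in> carrier M \<Longrightarrow> \<ominus>\<^bsub>M\<^esub> x \<oplus>\<^bsub>M\<^esub> x = \<zero>\<^bsub>M\<^esub>"
    and "x \<in> carrier M \<Longrightarrow> \<ominus>\<^bsub>M\<^esub> (\<ominus>\<^bsub>M\<^esub> x) = x"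
    and "\<ominus>\<^bsub>M\<^esub> \<zero>\<^bsub>M\<^esub> = \<zero>\<^bsub>M\<^esub>"
    by (simp_all add: r_neg l_neg)
  show "a \<in> carrier A \<Longrightarrow> x \<in> carrier M \<Longrightarrow> a \<odot>\<^bsub>M\<^esub> x \<in> carrier M"
    using assms by (simp add: right_module.rsmult_closed)
qed

lemma rmod_ac:
  assumes "rmod M" "x \<in> carrier M" "y \<in> carrier M"
  shows "z \<in> carrier M \<Longrightarrow> x \<oplus>\<^bsub>M\<^esub> y \<oplus>\<^bsub>M\<^esub> z = x \<oplus>\<^bsub>M\<^esub> (y \<oplus>\<^bsub>M\<^esub> z)"
    and "x \<oplus>\<^bsub>M\<^esub> y = y \<oplus>\<^bsub>M\<^esub> x"
    and "z \<in> carrier M \<Longrightarrow> x \<oplus>\<^bsub>M\<^esub> (y \<oplus>\<^bsub>M\<^esub> z) = y \<oplus>\<^bsub>M\<^esub> (x \<oplus>\<^bsub>M\<^esub> z)"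
    and "\<ominus>\<^bsub>M\<^esub> (x \<oplus>\<^bsub>M\<^esub> y) = \<ominus>\<^bsub>M\<^esub> x \<oplus>\<^bsub>M\<^esub> \<ominus>\<^bsub>M\<^esub> y"
proof -
  interpret abelian_group M using assms(1) by (rule rmod_ab)
  show "z \<in> carrier M \<Longrightarrow> x \<oplus>\<^bsub>M\<^esub> y \<oplus>\<^bsub>M\<^esub> z = x \<oplus>\<^bsub>M\<^esub> (y \<oplus>\<^bsub>M\<^esub> z)"
    and "x \<oplus>\<^bsub>M\<^esub> y = y \<oplus>\<^bsub>M\<^esub> x"
    and "z \<in> carrier M \<Longrightarrow> x \<oplus>\<^bsub>M\<^esub> (y \<oplus>\<^bsub>M\<^esub> z) = y \<oplus>\<^bsub>M\<^esub> (x \<oplus>\<^bsub>M\<^esub> z)"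
    and "\<ominus>\<^bsub>M\<^esub> (x \<oplus>\<^bsub>M\<^esub> y) = \<ominus>\<^bsub>M\<^esub> x \<oplus>\<^bsub>M\<^esub> \<ominus>\<^bsub>M\<^esub> y"
    using assms by (simp_all add: a_ac minus_add)
qed

lemma rmod_add_cancel:
  assumes "rmod M" "x \<in> carrier M" "y \<in> carrier M" "z \<in> carrier M"
  shows "x \<oplus>\<^bsub>M\<^esub> y = x \<oplus>\<^bsub>M\<^esub> z \<longleftrightarrow> y = z"
proof -
  interpret abelian_group M using assms(1) by (rule rmod_ab)
  show ?thesis using assms by simp
qed

lemma rmod_minus_unique:
  assumes "rmod M" "x \<in> carrier M" "y \<in> carrier M" "x \<oplus>\<^bsub>M\<^esub> y = \<zero>\<^bsub>M\<^esub>"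
  shows "x = \<ominus>\<^bsub>M\<^esub> y"
proof -
  interpret abelian_group M using assms(1) by (rule rmod_ab)
  show ?thesis using assms by (simp add: minus_equality)
qed

lemma rmod_double:
  assumes "rmod M" "x \<in> carrier M" "x \<oplus>\<^bsub>M\<^esub> x = x"
  shows "x = \<zero>\<^bsub>M\<^esub>"
  using rmod_add_cancel[of M x x "\<zero>\<^bsub>M\<^esub>"] assms by simp

lemma rmod_smult:
  assumes "rmod M" "x \<in> carrier M" "a \<in> carrier A"
  shows "y \<in> carrier M \<Longrightarrow> a \<odot>\<^bsub>M\<^esub> (x \<oplus>\<^bsub>M\<^esub> y) = a \<odot>\<^bsub>M\<^esub> x \<oplus>\<^bsub>M\<^esub> a \<odot>\<^bsub>M\<^esub> y"
    and "b \<in> carrier A \<Longrightarrow> (a \<oplus>\<^bsub>A\<^esub> b) \<odot>\<^bsub>M\<^esub> x = a \<odot>\<^bsub>M\<^esub> x \<oplus>\<^bsub>M\<^esub> b \<odot>\<^bsub>M\<^esub> x"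
    and "b \<in> carrier A \<Longrightarrow> b \<odot>\<^bsub>M\<^esub> (a \<odot>\<^bsub>M\<^esub> x) = (a \<otimes>\<^bsub>A\<^esub> b) \<odot>\<^bsub>M\<^esub> x"
    and "\<one>\<^bsub>A\<^esub> \<odot>\<^bsub>M\<^esub> x = x"
    and "a \<odot>\<^bsub>M\<^esub> \<zero>\<^bsub>M\<^esub> = \<zero>\<^bsub>M\<^esub>"
    and "\<zero>\<^bsub>A\<^esub> \<odot>\<^bsub>M\<^esub> x = \<zero>\<^bsub>M\<^esub>"
    and "a \<odot>\<^bsub>M\<^esub> (\<ominus>\<^bsub>M\<^esub> x) = \<ominus>\<^bsub>M\<^esub> (a \<odot>\<^bsub>M\<^esub> x)"
proof -
  interpret R: ring A by (rule ring_A)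
  interpret abelian_group M using assms(1) by (rule rmod_ab)
  interpret right_module A M by (rule assms(1))
  show "y \<in> carrier M \<Longrightarrow> a \<odot>\<^bsub>M\<^esub> (x \<oplus>\<^bsub>M\<^esub> y) = a \<odot>\<^bsub>M\<^esub> x \<oplus>\<^bsub>M\<^esub> a \<odot>\<^bsub>M\<^esub> y"
    "b \<in> carrier A \<Longrightarrow> (a \<oplus>\<^bsub>A\<^esub> b) \<odot>\<^bsub>M\<^esub> x = a \<odot>\<^bsub>M\<^esub> x \<oplus>\<^bsub>M\<^esub> b \<odot>\<^bsub>M\<^esub> x"
    "b \<in> carrier A \<Longrightarrow> b \<odot>\<^bsub>M\<^esub> (a \<odot>\<^bsub>M\<^esub> x) = (a \<otimes>\<^bsub>A\<^esub> b) \<odot>\<^bsub>M\<^esub> x"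
    "\<one>\<^bsub>A\<^esub> \<odot>\<^bsub>M\<^esub> x = x"
    using assms by (simp_all add: rsmult_r_distr rsmult_l_distr rsmult_assoc rsmult_one)
  show z: "a \<odot>\<^bsub>M\<^esub> \<zero>\<^bsub>M\<^esub> = \<zero>\<^bsub>M\<^esub>"
    using assms rsmult_r_distr[of a "\<zero>\<^bsub>M\<^esub>" "\<zero>\<^bsub>M\<^esub>"] by (intro rmod_double) simp_all
  show "\<zero>\<^bsub>A\<^esub> \<odot>\<^bsub>M\<^esub> x = \<zero>\<^bsub>M\<^esub>"
    using assms rsmult_l_distr[of "\<zero>\<^bsub>A\<^esub>" "\<zero>\<^bsub>A\<^esub>" x] by (intro rmod_double) simp_all
  have "a \<odot>\<^bsub>M\<^esub> (\<ominus>\<^bsub>M\<^esub> x) \<oplus>\<^bsub>M\<^esub> a \<odot>\<^bsub>M\<^esub> x = \<zero>\<^bsub>M\<^esub>"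
    using assms rsmult_r_distr[of a "\<ominus>\<^bsub>M\<^esub> x" x] z by (simp add: l_neg)
  then show "a \<odot>\<^bsub>M\<^esub> (\<ominus>\<^bsub>M\<^esub> x) = \<ominus>\<^bsub>M\<^esub> (a \<odot>\<^bsub>M\<^esub> x)"
    using assms by (simp add: minus_equality rsmult_closed)
qed

text \<open>Reduces an identity between six elements of a module to one between integer vectors.\<close>

lemma int_vectors:
  assumes M: "rmod M" and x: "x1 \<in> carrier M" "x2 \<in> carrier M" "x3 \<in> carrier M"
      "x4 \<in> carrier M" "x5 \<in> carrier M" "x6 \<in> carrier M"
    and *: "\<And>(L :: (nat \<Rightarrow> int) \<Rightarrow> 'm) d1 d2 d3 d4 d5 d6.
      \<lbrakk>x1 = L d1; x2 = L d2; x3 = L d3; x4 = L d4; x5 = L d5; x6 = L d6;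
       \<And>a b. L a \<oplus>\<^bsub>M\<^esub> L b = L (\<lambda>k. a k + b k); \<And>a. \<ominus>\<^bsub>M\<^esub> (L a) = L (\<lambda>k. - a k);
       \<zero>\<^bsub>M\<^esub> = L (\<lambda>k. 0)\<rbrakk> \<Longrightarrow> thesis"
  shows thesis
proof -
  interpret abelian_group M using M by (rule rmod_ab)
  define X where "X = [x1, x2, x3, x4, x5, x6]"
  have X: "X ! i \<in> carrier M" if "i < 6" for i
    using x that by (auto simp: X_def nth_Cons' )
  \<comment> \<open>\<open>L\<close> evaluates a coefficient vector at the six given elements. Sums,
    negatives and zero in \<open>M\<close> are images of the coordinatewise ones, so an identity
    follows once the coefficient functions agree. Callers with fewer elements fill up with zeros or
    repetitions.\<close>
  define L :: "(nat \<Rightarrow> int) \<Rightarrow> 'm" where "L = (\<lambda>c. \<Oplus>\<^bsub>M\<^esub>i\<in>{..<6::nat}. [c i] \<cdot>\<^bsub>M\<^esub> (X ! i))"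
  have cl: "[(k::int)] \<cdot>\<^bsub>M\<^esub> (X ! i) \<in> carrier M" if "i < 6" for i k
    using X[OF that] by (simp add: add.int_pow_closed)
  have add: "L a \<oplus>\<^bsub>M\<^esub> L b = L (\<lambda>k. a k + b k)" for a b
  proof -
    have "L (\<lambda>k. a k + b k) = (\<Oplus>\<^bsub>M\<^esub>i\<in>{..<6::nat}. [a i] \<cdot>\<^bsub>M\<^esub> (X ! i) \<oplus>\<^bsub>M\<^esub> [b i] \<cdot>\<^bsub>M\<^esub> (X ! i))"
      unfolding L_def using X cl by (intro finsum_cong') (auto simp: add.int_pow_mult)
    then show ?thesis unfolding L_def using cl by (subst (asm) finsum_addf) auto
  qed
  have cL: "L a \<in> carrier M" for a unfolding L_def by (auto intro!: finsum_closed cl)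
  have z: "\<zero>\<^bsub>M\<^esub> = L (\<lambda>k. 0)"
    using rmod_double[OF M cL, of "\<lambda>k. 0"] add[of "\<lambda>k. 0" "\<lambda>k. 0"] by simp
  have neg: "\<ominus>\<^bsub>M\<^esub> (L a) = L (\<lambda>k. - a k)" for a
    by (rule minus_equality) (simp_all add: cL add flip: z)
  have e: "X ! j = L (\<lambda>k. if k = j then 1 else 0)" if "j < 6" for j
  proof -
    have "L (\<lambda>k. if k = j then 1 else 0)
        = (\<Oplus>\<^bsub>M\<^esub>i\<in>{..<6::nat}. if j = i then X ! i else \<zero>\<^bsub>M\<^esub>)"
      unfolding L_def using X by (intro finsum_cong') (auto simp: add_pow_def int_pow_def)
    also have "\<dots> = X ! j" using X that by (subst finsum_singleton) auto
    finally show ?thesis by simp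
  qed
  show thesis
    by (rule *[OF e[of 0, unfolded X_def, simplified] e[of 1, unfolded X_def, simplified]
      e[of 2, unfolded X_def, simplified] e[of 3, unfolded X_def, simplified]
      e[of 4, unfolded X_def, simplified] e[of 5, unfolded X_def, simplified] add neg z])
qed

lemma rmod_smult_const [simp]:
  assumes "rmod M" "x \<in> carrier M"
  shows "\<one>\<^bsub>A\<^esub> \<odot>\<^bsub>M\<^esub> x = x" and "\<zero>\<^bsub>A\<^esub> \<odot>\<^bsub>M\<^esub> x = \<zero>\<^bsub>M\<^esub>"
  using rmod_smult(4,6)[OF assms ring_A_closed(1)] by auto

lemma rmod_smult_zero [simp]: "rmod M \<Longrightarrow> a \<in> carrier A \<Longrightarrow> a \<odot>\<^bsub>M\<^esub> \<zero>\<^bsub>M\<^esub> = \<zero>\<^bsub>M\<^esub>"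
  using rmod_smult(5)[of M "\<zero>\<^bsub>M\<^esub>" a] by simp

section \<open>Homomorphisms of right modules\<close>

lemma hom_rules:
  assumes "rmod M" "rmod N" "f \<in> hom M N"
  shows "x \<in> carrier M \<Longrightarrow> f x \<in> carrier N"
    and "x \<in> carrier M \<Longrightarrow> y \<in> carrier M \<Longrightarrow> f (x \<oplus>\<^bsub>M\<^esub> y) = f x \<oplus>\<^bsub>N\<^esub> f y"
    and "a \<in> carrier A \<Longrightarrow> x \<in> carrier M \<Longrightarrow> f (a \<odot>\<^bsub>M\<^esub> x) = a \<odot>\<^bsub>N\<^esub> f x"
    and "f \<zero>\<^bsub>M\<^esub> = \<zero>\<^bsub>N\<^esub>"
    and "x \<in> carrier M \<Longrightarrow> f (\<ominus>\<^bsub>M\<^esub> x) = \<ominus>\<^bsub>N\<^esub> f x"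
proof -
  interpret N: abelian_group N using assms(2) by (rule rmod_ab)
  show c: "\<And>x. x \<in> carrier M \<Longrightarrow> f x \<in> carrier N"
    and a: "\<And>x y. x \<in> carrier M \<Longrightarrow> y \<in> carrier M \<Longrightarrow> f (x \<oplus>\<^bsub>M\<^esub> y) = f x \<oplus>\<^bsub>N\<^esub> f y"
    and "a \<in> carrier A \<Longrightarrow> x \<in> carrier M \<Longrightarrow> f (a \<odot>\<^bsub>M\<^esub> x) = a \<odot>\<^bsub>N\<^esub> f x"
    using assms(3) by (auto simp: rm_hom_def)
  show z: "f \<zero>\<^bsub>M\<^esub> = \<zero>\<^bsub>N\<^esub>"
    using assms a[of "\<zero>\<^bsub>M\<^esub>" "\<zero>\<^bsub>M\<^esub>"] c by (intro rmod_double) simp_all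
  show "f (\<ominus>\<^bsub>M\<^esub> x) = \<ominus>\<^bsub>N\<^esub> f x" if "x \<in> carrier M"
    using a[of "\<ominus>\<^bsub>M\<^esub> x" x] that assms z by (intro N.minus_equality[symmetric]) (auto simp: c)
qed

lemma homI:
  assumes "\<And>x. x \<in> carrier M \<Longrightarrow> f x \<in> carrier N"
    and "\<And>x y. x \<in> carrier M \<Longrightarrow> y \<in> carrier M \<Longrightarrow> f (x \<oplus>\<^bsub>M\<^esub> y) = f x \<oplus>\<^bsub>N\<^esub> f y"
    and "\<And>a x. a \<in> carrier A \<Longrightarrow> x \<in> carrier M \<Longrightarrow> f (a \<odot>\<^bsub>M\<^esub> x) = a \<odot>\<^bsub>N\<^esub> f x"
  shows "f \<in> hom M N"
  using assms by (auto simp: rm_hom_def)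

lemma hom_id: "(\<lambda>x. x) \<in> hom M M"
  by (simp add: rm_hom_def)

lemma hom_comp: "f \<in> hom M N \<Longrightarrow> g \<in> hom N L \<Longrightarrow> (\<lambda>x. g (f x)) \<in> hom M L"
  by (auto simp: rm_hom_def Pi_iff)

lemma hom_zero: "rmod N \<Longrightarrow> (\<lambda>x. \<zero>\<^bsub>N\<^esub>) \<in> hom M N"
  using rmod_smult(5)[of N "\<zero>\<^bsub>N\<^esub>"] by (auto simp: rm_hom_def)

lemma hom_add:
  assumes "rmod M" "rmod N" "f \<in> hom M N" "g \<in> hom M N"
  shows "(\<lambda>x. f x \<oplus>\<^bsub>N\<^esub> g x) \<in> hom M N"
  using assms hom_rules[OF assms(1,2,3)] hom_rules[OF assms(1,2,4)]
  by (intro homI) (auto simp: rmod_smult rmod_ac)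

lemma hom_neg:
  assumes "rmod M" "rmod N" "f \<in> hom M N"
  shows "(\<lambda>x. \<ominus>\<^bsub>N\<^esub> f x) \<in> hom M N"
  using assms hom_rules[OF assms(1,2,3)]
  by (intro homI) (auto simp: rmod_smult rmod_ac)

lemma hom_cong:
  assumes "f \<in> hom M N" "\<And>x. x \<in> carrier M \<Longrightarrow> g x = f x" "rmod M"
  shows "g \<in> hom M N"
  using assms by (auto simp: rm_hom_def)

end

section \<open>Chain maps and homotopies\<close>

context complexes_over
begin

abbreviation cx :: "('a, 'm) cplx \<Rightarrow> bool" where "cx X \<equiv> is_complex A X"
abbreviation cm :: "('a, 'm) cplx \<Rightarrow> ('a, 'n) cplx \<Rightarrow> (int \<Rightarrow> 'm \<Rightarrow> 'n) set" where
  "cm X Y \<equiv> chain_map A X Y"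
abbreviation hty :: "('a, 'm) cplx \<Rightarrow> ('a, 'n) cplx \<Rightarrow> (int \<Rightarrow> 'm \<Rightarrow> 'n) \<Rightarrow> (int \<Rightarrow> 'm \<Rightarrow> 'n) \<Rightarrow> bool"
  where "hty X Y f g \<equiv> homotopic A X Y f g"
abbreviation null :: "('a, 'm) cplx \<Rightarrow> ('a, 'n) cplx \<Rightarrow> (int \<Rightarrow> 'm \<Rightarrow> 'n) \<Rightarrow> bool"
  where "null X Y f \<equiv> homotopic A X Y f (zero_map Y)"

definition neg_map :: "('a, 'n) cplx \<Rightarrow> (int \<Rightarrow> 'm \<Rightarrow> 'n) \<Rightarrow> int \<Rightarrow> 'm \<Rightarrow> 'n" where
  "neg_map Y f = (\<lambda>n x. \<ominus>\<^bsub>Ob Y n\<^esub> f n x)"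

lemma cx_rmod [simp]: "cx X \<Longrightarrow> rmod (Ob X n)"
  by (simp add: is_complex_def)

lemma diff_hom: "cx X \<Longrightarrow> Diff X n \<in> hom (Ob X n) (Ob X (n + 1))"
  by (simp add: is_complex_def)

lemma diff_rules:
  assumes "cx X"
  shows "m = n + 1 \<Longrightarrow> x \<in> carrier (Ob X n) \<Longrightarrow> Diff X n x \<in> carrier (Ob X m)"
    and "x \<in> carrier (Ob X n) \<Longrightarrow> y \<in> carrier (Ob X n) \<Longrightarrow>
      Diff X n (x \<oplus>\<^bsub>Ob X n\<^esub> y) = Diff X n x \<oplus>\<^bsub>Ob X (n + 1)\<^esub> Diff X n y"
    and "a \<in> carrier A \<Longrightarrow> x \<in> carrier (Ob X n) \<Longrightarrow>
      Diff X n (a \<odot>\<^bsub>Ob X n\<^esub> x) = a \<odot>\<^bsub>Ob X (n + 1)\<^esub> Diff X n x"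
    and "Diff X n \<zero>\<^bsub>Ob X n\<^esub> = \<zero>\<^bsub>Ob X (n + 1)\<^esub>"
    and "x \<in> carrier (Ob X n) \<Longrightarrow>
      Diff X n (\<ominus>\<^bsub>Ob X n\<^esub> x) = \<ominus>\<^bsub>Ob X (n + 1)\<^esub> Diff X n x"
    and "m = n + 1 \<Longrightarrow> x \<in> carrier (Ob X n) \<Longrightarrow> Diff X m (Diff X n x) = \<zero>\<^bsub>Ob X (m + 1)\<^esub>"
  using hom_rules[OF cx_rmod[OF assms] cx_rmod[OF assms] diff_hom[OF assms, of n]] assms
  by (auto simp: is_complex_def)

lemma cm_hom: "f \<in> cm X Y \<Longrightarrow> f n \<in> hom (Ob X n) (Ob Y n)"
  by (simp add: chain_map_def)

lemma cm_rules:
  assumes "cx X" "cx Y" "f \<in> cm X Y"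
  shows "x \<in> carrier (Ob X n) \<Longrightarrow> f n x \<in> carrier (Ob Y n)"
    and "x \<in> carrier (Ob X n) \<Longrightarrow> y \<in> carrier (Ob X n) \<Longrightarrow>
      f n (x \<oplus>\<^bsub>Ob X n\<^esub> y) = f n x \<oplus>\<^bsub>Ob Y n\<^esub> f n y"
    and "a \<in> carrier A \<Longrightarrow> x \<in> carrier (Ob X n) \<Longrightarrow> f n (a \<odot>\<^bsub>Ob X n\<^esub> x) = a \<odot>\<^bsub>Ob Y n\<^esub> f n x"
    and "f n \<zero>\<^bsub>Ob X n\<^esub> = \<zero>\<^bsub>Ob Y n\<^esub>"
    and "x \<in> carrier (Ob X n) \<Longrightarrow> f n (\<ominus>\<^bsub>Ob X n\<^esub> x) = \<ominus>\<^bsub>Ob Y n\<^esub> f n x"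
    and "m = n + 1 \<Longrightarrow> x \<in> carrier (Ob X n) \<Longrightarrow> f m (Diff X n x) = Diff Y n (f n x)"
  using hom_rules[OF cx_rmod[OF assms(1)] cx_rmod[OF assms(2)] cm_hom[OF assms(3), of n]] assms
  by (auto simp: chain_map_def)

lemma cmI:
  assumes "\<And>n. f n \<in> hom (Ob X n) (Ob Y n)"
    and "\<And>n x. x \<in> carrier (Ob X n) \<Longrightarrow> f (n + 1) (Diff X n x) = Diff Y n (f n x)"
  shows "f \<in> cm X Y"
  using assms by (auto simp: chain_map_def)

lemma cm_id: "id_map \<in> cm X X"
  by (simp add: chain_map_def id_map_def hom_id)

lemma cm_comp: "f \<in> cm X Y \<Longrightarrow> g \<in> cm Y Z \<Longrightarrow> comp_map g f \<in> cm X Z"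
  by (auto simp: chain_map_def comp_map_def rm_hom_def Pi_iff)

lemma cm_zero: "cx X \<Longrightarrow> cx Y \<Longrightarrow> zero_map Y \<in> cm X Y"
  by (auto simp: chain_map_def zero_map_def hom_zero diff_rules)

lemma cm_add:
  assumes "cx X" "cx Y" "f \<in> cm X Y" "g \<in> cm X Y"
  shows "add_map Y f g \<in> cm X Y"
  using assms hom_add[OF cx_rmod[OF assms(1)] cx_rmod[OF assms(2)]]
  by (intro cmI) (auto simp: add_map_def cm_hom cm_rules[OF assms(1,2)] diff_rules)

lemma cm_neg:
  assumes "cx X" "cx Y" "f \<in> cm X Y"
  shows "neg_map Y f \<in> cm X Y"
  using assms hom_neg[OF cx_rmod[OF assms(1)] cx_rmod[OF assms(2)]]
  by (intro cmI) (auto simp: neg_map_def cm_hom cm_rules[OF assms(1,2)] diff_rules)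

lemma htyI:
  assumes "\<And>n. h n \<in> hom (Ob X n) (Ob Y (n - 1))"
    and "\<And>n x. x \<in> carrier (Ob X n) \<Longrightarrow>
      f n x = g n x \<oplus>\<^bsub>Ob Y n\<^esub> (Diff Y (n - 1) (h n x) \<oplus>\<^bsub>Ob Y n\<^esub> h (n + 1) (Diff X n x))"
  shows "hty X Y f g"
  using assms by (auto simp: homotopic_def)

lemma nullI:
  assumes "cx X" "cx Y" "\<And>n. h n \<in> hom (Ob X n) (Ob Y (n - 1))"
    and "\<And>n x. x \<in> carrier (Ob X n) \<Longrightarrow>
      f n x = Diff Y (n - 1) (h n x) \<oplus>\<^bsub>Ob Y n\<^esub> h (n + 1) (Diff X n x)"
  shows "null X Y f"
proof (rule htyI[of h])
  fix n x assume x: "x \<in> carrier (Ob X n)"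
  have "h n x \<in> carrier (Ob Y (n - 1))" "h (n + 1) (Diff X n x) \<in> carrier (Ob Y n)"
    using hom_rules(1)[OF _ _ assms(3)[of n] x] diff_rules(1)[OF assms(1) refl x]
      hom_rules(1)[OF _ _ assms(3)[of "n + 1"]] assms(1,2) by auto
  then show "f n x = zero_map Y n x \<oplus>\<^bsub>Ob Y n\<^esub>
      (Diff Y (n - 1) (h n x) \<oplus>\<^bsub>Ob Y n\<^esub> h (n + 1) (Diff X n x))"
    using assms x by (simp add: zero_map_def diff_rules)
qed (use assms in auto)

text \<open>The closure fact has a free index \<open>m\<close> with the premise
  \<open>m = n - 1\<close>, so that it also matches degrees such as \<open>n\<close> when a homotopy
  in degree \<open>n + 1\<close> follows a differential. The remaining facts spell out that
  \<open>h\<close> is a module map, ready for rewriting.\<close>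

lemma htyE:
  assumes "hty X Y f g" "cx X" "cx Y"
  obtains h where "\<And>n. h n \<in> hom (Ob X n) (Ob Y (n - 1))"
    and "\<And>n m x. m = n - 1 \<Longrightarrow> x \<in> carrier (Ob X n) \<Longrightarrow> h n x \<in> carrier (Ob Y m)"
    and "\<And>n x y. x \<in> carrier (Ob X n) \<Longrightarrow> y \<in> carrier (Ob X n) \<Longrightarrow>
      h n (x \<oplus>\<^bsub>Ob X n\<^esub> y) = h n x \<oplus>\<^bsub>Ob Y (n - 1)\<^esub> h n y"
    and "\<And>n a x. a \<in> carrier A \<Longrightarrow> x \<in> carrier (Ob X n) \<Longrightarrow>
      h n (a \<odot>\<^bsub>Ob X n\<^esub> x) = a \<odot>\<^bsub>Ob Y (n - 1)\<^esub> h n x"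
    and "\<And>n. h n \<zero>\<^bsub>Ob X n\<^esub> = \<zero>\<^bsub>Ob Y (n - 1)\<^esub>"
    and "\<And>n x. x \<in> carrier (Ob X n) \<Longrightarrow> h n (\<ominus>\<^bsub>Ob X n\<^esub> x) = \<ominus>\<^bsub>Ob Y (n - 1)\<^esub> h n x"
    and "\<And>n x. x \<in> carrier (Ob X n) \<Longrightarrow>
      f n x = g n x \<oplus>\<^bsub>Ob Y n\<^esub> (Diff Y (n - 1) (h n x) \<oplus>\<^bsub>Ob Y n\<^esub> h (n + 1) (Diff X n x))"
proof -
  obtain h where h: "\<And>n. h n \<in> hom (Ob X n) (Ob Y (n - 1))"
    and e: "\<And>n x. x \<in> carrier (Ob X n) \<Longrightarrow>
      f n x = g n x \<oplus>\<^bsub>Ob Y n\<^esub> (Diff Y (n - 1) (h n x) \<oplus>\<^bsub>Ob Y n\<^esub> h (n + 1) (Diff X n x))"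
    using assms(1) by (auto simp: homotopic_def)
  note r = hom_rules[OF cx_rmod[OF assms(2)] cx_rmod[OF assms(3)] h]
  show thesis by (rule that[OF h _ _ _ _ _ e]) (simp_all add: r)
qed

lemma nullE:
  assumes "null X Y f" "cx X" "cx Y"
  obtains h where "\<And>n. h n \<in> hom (Ob X n) (Ob Y (n - 1))"
    and "\<And>n m x. m = n - 1 \<Longrightarrow> x \<in> carrier (Ob X n) \<Longrightarrow> h n x \<in> carrier (Ob Y m)"
    and "\<And>n x y. x \<in> carrier (Ob X n) \<Longrightarrow> y \<in> carrier (Ob X n) \<Longrightarrow>
      h n (x \<oplus>\<^bsub>Ob X n\<^esub> y) = h n x \<oplus>\<^bsub>Ob Y (n - 1)\<^esub> h n y"
    and "\<And>n a x. a \<in> carrier A \<Longrightarrow> x \<in> carrier (Ob X n) \<Longrightarrow>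
      h n (a \<odot>\<^bsub>Ob X n\<^esub> x) = a \<odot>\<^bsub>Ob Y (n - 1)\<^esub> h n x"
    and "\<And>n. h n \<zero>\<^bsub>Ob X n\<^esub> = \<zero>\<^bsub>Ob Y (n - 1)\<^esub>"
    and "\<And>n x. x \<in> carrier (Ob X n) \<Longrightarrow> h n (\<ominus>\<^bsub>Ob X n\<^esub> x) = \<ominus>\<^bsub>Ob Y (n - 1)\<^esub> h n x"
    and "\<And>n x. x \<in> carrier (Ob X n) \<Longrightarrow>
      f n x = Diff Y (n - 1) (h n x) \<oplus>\<^bsub>Ob Y n\<^esub> h (n + 1) (Diff X n x)"
  using assms
  by (elim htyE) (auto simp: zero_map_def diff_rules)

text \<open>Chain maps are functions on whole element types, but only their values on carriers
  matter. Functions that agree there may still differ as terms; the zero homotopy identifies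
  them.\<close>

lemma hty_eq:
  assumes "cx X" "cx Y" "f \<in> cm X Y" "\<And>n x. x \<in> carrier (Ob X n) \<Longrightarrow> f n x = g n x"
  shows "hty X Y f g"
proof (rule htyI[of "\<lambda>n x. \<zero>\<^bsub>Ob Y (n - 1)\<^esub>" X Y f g])
  fix n x assume "x \<in> carrier (Ob X n)"
  moreover from this have "g n x \<in> carrier (Ob Y n)"
    using assms cm_rules(1)[OF assms(1-3), of x n] by simp
  ultimately show "f n x = g n x \<oplus>\<^bsub>Ob Y n\<^esub>
      (Diff Y (n - 1) \<zero>\<^bsub>Ob Y (n - 1)\<^esub> \<oplus>\<^bsub>Ob Y n\<^esub> \<zero>\<^bsub>Ob Y (n + 1 - 1)\<^esub>)"
    using assms diff_rules(4)[OF assms(2), of "n - 1"] by simp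
qed (use assms in \<open>auto simp: hom_zero\<close>)

lemma hty_refl: "cx X \<Longrightarrow> cx Y \<Longrightarrow> f \<in> cm X Y \<Longrightarrow> hty X Y f f"
  by (rule hty_eq) auto

lemma hty_sym:
  assumes "hty X Y f g" "cx X" "cx Y" "g \<in> cm X Y"
  shows "hty X Y g f"
  using assms(1-3)
proof (rule htyE)
  fix h assume h: "\<And>n. h n \<in> hom (Ob X n) (Ob Y (n - 1))"
    and h2: "\<And>n m x. m = n - 1 \<Longrightarrow> x \<in> carrier (Ob X n) \<Longrightarrow> h n x \<in> carrier (Ob Y m)"
    and e: "\<And>n x. x \<in> carrier (Ob X n) \<Longrightarrow>
      f n x = g n x \<oplus>\<^bsub>Ob Y n\<^esub> (Diff Y (n - 1) (h n x) \<oplus>\<^bsub>Ob Y n\<^esub> h (n + 1) (Diff X n x))"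
  show ?thesis
  proof (rule htyI[of "\<lambda>n x. \<ominus>\<^bsub>Ob Y (n - 1)\<^esub> h n x"])
    show "(\<lambda>x. \<ominus>\<^bsub>Ob Y (n - 1)\<^esub> h n x) \<in> hom (Ob X n) (Ob Y (n - 1))" for n
      using h assms by (simp add: hom_neg)
    fix n x assume x: "x \<in> carrier (Ob X n)"
    show "g n x = f n x \<oplus>\<^bsub>Ob Y n\<^esub> (Diff Y (n - 1) (\<ominus>\<^bsub>Ob Y (n - 1)\<^esub> h n x) \<oplus>\<^bsub>Ob Y n\<^esub>
        \<ominus>\<^bsub>Ob Y (n + 1 - 1)\<^esub> h (n + 1) (Diff X n x))"
      apply (rule int_vectors[of "Ob Y n" "g n x" "Diff Y (n - 1) (h n x)" "h (n + 1) (Diff X n x)"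
        "g n x" "g n x" "g n x"])
      using x assms diff_rules(5)[OF assms(3), of _ "n - 1"]
      by (simp_all add: cm_rules diff_rules h2 e)
  qed
qed

lemma hty_trans:
  assumes "hty X Y f g" "hty X Y g k" "cx X" "cx Y" "k \<in> cm X Y"
  shows "hty X Y f k"
  using assms(1,3,4)
proof (rule htyE)
  fix h assume h: "\<And>n. h n \<in> hom (Ob X n) (Ob Y (n - 1))"
    and h2: "\<And>n m x. m = n - 1 \<Longrightarrow> x \<in> carrier (Ob X n) \<Longrightarrow> h n x \<in> carrier (Ob Y m)"
    and e: "\<And>n x. x \<in> carrier (Ob X n) \<Longrightarrow>
      f n x = g n x \<oplus>\<^bsub>Ob Y n\<^esub> (Diff Y (n - 1) (h n x) \<oplus>\<^bsub>Ob Y n\<^esub> h (n + 1) (Diff X n x))"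
  from assms(2-4) show ?thesis
  proof (rule htyE)
    fix h' assume h': "\<And>n. h' n \<in> hom (Ob X n) (Ob Y (n - 1))"
      and h2': "\<And>n m x. m = n - 1 \<Longrightarrow> x \<in> carrier (Ob X n) \<Longrightarrow> h' n x \<in> carrier (Ob Y m)"
      and e': "\<And>n x. x \<in> carrier (Ob X n) \<Longrightarrow>
        g n x = k n x \<oplus>\<^bsub>Ob Y n\<^esub> (Diff Y (n - 1) (h' n x) \<oplus>\<^bsub>Ob Y n\<^esub> h' (n + 1) (Diff X n x))"
    show ?thesis
      by (rule htyI[of "\<lambda>n x. h' n x \<oplus>\<^bsub>Ob Y (n - 1)\<^esub> h n x"])
        (use assms h h' diff_rules(2)[OF assms(4), of _ "n - 1" for n] in
          \<open>auto simp: hom_add cm_rules diff_rules rmod_ac h2 h2' e e'\<close>)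
  qed
qed

lemma hty_comp_left:
  assumes "hty X Y f g" "u \<in> cm Y Z" "cx X" "cx Y" "cx Z" "g \<in> cm X Y"
  shows "hty X Z (comp_map u f) (comp_map u g)"
  using assms(1,3,4)
proof (rule htyE)
  fix h assume h: "\<And>n. h n \<in> hom (Ob X n) (Ob Y (n - 1))"
    and h2: "\<And>n m x. m = n - 1 \<Longrightarrow> x \<in> carrier (Ob X n) \<Longrightarrow> h n x \<in> carrier (Ob Y m)"
    and e: "\<And>n x. x \<in> carrier (Ob X n) \<Longrightarrow>
      f n x = g n x \<oplus>\<^bsub>Ob Y n\<^esub> (Diff Y (n - 1) (h n x) \<oplus>\<^bsub>Ob Y n\<^esub> h (n + 1) (Diff X n x))"
  note ur = cm_rules[OF assms(4,5,2)]
  show ?thesis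
    by (rule htyI[of "\<lambda>n x. u (n - 1) (h n x)"])
      (use assms in \<open>auto simp: comp_map_def cm_rules ur diff_rules h2 e
        intro: hom_comp[OF h] cm_hom\<close>)
qed

lemma hty_comp_right:
  assumes "hty X Y f g" "u \<in> cm W X" "cx W" "cx X" "cx Y"
  shows "hty W Y (comp_map f u) (comp_map g u)"
  using assms(1,4,5)
proof (rule htyE)
  fix h assume h: "\<And>n. h n \<in> hom (Ob X n) (Ob Y (n - 1))"
    and e: "\<And>n x. x \<in> carrier (Ob X n) \<Longrightarrow>
      f n x = g n x \<oplus>\<^bsub>Ob Y n\<^esub> (Diff Y (n - 1) (h n x) \<oplus>\<^bsub>Ob Y n\<^esub> h (n + 1) (Diff X n x))"
  note ur = cm_rules[OF assms(3,4,2)]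
  show ?thesis
    by (rule htyI[of "\<lambda>n x. h n (u n x)"])
      (use assms h in \<open>auto simp: comp_map_def ur e intro: hom_comp cm_hom\<close>)
qed

lemma hty_add:
  assumes "hty X Y f g" "hty X Y f' g'" "cx X" "cx Y" "g \<in> cm X Y" "g' \<in> cm X Y"
  shows "hty X Y (add_map Y f f') (add_map Y g g')"
  using assms(1,3,4)
proof (rule htyE)
  fix h assume h: "\<And>n. h n \<in> hom (Ob X n) (Ob Y (n - 1))"
    and h2: "\<And>n m x. m = n - 1 \<Longrightarrow> x \<in> carrier (Ob X n) \<Longrightarrow> h n x \<in> carrier (Ob Y m)"
    and e: "\<And>n x. x \<in> carrier (Ob X n) \<Longrightarrow>
      f n x = g n x \<oplus>\<^bsub>Ob Y n\<^esub> (Diff Y (n - 1) (h n x) \<oplus>\<^bsub>Ob Y n\<^esub> h (n + 1) (Diff X n x))"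
  from assms(2-4) show ?thesis
  proof (rule htyE)
    fix h' assume h': "\<And>n. h' n \<in> hom (Ob X n) (Ob Y (n - 1))"
      and h2': "\<And>n m x. m = n - 1 \<Longrightarrow> x \<in> carrier (Ob X n) \<Longrightarrow> h' n x \<in> carrier (Ob Y m)"
      and e': "\<And>n x. x \<in> carrier (Ob X n) \<Longrightarrow>
        f' n x = g' n x \<oplus>\<^bsub>Ob Y n\<^esub> (Diff Y (n - 1) (h' n x) \<oplus>\<^bsub>Ob Y n\<^esub> h' (n + 1) (Diff X n x))"
    show ?thesis
      by (rule htyI[of "\<lambda>n x. h n x \<oplus>\<^bsub>Ob Y (n - 1)\<^esub> h' n x"])
        (use assms h h' diff_rules(2)[OF assms(4), of _ "n - 1" for n] in
          \<open>auto simp: add_map_def hom_add cm_rules diff_rules rmod_ac h2 h2' e e'\<close>)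
  qed
qed

text \<open>Vanishing of Hom in K(A). The argument sees Hom groups through this predicate, so that
  exactness of a triangle is used as implications between vanishing statements.\<close>

definition HZ :: "('a, 'm) cplx \<Rightarrow> ('a, 'n) cplx \<Rightarrow> bool" where
  "HZ X Y \<longleftrightarrow> (\<forall>f\<in>cm X Y. null X Y f)"

lemma null_comp_left:
  assumes "null X Y f" "u \<in> cm Y Z" "cx X" "cx Y" "cx Z"
  shows "null X Z (comp_map u f)"
proof -
  have "comp_map u (zero_map Y) = (zero_map Z :: int \<Rightarrow> 'b \<Rightarrow> 'd)"
    using cm_rules(4)[OF assms(4,5,2)] by (auto simp: comp_map_def zero_map_def)
  then show ?thesis using hty_comp_left[OF assms(1,2,3,4,5) cm_zero] assms by simp
qed

lemma null_comp_right:
  assumes "null X Y f" "u \<in> cm W X" "cx W" "cx X" "cx Y"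
  shows "null W Y (comp_map f u)"
  using hty_comp_right[OF assms] by (simp add: comp_map_def zero_map_def)

lemma null_add:
  assumes "null X Y f" "null X Y g" "cx X" "cx Y"
  shows "null X Y (add_map Y f g)"
proof -
  have "add_map Y (zero_map Y) (zero_map Y) = (zero_map Y :: int \<Rightarrow> 'b \<Rightarrow> 'c)"
    using assms by (auto simp: add_map_def zero_map_def)
  then show ?thesis using hty_add[OF assms(1,2,3,4) cm_zero cm_zero] assms by simp
qed

text \<open>Lets facts about null-homotopic maps, such as \<open>null_reindex\<close> and
  \<open>qis_null_cancel\<close>, act on homotopies between two maps.\<close>

lemma hty_iff_null:
  assumes "cx X" "cx Y" "f \<in> cm X Y" "g \<in> cm X Y"
  shows "hty X Y f g \<longleftrightarrow> null X Y (add_map Y f (neg_map Y g))"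
proof
  note fr = cm_rules[OF assms(1,2,3)] and gr = cm_rules[OF assms(1,2,4)]
  have n: "neg_map Y g \<in> cm X Y" using assms by (intro cm_neg)
  have z: "zero_map Y \<in> cm X Y" using assms by (intro cm_zero)
  {
    assume "hty X Y f g"
    then have *: "hty X Y (add_map Y f (neg_map Y g)) (add_map Y g (neg_map Y g))"
      using assms n by (intro hty_add hty_refl)
    have "null X Y (add_map Y g (neg_map Y g))"
      using assms n by (intro hty_eq cm_add) (auto simp: add_map_def neg_map_def zero_map_def gr)
    then show "null X Y (add_map Y f (neg_map Y g))"
      using * assms z by (blast intro: hty_trans)
  next
    assume "null X Y (add_map Y f (neg_map Y g))"
    then have *: "hty X Y (add_map Y (add_map Y f (neg_map Y g)) g) (add_map Y (zero_map Y) g)"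
      using assms z by (intro hty_add hty_refl)
    have 1: "hty X Y f (add_map Y (add_map Y f (neg_map Y g)) g)"
      using assms by (intro hty_eq) (auto simp: add_map_def neg_map_def fr gr rmod_ac)
    have 2: "hty X Y (add_map Y (zero_map Y) g) g"
      using assms z by (intro hty_eq cm_add) (auto simp: add_map_def zero_map_def gr)
    have 3: "add_map Y (zero_map Y) g \<in> cm X Y" using assms z by (intro cm_add)
    show "hty X Y f g"
      using hty_trans[OF 1 hty_trans[OF * 2]] assms by blast
  }
qed

end

section \<open>Direct sums, shifts, transport of structure\<close>

text \<open>Transport of structure along a map that is injective on the carrier. A cone of complexes
  on \<open>'u\<close> lives on pairs; an injection of pairs into \<open>'u\<close> brings it back
  among the complexes on \<open>'u\<close>, where it can be the next member of a sequence or an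
  object of the same generated subcategory.\<close>

definition mod_push :: "('m \<Rightarrow> 'n) \<Rightarrow> ('r, 'm) module \<Rightarrow> ('r, 'n) module" where
  "mod_push j M =
     \<lparr>carrier = j ` carrier M, mult = undefined, one = undefined, zero = j \<zero>\<^bsub>M\<^esub>,
      add = (\<lambda>x y. j (inv_into (carrier M) j x \<oplus>\<^bsub>M\<^esub> inv_into (carrier M) j y)),
      smult = (\<lambda>r x. j (r \<odot>\<^bsub>M\<^esub> inv_into (carrier M) j x))\<rparr>"

definition push :: "('m \<Rightarrow> 'n) \<Rightarrow> ('a, 'm) cplx \<Rightarrow> ('a, 'n) cplx" where
  "push j X =
     \<lparr>Ob = (\<lambda>n. mod_push j (Ob X n)),
      Diff = (\<lambda>n x. j (Diff X n (inv_into (carrier (Ob X n)) j x)))\<rparr>"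

definition unpush :: "('m \<Rightarrow> 'n) \<Rightarrow> ('a, 'm) cplx \<Rightarrow> int \<Rightarrow> 'n \<Rightarrow> 'm" where
  "unpush j X = (\<lambda>n. inv_into (carrier (Ob X n)) j)"

text \<open>The shift without sign; unlike \<open>shift\<close> it commutes strictly with the other constructions.\<close>

definition reindex :: "int \<Rightarrow> ('a, 'm) cplx \<Rightarrow> ('a, 'm) cplx" where
  "reindex k X = \<lparr>Ob = (\<lambda>n. Ob X (n + k)), Diff = (\<lambda>n. Diff X (n + k))\<rparr>"

text \<open>Isomorphism between \<open>shift k X\<close> and \<open>reindex k X\<close>. For odd
  \<open>k\<close> their differentials differ by a sign, which the factor (-1)^n in degree
  \<open>n\<close> absorbs.\<close>

definition twist_map :: "int \<Rightarrow> ('a, 'm) cplx \<Rightarrow> int \<Rightarrow> 'm \<Rightarrow> 'm" where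
  "twist_map k X = (\<lambda>n x. if odd k \<and> odd n then \<ominus>\<^bsub>Ob X (n + k)\<^esub> x else x)"

definition inl_map :: "('a, 'n) cplx \<Rightarrow> int \<Rightarrow> 'm \<Rightarrow> 'm \<times> 'n" where
  "inl_map Y = (\<lambda>n x. (x, \<zero>\<^bsub>Ob Y n\<^esub>))"

definition inr_map :: "('a, 'm) cplx \<Rightarrow> int \<Rightarrow> 'n \<Rightarrow> 'm \<times> 'n" where
  "inr_map X = (\<lambda>n y. (\<zero>\<^bsub>Ob X n\<^esub>, y))"

definition fst_map :: "int \<Rightarrow> 'm \<times> 'n \<Rightarrow> 'm" where "fst_map = (\<lambda>n. fst)"
definition snd_map :: "int \<Rightarrow> 'm \<times> 'n \<Rightarrow> 'n" where "snd_map = (\<lambda>n. snd)"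

definition cone_in :: "('a, 'm) cplx \<Rightarrow> int \<Rightarrow> 'n \<Rightarrow> 'm \<times> 'n" where
  "cone_in X = (\<lambda>n y. (\<zero>\<^bsub>Ob X (n + 1)\<^esub>, y))"

lemma mod_dsum_simps [simp]:
  "carrier (mod_dsum M N) = carrier M \<times> carrier N"
  "(x, y) \<oplus>\<^bsub>mod_dsum M N\<^esub> (x', y') = (x \<oplus>\<^bsub>M\<^esub> x', y \<oplus>\<^bsub>N\<^esub> y')"
  "\<zero>\<^bsub>mod_dsum M N\<^esub> = (\<zero>\<^bsub>M\<^esub>, \<zero>\<^bsub>N\<^esub>)"
  "r \<odot>\<^bsub>mod_dsum M N\<^esub> (x, y) = (r \<odot>\<^bsub>M\<^esub> x, r \<odot>\<^bsub>N\<^esub> y)"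
  by (simp_all add: mod_dsum_def)

lemma complex_simps [simp]:
  "Ob (dsum X Y) n = mod_dsum (Ob X n) (Ob Y n)"
  "Diff (dsum X Y) n (x, y) = (Diff X n x, Diff Y n y)"
  "Ob (shift k X) n = Ob X (n + k)"
  "Ob (reindex k X) n = Ob X (n + k)"
  "Diff (reindex k X) n = Diff X (n + k)"
  "Ob (cone X Y f) n = mod_dsum (Ob X (n + 1)) (Ob Y n)"
  "Ob (push j X) n = mod_push j (Ob X n)"
  by (simp_all add: dsum_def shift_def reindex_def cone_def push_def)

lemma cone_diff [simp]:
  "Diff (cone X Y f) n (x, y) = (\<ominus>\<^bsub>Ob X (n + 1 + 1)\<^esub> Diff X (n + 1) x,
                          f (n + 1) x \<oplus>\<^bsub>Ob Y (n + 1)\<^esub> Diff Y n y)"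
  by (simp add: cone_def)

lemma shift_diff:
  "Diff (shift k X) n x = (if even k then Diff X (n + k) x
                    else \<ominus>\<^bsub>Ob X (n + 1 + k)\<^esub> Diff X (n + k) x)"
  by (simp add: shift_def)

lemma reindex_reindex [simp]: "reindex i (reindex k X) = reindex (i + k) X"
  by (simp add: reindex_def ac_simps)

lemma reindex_0 [simp]: "reindex 0 X = X"
  by (simp add: reindex_def)

lemma reindex_cone: "reindex i (cone X Y f) = cone (reindex i X) (reindex i Y) (shift_map i f)"
  by (simp add: reindex_def cone_def shift_map_def ac_simps)

context complexes_over
begin

lemma rmodI:
  assumes "\<zero>\<^bsub>M\<^esub> \<in> carrier M"
    and "\<And>x y. x \<in> carrier M \<Longrightarrow> y \<in> carrier M \<Longrightarrow> x \<oplus>\<^bsub>M\<^esub> y \<in> carrier M"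
    and "\<And>x y z. x \<in> carrier M \<Longrightarrow> y \<in> carrier M \<Longrightarrow> z \<in> carrier M \<Longrightarrow>
      x \<oplus>\<^bsub>M\<^esub> y \<oplus>\<^bsub>M\<^esub> z = x \<oplus>\<^bsub>M\<^esub> (y \<oplus>\<^bsub>M\<^esub> z)"
    and "\<And>x y. x \<in> carrier M \<Longrightarrow> y \<in> carrier M \<Longrightarrow> x \<oplus>\<^bsub>M\<^esub> y = y \<oplus>\<^bsub>M\<^esub> x"
    and "\<And>x. x \<in> carrier M \<Longrightarrow> \<zero>\<^bsub>M\<^esub> \<oplus>\<^bsub>M\<^esub> x = x"
    and "\<And>x. x \<in> carrier M \<Longrightarrow> \<exists>y\<in>carrier M. y \<oplus>\<^bsub>M\<^esub> x = \<zero>\<^bsub>M\<^esub>"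
    and "\<And>a x. a \<in> carrier A \<Longrightarrow> x \<in> carrier M \<Longrightarrow> a \<odot>\<^bsub>M\<^esub> x \<in> carrier M"
    and "\<And>a b x. a \<in> carrier A \<Longrightarrow> b \<in> carrier A \<Longrightarrow> x \<in> carrier M \<Longrightarrow>
      (a \<oplus>\<^bsub>A\<^esub> b) \<odot>\<^bsub>M\<^esub> x = a \<odot>\<^bsub>M\<^esub> x \<oplus>\<^bsub>M\<^esub> b \<odot>\<^bsub>M\<^esub> x"
    and "\<And>a x y. a \<in> carrier A \<Longrightarrow> x \<in> carrier M \<Longrightarrow> y \<in> carrier M \<Longrightarrow>
      a \<odot>\<^bsub>M\<^esub> (x \<oplus>\<^bsub>M\<^esub> y) = a \<odot>\<^bsub>M\<^esub> x \<oplus>\<^bsub>M\<^esub> a \<odot>\<^bsub>M\<^esub> y"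
    and "\<And>a b x. a \<in> carrier A \<Longrightarrow> b \<in> carrier A \<Longrightarrow> x \<in> carrier M \<Longrightarrow>
      (a \<otimes>\<^bsub>A\<^esub> b) \<odot>\<^bsub>M\<^esub> x = b \<odot>\<^bsub>M\<^esub> (a \<odot>\<^bsub>M\<^esub> x)"
    and "\<And>x. x \<in> carrier M \<Longrightarrow> \<one>\<^bsub>A\<^esub> \<odot>\<^bsub>M\<^esub> x = x"
  shows "rmod M"
proof -
  have "abelian_group M" by (rule abelian_groupI) (use assms in auto)
  with ring_A show ?thesis
    by (intro right_module.intro right_module_axioms.intro) (rule assms | assumption)+
qed

lemma rmod_dsum [simp]:
  assumes "rmod M" "rmod N"
  shows "rmod (mod_dsum M N)"
proof -
  have "\<exists>y\<in>carrier (mod_dsum M N). y \<oplus>\<^bsub>mod_dsum M N\<^esub> x = \<zero>\<^bsub>mod_dsum M N\<^esub>"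
    if "x \<in> carrier (mod_dsum M N)" for x
    using that assms by (intro bexI[of _ "(\<ominus>\<^bsub>M\<^esub> fst x, \<ominus>\<^bsub>N\<^esub> snd x)"]) auto
  with assms show ?thesis
    by (intro rmodI) (auto simp: rmod_ac rmod_smult)
qed

lemma dsum_neg [simp]:
  assumes "rmod M" "rmod N" "x \<in> carrier M" "y \<in> carrier N"
  shows "\<ominus>\<^bsub>mod_dsum M N\<^esub> (x, y) = (\<ominus>\<^bsub>M\<^esub> x, \<ominus>\<^bsub>N\<^esub> y)"
proof -
  interpret D: abelian_group "mod_dsum M N" using assms by (intro rmod_ab rmod_dsum)
  show ?thesis using assms by (intro D.minus_equality) auto
qed

lemma hom_pair: "f \<in> hom L M \<Longrightarrow> g \<in> hom L N \<Longrightarrow> (\<lambda>x. (f x, g x)) \<in> hom L (mod_dsum M N)"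
  by (auto simp: rm_hom_def)

lemma hom_fst: "fst \<in> hom (mod_dsum M N) M" and hom_snd: "snd \<in> hom (mod_dsum M N) N"
  by (auto simp: rm_hom_def)

lemma hom_case:
  assumes "rmod M" "rmod N" "rmod L" "f \<in> hom M L" "g \<in> hom N L"
  shows "(\<lambda>p. f (fst p) \<oplus>\<^bsub>L\<^esub> g (snd p)) \<in> hom (mod_dsum M N) L"
  using assms by (intro hom_add rmod_dsum hom_comp[OF hom_fst] hom_comp[OF hom_snd])

lemma mod_push_hom:
  assumes "rmod M" "inj_on j (carrier M)"
  shows "j \<in> hom M (mod_push j M)" and "inv_into (carrier M) j \<in> hom (mod_push j M) M"
  using assms by (auto simp: rm_hom_def mod_push_def)

lemma rmod_push:
  assumes "rmod M" "inj_on j (carrier M)"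
  shows "rmod (mod_push j M)"
proof -
  have "\<exists>y\<in>carrier (mod_push j M). y \<oplus>\<^bsub>mod_push j M\<^esub> x = \<zero>\<^bsub>mod_push j M\<^esub>"
    if x: "x \<in> carrier (mod_push j M)" for x
  proof -
    obtain z where "z \<in> carrier M" "x = j z" using x by (auto simp: mod_push_def)
    then show ?thesis using assms
      by (intro bexI[of _ "j (\<ominus>\<^bsub>M\<^esub> z)"]) (auto simp: mod_push_def)
  qed
  with assms show ?thesis
    by (intro rmodI) (auto simp: mod_push_def rmod_smult rmod_ac)
qed

lemma cxI:
  assumes "\<And>n. rmod (Ob X n)" "\<And>n. Diff X n \<in> hom (Ob X n) (Ob X (n + 1))"
    and "\<And>n x. x \<in> carrier (Ob X n) \<Longrightarrow> Diff X (n + 1) (Diff X n x) = \<zero>\<^bsub>Ob X (n + 1 + 1)\<^esub>"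
  shows "cx X"
  using assms by (simp add: is_complex_def)

lemma cx_dsum [simp]:
  assumes "cx X" "cx Y"
  shows "cx (dsum X Y)"
proof (rule cxI)
  fix n
  have "Diff (dsum X Y) n = (\<lambda>p. (Diff X n (fst p), Diff Y n (snd p)))" by (auto simp: dsum_def)
  then show "Diff (dsum X Y) n \<in> hom (Ob (dsum X Y) n) (Ob (dsum X Y) (n + 1))"
    using assms by (auto intro!: hom_pair hom_comp[OF hom_fst] hom_comp[OF hom_snd] diff_hom)
qed (use assms in \<open>auto simp: diff_rules\<close>)

lemma reindex_diff_hom: "cx X \<Longrightarrow> Diff X (n + k) \<in> hom (Ob X (n + k)) (Ob X (n + 1 + k))"
  using diff_hom[of X "n + k"] by (simp add: ac_simps)

lemma cx_reindex [simp]: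
  assumes "cx X" shows "cx (reindex k X)"
proof (rule cxI)
  fix n x assume "x \<in> carrier (Ob (reindex k X) n)"
  then show "Diff (reindex k X) (n + 1) (Diff (reindex k X) n x) = \<zero>\<^bsub>Ob (reindex k X) (n + 1 + 1)\<^esub>"
    using diff_rules(6)[OF assms, of "n + 1 + k" "n + k" x] by (simp add: ac_simps)
qed (use assms in \<open>auto simp: reindex_diff_hom\<close>)

lemma cx_shift [simp]:
  assumes "cx X" shows "cx (shift k X)"
proof (rule cxI)
  fix n
  show "Diff (shift k X) n \<in> hom (Ob (shift k X) n) (Ob (shift k X) (n + 1))"
  proof (cases "even k")
    case True
    then have "Diff (shift k X) n = Diff X (n + k)" by (auto simp: shift_def)
    then show ?thesis using reindex_diff_hom[OF assms, of n k] by simp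
  next
    case False
    then have "Diff (shift k X) n = (\<lambda>x. \<ominus>\<^bsub>Ob X (n + 1 + k)\<^esub> Diff X (n + k) x)"
      by (auto simp: shift_def)
    then show ?thesis using reindex_diff_hom[OF assms, of n k] assms by (simp add: hom_neg)
  qed
  have 1: "Diff X (n + 1 + k) (\<ominus>\<^bsub>Ob X (n + 1 + k)\<^esub> x)
      = \<ominus>\<^bsub>Ob X (n + 1 + 1 + k)\<^esub> Diff X (n + 1 + k) x" if "x \<in> carrier (Ob X (n + 1 + k))" for x
    using diff_rules(5)[OF assms that] by (simp add: ac_simps)
  fix x assume "x \<in> carrier (Ob (shift k X) n)"
  then show "Diff (shift k X) (n + 1) (Diff (shift k X) n x) = \<zero>\<^bsub>Ob (shift k X) (n + 1 + 1)\<^esub>"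
    using assms diff_rules(1)[OF assms, of "n + 1 + k" "n + k" x]
      diff_rules(6)[OF assms, of "n + 1 + k" "n + k" x]
    by (simp add: shift_diff 1) (simp add: ac_simps)
qed (use assms in simp)

lemma cx_push [simp]:
  assumes "cx X" "\<And>n. inj_on j (carrier (Ob X n))"
  shows "cx (push j X)"
proof (rule cxI)
  fix n
  show "rmod (Ob (push j X) n)" using assms by (simp add: rmod_push)
  have "(\<lambda>x. j (Diff X n (inv_into (carrier (Ob X n)) j x)))
      \<in> hom (mod_push j (Ob X n)) (mod_push j (Ob X (n + 1)))"
    using assms by (intro hom_comp[OF mod_push_hom(2)] hom_comp[OF diff_hom] mod_push_hom) auto
  then show "Diff (push j X) n \<in> hom (Ob (push j X) n) (Ob (push j X) (n + 1))"
    by (simp add: push_def)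
qed (use assms in \<open>auto simp: push_def mod_push_def diff_rules\<close>)

lemma push_maps:
  assumes "cx X" "\<And>n. inj_on j (carrier (Ob X n))"
  shows "(\<lambda>n. j) \<in> cm X (push j X)" and "unpush j X \<in> cm (push j X) X"
    and "x \<in> carrier (Ob X n) \<Longrightarrow> unpush j X n (j x) = x"
    and "y \<in> carrier (Ob (push j X) n) \<Longrightarrow> j (unpush j X n y) = y"
proof -
  show "(\<lambda>n. j) \<in> cm X (push j X)"
    using assms by (intro cmI) (auto simp: mod_push_hom, auto simp: push_def)
  show "unpush j X \<in> cm (push j X) X"
    using assms by (intro cmI) (auto simp: mod_push_hom unpush_def, auto simp: push_def mod_push_def diff_rules)
qed (use assms in \<open>auto simp: unpush_def mod_push_def\<close>)

lemma cx_cone [simp]: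
  assumes "cx X" "cx Y" "f \<in> cm X Y"
  shows "cx (cone X Y f)"
proof (rule cxI)
  fix n
  note r = cm_rules[OF assms] diff_rules[OF assms(1)] diff_rules[OF assms(2)]
  have "(\<lambda>p. (\<ominus>\<^bsub>Ob X (n + 1 + 1)\<^esub> Diff X (n + 1) (fst p), f (n + 1) (fst p) \<oplus>\<^bsub>Ob Y (n + 1)\<^esub> Diff Y n (snd p)))
      \<in> hom (mod_dsum (Ob X (n + 1)) (Ob Y n)) (mod_dsum (Ob X (n + 1 + 1)) (Ob Y (n + 1)))"
    using assms
    by (intro hom_pair hom_case hom_comp[OF hom_fst] hom_neg diff_hom cm_hom) auto
  moreover have "Diff (cone X Y f) n = (\<lambda>p. (\<ominus>\<^bsub>Ob X (n + 1 + 1)\<^esub> Diff X (n + 1) (fst p), f (n + 1) (fst p) \<oplus>\<^bsub>Ob Y (n + 1)\<^esub> Diff Y n (snd p)))"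
    by (auto simp: cone_def)
  ultimately show "Diff (cone X Y f) n \<in> hom (Ob (cone X Y f) n) (Ob (cone X Y f) (n + 1))" by simp
  show "Diff (cone X Y f) (n + 1) (Diff (cone X Y f) n x) = \<zero>\<^bsub>Ob (cone X Y f) (n + 1 + 1)\<^esub>"
    if "x \<in> carrier (Ob (cone X Y f) n)" for x
    using that assms by (auto simp: r diff_rules)
qed (use assms in simp)

lemma twist_maps:
  assumes "cx X"
  shows "twist_map k X \<in> cm (shift k X) (reindex k X)"
    and "twist_map k X \<in> cm (reindex k X) (shift k X)"
    and "x \<in> carrier (Ob X (n + k)) \<Longrightarrow> twist_map k X n (twist_map k X n x) = x"
proof -
  have h: "twist_map k X n \<in> hom (Ob X (n + k)) (Ob X (n + k))" for n
    using assms hom_neg[OF _ _ hom_id, of "Ob X (n + k)"]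
    by (cases "odd k \<and> odd n") (auto simp: twist_map_def hom_id)
  have 1: "Diff X (n + k) (\<ominus>\<^bsub>Ob X (n + k)\<^esub> x) = \<ominus>\<^bsub>Ob X (n + 1 + k)\<^esub> Diff X (n + k) x"
    and 2: "Diff X (n + k) x \<in> carrier (Ob X (n + 1 + k))"
    if "x \<in> carrier (Ob X (n + k))" for n x
    using diff_rules(1)[OF assms, of "n + 1 + k", OF _ that] diff_rules(5)[OF assms that] by (simp_all add: ac_simps)
  show "twist_map k X \<in> cm (shift k X) (reindex k X)" "twist_map k X \<in> cm (reindex k X) (shift k X)"
    using h assms by (intro cmI; auto simp: twist_map_def shift_diff 1 2)+
  show "x \<in> carrier (Ob X (n + k)) \<Longrightarrow> twist_map k X n (twist_map k X n x) = x"
    using assms by (simp add: twist_map_def)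
qed

lemma dsum_maps:
  assumes "cx X" "cx Y"
  shows "inl_map Y \<in> cm X (dsum X Y)" and "inr_map X \<in> cm Y (dsum X Y)"
    and "fst_map \<in> cm (dsum X Y) X" and "snd_map \<in> cm (dsum X Y) Y"
  using assms
  by (auto intro!: cmI hom_pair hom_id hom_zero hom_fst hom_snd
    simp: inl_map_def inr_map_def fst_map_def snd_map_def diff_rules dsum_def)

lemma cm_shift_map: "f \<in> cm X Y \<Longrightarrow> shift_map k f \<in> cm (reindex k X) (reindex k Y)"
  by (auto simp: chain_map_def shift_map_def ac_simps) (metis add.assoc add.commute)+

lemma cm_shift_map_shift:
  assumes "cx X" "cx Y" "f \<in> cm X Y"
  shows "shift_map k f \<in> cm (shift k X) (shift k Y)"
proof (rule cmI)
  fix n x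
  show "shift_map k f n \<in> hom (Ob (shift k X) n) (Ob (shift k Y) n)"
    using assms by (simp add: shift_map_def cm_hom)
  assume x: "x \<in> carrier (Ob (shift k X) n)"
  have "Diff X (n + k) x \<in> carrier (Ob X (n + 1 + k))"
    using diff_rules(1)[OF assms(1), of "n + 1 + k" "n + k" x] x by simp
  then show "shift_map k f (n + 1) (Diff (shift k X) n x) = Diff (shift k Y) n (shift_map k f n x)"
    using x assms by (auto simp: shift_map_def shift_diff cm_rules)
qed

end

section \<open>Triangles\<close>

context complexes_over
begin

lemma comp_id [simp]: "comp_map f id_map = f" "comp_map id_map f = f"
  by (auto simp: comp_map_def id_map_def)

lemma comp_assoc: "comp_map f (comp_map g h) = comp_map (comp_map f g) h"
  by (simp add: comp_map_def)

lemma cone_in_cm: "cx X \<Longrightarrow> cx Y \<Longrightarrow> f \<in> cm X Y \<Longrightarrow> cone_in X \<in> cm Y (cone X Y f)"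
  by (intro cmI) (auto simp: cone_in_def diff_rules cm_rules intro!: hom_pair hom_zero hom_id)

lemma cone_out_cm: "cx X \<Longrightarrow> cx Y \<Longrightarrow> f \<in> cm X Y \<Longrightarrow> fst_map \<in> cm (cone X Y f) (shift 1 X)"
  by (intro cmI) (auto simp: fst_map_def shift_diff hom_fst)

text \<open>The connecting map in the form cone[-1] \<rightarrow> X. It commutes with the
  differentials because the sign of the odd shift cancels the sign in the cone.\<close>

lemma cone_out_cm':
  assumes "cx X" "cx Y" "f \<in> cm X Y"
  shows "fst_map \<in> cm (shift (-1) (cone X Y f)) X"
proof (rule cmI)
  fix n p assume p: "p \<in> carrier (Ob (shift (-1) (cone X Y f)) n)"
  obtain x y where xy: "p = (x, y)" "x \<in> carrier (Ob X n)" "y \<in> carrier (Ob Y (n - 1))"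
    using p by auto
  show "fst_map (n + 1) (Diff (shift (-1) (cone X Y f)) n p) = Diff X n (fst_map n p)"
    using xy assms diff_rules(1)[OF assms(2), of n "n - 1" y]
    by (simp add: fst_map_def shift_diff diff_rules cm_rules)
qed (simp add: fst_map_def hom_fst)

lemma cone_in_null:
  assumes "cx X" "cx Y" "f \<in> cm X Y"
  shows "null X (cone X Y f) (comp_map (cone_in X) f)"
proof (rule nullI[of _ _ "\<lambda>n x. (x, \<zero>\<^bsub>Ob Y (n - 1)\<^esub>)"])
  show "(\<lambda>x. (x, \<zero>\<^bsub>Ob Y (n - 1)\<^esub>)) \<in> hom (Ob X n) (Ob (cone X Y f) (n - 1))" for n
    using assms by (auto intro!: hom_pair hom_id hom_zero)
qed (use assms diff_rules(4)[OF assms(2), of "n - 1" for n] in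
      \<open>auto simp: cone_in_def comp_map_def diff_rules cm_rules\<close>)

text \<open>A null-homotopy \<open>h\<close> of \<open>comp_map j f\<close> is exactly the missing
  component of the extension on the summand X[1] of the cone: it sends (x, y) to h x + j y, and the
  homotopy equation says that this is a chain map.\<close>

lemma cone_extend:
  assumes "cx X" "cx Y" "f \<in> cm X Y" "cx V" "j \<in> cm Y V" "null X V (comp_map j f)"
  obtains I where "I \<in> cm (cone X Y f) V" "hty Y V (comp_map I (cone_in X)) j"
  using assms(6,1,4)
proof (rule nullE)
  fix h assume h: "\<And>n. h n \<in> hom (Ob X n) (Ob V (n - 1))"
    and r: "\<And>n m x. m = n - 1 \<Longrightarrow> x \<in> carrier (Ob X n) \<Longrightarrow> h n x \<in> carrier (Ob V m)"
      "\<And>n. h n \<zero>\<^bsub>Ob X n\<^esub> = \<zero>\<^bsub>Ob V (n - 1)\<^esub>"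
      "\<And>n x. x \<in> carrier (Ob X n) \<Longrightarrow> h n (\<ominus>\<^bsub>Ob X n\<^esub> x) = \<ominus>\<^bsub>Ob V (n - 1)\<^esub> h n x"
    and e: "\<And>n x. x \<in> carrier (Ob X n) \<Longrightarrow>
      comp_map j f n x = Diff V (n - 1) (h n x) \<oplus>\<^bsub>Ob V n\<^esub> h (n + 1) (Diff X n x)"
  note jr = cm_rules[OF assms(2,4,5)] and fr = cm_rules[OF assms(1,2,3)]
  have r3: "h (k + 1) (\<ominus>\<^bsub>Ob X (k + 1)\<^esub> x) = \<ominus>\<^bsub>Ob V k\<^esub> h (k + 1) x"
    if "x \<in> carrier (Ob X (k + 1))" for k x
    using r(3)[OF that] by simp
  define I where "I = (\<lambda>n p. h (n + 1) (fst p) \<oplus>\<^bsub>Ob V n\<^esub> j n (snd p))"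
  have hh: "h (n + 1) \<in> hom (Ob X (n + 1)) (Ob V n)" for n using h[of "n + 1"] by simp
  have I: "I \<in> cm (cone X Y f) V"
  proof (rule cmI)
    show "I n \<in> hom (Ob (cone X Y f) n) (Ob V n)" for n
      using assms hh by (auto simp: I_def intro!: hom_case cm_hom)
    fix n p assume "p \<in> carrier (Ob (cone X Y f) n)"
    then obtain x y where p: "p = (x, y)" "x \<in> carrier (Ob X (n + 1))" "y \<in> carrier (Ob Y n)"
      by auto
    have e1: "j (n + 1) (f (n + 1) x) = Diff V n (h (n + 1) x) \<oplus>\<^bsub>Ob V (n + 1)\<^esub> h (n + 1 + 1) (Diff X (n + 1) x)"
      using e[OF p(2)] by (simp add: comp_map_def)
    show "I (n + 1) (Diff (cone X Y f) n p) = Diff V n (I n p)"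
      unfolding I_def
      apply (rule int_vectors[of "Ob V (n + 1)" "Diff V n (h (n + 1) x)" "h (n + 1 + 1) (Diff X (n + 1) x)"
        "Diff V n (j n y)" "Diff V n (j n y)" "Diff V n (j n y)" "Diff V n (j n y)"])
      using p assms r3[of "Diff X (n + 1) x" "n + 1"]
      by (simp_all add: jr fr r(1,2) diff_rules e1)
  qed
  have ex: "hty Y V (comp_map I (cone_in X)) j"
    using I assms r(2)[of "n + 1" for n]
    by (intro hty_eq cm_comp[OF cone_in_cm]) (auto simp: comp_map_def I_def cone_in_def jr)
  show thesis by (rule that[OF I ex])
qed

text \<open>Exactness at the cone for maps out of it. With \<open>h\<close> a null-homotopy of the
  restriction to Y, the map x \<mapsto> F (x, 0) - h (f x) is a chain map on X[1], and (x, y)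
  \<mapsto> h y is a homotopy from F to its composite with the projection.\<close>

lemma cone_factor:
  assumes "cx X" "cx Y" "f \<in> cm X Y" "cx V" "F \<in> cm (cone X Y f) V"
    and "null Y V (comp_map F (cone_in X))"
  obtains G where "G \<in> cm (shift 1 X) V" "hty (cone X Y f) V F (comp_map G fst_map)"
  using assms(6,2,4)
proof (rule nullE)
  fix h assume h: "\<And>n. h n \<in> hom (Ob Y n) (Ob V (n - 1))"
    and r: "\<And>n m x. m = n - 1 \<Longrightarrow> x \<in> carrier (Ob Y n) \<Longrightarrow> h n x \<in> carrier (Ob V m)"
      "\<And>n x y. x \<in> carrier (Ob Y n) \<Longrightarrow> y \<in> carrier (Ob Y n) \<Longrightarrow>
        h n (x \<oplus>\<^bsub>Ob Y n\<^esub> y) = h n x \<oplus>\<^bsub>Ob V (n - 1)\<^esub> h n y"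
      "\<And>n. h n \<zero>\<^bsub>Ob Y n\<^esub> = \<zero>\<^bsub>Ob V (n - 1)\<^esub>"
      "\<And>n x. x \<in> carrier (Ob Y n) \<Longrightarrow> h n (\<ominus>\<^bsub>Ob Y n\<^esub> x) = \<ominus>\<^bsub>Ob V (n - 1)\<^esub> h n x"
    and e: "\<And>n x. x \<in> carrier (Ob Y n) \<Longrightarrow>
      comp_map F (cone_in X) n x = Diff V (n - 1) (h n x) \<oplus>\<^bsub>Ob V n\<^esub> h (n + 1) (Diff Y n x)"
  have cK: "cx (cone X Y f)" using assms by simp
  note Fr = cm_rules[OF cK assms(4,5)] and fr = cm_rules[OF assms(1,2,3)]
  have e0: "F n (\<zero>\<^bsub>Ob X (n + 1)\<^esub>, y) = Diff V (n - 1) (h n y) \<oplus>\<^bsub>Ob V n\<^esub> h (n + 1) (Diff Y n y)"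
    if "y \<in> carrier (Ob Y n)" for n y
    using e[OF that] by (simp add: comp_map_def cone_in_def)
  have split: "F n (x, y) = F n (x, \<zero>\<^bsub>Ob Y n\<^esub>) \<oplus>\<^bsub>Ob V n\<^esub> F n (\<zero>\<^bsub>Ob X (n + 1)\<^esub>, y)"
    if "x \<in> carrier (Ob X (n + 1))" "y \<in> carrier (Ob Y n)" for n x y
    using that assms Fr(2)[of "(x, \<zero>\<^bsub>Ob Y n\<^esub>)" n "(\<zero>\<^bsub>Ob X (n + 1)\<^esub>, y)"] by simp
  have Fc: "F n (x, y) \<in> carrier (Ob V n)" if "x \<in> carrier (Ob X (n + 1))" "y \<in> carrier (Ob Y n)" for n x y
    using that Fr(1)[of "(x, y)" n] by simp
  have Fneg: "F n (\<ominus>\<^bsub>Ob X (n + 1)\<^esub> x, \<zero>\<^bsub>Ob Y n\<^esub>) = \<ominus>\<^bsub>Ob V n\<^esub> F n (x, \<zero>\<^bsub>Ob Y n\<^esub>)"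
    if "x \<in> carrier (Ob X (n + 1))" for n x
    using that assms Fr(5)[of "(x, \<zero>\<^bsub>Ob Y n\<^esub>)" n] by simp
  have r4: "h (k + 1) (\<ominus>\<^bsub>Ob Y (k + 1)\<^esub> x) = \<ominus>\<^bsub>Ob V k\<^esub> h (k + 1) x"
    if "x \<in> carrier (Ob Y (k + 1))" for k x
    using r(4)[OF that] by simp
  have r2: "h (k + 1) (x \<oplus>\<^bsub>Ob Y (k + 1)\<^esub> y) = h (k + 1) x \<oplus>\<^bsub>Ob V k\<^esub> h (k + 1) y"
    if "x \<in> carrier (Ob Y (k + 1))" "y \<in> carrier (Ob Y (k + 1))" for k x y
    using r(2)[OF that] by simp
  define G where "G = (\<lambda>n x. F n (x, \<zero>\<^bsub>Ob Y n\<^esub>) \<oplus>\<^bsub>Ob V n\<^esub> \<ominus>\<^bsub>Ob V n\<^esub> h (n + 1) (f (n + 1) x))"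
  have hh: "h (n + 1) \<in> hom (Ob Y (n + 1)) (Ob V n)" for n using h[of "n + 1"] by simp
  have G: "G \<in> cm (shift 1 X) V"
  proof (rule cmI)
    fix n
    have "(\<lambda>x. F n (x, \<zero>\<^bsub>Ob Y n\<^esub>)) \<in> hom (Ob X (n + 1)) (Ob V n)"
      using assms cm_hom[OF assms(5), of n] by (auto intro: hom_comp[OF hom_pair[OF hom_id hom_zero]])
    then show "G n \<in> hom (Ob (shift 1 X) n) (Ob V n)"
      using assms unfolding G_def by (auto intro!: hom_add hom_neg hom_comp[OF cm_hom hh])
    fix x assume "x \<in> carrier (Ob (shift 1 X) n)"
    then have x: "x \<in> carrier (Ob X (n + 1))" by simp
    have "Diff V n (F n (x, \<zero>\<^bsub>Ob Y n\<^esub>)) = F (n + 1) (\<ominus>\<^bsub>Ob X (n + 1 + 1)\<^esub> Diff X (n + 1) x, f (n + 1) x)"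
      using Fr(6)[of "n + 1" n "(x, \<zero>\<^bsub>Ob Y n\<^esub>)"] x assms by (simp add: diff_rules fr)
    also have "\<dots> = \<ominus>\<^bsub>Ob V (n + 1)\<^esub> F (n + 1) (Diff X (n + 1) x, \<zero>\<^bsub>Ob Y (n + 1)\<^esub>) \<oplus>\<^bsub>Ob V (n + 1)\<^esub>
        (Diff V n (h (n + 1) (f (n + 1) x)) \<oplus>\<^bsub>Ob V (n + 1)\<^esub> h (n + 1 + 1) (Diff Y (n + 1) (f (n + 1) x)))"
      using x assms e0[of "f (n + 1) x" "n + 1"] Fneg[of "Diff X (n + 1) x" "n + 1"]
      by (subst split) (simp_all add: diff_rules fr)
    finally have 1: "Diff V n (F n (x, \<zero>\<^bsub>Ob Y n\<^esub>)) = \<dots>" .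
    show "G (n + 1) (Diff (shift 1 X) n x) = Diff V n (G n x)"
      unfolding G_def
      apply (rule int_vectors[of "Ob V (n + 1)" "Diff V n (h (n + 1) (f (n + 1) x))"
        "h (n + 1 + 1) (Diff Y (n + 1) (f (n + 1) x))"
        "F (n + 1) (Diff X (n + 1) x, \<zero>\<^bsub>Ob Y (n + 1)\<^esub>)" "\<zero>\<^bsub>Ob V (n + 1)\<^esub>" "\<zero>\<^bsub>Ob V (n + 1)\<^esub>" "\<zero>\<^bsub>Ob V (n + 1)\<^esub>"])
      using x assms 1 Fneg[of "Diff X (n + 1) x" "n + 1"] r4[of "f (n + 1 + 1) (Diff X (n + 1) x)" "n + 1"]
      by (simp_all add: diff_rules fr r(1,3) Fc shift_diff)
  qed
  have "hty (cone X Y f) V F (comp_map G fst_map)"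
  proof (rule htyI[of "\<lambda>n p. h n (snd p)"])
    show "(\<lambda>p. h n (snd p)) \<in> hom (Ob (cone X Y f) n) (Ob V (n - 1))" for n
      by (auto intro: hom_comp[OF hom_snd] h)
    fix n p assume "p \<in> carrier (Ob (cone X Y f) n)"
    then obtain x y where p: "p = (x, y)" "x \<in> carrier (Ob X (n + 1))" "y \<in> carrier (Ob Y n)"
      by auto
    show "F n p = comp_map G fst_map n p \<oplus>\<^bsub>Ob V n\<^esub> (Diff V (n - 1) (h n (snd p)) \<oplus>\<^bsub>Ob V n\<^esub>
        h (n + 1) (snd (Diff (cone X Y f) n p)))"
      unfolding p(1)
      apply (subst split[OF p(2,3)])
      apply (rule int_vectors[of "Ob V n" "F n (x, \<zero>\<^bsub>Ob Y n\<^esub>)" "Diff V (n - 1) (h n y)" "h (n + 1) (Diff Y n y)"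
        "h (n + 1) (f (n + 1) x)" "\<zero>\<^bsub>Ob V n\<^esub>" "\<zero>\<^bsub>Ob V n\<^esub>"])
      using p assms e0[OF p(3)] r2[of "f (n + 1) x" n "Diff Y n y"]
      by (simp_all add: diff_rules fr r(1,3) Fc comp_map_def fst_map_def G_def)
  qed
  then show thesis by (rule that[OF G])
qed

text \<open>Exactness at the cone for maps into it. A null-homotopy \<open>h\<close> of the first
  component of F corrects the second one to a chain map snd F - f h into Y; what is subtracted is
  the boundary of (h, 0).\<close>

lemma cone_target_factor:
  assumes "cx X" "cx Y" "f \<in> cm X Y" "cx V" "F \<in> cm V (cone X Y f)"
    and "null V (shift 1 X) (comp_map fst_map F)"
  obtains u where "u \<in> cm V Y" "hty V (cone X Y f) F (comp_map (cone_in X) u)"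
  using assms(6,4) cx_shift[OF assms(1)]
proof (rule nullE)
  fix h assume h: "\<And>n. h n \<in> hom (Ob V n) (Ob (shift 1 X) (n - 1))"
    and r: "\<And>n m x. m = n - 1 \<Longrightarrow> x \<in> carrier (Ob V n) \<Longrightarrow> h n x \<in> carrier (Ob (shift 1 X) m)"
    and e: "\<And>n x. x \<in> carrier (Ob V n) \<Longrightarrow> comp_map fst_map F n x
      = Diff (shift 1 X) (n - 1) (h n x) \<oplus>\<^bsub>Ob (shift 1 X) n\<^esub> h (n + 1) (Diff V n x)"
  have cK: "cx (cone X Y f)" using assms by simp
  note Fr = cm_rules[OF assms(4) cK assms(5)] and fr = cm_rules[OF assms(1,2,3)]
  have hh: "h n \<in> hom (Ob V n) (Ob X n)" for n using h[of n] by simp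
  have hc: "h n x \<in> carrier (Ob X n)" if "x \<in> carrier (Ob V n)" for n x using r[OF refl that] by simp
  have e1: "fst (F n x) = \<ominus>\<^bsub>Ob X (n + 1)\<^esub> Diff X n (h n x) \<oplus>\<^bsub>Ob X (n + 1)\<^esub> h (n + 1) (Diff V n x)"
    if "x \<in> carrier (Ob V n)" for n x
    using e[OF that] by (simp add: comp_map_def fst_map_def shift_diff)
  have F2: "snd (F n x) \<in> carrier (Ob Y n)" if "x \<in> carrier (Ob V n)" for n x
    using Fr(1)[OF that] by auto
  define u where "u = (\<lambda>n x. snd (F n x) \<oplus>\<^bsub>Ob Y n\<^esub> \<ominus>\<^bsub>Ob Y n\<^esub> f n (h n x))"
  have u: "u \<in> cm V Y"
  proof (rule cmI)
    fix n
    have "(\<lambda>x. snd (F n x)) \<in> hom (Ob V n) (Ob Y n)"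
      using hom_comp[OF cm_hom[OF assms(5), of n], of snd] hom_snd by auto
    then show "u n \<in> hom (Ob V n) (Ob Y n)"
      unfolding u_def using assms by (auto intro!: hom_add hom_neg hom_comp[OF hh cm_hom[OF assms(3)]])
    fix x assume x: "x \<in> carrier (Ob V n)"
    have "F (n + 1) (Diff V n x) = Diff (cone X Y f) n (fst (F n x), snd (F n x))"
      using Fr(6)[OF refl x] by simp
    then have 1: "snd (F (n + 1) (Diff V n x)) = f (n + 1) (fst (F n x)) \<oplus>\<^bsub>Ob Y (n + 1)\<^esub> Diff Y n (snd (F n x))"
      by (simp only: cone_diff prod.sel)
    show "u (n + 1) (Diff V n x) = Diff Y n (u n x)"
      unfolding u_def
      apply (rule int_vectors[of "Ob Y (n + 1)" "Diff Y n (f n (h n x))"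
        "f (n + 1) (h (n + 1) (Diff V n x))" "Diff Y n (snd (F n x))" "\<zero>\<^bsub>Ob Y (n + 1)\<^esub>" "\<zero>\<^bsub>Ob Y (n + 1)\<^esub>" "\<zero>\<^bsub>Ob Y (n + 1)\<^esub>"])
      using x assms
      by (simp_all add: diff_rules fr hc F2 1 e1)
  qed
  have "hty V (cone X Y f) F (comp_map (cone_in X) u)"
  proof (rule htyI[of "\<lambda>n x. (h n x, \<zero>\<^bsub>Ob Y (n - 1)\<^esub>)"])
    show "(\<lambda>x. (h n x, \<zero>\<^bsub>Ob Y (n - 1)\<^esub>)) \<in> hom (Ob V n) (Ob (cone X Y f) (n - 1))" for n
      using assms hh by (auto intro!: hom_pair hom_zero)
    fix n x assume x: "x \<in> carrier (Ob V n)"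
    have "snd (F n x) = snd (F n x) \<oplus>\<^bsub>Ob Y n\<^esub> \<ominus>\<^bsub>Ob Y n\<^esub> f n (h n x) \<oplus>\<^bsub>Ob Y n\<^esub> f n (h n x)"
      using x assms by (simp add: rmod_ac F2 fr hc)
    then show "F n x = comp_map (cone_in X) u n x \<oplus>\<^bsub>Ob (cone X Y f) n\<^esub>
        (Diff (cone X Y f) (n - 1) (h n x, \<zero>\<^bsub>Ob Y (n - 1)\<^esub>) \<oplus>\<^bsub>Ob (cone X Y f) n\<^esub> (h (n + 1) (Diff V n x), \<zero>\<^bsub>Ob Y (n + 1 - 1)\<^esub>))"
      using x assms e1[OF x] diff_rules(4)[OF assms(2), of "n - 1"]
      by (intro prod_eqI)
        (simp_all add: comp_map_def cone_in_def u_def diff_rules fr hc F2)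
  qed
  then show thesis by (rule that[OF u])
qed

text \<open>A null-homotopy into the cone has two components: the one in X is a chain map
  \<open>v\<close>, the one in Y is a homotopy between F and the composite of f with
  \<open>v\<close>.\<close>

lemma cone_in_null_factor:
  assumes "cx X" "cx Y" "f \<in> cm X Y" "cx V" "F \<in> cm V Y"
    and "null V (cone X Y f) (comp_map (cone_in X) F)"
  obtains v where "v \<in> cm V X" "hty V Y F (comp_map f v)"
  using assms(6,4) cx_cone[OF assms(1-3)]
proof (rule nullE)
  fix h assume h: "\<And>n. h n \<in> hom (Ob V n) (Ob (cone X Y f) (n - 1))"
    and r: "\<And>n m x. m = n - 1 \<Longrightarrow> x \<in> carrier (Ob V n) \<Longrightarrow> h n x \<in> carrier (Ob (cone X Y f) m)"
    and e: "\<And>n x. x \<in> carrier (Ob V n) \<Longrightarrow> comp_map (cone_in X) F n x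
      = Diff (cone X Y f) (n - 1) (h n x) \<oplus>\<^bsub>Ob (cone X Y f) n\<^esub> h (n + 1) (Diff V n x)"
  note Fr = cm_rules[OF assms(4) assms(2) assms(5)] and fr = cm_rules[OF assms(1,2,3)]
  have h1: "(\<lambda>x. fst (h n x)) \<in> hom (Ob V n) (Ob X n)"
    and h2: "(\<lambda>x. snd (h n x)) \<in> hom (Ob V n) (Ob Y (n - 1))" for n
    using h[of n] by (auto intro: hom_comp[OF _ hom_fst] hom_comp[OF _ hom_snd])
  have c: "fst (h n x) \<in> carrier (Ob X n)" "snd (h n x) \<in> carrier (Ob Y (n - 1))"
    "fst (h (n + 1) (Diff V n x)) \<in> carrier (Ob X (n + 1))" "snd (h (n + 1) (Diff V n x)) \<in> carrier (Ob Y n)"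
    if x: "x \<in> carrier (Ob V n)" for n x
    using r[OF refl x] r[OF refl diff_rules(1)[OF assms(4) refl x]] by auto
  have d: "Diff (cone X Y f) (n - 1) (h n x) \<oplus>\<^bsub>Ob (cone X Y f) n\<^esub> h (n + 1) (Diff V n x)
    = (\<ominus>\<^bsub>Ob X (n + 1)\<^esub> Diff X n (fst (h n x)) \<oplus>\<^bsub>Ob X (n + 1)\<^esub> fst (h (n + 1) (Diff V n x)),
       (f n (fst (h n x)) \<oplus>\<^bsub>Ob Y n\<^esub> Diff Y (n - 1) (snd (h n x))) \<oplus>\<^bsub>Ob Y n\<^esub> snd (h (n + 1) (Diff V n x)))"
    for n x
    by (cases "h n x"; cases "h (n + 1) (Diff V n x)") simp
  have e1: "\<ominus>\<^bsub>Ob X (n + 1)\<^esub> Diff X n (fst (h n x)) \<oplus>\<^bsub>Ob X (n + 1)\<^esub> fst (h (n + 1) (Diff V n x)) = \<zero>\<^bsub>Ob X (n + 1)\<^esub>"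
    and e2: "F n x = (f n (fst (h n x)) \<oplus>\<^bsub>Ob Y n\<^esub> Diff Y (n - 1) (snd (h n x))) \<oplus>\<^bsub>Ob Y n\<^esub> snd (h (n + 1) (Diff V n x))"
    if x: "x \<in> carrier (Ob V n)" for n x
    using e[OF x] unfolding d by (simp_all add: comp_map_def cone_in_def)
  have v: "(\<lambda>n x. fst (h n x)) \<in> cm V X"
  proof (rule cmI)
    show "(\<lambda>x. fst (h n x)) \<in> hom (Ob V n) (Ob X n)" for n by (rule h1)
    fix n x assume x: "x \<in> carrier (Ob V n)"
    have "Diff X n (fst (h n x)) \<oplus>\<^bsub>Ob X (n + 1)\<^esub> (\<ominus>\<^bsub>Ob X (n + 1)\<^esub> Diff X n (fst (h n x)) \<oplus>\<^bsub>Ob X (n + 1)\<^esub> fst (h (n + 1) (Diff V n x))) = Diff X n (fst (h n x))"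
      using x assms c by (simp add: e1 diff_rules)
    then show "fst (h (n + 1) (Diff V n x)) = Diff X n (fst (h n x))"
      using x assms c by (simp add: diff_rules flip: rmod_ac(1))
  qed
  have "hty V Y F (comp_map f (\<lambda>n x. fst (h n x)))"
    by (rule htyI[OF h2])
      (use assms c in \<open>auto simp: e2 comp_map_def fr diff_rules rmod_ac(1)\<close>)
  then show thesis by (rule that[OF v])
qed

text \<open>A null-homotopy \<open>h\<close> of the composite with f completes F to the chain map
  (F, -h) into cone[-1]; the sign of \<open>h\<close> is dictated by the sign of the odd
  shift.\<close>

lemma cone_lift:
  assumes "cx X" "cx Y" "f \<in> cm X Y" "cx V" "F \<in> cm V X" "null V Y (comp_map f F)"
  obtains w where "w \<in> cm V (shift (-1) (cone X Y f))" "hty V X F (comp_map fst_map w)"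
  using assms(6,4,2)
proof (rule nullE)
  fix h assume h: "\<And>n. h n \<in> hom (Ob V n) (Ob Y (n - 1))"
    and r: "\<And>n m x. m = n - 1 \<Longrightarrow> x \<in> carrier (Ob V n) \<Longrightarrow> h n x \<in> carrier (Ob Y m)"
    and e: "\<And>n x. x \<in> carrier (Ob V n) \<Longrightarrow>
      comp_map f F n x = Diff Y (n - 1) (h n x) \<oplus>\<^bsub>Ob Y n\<^esub> h (n + 1) (Diff V n x)"
  note Fr = cm_rules[OF assms(4) assms(1) assms(5)] and fr = cm_rules[OF assms(1,2,3)]
  define w where "w = (\<lambda>n x. (F n x, \<ominus>\<^bsub>Ob Y (n - 1)\<^esub> h n x))"
  have w: "w \<in> cm V (shift (-1) (cone X Y f))"
  proof (rule cmI)
    show "w n \<in> hom (Ob V n) (Ob (shift (-1) (cone X Y f)) n)" for n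
      unfolding w_def using assms h by (auto intro!: hom_pair hom_neg cm_hom)
    fix n x assume x: "x \<in> carrier (Ob V n)"
    have "\<ominus>\<^bsub>Ob Y n\<^esub> h (n + 1) (Diff V n x)
        = \<ominus>\<^bsub>Ob Y n\<^esub> (f n (F n x) \<oplus>\<^bsub>Ob Y n\<^esub> Diff Y (n - 1) (\<ominus>\<^bsub>Ob Y (n - 1)\<^esub> h n x))"
      apply (rule int_vectors[of "Ob Y n" "Diff Y (n - 1) (h n x)"
        "h (n + 1) (Diff V n x)" "\<zero>\<^bsub>Ob Y n\<^esub>" "\<zero>\<^bsub>Ob Y n\<^esub>" "\<zero>\<^bsub>Ob Y n\<^esub>" "\<zero>\<^bsub>Ob Y n\<^esub>"])
      using x assms e[OF x] diff_rules(5)[OF assms(2), of "h n x" "n - 1"]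
      by (simp_all add: comp_map_def diff_rules r)
    then show "w (n + 1) (Diff V n x) = Diff (shift (-1) (cone X Y f)) n (w n x)"
      using x assms
      by (simp add: w_def shift_diff diff_rules fr Fr r)
  qed
  have "hty V X F (comp_map fst_map w)"
    using assms by (intro hty_eq) (auto simp: comp_map_def fst_map_def w_def)
  then show thesis by (rule that[OF w])
qed

section \<open>Vanishing of Hom along the sides of a triangle\<close>

lemma HZD: "HZ X Y \<Longrightarrow> f \<in> cm X Y \<Longrightarrow> null X Y f"
  by (simp add: HZ_def)

lemma null_hty: "hty X Y f g \<Longrightarrow> null X Y g \<Longrightarrow> cx X \<Longrightarrow> cx Y \<Longrightarrow> null X Y f"
  by (rule hty_trans) (auto intro: cm_zero)

text \<open>Here Hom(V, Y) may be nonzero, as long as Hom(V, f) is onto it. This is the situation of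
  an approximation, and the reason why each triangle of the construction removes a degree from
  Hom(P, -).\<close>

lemma HZ_cone_target_lift:
  assumes "cx X" "cx Y" "f \<in> cm X Y" "cx V"
    and lift: "\<And>u. u \<in> cm V Y \<Longrightarrow> \<exists>v\<in>cm V X. hty V Y u (comp_map f v)"
    and z: "HZ V (shift 1 X)"
  shows "HZ V (cone X Y f)"
  unfolding HZ_def
proof
  fix F assume F: "F \<in> cm V (cone X Y f)"
  have i: "cone_in X \<in> cm Y (cone X Y f)" using assms by (intro cone_in_cm)
  have "null V (shift 1 X) (comp_map fst_map F)"
    using assms by (intro HZD[OF z] cm_comp[OF F] cone_out_cm)
  then obtain u where u: "u \<in> cm V Y" "hty V (cone X Y f) F (comp_map (cone_in X) u)"
    using cone_target_factor[OF assms(1-4) F] by blast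
  obtain v where v: "v \<in> cm V X" "hty V Y u (comp_map f v)" using lift[OF u(1)] by blast
  have "hty V (cone X Y f) (comp_map (cone_in X) u) (comp_map (cone_in X) (comp_map f v))"
    using assms v by (intro hty_comp_left[OF v(2) i] cx_cone cm_comp[OF v(1)])
  moreover have "null V (cone X Y f) (comp_map (comp_map (cone_in X) f) v)"
    using assms by (intro null_comp_right[OF cone_in_null v(1)]) auto
  ultimately have "null V (cone X Y f) (comp_map (cone_in X) u)"
    using assms by (auto simp: comp_assoc intro: null_hty)
  then show "null V (cone X Y f) F"
    using assms by (intro null_hty[OF u(2)]) auto
qed

lemma HZ_cone_target:
  assumes "cx X" "cx Y" "f \<in> cm X Y" "cx V" "HZ V Y" "HZ V (shift 1 X)"
  shows "HZ V (cone X Y f)"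
proof (rule HZ_cone_target_lift[OF assms(1-4) _ assms(6)])
  fix u assume "u \<in> cm V Y"
  moreover have "comp_map f (zero_map X) = (zero_map Y :: int \<Rightarrow> 'd \<Rightarrow> 'c)"
    using cm_rules(4)[OF assms(1-3)] by (auto simp: comp_map_def zero_map_def)
  ultimately show "\<exists>v\<in>cm V X. hty V Y u (comp_map f v)"
    using assms by (intro bexI[of _ "zero_map X"]) (auto intro: HZD cm_zero)
qed

lemma HZ_cone_middle:
  assumes "cx X" "cx Y" "f \<in> cm X Y" "cx V" "HZ V X" "HZ V (cone X Y f)"
  shows "HZ V Y"
  unfolding HZ_def
proof
  fix F assume F: "F \<in> cm V Y"
  have "null V (cone X Y f) (comp_map (cone_in X) F)"
    using assms by (intro HZD[OF assms(6)] cm_comp[OF F] cone_in_cm)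
  then obtain v where v: "v \<in> cm V X" "hty V Y F (comp_map f v)"
    using cone_in_null_factor[OF assms(1-4) F] by blast
  then show "null V Y F"
    using assms by (auto intro: null_hty null_comp_left HZD)
qed

lemma HZ_cone_source:
  assumes "cx X" "cx Y" "f \<in> cm X Y" "cx V" "HZ V Y" "HZ V (shift (-1) (cone X Y f))"
  shows "HZ V X"
  unfolding HZ_def
proof
  fix F assume F: "F \<in> cm V X"
  have "null V Y (comp_map f F)" using assms F by (auto intro: HZD cm_comp)
  then obtain w where w: "w \<in> cm V (shift (-1) (cone X Y f))" "hty V X F (comp_map fst_map w)"
    using cone_lift[OF assms(1-4) F] by blast
  have "null V X (comp_map fst_map w)"
    using assms w by (intro null_comp_left[OF _ cone_out_cm'] HZD) auto
  then show "null V X F"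
    using assms w by (auto intro: null_hty)
qed

section \<open>Retracts\<close>

text \<open>Retracts up to homotopy. Vanishing of Hom passes to retracts in either argument, so
  complexes that differ by signs or by their element type are compared through a pair of
  retractions, one in each direction.\<close>

definition ret :: "('a, 'm) cplx \<Rightarrow> ('a, 'n) cplx \<Rightarrow> bool" where
  "ret X Y \<longleftrightarrow> (\<exists>i\<in>cm X Y. \<exists>p\<in>cm Y X. hty X X (comp_map p i) id_map)"

lemma retI:
  assumes "cx X" "i \<in> cm X Y" "p \<in> cm Y X" "\<And>n x. x \<in> carrier (Ob X n) \<Longrightarrow> p n (i n x) = x"
  shows "ret X Y"
proof -
  have "comp_map p i \<in> cm X X" using assms by (intro cm_comp)
  then have "hty X X (comp_map p i) id_map"
    using assms by (intro hty_eq) (auto simp: id_map_def comp_map_def)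
  then show ?thesis unfolding ret_def using assms by blast
qed

lemma HZ_ret_left:
  assumes "ret X X'" "HZ X' Y" "cx X" "cx X'" "cx Y"
  shows "HZ X Y"
  unfolding HZ_def
proof
  fix f assume f: "f \<in> cm X Y"
  obtain i p where ip: "i \<in> cm X X'" "p \<in> cm X' X" "hty X X (comp_map p i) id_map"
    using assms(1) by (auto simp: ret_def)
  have "hty X Y (comp_map f (comp_map p i)) f"
    using hty_comp_left[OF ip(3) f] assms cm_id by fastforce
  then have "hty X Y f (comp_map (comp_map f p) i)"
    using assms f by (auto simp: comp_assoc intro: hty_sym)
  moreover have "null X Y (comp_map (comp_map f p) i)"
    using assms ip f by (auto intro!: null_comp_right[OF HZD] intro: cm_comp)
  ultimately show "null X Y f" using assms by (blast intro: null_hty)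
qed

lemma HZ_ret_right:
  assumes "ret Y Y'" "HZ X Y'" "cx X" "cx Y" "cx Y'"
  shows "HZ X Y"
  unfolding HZ_def
proof
  fix f assume f: "f \<in> cm X Y"
  obtain i p where ip: "i \<in> cm Y Y'" "p \<in> cm Y' Y" "hty Y Y (comp_map p i) id_map"
    using assms(1) by (auto simp: ret_def)
  have "hty X Y (comp_map (comp_map p i) f) f"
    using hty_comp_right[OF ip(3) f] assms by simp
  then have "hty X Y f (comp_map p (comp_map i f))"
    using assms f by (auto simp: comp_assoc intro: hty_sym)
  moreover have "null X Y (comp_map p (comp_map i f))"
    using assms ip f by (auto intro!: null_comp_left[OF HZD] intro: cm_comp)
  ultimately show "null X Y f" using assms by (blast intro: null_hty)
qed

lemma null_reindex:
  assumes "null X Y f" "cx X" "cx Y"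
  shows "null (reindex k X) (reindex k Y) (shift_map k f)"
  using assms
proof (rule nullE)
  fix h assume h: "\<And>n. h n \<in> hom (Ob X n) (Ob Y (n - 1))"
    and e: "\<And>n x. x \<in> carrier (Ob X n) \<Longrightarrow>
      f n x = Diff Y (n - 1) (h n x) \<oplus>\<^bsub>Ob Y n\<^esub> h (n + 1) (Diff X n x)"
  show ?thesis
  proof (rule nullI[of _ _ "\<lambda>n. h (n + k)"])
    show "h (n + k) \<in> hom (Ob (reindex k X) n) (Ob (reindex k Y) (n - 1))" for n
      using h[of "n + k"] by (simp add: algebra_simps)
    show "shift_map k f n x = Diff (reindex k Y) (n - 1) (h (n + k) x) \<oplus>\<^bsub>Ob (reindex k Y) n\<^esub>
        h (n + 1 + k) (Diff (reindex k X) n x)" if "x \<in> carrier (Ob (reindex k X) n)" for n x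
      using e[of x "n + k"] that by (simp add: shift_map_def algebra_simps)
  qed (use assms in auto)
qed

lemma HZ_reindex_imp:
  assumes "HZ X Y" "cx X" "cx Y"
  shows "HZ (reindex k X) (reindex k Y)"
  unfolding HZ_def
proof
  fix f assume "f \<in> cm (reindex k X) (reindex k Y)"
  then have "shift_map (- k) f \<in> cm X Y" using cm_shift_map[of f _ _ "- k"] by fastforce
  then have "null (reindex k X) (reindex k Y) (shift_map k (shift_map (- k) f))"
    using assms by (intro null_reindex HZD)
  then show "null (reindex k X) (reindex k Y) f" by (simp add: shift_map_def)
qed

lemma HZ_reindex: "cx X \<Longrightarrow> cx Y \<Longrightarrow> HZ (reindex k X) (reindex k Y) \<longleftrightarrow> HZ X Y"
  using HZ_reindex_imp[of X Y k] HZ_reindex_imp[of "reindex k X" "reindex k Y" "- k"] by auto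

lemma ret_shift_reindex:
  assumes "cx X"
  shows "ret (reindex i (shift k X)) (reindex (i + k) X)" "ret (reindex (i + k) X) (reindex i (shift k X))"
proof -
  note t = twist_maps(1,2)[OF assms, of k] twist_maps(3)[OF assms, where k = k]
  note s = cm_shift_map[OF t(1), where k = i, simplified] cm_shift_map[OF t(2), where k = i, simplified]
  have inv: "shift_map i (twist_map k X) n (shift_map i (twist_map k X) n x) = x"
    if "x \<in> carrier (Ob X (n + (i + k)))" for n x
    using t(3)[of x "n + i"] that by (simp add: shift_map_def ac_simps)
  show "ret (reindex i (shift k X)) (reindex (i + k) X)" "ret (reindex (i + k) X) (reindex i (shift k X))"
    using assms by (auto intro!: retI[OF _ s(1) s(2)] retI[OF _ s(2) s(1)] inv simp: add.assoc)
qed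

lemma ret_shift: "cx X \<Longrightarrow> ret (shift k X) (reindex k X)" "cx X \<Longrightarrow> ret (reindex k X) (shift k X)"
  using ret_shift_reindex[of X 0 k] by auto

text \<open>\<open>VZ X Y i\<close> stands for the vanishing of Hom(X, Y[i]) in K(A). The unsigned
  shift is isomorphic to the signed one and satisfies identities such as \<open>reindex_cone\<close>
  strictly.\<close>

definition VZ :: "('a, 'm) cplx \<Rightarrow> ('a, 'n) cplx \<Rightarrow> int \<Rightarrow> bool" where
  "VZ X Y i \<longleftrightarrow> HZ X (reindex i Y)"

lemma VZ_shift_right:
  assumes "cx X" "cx Y" shows "VZ X (shift b Y) i \<longleftrightarrow> VZ X Y (i + b)"
  unfolding VZ_def using assms ret_shift_reindex[of Y i b] by (auto intro: HZ_ret_right)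

lemma VZ_shift_left:
  assumes "cx X" "cx Y" shows "VZ (shift a X) Y i \<longleftrightarrow> VZ X Y (i - a)"
proof -
  have "HZ (shift a X) (reindex i Y) \<longleftrightarrow> HZ (reindex a X) (reindex i Y)"
    using assms ret_shift[of X a] by (auto intro: HZ_ret_left)
  also have "\<dots> \<longleftrightarrow> HZ (reindex a X) (reindex a (reindex (i - a) Y))" by simp
  also have "\<dots> \<longleftrightarrow> HZ X (reindex (i - a) Y)" using assms by (intro HZ_reindex) auto
  finally show ?thesis by (simp add: VZ_def)
qed

lemma HZ_shift: "cx X \<Longrightarrow> cx Y \<Longrightarrow> HZ X (shift b Y) \<longleftrightarrow> VZ X Y b"
  using VZ_shift_right[of X Y b 0] by (simp add: VZ_def)

lemma VZ_ret_left: "ret X X' \<Longrightarrow> VZ X' Y i \<Longrightarrow> cx X \<Longrightarrow> cx X' \<Longrightarrow> cx Y \<Longrightarrow> VZ X Y i"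
  unfolding VZ_def by (rule HZ_ret_left[of X X']) auto

lemma ret_reindex:
  assumes "ret X Y" "cx X" "cx Y"
  shows "ret (reindex k X) (reindex k Y)"
proof -
  obtain i p where ip: "i \<in> cm X Y" "p \<in> cm Y X" "hty X X (comp_map p i) id_map"
    using assms(1) by (auto simp: ret_def)
  have "null X X (add_map X (comp_map p i) (neg_map X id_map))"
    using ip assms cm_comp[OF ip(1,2)] hty_iff_null[of X X "comp_map p i" id_map] cm_id by blast
  then have *: "null (reindex k X) (reindex k X) (shift_map k (add_map X (comp_map p i) (neg_map X id_map)))"
    using assms by (intro null_reindex)
  have **: "shift_map k (add_map X (comp_map p i) (neg_map X id_map))
    = add_map (reindex k X) (comp_map (shift_map k p) (shift_map k i)) (neg_map (reindex k X) id_map)"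
    by (simp add: shift_map_def add_map_def comp_map_def neg_map_def id_map_def)
  have "hty (reindex k X) (reindex k X) (comp_map (shift_map k p) (shift_map k i)) id_map"
    using * ip assms unfolding **
    by (subst hty_iff_null) (auto intro!: cm_comp cm_shift_map cm_id)
  then show ?thesis unfolding ret_def using ip by (blast intro: cm_shift_map)
qed

lemma VZ_ret_right: "ret Y Y' \<Longrightarrow> VZ X Y' i \<Longrightarrow> cx X \<Longrightarrow> cx Y \<Longrightarrow> cx Y' \<Longrightarrow> VZ X Y i"
  unfolding VZ_def by (rule HZ_ret_right[OF ret_reindex]) auto

lemma ret_push:
  assumes "cx X" "\<And>n. inj_on j (carrier (Ob X n))"
  shows "ret X (push j X)" "ret (push j X) X"
  using assms push_maps[OF assms]
  by (auto intro!: retI[of _ "\<lambda>n. j" _ "unpush j X"] retI[of _ "unpush j X" _ "\<lambda>n. j"])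

lemma VZ_cone_target:
  assumes "cx X" "cx Y" "f \<in> cm X Y" "cx V" "VZ V Y i" "VZ V X (i + 1)"
  shows "VZ V (cone X Y f) i"
  unfolding VZ_def reindex_cone using assms
  by (intro HZ_cone_target) (auto intro: cm_shift_map simp: HZ_shift VZ_def add.commute)

lemma VZ_cone_middle:
  assumes "cx X" "cx Y" "f \<in> cm X Y" "cx V" "VZ V X i" "VZ V (cone X Y f) i"
  shows "VZ V Y i"
  using assms HZ_cone_middle[of "reindex i X" "reindex i Y" "shift_map i f" V]
  by (auto intro: cm_shift_map simp: VZ_def reindex_cone)

lemma VZ_cone_source:
  assumes "cx X" "cx Y" "f \<in> cm X Y" "cx V" "VZ V Y i" "VZ V (cone X Y f) (i - 1)"
  shows "VZ V X i"
proof -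
  have "HZ V (shift (-1) (cone (reindex i X) (reindex i Y) (shift_map i f)))"
    using assms by (simp add: HZ_shift VZ_def cm_shift_map flip: reindex_cone)
  then show ?thesis
    using assms HZ_cone_source[of "reindex i X" "reindex i Y" "shift_map i f" V]
    by (auto intro: cm_shift_map simp: VZ_def)
qed

end

section \<open>Finitely generated projective modules\<close>

text \<open>Sums with an explicit order of the terms: additivity, exchange of double sums and
  concatenation become plain inductions on the length.\<close>

primrec msum :: "('m, 'x) ring_scheme \<Rightarrow> (nat \<Rightarrow> 'm) \<Rightarrow> nat \<Rightarrow> 'm" where
  "msum G f 0 = \<zero>\<^bsub>G\<^esub>"
| "msum G f (Suc k) = msum G f k \<oplus>\<^bsub>G\<^esub> f k"

lemma msum_closed [simp]:
  "abelian_group G \<Longrightarrow> (\<And>j. j < n \<Longrightarrow> f j \<in> carrier G) \<Longrightarrow> msum G f n \<in> carrier G"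
proof (induction n)
  case (Suc n)
  interpret abelian_group G by fact
  show ?case using Suc by simp
qed (simp add: abelian_group_def abelian_monoid.zero_closed)

lemma msum_cong: "(\<And>j. j < n \<Longrightarrow> f j = g j) \<Longrightarrow> msum G f n = msum G g n"
  by (induction n) simp_all

lemma msum_zero: "abelian_group G \<Longrightarrow> (\<And>j. j < n \<Longrightarrow> f j = \<zero>\<^bsub>G\<^esub>) \<Longrightarrow> msum G f n = \<zero>\<^bsub>G\<^esub>"
proof (induction n)
  case (Suc n)
  interpret abelian_group G by fact
  show ?case using Suc by simp
qed simp

lemma msum_add:
  assumes "abelian_group G" "\<And>j. j < n \<Longrightarrow> f j \<in> carrier G" "\<And>j. j < n \<Longrightarrow> g j \<in> carrier G"
  shows "msum G (\<lambda>j. f j \<oplus>\<^bsub>G\<^esub> g j) n = msum G f n \<oplus>\<^bsub>G\<^esub> msum G g n"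
proof -
  interpret abelian_group G by fact
  show ?thesis using assms(2,3) by (induction n) (simp_all add: a_ac assms(1))
qed

lemma msum_append:
  assumes "abelian_group G" "\<And>j. j < n + m \<Longrightarrow> f j \<in> carrier G"
  shows "msum G f (n + m) = msum G f n \<oplus>\<^bsub>G\<^esub> msum G (\<lambda>j. f (n + j)) m"
proof -
  interpret abelian_group G by fact
  show ?thesis using assms(2) by (induction m) (simp_all add: a_ac assms(1))
qed

lemma msum_additive:
  assumes "abelian_group G" "abelian_group H" "h \<zero>\<^bsub>G\<^esub> = \<zero>\<^bsub>H\<^esub>"
    and "\<And>x y. x \<in> carrier G \<Longrightarrow> y \<in> carrier G \<Longrightarrow> h (x \<oplus>\<^bsub>G\<^esub> y) = h x \<oplus>\<^bsub>H\<^esub> h y"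
    and "\<And>j. j < n \<Longrightarrow> f j \<in> carrier G"
  shows "h (msum G f n) = msum H (\<lambda>j. h (f j)) n"
  using assms(5) by (induction n) (simp_all add: assms(1-4))

lemma msum_swap:
  assumes G: "abelian_group G" and "\<And>i j. i < n \<Longrightarrow> j < m \<Longrightarrow> f i j \<in> carrier G"
  shows "msum G (\<lambda>i. msum G (f i) m) n = msum G (\<lambda>j. msum G (\<lambda>i. f i j) n) m"
  using assms(2)
proof (induction n)
  case 0
  then show ?case using G by (simp add: msum_zero)
next
  case (Suc n)
  then show ?case using G by (simp add: msum_add)
qed

lemma mod_power_simps [simp]:
  "carrier (mod_power M n) = {..<n} \<rightarrow>\<^sub>E carrier M"
  "\<zero>\<^bsub>mod_power M n\<^esub> = (\<lambda>i\<in>{..<n}. \<zero>\<^bsub>M\<^esub>)"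
  "u \<oplus>\<^bsub>mod_power M n\<^esub> v = (\<lambda>i\<in>{..<n}. u i \<oplus>\<^bsub>M\<^esub> v i)"
  "r \<odot>\<^bsub>mod_power M n\<^esub> u = (\<lambda>i\<in>{..<n}. r \<odot>\<^bsub>M\<^esub> u i)"
  by (simp_all add: mod_power_def)

lemma regular_simps [simp]:
  "carrier (regular_module R) = carrier R"
  "\<zero>\<^bsub>regular_module R\<^esub> = \<zero>\<^bsub>R\<^esub>"
  "x \<oplus>\<^bsub>regular_module R\<^esub> y = x \<oplus>\<^bsub>R\<^esub> y"
  "r \<odot>\<^bsub>regular_module R\<^esub> x = x \<otimes>\<^bsub>R\<^esub> r"
  by (simp_all add: regular_module_def)

context complexes_over
begin

abbreviation reg :: "('a, 'a) module" where "reg \<equiv> regular_module A"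
abbreviation fgp :: "('a, 'm) module \<Rightarrow> bool" where "fgp M \<equiv> fg_projective A M"

text \<open>The working form of finitely generated projectivity. Lifts are written down with it, and
  traces are defined by it.\<close>

definition dual_basis ::
  "('a, 'm) module \<Rightarrow> nat \<Rightarrow> (nat \<Rightarrow> 'm) \<Rightarrow> (nat \<Rightarrow> 'm \<Rightarrow> 'a) \<Rightarrow> bool" where
  "dual_basis M n e \<epsilon> \<longleftrightarrow>
     (\<forall>j<n. e j \<in> carrier M \<and> \<epsilon> j \<in> hom M reg) \<and>
     (\<forall>x\<in>carrier M. x = msum M (\<lambda>j. \<epsilon> j x \<odot>\<^bsub>M\<^esub> e j) n)"

lemma rmod_reg [simp]: "rmod reg"
proof -
  interpret ring A by (rule ring_A)
  have "\<exists>y\<in>carrier reg. y \<oplus>\<^bsub>reg\<^esub> x = \<zero>\<^bsub>reg\<^esub>" if "x \<in> carrier reg" for x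
    using that by (intro bexI[of _ "\<ominus>\<^bsub>A\<^esub> x"]) (auto simp: l_neg)
  then show ?thesis
    by (intro rmodI) (auto simp: a_ac m_assoc l_distr r_distr)
qed

lemma rmod_power [simp]:
  assumes "rmod M"
  shows "rmod (mod_power M n)"
proof -
  have "\<exists>y\<in>carrier (mod_power M n). y \<oplus>\<^bsub>mod_power M n\<^esub> x = \<zero>\<^bsub>mod_power M n\<^esub>"
    if "x \<in> carrier (mod_power M n)" for x
    using that assms by (intro bexI[of _ "\<lambda>i\<in>{..<n}. \<ominus>\<^bsub>M\<^esub> x i"]) (auto simp: PiE_iff cong: restrict_cong)
  moreover have "restrict x {..<n} = x" if "x \<in> {..<n} \<rightarrow>\<^sub>E carrier M" for x
    using that by (simp add: PiE_iff extensional_restrict)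
  ultimately show ?thesis
    using assms
    by (intro rmodI)
      (simp_all add: PiE_mem[of _ "{..<n}" "\<lambda>_. carrier M"] rmod_ac rmod_smult cong: restrict_cong)
qed

lemma smult_hom: "rmod M \<Longrightarrow> y \<in> carrier M \<Longrightarrow> (\<lambda>a. a \<odot>\<^bsub>M\<^esub> y) \<in> hom reg M"
  by (auto intro!: homI simp: rmod_smult)

lemma msum_hom:
  assumes "rmod L" "rmod M" "\<And>j. j < n \<Longrightarrow> h j \<in> hom L M"
  shows "(\<lambda>x. msum M (\<lambda>j. h j x) n) \<in> hom L M"
  using assms(3) by (induction n) (auto intro!: hom_zero hom_add assms(1,2))

lemma hom_msum:
  assumes "rmod M" "rmod N" "h \<in> hom M N" "\<And>j. j < n \<Longrightarrow> f j \<in> carrier M"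
  shows "h (msum M f n) = msum N (\<lambda>j. h (f j)) n"
  using assms hom_rules[OF assms(1-3)] by (intro msum_additive) (auto intro: rmod_ab)

lemma dual_basisD:
  assumes "dual_basis M n e \<epsilon>" "rmod M"
  shows "j < n \<Longrightarrow> e j \<in> carrier M" "j < n \<Longrightarrow> \<epsilon> j \<in> hom M reg"
    "x \<in> carrier M \<Longrightarrow> j < n \<Longrightarrow> \<epsilon> j x \<in> carrier A"
    "x \<in> carrier M \<Longrightarrow> msum M (\<lambda>j. \<epsilon> j x \<odot>\<^bsub>M\<^esub> e j) n = x"
  using assms hom_rules(1)[OF assms(2) rmod_reg] by (auto simp: dual_basis_def)

lemma fgp_iff: "fgp M \<longleftrightarrow> rmod M \<and> (\<exists>n e \<epsilon>. dual_basis M n e \<epsilon>)"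
proof
  assume "fgp M"
  then obtain n i p where M: "rmod M" and i: "i \<in> hom M (mod_power reg n)"
    and p: "p \<in> hom (mod_power reg n) M" and pi: "\<And>x. x \<in> carrier M \<Longrightarrow> p (i x) = x"
    by (auto simp: fg_projective_def)
  interpret ring A by (rule ring_A)
  note ir = hom_rules[OF M rmod_power[OF rmod_reg] i] and pr = hom_rules[OF rmod_power[OF rmod_reg] M p]
  define E where "E = (\<lambda>j::nat. \<lambda>l\<in>{..<n}. if l = j then \<one>\<^bsub>A\<^esub> else \<zero>\<^bsub>A\<^esub>)"
  \<comment> \<open>\<open>T u k\<close> keeps the first \<open>k\<close> coordinates of
    \<open>u\<close>. Induction on \<open>k\<close> expands the value of \<open>p\<close> on it over
    the images of the unit vectors, and for \<open>k = n\<close> the truncation is \<open>u\<close>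
    itself. The dual basis consists of these images together with the coordinates of
    \<open>i\<close>.\<close>
  define T where "T = (\<lambda>u k. \<lambda>l\<in>{..<n}. if l < k then u l else \<zero>\<^bsub>A\<^esub>)"
  have E: "E j \<in> {..<n} \<rightarrow>\<^sub>E carrier A" for j :: nat by (auto simp: E_def)
  have "p (T u k) = msum M (\<lambda>j. u j \<odot>\<^bsub>M\<^esub> p (E j)) k"
    if u: "u \<in> {..<n} \<rightarrow>\<^sub>E carrier A" and "k \<le> n" for u k
    using \<open>k \<le> n\<close>
  proof (induction k)
    case 0
    have "T u 0 = \<zero>\<^bsub>mod_power reg n\<^esub>" by (auto simp: T_def)
    then show ?case using pr(4) by (simp only: msum.simps)
  next
    case (Suc k)
    note ul = PiE_mem[OF u]
    have uk: "u k \<in> carrier A" using ul[of k] Suc(2) by simp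
    have T: "T u k \<in> {..<n} \<rightarrow>\<^sub>E carrier A"
      unfolding T_def restrict_PiE_iff using ul by simp
    have e1: "T u (Suc k) = T u k \<oplus>\<^bsub>mod_power reg n\<^esub> (u k \<odot>\<^bsub>mod_power reg n\<^esub> E k)"
      unfolding T_def mod_power_simps
    proof (rule restrict_ext)
      fix l assume l: "l \<in> {..<n}"
      have "E k l \<otimes>\<^bsub>A\<^esub> u k = (if l = k then u k else \<zero>\<^bsub>A\<^esub>)" using l uk by (simp add: E_def)
      then show "(if l < Suc k then u l else \<zero>\<^bsub>A\<^esub>) = (\<lambda>l\<in>{..<n}. if l < k then u l else \<zero>\<^bsub>A\<^esub>) l
          \<oplus>\<^bsub>reg\<^esub> (\<lambda>i\<in>{..<n}. u k \<odot>\<^bsub>reg\<^esub> E k i) l"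
        using l uk ul[OF l] by (cases l k rule: linorder_cases) simp_all
    qed
    have e2: "p (T u k \<oplus>\<^bsub>mod_power reg n\<^esub> (u k \<odot>\<^bsub>mod_power reg n\<^esub> E k)) =
        p (T u k) \<oplus>\<^bsub>M\<^esub> u k \<odot>\<^bsub>M\<^esub> p (E k)"
      using pr(2)[of "T u k" "u k \<odot>\<^bsub>mod_power reg n\<^esub> E k"] pr(3)[of "u k" "E k"] T E[of k] uk
        rmod_simps(10)[of "mod_power reg n" "u k" "E k"]
      by simp
    show ?case unfolding e1 e2 using Suc by (simp only: msum.simps Suc_leD)
  qed
  note T = this
  have "x = msum M (\<lambda>j. i x j \<odot>\<^bsub>M\<^esub> p (E j)) n" if x: "x \<in> carrier M" for x
  proof -
    have ix: "i x \<in> {..<n} \<rightarrow>\<^sub>E carrier A" using ir(1)[OF x] by simp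
    then have "T (i x) n = i x" by (auto simp: T_def PiE_iff extensional_def)
    then show ?thesis using T[OF ix order_refl] pi[OF x] by simp
  qed
  moreover have "(\<lambda>x. i x j) \<in> hom M reg" if "j < n" for j
    using ir that by (intro homI) (auto simp: PiE_iff)
  ultimately have "dual_basis M n (\<lambda>j. p (E j)) (\<lambda>j x. i x j)"
    using pr(1) E by (auto simp: dual_basis_def)
  then show "rmod M \<and> (\<exists>n e \<epsilon>. dual_basis M n e \<epsilon>)" using M by blast
next
  assume "rmod M \<and> (\<exists>n e \<epsilon>. dual_basis M n e \<epsilon>)"
  then obtain n e \<epsilon> where M: "rmod M" and d: "dual_basis M n e \<epsilon>" by blast
  note dd = dual_basisD[OF d M]
  have i: "(\<lambda>x. \<lambda>j\<in>{..<n}. \<epsilon> j x) \<in> hom M (mod_power reg n)"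
    using dd(3) hom_rules[OF M rmod_reg dd(2)] by (intro homI) (auto intro!: restrict_ext)
  have p: "(\<lambda>u. msum M (\<lambda>j. u j \<odot>\<^bsub>M\<^esub> e j) n) \<in> hom (mod_power reg n) M"
    using M dd(1) by (intro msum_hom homI) (auto simp: rmod_smult PiE_iff)
  have pi: "msum M (\<lambda>j. (\<lambda>j\<in>{..<n}. \<epsilon> j x) j \<odot>\<^bsub>M\<^esub> e j) n = x" if "x \<in> carrier M" for x
    using dd(4)[OF that] by (simp cong: msum_cong)
  show "fgp M" unfolding fg_projective_def
    by (intro conjI M exI[of _ n] bexI[OF _ i] bexI[OF _ p] ballI pi)
qed

lemma fgp_rmod: "fgp M \<Longrightarrow> rmod M"
  by (simp add: fgp_iff)

text \<open>It is enough to choose preimages of the values of f on the elements of a dual basis; the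
  coordinate functions extend this choice linearly.\<close>

lemma fgp_lift:
  assumes "fgp M" "rmod N" "rmod L" "\<pi> \<in> hom N L" "f \<in> hom M L"
    and ex: "\<And>x. x \<in> carrier M \<Longrightarrow> \<exists>y\<in>carrier N. \<pi> y = f x"
  obtains h where "h \<in> hom M N" "\<And>x. x \<in> carrier M \<Longrightarrow> \<pi> (h x) = f x"
proof -
  obtain n e \<epsilon> where M: "rmod M" and d: "dual_basis M n e \<epsilon>" using assms(1) by (auto simp: fgp_iff)
  note dd = dual_basisD[OF d M] and pr = hom_rules[OF assms(2,3,4)] and fr = hom_rules[OF M assms(3,5)]
  have "\<forall>j. \<exists>y. j < n \<longrightarrow> y \<in> carrier N \<and> \<pi> y = f (e j)" using ex dd(1) by blast
  then obtain y where y: "\<And>j. j < n \<Longrightarrow> y j \<in> carrier N" "\<And>j. j < n \<Longrightarrow> \<pi> (y j) = f (e j)"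
    by metis
  define h where "h = (\<lambda>x. msum N (\<lambda>j. \<epsilon> j x \<odot>\<^bsub>N\<^esub> y j) n)"
  have h: "h \<in> hom M N" unfolding h_def
    using assms y dd by (intro msum_hom M) (auto intro: hom_comp[OF _ smult_hom])
  moreover have "\<pi> (h x) = f x" if x: "x \<in> carrier M" for x
  proof -
    have "\<pi> (h x) = msum L (\<lambda>j. \<epsilon> j x \<odot>\<^bsub>L\<^esub> f (e j)) n"
      unfolding h_def using assms y dd(3)[OF x]
      by (subst hom_msum[OF assms(2,3,4)]) (auto simp: pr intro!: msum_cong)
    also have "\<dots> = f (msum M (\<lambda>j. \<epsilon> j x \<odot>\<^bsub>M\<^esub> e j) n)"
      using M dd(1) dd(3)[OF x] by (subst hom_msum[OF M assms(3,5)]) (auto simp: fr intro!: msum_cong)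
    finally show ?thesis using dd(4)[OF x] by simp
  qed
  ultimately show thesis by (rule that)
qed

lemma fgp_retract:
  assumes "fgp N" "rmod M" "i \<in> hom M N" "p \<in> hom N M" "\<And>x. x \<in> carrier M \<Longrightarrow> p (i x) = x"
  shows "fgp M"
proof -
  obtain n e \<epsilon> where N: "rmod N" and d: "dual_basis N n e \<epsilon>" using assms(1) by (auto simp: fgp_iff)
  note dd = dual_basisD[OF d N] and pr = hom_rules[OF N assms(2,4)] and ir = hom_rules[OF assms(2) N assms(3)]
  have "msum M (\<lambda>j. \<epsilon> j (i x) \<odot>\<^bsub>M\<^esub> p (e j)) n = x" if x: "x \<in> carrier M" for x
  proof -
    have "x = p (msum N (\<lambda>j. \<epsilon> j (i x) \<odot>\<^bsub>N\<^esub> e j) n)" using dd(4)[OF ir(1)[OF x]] assms(5)[OF x] by simp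
    also have "\<dots> = msum M (\<lambda>j. \<epsilon> j (i x) \<odot>\<^bsub>M\<^esub> p (e j)) n"
      using N dd(1) dd(3)[OF ir(1)[OF x]]
      by (subst hom_msum[OF N assms(2,4)]) (auto simp: pr intro!: msum_cong)
    finally show ?thesis by simp
  qed
  then have "dual_basis M n (\<lambda>j. p (e j)) (\<lambda>j x. \<epsilon> j (i x))"
    using dd pr by (auto simp: dual_basis_def intro: hom_comp[OF assms(3)])
  then show ?thesis using assms(2) by (auto simp: fgp_iff)
qed

lemma fgp_zero:
  assumes "rmod M" "carrier M = {\<zero>\<^bsub>M\<^esub>}" shows "fgp M"
proof -
  have "dual_basis M 0 undefined undefined" using assms by (simp add: dual_basis_def)
  then show ?thesis using assms by (auto simp: fgp_iff)
qed

lemma fgp_reg: "fgp reg"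
proof -
  interpret ring A by (rule ring_A)
  have "dual_basis reg 1 (\<lambda>j. \<one>\<^bsub>A\<^esub>) (\<lambda>j x. x)" by (simp add: dual_basis_def hom_id)
  then show ?thesis by (auto simp: fgp_iff)
qed

lemma fgp_dsum:
  assumes "fgp M" "fgp N"
  shows "fgp (mod_dsum M N)"
proof -
  obtain n e \<epsilon> where M: "rmod M" and d: "dual_basis M n e \<epsilon>" using assms(1) by (auto simp: fgp_iff)
  obtain n' e' \<epsilon>' where N: "rmod N" and d': "dual_basis N n' e' \<epsilon>'" using assms(2) by (auto simp: fgp_iff)
  note dd = dual_basisD[OF d M] and dd' = dual_basisD[OF d' N]
  define E where "E = (\<lambda>j. if j < n then (e j, \<zero>\<^bsub>N\<^esub>) else (\<zero>\<^bsub>M\<^esub>, e' (j - n)))"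
  define F where "F = (\<lambda>j x. if j < n then \<epsilon> j (fst x) else \<epsilon>' (j - n) (snd x))"
  have D: "rmod (mod_dsum M N)" using M N by simp
  have E: "E j \<in> carrier (mod_dsum M N)" if "j < n + n'" for j
    using that M N dd(1) dd'(1) by (auto simp: E_def)
  have Fh: "F j \<in> hom (mod_dsum M N) reg" if "j < n + n'" for j
  proof (cases "j < n")
    case True
    then have "F j = (\<lambda>x. \<epsilon> j (fst x))" by (auto simp: F_def)
    then show ?thesis using dd(2) True by (simp add: hom_comp[OF hom_fst])
  next
    case False
    then have "F j = (\<lambda>x. \<epsilon>' (j - n) (snd x))" by (auto simp: F_def)
    then show ?thesis using dd'(2)[of "j - n"] False that by (simp add: hom_comp[OF hom_snd])
  qed
  have "msum (mod_dsum M N) (\<lambda>j. F j x \<odot>\<^bsub>mod_dsum M N\<^esub> E j) (n + n') = x"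
    if xc: "x \<in> carrier (mod_dsum M N)" for x
  proof -
    obtain y z where x: "x = (y, z)" "y \<in> carrier M" "z \<in> carrier N" using xc by auto
    have c: "F j x \<odot>\<^bsub>mod_dsum M N\<^esub> E j \<in> carrier (mod_dsum M N)" if "j < n + n'" for j
      using that D E hom_rules(1)[OF D rmod_reg Fh[OF that]] x by (intro rmod_simps) auto
    have "msum (mod_dsum M N) (\<lambda>j. F j x \<odot>\<^bsub>mod_dsum M N\<^esub> E j) n = (msum M (\<lambda>j. \<epsilon> j y \<odot>\<^bsub>M\<^esub> e j) n, \<zero>\<^bsub>N\<^esub>)"
    proof -
      have "msum (mod_dsum M N) (\<lambda>j. F j x \<odot>\<^bsub>mod_dsum M N\<^esub> E j) k = (msum M (\<lambda>j. \<epsilon> j y \<odot>\<^bsub>M\<^esub> e j) k, \<zero>\<^bsub>N\<^esub>)" if "k \<le> n" for k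
        using that by (induction k) (use x M N dd in \<open>auto simp: E_def F_def rmod_smult\<close>)
      then show ?thesis by simp
    qed
    moreover have "msum (mod_dsum M N) (\<lambda>j. F (n + j) x \<odot>\<^bsub>mod_dsum M N\<^esub> E (n + j)) n' = (\<zero>\<^bsub>M\<^esub>, msum N (\<lambda>j. \<epsilon>' j z \<odot>\<^bsub>N\<^esub> e' j) n')"
    proof -
      have "msum (mod_dsum M N) (\<lambda>j. F (n + j) x \<odot>\<^bsub>mod_dsum M N\<^esub> E (n + j)) k = (\<zero>\<^bsub>M\<^esub>, msum N (\<lambda>j. \<epsilon>' j z \<odot>\<^bsub>N\<^esub> e' j) k)" if "k \<le> n'" for k
        using that by (induction k) (use x M N dd' in \<open>auto simp: E_def F_def rmod_smult\<close>)
      then show ?thesis by simp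
    qed
    ultimately show ?thesis
      using c D x M N dd(4)[OF x(2)] dd'(4)[OF x(3)]
      by (subst msum_append) (auto intro: rmod_ab)
  qed
  then have "dual_basis (mod_dsum M N) (n + n') E F" using E Fh by (auto simp: dual_basis_def)
  then show ?thesis using D by (auto simp: fgp_iff)
qed

section \<open>Bounded complexes of finitely generated projectives\<close>

abbreviation kb :: "('a, 'm) cplx \<Rightarrow> bool" where "kb X \<equiv> in_Kb_proj A X"

lemma kbI:
  assumes "cx X" "\<And>n. fgp (Ob X n)" "\<And>n. n \<notin> {a..b} \<Longrightarrow> carrier (Ob X n) = {\<zero>\<^bsub>Ob X n\<^esub>}"
  shows "kb X"
  using assms by (auto simp: in_Kb_proj_def intro: finite_subset[of _ "{a..b}"])

lemma kb_fgp: "kb X \<Longrightarrow> fgp (Ob X n)"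
  by (simp add: in_Kb_proj_def)

lemma kb_bounds:
  assumes "kb X"
  shows "\<exists>a b. \<forall>n. n < a \<or> b < n \<longrightarrow> carrier (Ob X n) = {\<zero>\<^bsub>Ob X n\<^esub>}"
proof -
  let ?S = "{n. carrier (Ob X n) \<noteq> {\<zero>\<^bsub>Ob X n\<^esub>}}"
  have S: "finite ?S" using assms by (auto simp: in_Kb_proj_def)
  obtain a where a: "\<And>n. n \<in> ?S \<Longrightarrow> a \<le> n" using S by (meson bdd_below.unfold bdd_below_finite)
  obtain b where b: "\<And>n. n \<in> ?S \<Longrightarrow> n \<le> b" using S by (meson bdd_above.unfold bdd_above_finite)
  have "n \<notin> ?S" if "n < a \<or> b < n" for n
  proof
    assume "n \<in> ?S"
    from a[OF this] b[OF this] that show False by linarith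
  qed
  then show ?thesis by blast
qed

lemma kb_cx [simp]: "kb X \<Longrightarrow> cx X"
  by (simp add: in_Kb_proj_def)

lemma kb_reindex [simp]: assumes "kb X" shows "kb (reindex k X)"
proof -
  obtain a b where "\<And>n. n < a \<or> b < n \<Longrightarrow> carrier (Ob X n) = {\<zero>\<^bsub>Ob X n\<^esub>}"
    using kb_bounds[OF assms] by blast
  then show ?thesis using kb_fgp[OF assms] kb_cx[OF assms] by (intro kbI[of _ "a - k" "b - k"]) auto
qed

lemma kb_shift [simp]: assumes "kb X" shows "kb (shift k X)"
proof -
  obtain a b where "\<And>n. n < a \<or> b < n \<Longrightarrow> carrier (Ob X n) = {\<zero>\<^bsub>Ob X n\<^esub>}"
    using kb_bounds[OF assms] by blast
  then show ?thesis using kb_fgp[OF assms] kb_cx[OF assms] by (intro kbI[of _ "a - k" "b - k"]) auto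
qed

lemma kb_dsum [simp]: assumes "kb X" "kb Y" shows "kb (dsum X Y)"
proof -
  obtain a b where "\<And>n. n < a \<or> b < n \<Longrightarrow> carrier (Ob X n) = {\<zero>\<^bsub>Ob X n\<^esub>}"
    using kb_bounds[OF assms(1)] by blast
  moreover obtain a' b' where "\<And>n. n < a' \<or> b' < n \<Longrightarrow> carrier (Ob Y n) = {\<zero>\<^bsub>Ob Y n\<^esub>}"
    using kb_bounds[OF assms(2)] by blast
  ultimately show ?thesis
    using kb_fgp[OF assms(1)] kb_fgp[OF assms(2)] kb_cx[OF assms(1)] kb_cx[OF assms(2)] by (intro kbI[of _ "min a a'" "max b b'"])
      (auto simp: fgp_dsum min_le_iff_disj le_max_iff_disj not_le)
qed

lemma kb_cone [simp]: assumes "kb X" "kb Y" "f \<in> cm X Y" shows "kb (cone X Y f)"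
proof -
  obtain a b where "\<And>n. n < a \<or> b < n \<Longrightarrow> carrier (Ob X n) = {\<zero>\<^bsub>Ob X n\<^esub>}"
    using kb_bounds[OF assms(1)] by blast
  moreover obtain a' b' where "\<And>n. n < a' \<or> b' < n \<Longrightarrow> carrier (Ob Y n) = {\<zero>\<^bsub>Ob Y n\<^esub>}"
    using kb_bounds[OF assms(2)] by blast
  ultimately show ?thesis
    using kb_fgp[OF assms(1)] kb_fgp[OF assms(2)] kb_cx[OF assms(1)] kb_cx[OF assms(2)] using assms(3)
    by (intro kbI[of _ "min (a - 1) a'" "max b b'"])
      (auto simp: fgp_dsum min_le_iff_disj le_max_iff_disj not_le)
qed

lemma fgp_push: "fgp M \<Longrightarrow> inj_on j (carrier M) \<Longrightarrow> fgp (mod_push j M)"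
  using fgp_rmod[of M]
  by (intro fgp_retract[of M "mod_push j M" "inv_into (carrier M) j" j])
    (auto simp: rmod_push mod_push_hom, auto simp: mod_push_def)

lemma kb_push [simp]: assumes "kb X" "\<And>n. inj_on j (carrier (Ob X n))" shows "kb (push j X)"
proof -
  obtain a b where "\<And>n. n < a \<or> b < n \<Longrightarrow> carrier (Ob X n) = {\<zero>\<^bsub>Ob X n\<^esub>}"
    using kb_bounds[OF assms(1)] by blast
  then show ?thesis using assms(2) kb_fgp[OF assms(1)] kb_cx[OF assms(1)]
    by (intro kbI[of _ a b]) (auto simp: fgp_push, auto simp: mod_push_def)
qed

lemma rmod_zero_module [simp]: "rmod M \<Longrightarrow> rmod (zero_module M)"
  by (intro rmodI) (auto simp: zero_module_def rmod_smult)

lemma cx_stalk [simp]: "rmod M \<Longrightarrow> cx (stalk M)"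
  by (rule cxI) (auto simp: stalk_def zero_module_def rm_hom_def rmod_smult intro!: rmod_zero_module[unfolded zero_module_def])

lemma kb_stalk [simp]: "fgp M \<Longrightarrow> kb (stalk M)"
  using fgp_rmod[of M]
  by (intro kbI[of _ 0 0] cx_stalk) (auto simp: stalk_def intro!: fgp_zero, auto simp: zero_module_def)

end

section \<open>Cohomology and quasi-isomorphisms\<close>

context complexes_over
begin

abbreviation qis :: "('a, 'm) cplx \<Rightarrow> ('a, 'n) cplx \<Rightarrow> (int \<Rightarrow> 'm \<Rightarrow> 'n) \<Rightarrow> bool" where
  "qis X Y f \<equiv> quasi_iso A X Y f"

definition cyc :: "('a, 'm) cplx \<Rightarrow> int \<Rightarrow> 'm \<Rightarrow> bool" where
  "cyc X n x \<longleftrightarrow> x \<in> carrier (Ob X n) \<and> Diff X n x = \<zero>\<^bsub>Ob X (n + 1)\<^esub>"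

text \<open>Congruence modulo coboundaries, written the way the elements of the right cosets in
  \<open>cohomology\<close> look.\<close>

definition cob :: "('a, 'm) cplx \<Rightarrow> int \<Rightarrow> 'm \<Rightarrow> 'm \<Rightarrow> bool" where
  "cob X n x y \<longleftrightarrow> (\<exists>w\<in>carrier (Ob X (n - 1)). x = Diff X (n - 1) w \<oplus>\<^bsub>Ob X n\<^esub> y)"

definition acyclic :: "('a, 'm) cplx \<Rightarrow> bool" where
  "acyclic X \<longleftrightarrow> (\<forall>n x. cyc X n x \<longrightarrow> cob X n x \<zero>\<^bsub>Ob X n\<^esub>)"

lemma diff_pred:
  assumes "cx X"
  shows "w \<in> carrier (Ob X (n - 1)) \<Longrightarrow> Diff X (n - 1) w \<in> carrier (Ob X n)"
    and "w \<in> carrier (Ob X (n - 1)) \<Longrightarrow> v \<in> carrier (Ob X (n - 1)) \<Longrightarrow>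
      Diff X (n - 1) (w \<oplus>\<^bsub>Ob X (n - 1)\<^esub> v) = Diff X (n - 1) w \<oplus>\<^bsub>Ob X n\<^esub> Diff X (n - 1) v"
    and "w \<in> carrier (Ob X (n - 1)) \<Longrightarrow>
      Diff X (n - 1) (\<ominus>\<^bsub>Ob X (n - 1)\<^esub> w) = \<ominus>\<^bsub>Ob X n\<^esub> Diff X (n - 1) w"
    and "Diff X (n - 1) \<zero>\<^bsub>Ob X (n - 1)\<^esub> = \<zero>\<^bsub>Ob X n\<^esub>"
    and "w \<in> carrier (Ob X (n - 1)) \<Longrightarrow> Diff X n (Diff X (n - 1) w) = \<zero>\<^bsub>Ob X (n + 1)\<^esub>"
  using assms diff_rules(2)[OF assms, of w "n - 1" v] diff_rules(5)[OF assms, of w "n - 1"]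
    diff_rules(4)[OF assms, of "n - 1"] by (auto simp: diff_rules)

lemma cob_refl: "cx X \<Longrightarrow> x \<in> carrier (Ob X n) \<Longrightarrow> cob X n x x"
  unfolding cob_def by (intro bexI[of _ "\<zero>\<^bsub>Ob X (n - 1)\<^esub>"]) (auto simp: diff_pred)

lemma cob_sym:
  assumes "cx X" "y \<in> carrier (Ob X n)" "cob X n x y"
  shows "cob X n y x"
proof -
  obtain w where w: "w \<in> carrier (Ob X (n - 1))" "x = Diff X (n - 1) w \<oplus>\<^bsub>Ob X n\<^esub> y"
    using assms(3) by (auto simp: cob_def)
  show ?thesis unfolding cob_def
  proof (intro bexI[of _ "\<ominus>\<^bsub>Ob X (n - 1)\<^esub> w"])
    show "y = Diff X (n - 1) (\<ominus>\<^bsub>Ob X (n - 1)\<^esub> w) \<oplus>\<^bsub>Ob X n\<^esub> x"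
      using assms w by (simp add: diff_pred flip: rmod_ac(1))
  qed (use assms w in simp)
qed

lemma cob_trans:
  assumes "cx X" "z \<in> carrier (Ob X n)" "cob X n x y" "cob X n y z"
  shows "cob X n x z"
proof -
  obtain w v where "w \<in> carrier (Ob X (n - 1))" "x = Diff X (n - 1) w \<oplus>\<^bsub>Ob X n\<^esub> y"
    "v \<in> carrier (Ob X (n - 1))" "y = Diff X (n - 1) v \<oplus>\<^bsub>Ob X n\<^esub> z"
    using assms(3,4) by (auto simp: cob_def)
  then show ?thesis unfolding cob_def using assms
    by (intro bexI[of _ "w \<oplus>\<^bsub>Ob X (n - 1)\<^esub> v"]) (auto simp: diff_pred rmod_ac)
qed

lemma cob_add:
  assumes "cx X" "y \<in> carrier (Ob X n)" "y' \<in> carrier (Ob X n)" "cob X n x y" "cob X n x' y'"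
  shows "cob X n (x \<oplus>\<^bsub>Ob X n\<^esub> x') (y \<oplus>\<^bsub>Ob X n\<^esub> y')"
proof -
  obtain w v where "w \<in> carrier (Ob X (n - 1))" "x = Diff X (n - 1) w \<oplus>\<^bsub>Ob X n\<^esub> y"
    "v \<in> carrier (Ob X (n - 1))" "x' = Diff X (n - 1) v \<oplus>\<^bsub>Ob X n\<^esub> y'"
    using assms(4,5) by (auto simp: cob_def)
  then show ?thesis unfolding cob_def using assms
    by (intro bexI[of _ "w \<oplus>\<^bsub>Ob X (n - 1)\<^esub> v"]) (auto simp: diff_pred rmod_ac)
qed

lemma cob_add_right:
  assumes "cx X" "x \<in> carrier (Ob X n)" "y \<in> carrier (Ob X n)" "z \<in> carrier (Ob X n)" "cob X n x y"
  shows "cob X n (x \<oplus>\<^bsub>Ob X n\<^esub> z) (y \<oplus>\<^bsub>Ob X n\<^esub> z)"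
  using assms by (intro cob_add cob_refl)

lemma cob_diff_iff:
  assumes "cx X" "x \<in> carrier (Ob X n)" "y \<in> carrier (Ob X n)"
  shows "cob X n (x \<oplus>\<^bsub>Ob X n\<^esub> \<ominus>\<^bsub>Ob X n\<^esub> y) \<zero>\<^bsub>Ob X n\<^esub> \<longleftrightarrow> cob X n x y"
  using cob_add_right[OF assms(1) assms(2,3), of "\<ominus>\<^bsub>Ob X n\<^esub> y"]
    cob_add_right[OF assms(1), of "x \<oplus>\<^bsub>Ob X n\<^esub> \<ominus>\<^bsub>Ob X n\<^esub> y" n "\<zero>\<^bsub>Ob X n\<^esub>" y] assms
  by (auto simp: rmod_ac(1))

lemma cob_map:
  assumes "cx X" "cx Y" "f \<in> cm X Y" "y \<in> carrier (Ob X n)" "cob X n x y"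
  shows "cob Y n (f n x) (f n y)"
proof -
  note fr = cm_rules[OF assms(1-3)]
  obtain w where "w \<in> carrier (Ob X (n - 1))" "x = Diff X (n - 1) w \<oplus>\<^bsub>Ob X n\<^esub> y"
    using assms(5) by (auto simp: cob_def)
  then show ?thesis unfolding cob_def using assms(1,4)
    by (intro bexI[of _ "f (n - 1) w"]) (auto simp: diff_pred fr)
qed

lemma cob_map_zero:
  assumes "cx X" "cx Y" "f \<in> cm X Y" "cob X n x \<zero>\<^bsub>Ob X n\<^esub>"
  shows "cob Y n (f n x) \<zero>\<^bsub>Ob Y n\<^esub>"
  using cob_map[OF assms(1-3) _ assms(4)] cm_rules(4)[OF assms(1-3)] assms(1) by simp

lemma cycD: "cyc X n x \<Longrightarrow> x \<in> carrier (Ob X n)" "cyc X n x \<Longrightarrow> Diff X n x = \<zero>\<^bsub>Ob X (n + 1)\<^esub>"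
  by (simp_all add: cyc_def)

lemma cyc_zero: "cx X \<Longrightarrow> cyc X n \<zero>\<^bsub>Ob X n\<^esub>"
  by (simp add: cyc_def diff_rules)

lemma cyc_map: "cx X \<Longrightarrow> cx Y \<Longrightarrow> f \<in> cm X Y \<Longrightarrow> cyc X n x \<Longrightarrow> cyc Y n (f n x)"
  using cm_rules(6)[of X Y f "n + 1" n x] by (auto simp: cyc_def cm_rules)

lemma cyc_sub: "cx X \<Longrightarrow> cyc X n x \<Longrightarrow> cyc X n y \<Longrightarrow> cyc X n (x \<oplus>\<^bsub>Ob X n\<^esub> \<ominus>\<^bsub>Ob X n\<^esub> y)"
  by (simp add: cyc_def diff_rules)

lemma cob_hty:
  assumes "hty X Y f g" "cx X" "cx Y" "g \<in> cm X Y" "cyc X n x"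
  shows "cob Y n (f n x) (g n x)"
  using assms(1-3)
proof (rule htyE)
  fix h assume r: "\<And>n m x. m = n - 1 \<Longrightarrow> x \<in> carrier (Ob X n) \<Longrightarrow> h n x \<in> carrier (Ob Y m)"
      "\<And>n. h n \<zero>\<^bsub>Ob X n\<^esub> = \<zero>\<^bsub>Ob Y (n - 1)\<^esub>"
    and e: "\<And>n x. x \<in> carrier (Ob X n) \<Longrightarrow>
      f n x = g n x \<oplus>\<^bsub>Ob Y n\<^esub> (Diff Y (n - 1) (h n x) \<oplus>\<^bsub>Ob Y n\<^esub> h (n + 1) (Diff X n x))"
  show ?thesis unfolding cob_def
    using assms(2-5) cycD[OF assms(5)] r(2)[of "n + 1"] e[of x n] cm_rules(1)[OF assms(2-4), of x n]
    by (intro bexI[of _ "h n x"]) (auto simp: r(1) diff_pred rmod_ac)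
qed

lemma coset_eq:
  "coboundaries X n +>\<^bsub>Ob X n\<^esub> x = {Diff X (n - 1) w \<oplus>\<^bsub>Ob X n\<^esub> x |w. w \<in> carrier (Ob X (n - 1))}"
  by (auto simp: a_r_coset_def r_coset_def coboundaries_def)

lemma coset_eq_iff:
  assumes "cx X" "x \<in> carrier (Ob X n)" "y \<in> carrier (Ob X n)"
  shows "coboundaries X n +>\<^bsub>Ob X n\<^esub> x = coboundaries X n +>\<^bsub>Ob X n\<^esub> y \<longleftrightarrow> cob X n x y"
proof -
  have *: "coboundaries X n +>\<^bsub>Ob X n\<^esub> z = {u. cob X n u z}" for z
    by (auto simp: coset_eq cob_def)
  show ?thesis unfolding *
    using cob_refl[OF assms(1,2)] cob_trans[OF assms(1)] cob_sym[OF assms(1)] assms by blast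
qed

lemma cohomology_eq: "cohomology X n = (\<lambda>x. coboundaries X n +>\<^bsub>Ob X n\<^esub> x) ` {x. cyc X n x}"
  by (auto simp: cohomology_def cocycles_def a_kernel_def' cyc_def)

lemma cohomology_map_eq:
  assumes "cx X" "cx Y" "f \<in> cm X Y" "x \<in> carrier (Ob X n)"
  shows "cohomology_map Y f n (coboundaries X n +>\<^bsub>Ob X n\<^esub> x) = coboundaries Y n +>\<^bsub>Ob Y n\<^esub> f n x"
proof -
  note fr = cm_rules[OF assms(1-3)]
  have "coboundaries Y n +>\<^bsub>Ob Y n\<^esub> f n z = coboundaries Y n +>\<^bsub>Ob Y n\<^esub> f n x" if "cob X n z x" for z
  proof -
    have "z \<in> carrier (Ob X n)" using that assms by (auto simp: cob_def diff_pred)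
    then show ?thesis using that assms fr cob_map[OF assms(1-3)] by (subst coset_eq_iff) auto
  qed
  note const = this
  have "coboundaries X n +>\<^bsub>Ob X n\<^esub> x = {u. cob X n u x}" by (auto simp: coset_eq cob_def)
  then have "cohomology_map Y f n (coboundaries X n +>\<^bsub>Ob X n\<^esub> x)
      = (\<Union>z\<in>{u. cob X n u x}. coboundaries Y n +>\<^bsub>Ob Y n\<^esub> f n x)"
    unfolding cohomology_map_def by (simp add: const)
  moreover have "{u. cob X n u x} \<noteq> {}" using cob_refl[OF assms(1,4)] by blast
  ultimately show ?thesis by auto
qed

lemma cohomology_zero_iff:
  assumes "cx X"
  shows "cohomology_zero X n \<longleftrightarrow> (\<forall>x. cyc X n x \<longrightarrow> cob X n x \<zero>\<^bsub>Ob X n\<^esub>)"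
proof -
  have 0: "coboundaries X n = coboundaries X n +>\<^bsub>Ob X n\<^esub> \<zero>\<^bsub>Ob X n\<^esub>"
    unfolding coset_eq using assms by (force simp: coboundaries_def diff_pred)
  have "cohomology_zero X n \<longleftrightarrow> (\<forall>x. cyc X n x \<longrightarrow> coboundaries X n +>\<^bsub>Ob X n\<^esub> x = coboundaries X n)"
    unfolding cohomology_zero_def cohomology_eq using cyc_zero[OF assms, of n] by auto
  also have "\<dots> \<longleftrightarrow> (\<forall>x. cyc X n x \<longrightarrow> cob X n x \<zero>\<^bsub>Ob X n\<^esub>)"
    by (subst (2) 0) (use assms coset_eq_iff[OF assms, of _ n "\<zero>\<^bsub>Ob X n\<^esub>"] in \<open>auto dest: cycD\<close>)
  finally show ?thesis .
qed

text \<open>Bijectivity on cosets, restated for cocycles, so that diagram chases need no cosets.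
  Injectivity only has to be tested against zero, because cocycles can be subtracted.\<close>

lemma quasi_iso_iff:
  assumes "cx X" "cx Y"
  shows "qis X Y f \<longleftrightarrow> f \<in> cm X Y \<and>
    (\<forall>n x. cyc X n x \<longrightarrow> cob Y n (f n x) \<zero>\<^bsub>Ob Y n\<^esub> \<longrightarrow> cob X n x \<zero>\<^bsub>Ob X n\<^esub>) \<and>
    (\<forall>n y. cyc Y n y \<longrightarrow> (\<exists>x. cyc X n x \<and> cob Y n y (f n x)))"
proof (cases "f \<in> cm X Y")
  case True
  note fr = cm_rules[OF assms True]
  let ?c = "\<lambda>n x. coboundaries X n +>\<^bsub>Ob X n\<^esub> x" and ?d = "\<lambda>n x. coboundaries Y n +>\<^bsub>Ob Y n\<^esub> x"
  have m: "cohomology_map Y f n (?c n x) = ?d n (f n x)" if "cyc X n x" for n x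
    using cohomology_map_eq[OF assms True cycD(1)[OF that]] .
  have e: "?c n x = ?c n y \<longleftrightarrow> cob X n x y" "?d n (f n x) = ?d n (f n y) \<longleftrightarrow> cob Y n (f n x) (f n y)"
    if "cyc X n x" "cyc X n y" for n x y
    using that assms by (auto simp: coset_eq_iff cycD fr)
  have "inj_on (cohomology_map Y f n) (cohomology X n) \<longleftrightarrow>
      (\<forall>x. cyc X n x \<longrightarrow> cob Y n (f n x) \<zero>\<^bsub>Ob Y n\<^esub> \<longrightarrow> cob X n x \<zero>\<^bsub>Ob X n\<^esub>)" (is "?I \<longleftrightarrow> ?J") for n
  proof -
    have "?I \<longleftrightarrow> (\<forall>x y. cyc X n x \<longrightarrow> cyc X n y \<longrightarrow> cob Y n (f n x) (f n y) \<longrightarrow> cob X n x y)"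
      unfolding cohomology_eq inj_on_def using m e by auto
    also have "\<dots> \<longleftrightarrow> ?J"
    proof
      assume *: "\<forall>x y. cyc X n x \<longrightarrow> cyc X n y \<longrightarrow> cob Y n (f n x) (f n y) \<longrightarrow> cob X n x y"
      then show ?J using cyc_zero[OF assms(1), of n] fr(4)[of n] by metis
    next
      assume J: ?J
      show "\<forall>x y. cyc X n x \<longrightarrow> cyc X n y \<longrightarrow> cob Y n (f n x) (f n y) \<longrightarrow> cob X n x y"
      proof (intro allI impI)
        fix x y assume c: "cyc X n x" "cyc X n y" and "cob Y n (f n x) (f n y)"
        then have "cob Y n (f n x \<oplus>\<^bsub>Ob Y n\<^esub> \<ominus>\<^bsub>Ob Y n\<^esub> f n y) \<zero>\<^bsub>Ob Y n\<^esub>"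
          using assms by (subst cob_diff_iff) (auto simp: fr cycD)
        then have "cob Y n (f n (x \<oplus>\<^bsub>Ob X n\<^esub> \<ominus>\<^bsub>Ob X n\<^esub> y)) \<zero>\<^bsub>Ob Y n\<^esub>"
          using c assms by (simp add: fr cycD)
        then show "cob X n x y"
          using J cyc_sub[OF assms(1) c] cob_diff_iff[OF assms(1) cycD(1)[OF c(1)] cycD(1)[OF c(2)]] by blast
      qed
    qed
    finally show ?thesis .
  qed
  moreover have "cohomology_map Y f n ` cohomology X n = cohomology Y n \<longleftrightarrow>
      (\<forall>y. cyc Y n y \<longrightarrow> (\<exists>x. cyc X n x \<and> cob Y n y (f n x)))" for n
  proof -
    have "cohomology_map Y f n ` cohomology X n = (\<lambda>x. ?d n (f n x)) ` {x. cyc X n x}"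
      unfolding cohomology_eq image_image using m by auto
    moreover have "(\<lambda>x. ?d n (f n x)) ` {x. cyc X n x} \<subseteq> cohomology Y n"
      unfolding cohomology_eq using cyc_map[OF assms True] by auto
    ultimately have "cohomology_map Y f n ` cohomology X n = cohomology Y n \<longleftrightarrow>
      cohomology Y n \<subseteq> (\<lambda>x. ?d n (f n x)) ` {x. cyc X n x}"
      by (metis subset_antisym subset_refl)
    then have "cohomology_map Y f n ` cohomology X n = cohomology Y n \<longleftrightarrow>
      (\<forall>y. cyc Y n y \<longrightarrow> (\<exists>x. cyc X n x \<and> ?d n y = ?d n (f n x)))"
      unfolding cohomology_eq[of Y] by (simp add: image_subset_iff image_iff Bex_def)
    moreover have "?d n y = ?d n (f n x) \<longleftrightarrow> cob Y n y (f n x)" if "cyc Y n y" "cyc X n x" for x y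
      using that assms by (intro coset_eq_iff) (auto simp: fr cycD)
    ultimately show ?thesis by (simp cong: conj_cong)
  qed
  ultimately show ?thesis using True unfolding quasi_iso_def bij_betw_def by auto
qed (auto simp: quasi_iso_def)

section \<open>Calculus of quasi-isomorphisms\<close>

lemma qisD:
  assumes "qis X Y f" "cx X" "cx Y"
  shows "f \<in> cm X Y"
    and "cyc X n x \<Longrightarrow> cob Y n (f n x) \<zero>\<^bsub>Ob Y n\<^esub> \<Longrightarrow> cob X n x \<zero>\<^bsub>Ob X n\<^esub>"
    and "cyc Y n y \<Longrightarrow> \<exists>x. cyc X n x \<and> cob Y n y (f n x)"
  using assms by (auto simp: quasi_iso_iff)

lemma qisI:
  assumes "cx X" "cx Y" "f \<in> cm X Y"
    and "\<And>n x. cyc X n x \<Longrightarrow> cob Y n (f n x) \<zero>\<^bsub>Ob Y n\<^esub> \<Longrightarrow> cob X n x \<zero>\<^bsub>Ob X n\<^esub>"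
    and "\<And>n y. cyc Y n y \<Longrightarrow> \<exists>x. cyc X n x \<and> cob Y n y (f n x)"
  shows "qis X Y f"
  using assms by (auto simp: quasi_iso_iff)

lemma qis_comp:
  assumes f: "qis X Y f" and g: "qis Y Z g" and c: "cx X" "cx Y" "cx Z"
  shows "qis X Z (comp_map g f)"
proof (rule qisI)
  note fc = qisD(1)[OF f c(1,2)] and gc = qisD(1)[OF g c(2,3)]
  note fr = cm_rules[OF c(1,2) fc] and gr = cm_rules[OF c(2,3) gc]
  show "comp_map g f \<in> cm X Z" by (rule cm_comp[OF fc gc])
  show "cob X n x \<zero>\<^bsub>Ob X n\<^esub>" if "cyc X n x" "cob Z n (comp_map g f n x) \<zero>\<^bsub>Ob Z n\<^esub>" for n x
    using that qisD(2)[OF f c(1,2)] qisD(2)[OF g c(2,3)] cyc_map[OF c(1,2) fc] by (auto simp: comp_map_def)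
  show "\<exists>x. cyc X n x \<and> cob Z n z (comp_map g f n x)" if z: "cyc Z n z" for n z
  proof -
    obtain y where y: "cyc Y n y" "cob Z n z (g n y)" using qisD(3)[OF g c(2,3) z] by blast
    obtain x where x: "cyc X n x" "cob Y n y (f n x)" using qisD(3)[OF f c(1,2) y(1)] by blast
    have "cob Z n z (g n (f n x))"
      using cob_trans[OF c(3) _ y(2) cob_map[OF c(2,3) gc _ x(2)]] x by (simp add: fr gr cycD)
    then show ?thesis using x by (auto simp: comp_map_def)
  qed
qed (use c in auto)

lemma qis_hty:
  assumes f: "qis X Y f" and h: "hty X Y f g" and g: "g \<in> cm X Y" and c: "cx X" "cx Y"
  shows "qis X Y g"
proof (rule qisI)
  note fc = qisD(1)[OF f c]
  note fr = cm_rules[OF c fc] and gr = cm_rules[OF c g]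
  show "cob X n x \<zero>\<^bsub>Ob X n\<^esub>" if "cyc X n x" "cob Y n (g n x) \<zero>\<^bsub>Ob Y n\<^esub>" for n x
    using qisD(2)[OF f c that(1)] cob_trans[OF c(2) _ cob_hty[OF h c g that(1)] that(2)] c by simp
  show "\<exists>x. cyc X n x \<and> cob Y n y (g n x)" if y: "cyc Y n y" for n y
  proof -
    obtain x where x: "cyc X n x" "cob Y n y (f n x)" using qisD(3)[OF f c y] by blast
    then show ?thesis
      using cob_trans[OF c(2) gr(1)[OF cycD(1)[OF x(1)]] x(2) cob_hty[OF h c g x(1)]] by blast
  qed
qed (use c g in auto)

lemma qis_cancel_left:
  assumes g: "qis Y Z g" and gf: "qis X Z (comp_map g f)" and f: "f \<in> cm X Y" and c: "cx X" "cx Y" "cx Z"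
  shows "qis X Y f"
proof (rule qisI)
  note gc = qisD(1)[OF g c(2,3)]
  note fr = cm_rules[OF c(1,2) f] and gr = cm_rules[OF c(2,3) gc]
  show "cob X n x \<zero>\<^bsub>Ob X n\<^esub>" if "cyc X n x" "cob Y n (f n x) \<zero>\<^bsub>Ob Y n\<^esub>" for n x
    using cob_map_zero[OF c(2,3) gc that(2)] qisD(2)[OF gf c(1,3) that(1)] by (simp add: comp_map_def)
  show "\<exists>x. cyc X n x \<and> cob Y n y (f n x)" if y: "cyc Y n y" for n y
  proof -
    obtain x where x: "cyc X n x" "cob Z n (g n y) (g n (f n x))"
      using qisD(3)[OF gf c(1,3) cyc_map[OF c(2,3) gc y]] by (auto simp: comp_map_def)
    have fx: "cyc Y n (f n x)" by (rule cyc_map[OF c(1,2) f x(1)])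
    have "cob Z n (g n y \<oplus>\<^bsub>Ob Z n\<^esub> \<ominus>\<^bsub>Ob Z n\<^esub> g n (f n x)) \<zero>\<^bsub>Ob Z n\<^esub>"
      using x y c fx by (subst cob_diff_iff) (auto simp: gr fr cycD)
    then have "cob Z n (g n (y \<oplus>\<^bsub>Ob Y n\<^esub> \<ominus>\<^bsub>Ob Y n\<^esub> f n x)) \<zero>\<^bsub>Ob Z n\<^esub>"
      using y fx c by (simp add: gr cycD)
    then show ?thesis
      using qisD(2)[OF g c(2,3) cyc_sub[OF c(2) y fx]] x(1)
        cob_diff_iff[OF c(2) cycD(1)[OF y] cycD(1)[OF fx]] by blast
  qed
qed (use c f in auto)

lemma qis_homotopy_equiv:
  assumes f: "f \<in> cm X Y" and g: "g \<in> cm Y X" and c: "cx X" "cx Y"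
    and "hty X X (comp_map g f) id_map" "hty Y Y (comp_map f g) id_map"
  shows "qis X Y f"
proof (rule qisI)
  note fr = cm_rules[OF c f] and gr = cm_rules[OF c(2,1) g]
  show "cob X n x \<zero>\<^bsub>Ob X n\<^esub>" if x: "cyc X n x" and b: "cob Y n (f n x) \<zero>\<^bsub>Ob Y n\<^esub>" for n x
  proof -
    have "cob X n (g n (f n x)) x"
      using cob_hty[OF assms(5) c(1,1) cm_id x] by (simp add: comp_map_def id_map_def)
    then have "cob X n x (g n (f n x))" using c x by (auto intro: cob_sym dest: cycD(1))
    then show ?thesis using cob_map_zero[OF c(2,1) g b] c cob_trans[OF c(1)] by auto
  qed
  show "\<exists>x. cyc X n x \<and> cob Y n y (f n x)" if y: "cyc Y n y" for n y
  proof -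
    have "cob Y n (f n (g n y)) y"
      using cob_hty[OF assms(6) c(2,2) cm_id y] by (simp add: comp_map_def id_map_def)
    then have "cob Y n y (f n (g n y))" using c y by (auto intro: cob_sym dest: cycD(1))
    then show ?thesis using cyc_map[OF c(2,1) g y] by blast
  qed
qed (use c f in auto)

lemma qis_iso:
  assumes "f \<in> cm X Y" "g \<in> cm Y X" "cx X" "cx Y"
    and "\<And>n x. x \<in> carrier (Ob X n) \<Longrightarrow> g n (f n x) = x" "\<And>n y. y \<in> carrier (Ob Y n) \<Longrightarrow> f n (g n y) = y"
  shows "qis X Y f"
proof (rule qis_homotopy_equiv[OF assms(1-4)])
  show "hty X X (comp_map g f) id_map" "hty Y Y (comp_map f g) id_map"
    using assms cm_comp[OF assms(1,2)] cm_comp[OF assms(2,1)]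
    by (auto intro!: hty_eq simp: comp_map_def id_map_def)
qed

lemma qis_id: "cx X \<Longrightarrow> qis X X id_map"
  by (rule qis_iso[OF cm_id cm_id]) (auto simp: id_map_def)

lemma qis_push:
  assumes "cx X" "\<And>n. inj_on j (carrier (Ob X n))"
  shows "qis X (push j X) (\<lambda>n. j)" "qis (push j X) X (unpush j X)"
  using assms push_maps[OF assms]
  by (auto intro!: qis_iso[of "\<lambda>n. j" _ _ "unpush j X"] qis_iso[of "unpush j X" _ _ "\<lambda>n. j"])

lemma acyclic_cone:
  assumes f: "qis X Y f" and c: "cx X" "cx Y"
  shows "acyclic (cone X Y f)"
  unfolding acyclic_def
proof (intro allI impI)
  fix n p assume p: "cyc (cone X Y f) n p"
  note fc = qisD(1)[OF f c]
  note fr = cm_rules[OF c fc]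
  obtain z y where zy: "p = (z, y)" "z \<in> carrier (Ob X (n + 1))" "y \<in> carrier (Ob Y n)"
    using cycD(1)[OF p] by auto
  have e: "\<ominus>\<^bsub>Ob X (n + 1 + 1)\<^esub> Diff X (n + 1) z = \<zero>\<^bsub>Ob X (n + 1 + 1)\<^esub>"
    "f (n + 1) z \<oplus>\<^bsub>Ob Y (n + 1)\<^esub> Diff Y n y = \<zero>\<^bsub>Ob Y (n + 1)\<^esub>"
    using cycD(2)[OF p] zy by auto
  have "Diff X (n + 1) z = \<ominus>\<^bsub>Ob X (n + 1 + 1)\<^esub> (\<ominus>\<^bsub>Ob X (n + 1 + 1)\<^esub> Diff X (n + 1) z)"
    using zy c diff_rules(1)[OF c(1) refl zy(2)] by simp
  then have z: "cyc X (n + 1) z" using e(1) zy c by (simp add: cyc_def)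
  have "cob Y (n + 1) (f (n + 1) z) \<zero>\<^bsub>Ob Y (n + 1)\<^esub>"
  proof -
    have "f (n + 1) z = Diff Y n (\<ominus>\<^bsub>Ob Y n\<^esub> y)"
      using e(2) zy c rmod_minus_unique[of "Ob Y (n + 1)" "f (n + 1) z" "Diff Y n y"]
      by (auto simp: fr diff_rules)
    then show ?thesis unfolding cob_def using zy c
      by (intro bexI[of _ "\<ominus>\<^bsub>Ob Y n\<^esub> y"]) (auto simp: diff_rules)
  qed
  then have "cob X (n + 1) z \<zero>\<^bsub>Ob X (n + 1)\<^esub>" by (rule qisD(2)[OF f c z])
  then obtain z' where z': "z' \<in> carrier (Ob X n)" "z = Diff X n z'"
    using c by (auto simp: cob_def diff_rules)
  have "cyc Y n (y \<oplus>\<^bsub>Ob Y n\<^esub> f n z')"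
    using zy z' c e(2) rmod_ac(2)[of "Ob Y (n + 1)" "f (n + 1) z" "Diff Y n y"]
    by (auto simp: cyc_def diff_rules fr)
  then obtain x where x: "cyc X n x" "cob Y n (y \<oplus>\<^bsub>Ob Y n\<^esub> f n z') (f n x)"
    using qisD(3)[OF f c] by blast
  then obtain y' where y': "y' \<in> carrier (Ob Y (n - 1))"
      "y \<oplus>\<^bsub>Ob Y n\<^esub> f n z' = Diff Y (n - 1) y' \<oplus>\<^bsub>Ob Y n\<^esub> f n x"
    by (auto simp: cob_def)
  \<comment> \<open>The cocycle (z, y) has z = d z', and y + f z' = d y' + f x for a cocycle x. Then
    (x - z', y') bounds it: its first component reproduces z since d x = 0, and its second one
    collects the remaining terms of y.\<close>
  define a where "a = x \<oplus>\<^bsub>Ob X n\<^esub> \<ominus>\<^bsub>Ob X n\<^esub> z'"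
  have a: "a \<in> carrier (Ob X n)" using x z' c by (auto simp: a_def cycD)
  have 1: "z = \<ominus>\<^bsub>Ob X (n + 1)\<^esub> Diff X n a"
    using x z' c by (auto simp: a_def cycD diff_rules)
  have "y = (y \<oplus>\<^bsub>Ob Y n\<^esub> f n z') \<oplus>\<^bsub>Ob Y n\<^esub> \<ominus>\<^bsub>Ob Y n\<^esub> f n z'"
    using zy z' c by (simp add: rmod_ac(1) fr)
  then have 2: "y = f n a \<oplus>\<^bsub>Ob Y n\<^esub> Diff Y (n - 1) y'"
    unfolding y'(2) using zy z' c x y' by (auto simp: a_def fr cycD diff_pred rmod_ac)
  show "cob (cone X Y f) n p \<zero>\<^bsub>Ob (cone X Y f) n\<^esub>"
    unfolding cob_def using a y' 1 2 zy c
    by (intro bexI[of _ "(a, y')"]) (auto simp: diff_rules fr diff_pred)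
qed

end

section \<open>Bounded complexes of projectives and the derived category\<close>

context complexes_over
begin

text \<open>The homotopy is built degree by degree, from the top degree of \<open>X\<close> downwards.\<close>

lemma HZ_acyclic:
  assumes X: "kb X" and E: "cx E" "acyclic E"
  shows "HZ X E"
  unfolding HZ_def
proof
  fix f assume f: "f \<in> cm X E"
  have cX: "cx X" using X by simp
  note fr = cm_rules[OF cX E(1) f]
  obtain a b where ab: "\<And>n. n < a \<or> b < n \<Longrightarrow> carrier (Ob X n) = {\<zero>\<^bsub>Ob X n\<^esub>}"
    using kb_bounds[OF X] by blast
  define m where "m = (\<lambda>k::nat. b - int k)"
  have m: "m k + 1 - 1 = m k" "m (Suc k) = m k - 1" for k by (auto simp: m_def)
  \<comment> \<open>\<open>?P k\<close> concerns the homotopy in degree \<open>m k + 1\<close>. The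
    equation d h d = f d makes f - h d take values in cocycles, which is the obstruction to the next
    step down; acyclicity of \<open>E\<close> turns these values into boundaries and projectivity
    lifts them to a map. \<open>?Q\<close> records the homotopy equation in degree
    \<open>m k\<close>.\<close>
  let ?P = "\<lambda>k h. h \<in> hom (Ob X (m k + 1)) (Ob E (m k)) \<and>
    (\<forall>x\<in>carrier (Ob X (m k)). Diff E (m k) (h (Diff X (m k) x)) = f (m k + 1) (Diff X (m k) x))"
  let ?Q = "\<lambda>k h h'. \<forall>x\<in>carrier (Ob X (m k)). f (m k) x = Diff E (m k - 1) (h' x) \<oplus>\<^bsub>Ob E (m k)\<^esub> h (Diff X (m k) x)"
  have "\<exists>H. \<forall>k. ?P k (H k) \<and> ?Q k (H k) (H (Suc k))"
  proof (rule dependent_nat_choice)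
    have "Diff X (m 0) x = \<zero>\<^bsub>Ob X (m 0 + 1)\<^esub>" if "x \<in> carrier (Ob X (m 0))" for x
      using diff_rules(1)[OF cX refl that] ab[of "m 0 + 1"] by (simp add: m_def)
    then have "?P 0 (\<lambda>x. \<zero>\<^bsub>Ob E (m 0)\<^esub>)"
      using E(1) by (auto simp: hom_zero diff_rules fr)
    then show "\<exists>h. ?P 0 h" by blast
    fix h k assume P: "?P k h"
    define F where "F = (\<lambda>x. f (m k) x \<oplus>\<^bsub>Ob E (m k)\<^esub> \<ominus>\<^bsub>Ob E (m k)\<^esub> h (Diff X (m k) x))"
    have h: "h \<in> hom (Ob X (m k + 1)) (Ob E (m k))" using P by blast
    have hc: "h y \<in> carrier (Ob E (m k))" if "y \<in> carrier (Ob X (m k + 1))" for y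
      using hom_rules(1)[OF _ _ h that] cX E(1) by simp
    have F: "F \<in> hom (Ob X (m k)) (Ob E (m k))"
      unfolding F_def using cX E(1) f
      by (intro hom_add hom_neg hom_comp[OF diff_hom h] cm_hom) auto
    have ex: "\<exists>y\<in>carrier (Ob E (m k - 1)). Diff E (m k - 1) y = F x" if x: "x \<in> carrier (Ob X (m k))" for x
    proof -
      have "cyc E (m k) (F x)"
        using x P cX E(1) hc by (simp add: cyc_def F_def fr diff_rules)
      then have "cob E (m k) (F x) \<zero>\<^bsub>Ob E (m k)\<^esub>" using E(2) by (simp add: acyclic_def)
      then show ?thesis using E(1) by (auto simp: cob_def diff_pred)
    qed
    have dE: "Diff E (m k - 1) \<in> hom (Ob E (m k - 1)) (Ob E (m k))"
      using diff_hom[OF E(1), of "m k - 1"] by simp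
    obtain h' where h': "h' \<in> hom (Ob X (m k)) (Ob E (m k - 1))"
      and e: "\<And>x. x \<in> carrier (Ob X (m k)) \<Longrightarrow> Diff E (m k - 1) (h' x) = F x"
      using fgp_lift[OF kb_fgp[OF X] cx_rmod[OF E(1)] cx_rmod[OF E(1)] dE F ex] by blast
    have c': "h' y \<in> carrier (Ob E (m k - 1))" if "y \<in> carrier (Ob X (m k))" for y
      using hom_rules(1)[OF _ _ h' that] cX E(1) by simp
    have Q: "?Q k h h'"
      using cX E(1) hc by (auto simp: e F_def rmod_ac(1) fr diff_rules)
    have d0: "h \<zero>\<^bsub>Ob X (m k + 1)\<^esub> = \<zero>\<^bsub>Ob E (m k)\<^esub>" using hom_rules(4)[OF _ _ h] cX E(1) by simp
    have "?P (Suc k) h'"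
    proof (intro conjI ballI)
      show "h' \<in> hom (Ob X (m (Suc k) + 1)) (Ob E (m (Suc k)))" using h' by (simp add: m)
      fix x assume x: "x \<in> carrier (Ob X (m (Suc k)))"
      have dx: "Diff X (m k - 1) x \<in> carrier (Ob X (m k))" using x cX by (simp add: m diff_pred)
      show "Diff E (m (Suc k)) (h' (Diff X (m (Suc k)) x)) = f (m (Suc k) + 1) (Diff X (m (Suc k)) x)"
        using x dx cX E(1) by (simp add: m e F_def diff_pred d0 fr)
    qed
    then show "\<exists>h'. ?P (Suc k) h' \<and> ?Q k h h'" using Q by blast
  qed
  then obtain H where P: "\<And>k. ?P k (H k)" and Q: "\<And>k. ?Q k (H k) (H (Suc k))" by blast
  \<comment> \<open>\<open>H k\<close> belongs to degree \<open>m k + 1 = b + 1 - k\<close>, which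
    is solved here for \<open>k\<close>. Above \<open>b\<close> the complex \<open>X\<close>
    vanishes and any linear choice would do.\<close>
  define h where "h = (\<lambda>n. if n \<le> b + 1 then H (nat (b + 1 - n)) else (\<lambda>x. \<zero>\<^bsub>Ob E (n - 1)\<^esub>))"
  show "null X E f"
  proof (rule nullI[of _ _ h])
    fix n
    show "h n \<in> hom (Ob X n) (Ob E (n - 1))"
      using P[of "nat (b + 1 - n)"] E(1) by (auto simp: h_def m_def hom_zero)
    fix x assume x: "x \<in> carrier (Ob X n)"
    show "f n x = Diff E (n - 1) (h n x) \<oplus>\<^bsub>Ob E n\<^esub> h (n + 1) (Diff X n x)"
    proof (cases "n \<le> b")
      case True
      define k where "k = nat (b - n)"
      have k: "m k = n" "nat (b + 1 - n) = Suc k" "nat (b - n) = k" using True by (auto simp: k_def m_def)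
      show ?thesis using Q[of k] x True by (simp add: h_def k)
    next
      case False
      then have x0: "x = \<zero>\<^bsub>Ob X n\<^esub>" using ab[of n] x by auto
      have "h n x = \<zero>\<^bsub>Ob E (n - 1)\<^esub>"
        using \<open>h n \<in> _\<close> x0 hom_rules(4)[of "Ob X n" "Ob E (n - 1)" "h n"] cX E(1) by simp
      moreover have "h (n + 1) (Diff X n x) = \<zero>\<^bsub>Ob E n\<^esub>" using False by (simp add: h_def)
      ultimately show ?thesis using x0 E(1) by (simp add: fr diff_pred)
    qed
  qed (use cX E in auto)
qed

lemma acyclic_reindex: "acyclic X \<Longrightarrow> acyclic (reindex i X)"
  unfolding acyclic_def
proof (intro allI impI)
  fix n x assume *: "\<forall>n x. cyc X n x \<longrightarrow> cob X n x \<zero>\<^bsub>Ob X n\<^esub>" and "cyc (reindex i X) n x"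
  then have "cob X (n + i) x \<zero>\<^bsub>Ob X (n + i)\<^esub>" by (simp add: cyc_def ac_simps)
  then show "cob (reindex i X) n x \<zero>\<^bsub>Ob (reindex i X) n\<^esub>" by (simp add: cob_def algebra_simps)
qed

lemma VZ_acyclic: "kb X \<Longrightarrow> cx E \<Longrightarrow> acyclic E \<Longrightarrow> VZ X E i"
  unfolding VZ_def by (intro HZ_acyclic acyclic_reindex) auto

text \<open>The cone of \<open>q\<close> is acyclic and receives no maps from \<open>X\<close> in
  any degree, so the triangle of \<open>q\<close> identifies the two vanishing statements.\<close>

lemma VZ_qis:
  assumes "kb X" "qis Y Z q" "cx Y" "cx Z"
  shows "VZ X Y i \<longleftrightarrow> VZ X Z i"
proof -
  note c = assms(3,4) qisD(1)[OF assms(2-4)]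
  have *: "VZ X (cone Y Z q) j" for j
    using assms c by (intro VZ_acyclic acyclic_cone) auto
  show ?thesis
    using VZ_cone_middle[OF c kb_cx[OF assms(1)] _ *] VZ_cone_source[OF c kb_cx[OF assms(1)] _ *] by blast
qed

lemma HZ_VZ: "HZ X Y \<longleftrightarrow> VZ X Y 0"
  by (simp add: VZ_def)

text \<open>Complexes in K^b(proj A) are K-projective: this is the surjectivity of Hom(X, q), and
  \<open>qis_hty_cancel\<close> is its injectivity. The obstruction lies in maps from
  \<open>X\<close> to the acyclic cone of \<open>q\<close>.\<close>

lemma qis_lift:
  assumes "kb X" "qis Y Z q" "cx Y" "cx Z" "f \<in> cm X Z"
  obtains u where "u \<in> cm X Y" "hty X Z f (comp_map q u)"
proof -
  note c = assms(3,4) qisD(1)[OF assms(2-4)]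
  have "HZ X (cone Y Z q)" using assms c by (intro HZ_acyclic acyclic_cone) auto
  then have "null X (cone Y Z q) (comp_map (cone_in Y) f)"
    using assms c by (intro HZD cm_comp[OF assms(5)] cone_in_cm)
  then show thesis using cone_in_null_factor[OF c _ assms(5)] assms(1) that by auto
qed

text \<open>A map killed by \<open>q\<close> comes from the shifted cone of \<open>q\<close>, which
  is acyclic.\<close>

lemma qis_null_cancel:
  assumes "kb X" "qis Y Z q" "cx Y" "cx Z" "f \<in> cm X Y" "null X Z (comp_map q f)"
  shows "null X Y f"
proof -
  note c = assms(3,4) qisD(1)[OF assms(2-4)]
  obtain w where w: "w \<in> cm X (shift (-1) (cone Y Z q))" "hty X Y f (comp_map fst_map w)"
    using cone_lift[OF c _ assms(5,6)] assms(1) by auto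
  have "VZ X (cone Y Z q) (-1)" using assms c by (intro VZ_acyclic acyclic_cone) auto
  then have "HZ X (shift (-1) (cone Y Z q))" using c assms(1) by (simp add: HZ_shift)
  then have "null X Y (comp_map fst_map w)"
    using c w assms(1) by (intro null_comp_left[OF HZD cone_out_cm']) auto
  then show ?thesis using w(2) assms by (auto intro: null_hty)
qed

lemma qis_hty_cancel:
  assumes "kb X" "qis Y Z q" "cx Y" "cx Z" "f \<in> cm X Y" "g \<in> cm X Y"
    and "hty X Z (comp_map q f) (comp_map q g)"
  shows "hty X Y f g"
proof -
  note c = assms(3,4) qisD(1)[OF assms(2-4)]
  have cX: "cx X" using assms by simp
  note qr = cm_rules[OF c] and fr = cm_rules[OF cX assms(3,5)] and gr = cm_rules[OF cX assms(3,6)]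
  have d: "add_map Y f (neg_map Y g) \<in> cm X Y" using assms cX by (intro cm_add cm_neg)
  have "null X Z (add_map Z (comp_map q f) (neg_map Z (comp_map q g)))"
    using assms cX c hty_iff_null[OF cX assms(4) cm_comp[OF assms(5) c(3)] cm_comp[OF assms(6) c(3)]] by simp
  moreover have "hty X Z (comp_map q (add_map Y f (neg_map Y g))) (add_map Z (comp_map q f) (neg_map Z (comp_map q g)))"
    using cX assms cm_comp[OF d c(3)]
    by (intro hty_eq) (auto simp: comp_map_def add_map_def neg_map_def qr fr gr)
  ultimately have "null X Z (comp_map q (add_map Y f (neg_map Y g)))"
    using cX assms by (blast intro: null_hty)
  then have "null X Y (add_map Y f (neg_map Y g))"
    by (rule qis_null_cancel[OF assms(1-4) d])
  then show ?thesis using hty_iff_null[OF cX assms(3,5,6)] by simp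
qed

section \<open>Comparison with the derived category\<close>

lemma roofsE:
  assumes "\<rho> \<in> roofs A X Y" "cx X"
  obtains Z s f where "\<rho> = (Z, s, f)" "cx Z" "qis Z X s" "f \<in> cm Z Y"
  using assms by (auto simp: roofs_def)

text \<open>If the roof given by a map \<open>f\<close> out of \<open>R\<close> is trivial, then
  \<open>f\<close> becomes null-homotopic after some quasi-isomorphism \<open>u\<close> into
  \<open>R\<close>, and K-projectivity splits \<open>u\<close> up to homotopy. Conversely
  \<open>q\<close> lifts to the apex of every roof, so \<open>R\<close> itself serves as the common
  apex that shows the roof to be trivial.\<close>

lemma homD_zero_iff:
  fixes X R :: "('a, 'm) cplx" and Y :: "('a, 'n) cplx"
  assumes R: "kb R" "qis R X q" and c: "cx X" "cx Y"
  shows "homD_zero A X Y \<longleftrightarrow> HZ R Y"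
proof
  have cR: "cx R" using R by simp
  note qc = qisD(1)[OF R(2) cR c(1)]
  assume D: "homD_zero A X Y"
  show "HZ R Y" unfolding HZ_def
  proof
    fix f assume f: "f \<in> cm R Y"
    then have "(R, q, f) \<in> roofs A X Y" using R cR by (simp add: roofs_def)
    then have "roof_equiv A X Y (R, q, f) (X, id_map, zero_map Y)" using D by (simp add: homD_zero_def)
    then obtain W :: "('a, 'm) cplx" and u u' where W: "cx W" "u \<in> cm W R" "u' \<in> cm W X"
        "qis W X (comp_map q u)" "hty W Y (comp_map f u) (comp_map (zero_map Y) u')"
      by (auto simp: roof_equiv_def)
    have u: "qis W R u" using qis_cancel_left[OF R(2) W(4) W(2)] W cR c by simp
    obtain v where v: "v \<in> cm R W" "hty R R id_map (comp_map u v)"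
      using qis_lift[OF R(1) u W(1) cR cm_id] by blast
    have "null W Y (comp_map f u)" using W(5) by (simp add: comp_map_def zero_map_def)
    then have 1: "null R Y (comp_map (comp_map f u) v)" by (rule null_comp_right[OF _ v(1) cR W(1) c(2)])
    have "hty R Y (comp_map f id_map) (comp_map f (comp_map u v))"
      using v W f cR c by (intro hty_comp_left[OF v(2)] cm_comp) auto
    then show "null R Y f" using 1 cR c by (auto simp: comp_assoc intro: null_hty)
  qed
next
  have cR: "cx R" using R by simp
  note qc = qisD(1)[OF R(2) cR c(1)]
  assume H: "HZ R Y"
  show "homD_zero A X Y" unfolding homD_zero_def
  proof
    fix \<rho> assume "\<rho> \<in> roofs A X Y"
    then obtain Z s f where \<rho>: "\<rho> = (Z, s, f)" "cx Z" "qis Z X s" "f \<in> cm Z Y"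
      using c(1) by (rule roofsE)
    note sc = qisD(1)[OF \<rho>(3,2) c(1)]
    obtain u where u: "u \<in> cm R Z" "hty R X q (comp_map s u)"
      using qis_lift[OF R(1) \<rho>(3,2) c(1) qc] by blast
    have su: "comp_map s u \<in> cm R X" by (rule cm_comp[OF u(1) sc])
    have 1: "qis R X (comp_map s u)" by (rule qis_hty[OF R(2) u(2) su cR c(1)])
    have 2: "hty R X (comp_map s u) (comp_map id_map q)"
      using hty_sym[OF u(2) cR c(1) su] by simp
    have "hty R Y (comp_map f u) (comp_map (zero_map Y) q)"
      using HZD[OF H cm_comp[OF u(1) \<rho>(4)]] by (simp add: comp_map_def zero_map_def)
    then show "roof_equiv A X Y \<rho> (X, id_map, zero_map Y)"
      unfolding \<rho>(1) roof_equiv_def prod.case using cR u(1) qc 1 2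
      by (intro exI[of _ R] exI[of _ u] exI[of _ q] conjI) auto
  qed
qed

lemma derived_isoI:
  assumes "qis X Y f" "cx X"
  shows "derived_iso A X Y"
proof -
  have "f \<in> cm X Y" using assms(1) by (simp add: quasi_iso_def)
  then show ?thesis unfolding derived_iso_def
    using assms qis_id by (intro bexI[of _ "(X, id_map, f)"]) (auto simp: roofs_def)
qed

lemma derived_isoE:
  fixes X :: "('a, 'm) cplx"
  assumes "derived_iso A X Y"
  obtains Z :: "('a, 'm) cplx" and s f where "cx Z" "qis Z X s" "qis Z Y f"
  using assms by (auto simp: derived_iso_def roofs_def)

text \<open>A chain map from the stalk of A is determined by the image of 1, which can be any
  cocycle of degree 0; null-homotopies correspond in the same way to elements bounding that
  cocycle.\<close>

lemma HZ_regular_iff: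
  assumes c: "cx Y"
  shows "HZ (stalk reg) Y \<longleftrightarrow> cohomology_zero Y 0"
proof
  interpret ring A by (rule ring_A)
  assume H: "HZ (stalk reg) Y"
  show "cohomology_zero Y 0" unfolding cohomology_zero_iff[OF c]
  proof (intro allI impI)
    fix y assume y: "cyc Y 0 y"
    define f where "f = (\<lambda>n a. if n = (0::int) then a \<odot>\<^bsub>Ob Y n\<^esub> y else \<zero>\<^bsub>Ob Y n\<^esub>)"
    have "f n \<in> hom (Ob (stalk reg) n) (Ob Y n)" for n
      using y c smult_hom[of "Ob Y 0" y] by (cases "n = 0") (simp_all add: f_def stalk_def hom_zero cycD)
    moreover have "f (n + 1) (Diff (stalk reg) n x) = Diff Y n (f n x)" if "x \<in> carrier (Ob (stalk reg) n)" for n x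
    proof -
      have "f (n + 1) (Diff (stalk reg) n x) = \<zero>\<^bsub>Ob Y (n + 1)\<^esub>"
        using y c by (simp add: f_def stalk_def cycD)
      moreover have "Diff Y n (f n x) = \<zero>\<^bsub>Ob Y (n + 1)\<^esub>"
      proof (cases "n = 0")
        case True
        have x: "x \<in> carrier A" using that True by (simp add: stalk_def)
        show ?thesis using diff_rules(3)[OF c x cycD(1)[OF y]] cycD(2)[OF y] x c True by (simp add: f_def)
      qed (simp add: f_def diff_rules c)
      ultimately show ?thesis by simp
    qed
    ultimately have "f \<in> cm (stalk reg) Y" by (intro cmI) auto
    then have "null (stalk reg) Y f" by (rule HZD[OF H])
    then show "cob Y 0 y \<zero>\<^bsub>Ob Y 0\<^esub>"
    proof (rule nullE)
      fix h assume r: "\<And>n m x. m = n - 1 \<Longrightarrow> x \<in> carrier (Ob (stalk reg) n) \<Longrightarrow> h n x \<in> carrier (Ob Y m)"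
        "\<And>n. h n \<zero>\<^bsub>Ob (stalk reg) n\<^esub> = \<zero>\<^bsub>Ob Y (n - 1)\<^esub>"
        and e: "\<And>n x. x \<in> carrier (Ob (stalk reg) n) \<Longrightarrow>
          f n x = Diff Y (n - 1) (h n x) \<oplus>\<^bsub>Ob Y n\<^esub> h (n + 1) (Diff (stalk reg) n x)"
      have o: "\<one>\<^bsub>A\<^esub> \<in> carrier (Ob (stalk reg) 0)" by (simp add: stalk_def)
      have "h 1 (Diff (stalk reg) 0 \<one>\<^bsub>A\<^esub>) = \<zero>\<^bsub>Ob Y 0\<^esub>"
        using r(2)[of 1] by (simp add: stalk_def zero_module_def)
      then have "y = Diff Y (- 1) (h 0 \<one>\<^bsub>A\<^esub>) \<oplus>\<^bsub>Ob Y 0\<^esub> \<zero>\<^bsub>Ob Y 0\<^esub>"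
        using e[OF o] y c by (simp add: f_def cycD)
      then show ?thesis using r(1)[OF _ o, of "-1"] by (auto simp: cob_def)
    qed (use c in auto)
  qed
next
  interpret ring A by (rule ring_A)
  assume Z: "cohomology_zero Y 0"
  show "HZ (stalk reg) Y" unfolding HZ_def
  proof
    fix f assume f: "f \<in> cm (stalk reg) Y"
    have cs: "cx (stalk reg)" by simp
    note fr = cm_rules[OF cs c f]
    have o: "\<one>\<^bsub>A\<^esub> \<in> carrier (Ob (stalk reg) 0)" by (simp add: stalk_def)
    have "Diff Y 0 (f 0 \<one>\<^bsub>A\<^esub>) = \<zero>\<^bsub>Ob Y 1\<^esub>"
      using fr(6)[OF _ o, of 1] fr(4)[of 1] by (simp add: stalk_def zero_module_def)
    then have "cyc Y 0 (f 0 \<one>\<^bsub>A\<^esub>)" using fr(1)[OF o] by (simp add: cyc_def)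
    then obtain z where z: "z \<in> carrier (Ob Y (- 1))" "f 0 \<one>\<^bsub>A\<^esub> = Diff Y (- 1) z"
      using Z c diff_pred(1)[OF c, of _ 0] unfolding cohomology_zero_iff[OF c] by (auto simp: cob_def)
    define h where "h = (\<lambda>n a. if n = (0::int) then a \<odot>\<^bsub>Ob Y (- 1)\<^esub> z else \<zero>\<^bsub>Ob Y (n - 1)\<^esub>)"
    show "null (stalk reg) Y f"
    proof (rule nullI[of _ _ h])
      show "h n \<in> hom (Ob (stalk reg) n) (Ob Y (n - 1))" for n
        using z c smult_hom[of "Ob Y (-1)" z] by (cases "n = 0") (simp_all add: h_def stalk_def hom_zero)
      fix n x assume x: "x \<in> carrier (Ob (stalk reg) n)"
      show "f n x = Diff Y (n - 1) (h n x) \<oplus>\<^bsub>Ob Y n\<^esub> h (n + 1) (Diff (stalk reg) n x)"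
      proof (cases "n = 0")
        case True
        have x: "x \<in> carrier A" using x True by (simp add: stalk_def)
        have "f 0 x = x \<odot>\<^bsub>Ob Y 0\<^esub> f 0 \<one>\<^bsub>A\<^esub>"
          using fr(3)[OF x o] x by (simp add: stalk_def)
        also have "\<dots> = Diff Y (- 1) (x \<odot>\<^bsub>Ob Y (- 1)\<^esub> z)"
          using diff_rules(3)[OF c x z(1)] z by simp
        finally show ?thesis using True x z c diff_pred(1)[OF c, of _ 0] by (simp add: h_def)
      next
        case False
        then have x0: "x = \<zero>\<^bsub>Ob (stalk reg) n\<^esub>" using x by (simp add: stalk_def zero_module_def)
        have "f n x = \<zero>\<^bsub>Ob Y n\<^esub>" unfolding x0 by (rule fr(4))
        moreover have "h (n + 1) (Diff (stalk reg) n x) = \<zero>\<^bsub>Ob Y n\<^esub>"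
        proof (cases "n + 1 = 0")
          case True
          then have n: "n = - 1" by simp
          show ?thesis using z c unfolding n by (simp add: h_def stalk_def)
        qed (simp add: h_def)
        ultimately show ?thesis using False c by (simp add: h_def diff_pred)
      qed
    qed (use c cs in auto)
  qed
qed

lemma cohomology_zero_reindex: "cx Y \<Longrightarrow> cohomology_zero (reindex i Y) n \<longleftrightarrow> cohomology_zero Y (n + i)"
  by (simp add: cohomology_zero_iff cyc_def cob_def algebra_simps)

lemma VZ_regular_iff: "cx Y \<Longrightarrow> VZ (stalk reg) Y i \<longleftrightarrow> cohomology_zero Y i"
  by (simp add: VZ_def HZ_regular_iff cohomology_zero_reindex)

end

section \<open>Duality over a symmetric algebra\<close>

text \<open>The kernel of the functional is a maximal subspace avoiding \<open>v\<close>.\<close>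

lemma (in module) separating_functional:
  assumes "field R" and B: "B \<subseteq> carrier M" "\<zero>\<^bsub>M\<^esub> \<in> B"
    "\<And>x y. x \<in> B \<Longrightarrow> y \<in> B \<Longrightarrow> x \<oplus>\<^bsub>M\<^esub> y \<in> B"
    "\<And>c x. c \<in> carrier R \<Longrightarrow> x \<in> B \<Longrightarrow> c \<odot>\<^bsub>M\<^esub> x \<in> B"
    and v: "v \<in> carrier M" "v \<notin> B"
  obtains \<phi> where "\<phi> \<in> carrier M \<rightarrow> carrier R"
    "\<And>x y. x \<in> carrier M \<Longrightarrow> y \<in> carrier M \<Longrightarrow> \<phi> (x \<oplus>\<^bsub>M\<^esub> y) = \<phi> x \<oplus> \<phi> y"
    "\<And>c x. c \<in> carrier R \<Longrightarrow> x \<in> carrier M \<Longrightarrow> \<phi> (c \<odot>\<^bsub>M\<^esub> x) = c \<otimes> \<phi> x"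
    "\<And>x. x \<in> B \<Longrightarrow> \<phi> x = \<zero>" "\<phi> v = \<one>"
proof -
  interpret F: field R by fact
  define S where "S = {W. B \<subseteq> W \<and> W \<subseteq> carrier M \<and> v \<notin> W \<and> (\<forall>x\<in>W. \<forall>y\<in>W. x \<oplus>\<^bsub>M\<^esub> y \<in> W) \<and>
    (\<forall>c\<in>carrier R. \<forall>x\<in>W. c \<odot>\<^bsub>M\<^esub> x \<in> W)}"
  have chain: "\<Union>C \<in> S" if C: "C \<in> chains S" "C \<noteq> {}" for C
  proof -
    have lin: "W \<subseteq> W' \<or> W' \<subseteq> W" if "W \<in> C" "W' \<in> C" for W W'
      using C(1) that by (auto simp: chains_def chain_subset_def)
    have CS: "W \<in> S" if "W \<in> C" for W using C(1) that by (auto simp: chains_def)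
    have "x \<oplus>\<^bsub>M\<^esub> y \<in> \<Union>C" if xy: "x \<in> \<Union>C" "y \<in> \<Union>C" for x y
    proof -
      obtain W where "W \<in> C" "x \<in> W" "y \<in> W" using xy lin by blast
      then show ?thesis using CS[of W] unfolding S_def by blast
    qed
    moreover have "c \<odot>\<^bsub>M\<^esub> x \<in> \<Union>C" if "x \<in> \<Union>C" "c \<in> carrier R" for c x
      using that CS by (force simp: S_def)
    moreover have "B \<subseteq> \<Union>C" using C(2) CS by (force simp: S_def)
    moreover have "\<Union>C \<subseteq> carrier M" "v \<notin> \<Union>C" using CS unfolding S_def by blast+
    ultimately show ?thesis by (simp add: S_def)
  qed
  have "B \<in> S" using assms by (auto simp: S_def)
  then have "\<exists>W\<in>S. \<forall>X\<in>S. W \<subseteq> X \<longrightarrow> X = W"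
    using chain by (intro subset_Zorn_nonempty) (auto simp: chains_alt_def)
  then obtain W where W: "W \<in> S" and max: "\<And>X. X \<in> S \<Longrightarrow> W \<subseteq> X \<Longrightarrow> X = W"
    by blast
  have Wc: "x \<in> carrier M" if "x \<in> W" for x using W that by (auto simp: S_def)
  have Wadd: "x \<oplus>\<^bsub>M\<^esub> y \<in> W" if "x \<in> W" "y \<in> W" for x y using W that by (auto simp: S_def)
  have Wsm: "c \<odot>\<^bsub>M\<^esub> x \<in> W" if "x \<in> W" "c \<in> carrier R" for c x using W that by (auto simp: S_def)
  have W0: "\<zero>\<^bsub>M\<^esub> \<in> W" and Wv: "v \<notin> W" using W B by (auto simp: S_def)
  have Wneg: "\<ominus>\<^bsub>M\<^esub> x \<in> W" if "x \<in> W" for x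
    using Wsm[OF that, of "\<ominus> \<one>"] Wc[OF that] by (simp add: smult_l_minus)
  \<comment> \<open>By maximality, adjoining a vector x outside \<open>W\<close> brings v into the
    span, so v = w + c x with c nonzero. Solving for x places it in W + K v.\<close>
  have dec: "\<exists>c\<in>carrier R. \<exists>w\<in>W. x = w \<oplus>\<^bsub>M\<^esub> c \<odot>\<^bsub>M\<^esub> v" if x: "x \<in> carrier M" for x
  proof (cases "x \<in> W")
    case True
    then show ?thesis using v x by (intro bexI[of _ \<zero>] bexI[of _ x]) auto
  next
    case False
    define X where "X = {w \<oplus>\<^bsub>M\<^esub> c \<odot>\<^bsub>M\<^esub> x |w c. w \<in> W \<and> c \<in> carrier R}"
    have WX: "W \<subseteq> X"
    proof
      fix w assume "w \<in> W"
      then show "w \<in> X" unfolding X_def using Wc x by (auto intro!: exI[of _ w] exI[of _ \<zero>])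
    qed
    have "x \<in> X" unfolding X_def using W0 x by (auto intro!: exI[of _ "\<zero>\<^bsub>M\<^esub>"] exI[of _ \<one>])
    then have "X \<notin> S" using max[OF _ WX] False by auto
    moreover have "a \<oplus>\<^bsub>M\<^esub> b \<in> X" if ab: "a \<in> X" "b \<in> X" for a b
    proof -
      obtain w c w' c' where 1: "a = w \<oplus>\<^bsub>M\<^esub> c \<odot>\<^bsub>M\<^esub> x" "w \<in> W" "c \<in> carrier R"
        "b = w' \<oplus>\<^bsub>M\<^esub> c' \<odot>\<^bsub>M\<^esub> x" "w' \<in> W" "c' \<in> carrier R" using ab by (auto simp: X_def)
      then have "a \<oplus>\<^bsub>M\<^esub> b = (w \<oplus>\<^bsub>M\<^esub> w') \<oplus>\<^bsub>M\<^esub> (c \<oplus> c') \<odot>\<^bsub>M\<^esub> x"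
        using x Wc by (simp add: smult_l_distr M.a_ac)
      then show ?thesis unfolding X_def using 1 Wadd by blast
    qed
    moreover have "c \<odot>\<^bsub>M\<^esub> a \<in> X" if ca: "c \<in> carrier R" "a \<in> X" for a c
    proof -
      obtain w d where 1: "a = w \<oplus>\<^bsub>M\<^esub> d \<odot>\<^bsub>M\<^esub> x" "w \<in> W" "d \<in> carrier R" using ca by (auto simp: X_def)
      then have "c \<odot>\<^bsub>M\<^esub> a = c \<odot>\<^bsub>M\<^esub> w \<oplus>\<^bsub>M\<^esub> (c \<otimes> d) \<odot>\<^bsub>M\<^esub> x"
        using x Wc ca by (simp add: smult_r_distr smult_assoc1)
      then show ?thesis unfolding X_def using 1 Wsm ca by blast
    qed
    moreover have "X \<subseteq> carrier M" using x Wc by (auto simp: X_def)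
    ultimately have "v \<in> X" using WX W by (auto simp: S_def)
    then obtain w c where wc: "v = w \<oplus>\<^bsub>M\<^esub> c \<odot>\<^bsub>M\<^esub> x" "w \<in> W" "c \<in> carrier R" by (auto simp: X_def)
    have "c \<noteq> \<zero>" using wc Wv x Wc by auto
    then have c: "inv c \<in> carrier R" "inv c \<otimes> c = \<one>" using wc F.field_Units by (auto intro: R.Units_l_inv)
    have "inv c \<odot>\<^bsub>M\<^esub> v = inv c \<odot>\<^bsub>M\<^esub> w \<oplus>\<^bsub>M\<^esub> (inv c \<otimes> c) \<odot>\<^bsub>M\<^esub> x"
      unfolding wc(1) using wc c(1) x Wc by (simp only: smult_r_distr smult_assoc1 smult_closed)
    then have e: "inv c \<odot>\<^bsub>M\<^esub> v = inv c \<odot>\<^bsub>M\<^esub> w \<oplus>\<^bsub>M\<^esub> x" using c(2) x by simp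
    have "x = \<ominus>\<^bsub>M\<^esub> (inv c \<odot>\<^bsub>M\<^esub> w) \<oplus>\<^bsub>M\<^esub> (inv c \<odot>\<^bsub>M\<^esub> w \<oplus>\<^bsub>M\<^esub> x)"
      using wc c x Wc by (simp add: M.r_neg1)
    then have "x = \<ominus>\<^bsub>M\<^esub> (inv c \<odot>\<^bsub>M\<^esub> w) \<oplus>\<^bsub>M\<^esub> inv c \<odot>\<^bsub>M\<^esub> v" using e by simp
    then show ?thesis using c Wneg[OF Wsm[OF wc(2) c(1)]] by blast
  qed
  have uniq: "c = d" if "c \<in> carrier R" "d \<in> carrier R" "w \<in> W" "w' \<in> W" "w \<oplus>\<^bsub>M\<^esub> c \<odot>\<^bsub>M\<^esub> v = w' \<oplus>\<^bsub>M\<^esub> d \<odot>\<^bsub>M\<^esub> v" for c d w w'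
  proof (rule ccontr)
    assume "c \<noteq> d"
    define k where "k = c \<ominus> d"
    have "c = k \<oplus> d" using that by (simp add: k_def a_minus_def R.a_assoc R.l_neg)
    then have k: "k \<in> carrier R" "k \<noteq> \<zero>" using that \<open>c \<noteq> d\<close> by (auto simp: k_def)
    then have ik: "inv k \<in> carrier R" "inv k \<otimes> k = \<one>" using F.field_Units by (auto intro: R.Units_l_inv)
    have "k \<odot>\<^bsub>M\<^esub> v = (\<ominus>\<^bsub>M\<^esub> w \<oplus>\<^bsub>M\<^esub> (w \<oplus>\<^bsub>M\<^esub> c \<odot>\<^bsub>M\<^esub> v)) \<oplus>\<^bsub>M\<^esub> \<ominus>\<^bsub>M\<^esub> (d \<odot>\<^bsub>M\<^esub> v)"
      using that(1-4) v Wc by (simp add: M.r_neg1 k_def a_minus_def smult_l_distr smult_l_minus)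
    also have "\<dots> = (\<ominus>\<^bsub>M\<^esub> w \<oplus>\<^bsub>M\<^esub> (w' \<oplus>\<^bsub>M\<^esub> d \<odot>\<^bsub>M\<^esub> v)) \<oplus>\<^bsub>M\<^esub> \<ominus>\<^bsub>M\<^esub> (d \<odot>\<^bsub>M\<^esub> v)" by (simp only: that(5))
    also have "\<dots> = \<ominus>\<^bsub>M\<^esub> w \<oplus>\<^bsub>M\<^esub> w'" using that(1-4) v Wc by (simp add: M.a_assoc M.r_neg)
    finally have "k \<odot>\<^bsub>M\<^esub> v \<in> W" using that Wneg Wadd by simp
    then have "inv k \<odot>\<^bsub>M\<^esub> (k \<odot>\<^bsub>M\<^esub> v) \<in> W" using Wsm ik by blast
    then show False using ik k v Wv by (simp flip: smult_assoc1)
  qed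
  define \<phi> where "\<phi> = (\<lambda>x. THE c. c \<in> carrier R \<and> (\<exists>w\<in>W. x = w \<oplus>\<^bsub>M\<^esub> c \<odot>\<^bsub>M\<^esub> v))"
  have \<phi>: "\<phi> x = c" if "c \<in> carrier R" "w \<in> W" "x = w \<oplus>\<^bsub>M\<^esub> c \<odot>\<^bsub>M\<^esub> v" for x c w
    unfolding \<phi>_def using that uniq by (intro the_equality) blast+
  have \<phi>d: "\<exists>w\<in>W. x = w \<oplus>\<^bsub>M\<^esub> \<phi> x \<odot>\<^bsub>M\<^esub> v" "\<phi> x \<in> carrier R" if "x \<in> carrier M" for x
    using dec[OF that] \<phi> by auto
  show thesis
  proof (rule that[of \<phi>])
    show "\<phi> \<in> carrier M \<rightarrow> carrier R" using \<phi>d by auto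
    fix x assume x: "x \<in> carrier M"
    obtain w where w: "w \<in> W" "x = w \<oplus>\<^bsub>M\<^esub> \<phi> x \<odot>\<^bsub>M\<^esub> v" using \<phi>d[OF x] by blast
    { fix y assume y: "y \<in> carrier M"
      obtain w' where w': "w' \<in> W" "y = w' \<oplus>\<^bsub>M\<^esub> \<phi> y \<odot>\<^bsub>M\<^esub> v" using \<phi>d[OF y] by blast
      have "(w \<oplus>\<^bsub>M\<^esub> \<phi> x \<odot>\<^bsub>M\<^esub> v) \<oplus>\<^bsub>M\<^esub> (w' \<oplus>\<^bsub>M\<^esub> \<phi> y \<odot>\<^bsub>M\<^esub> v) = (w \<oplus>\<^bsub>M\<^esub> w') \<oplus>\<^bsub>M\<^esub> (\<phi> x \<oplus> \<phi> y) \<odot>\<^bsub>M\<^esub> v"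
        using \<phi>d(2)[OF x] \<phi>d(2)[OF y] v w(1) w'(1) Wc by (simp add: smult_l_distr M.a_ac)
      then show "\<phi> (x \<oplus>\<^bsub>M\<^esub> y) = \<phi> x \<oplus> \<phi> y"
        using \<phi>d(2)[OF x] \<phi>d(2)[OF y] w w' Wadd by (intro \<phi>[of _ "w \<oplus>\<^bsub>M\<^esub> w'"]) auto }
    { fix c assume c: "c \<in> carrier R"
      have "c \<odot>\<^bsub>M\<^esub> (w \<oplus>\<^bsub>M\<^esub> \<phi> x \<odot>\<^bsub>M\<^esub> v) = c \<odot>\<^bsub>M\<^esub> w \<oplus>\<^bsub>M\<^esub> (c \<otimes> \<phi> x) \<odot>\<^bsub>M\<^esub> v"
        using \<phi>d(2)[OF x] v w(1) Wc c by (simp add: smult_r_distr smult_assoc1)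
      then show "\<phi> (c \<odot>\<^bsub>M\<^esub> x) = c \<otimes> \<phi> x"
        using \<phi>d(2)[OF x] w Wsm c by (intro \<phi>[of _ "c \<odot>\<^bsub>M\<^esub> w"]) auto }
  next
    show "\<phi> x = \<zero>" if "x \<in> B" for x
    proof (rule \<phi>[of _ x])
      show "x \<in> W" using that W by (auto simp: S_def)
      then show "x = x \<oplus>\<^bsub>M\<^esub> \<zero> \<odot>\<^bsub>M\<^esub> v" using v Wc by simp
    qed simp
    show "\<phi> v = \<one>" using v by (intro \<phi>[of _ "\<zero>\<^bsub>M\<^esub>"] W0) auto
  qed
qed

text \<open>The bimodule isomorphism from A to its dual, stored as the image \<tau> of 1: a
  symmetric nondegenerate form through which every linear form on A is represented by an
  element.\<close>

locale symmetric_form = complexes_over A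
  for A :: "('k, 'a, 'ax) module_scheme" +
  fixes K :: "('k, 'kx) ring_scheme" and \<tau> :: "'a \<Rightarrow> 'k"
  assumes field_K: "field K" and module_A: "module K A"
    and smult_mult: "\<And>c x y. c \<in> carrier K \<Longrightarrow> x \<in> carrier A \<Longrightarrow> y \<in> carrier A \<Longrightarrow>
      (c \<odot>\<^bsub>A\<^esub> x) \<otimes>\<^bsub>A\<^esub> y = c \<odot>\<^bsub>A\<^esub> (x \<otimes>\<^bsub>A\<^esub> y)"
    and mult_smult: "\<And>c x y. c \<in> carrier K \<Longrightarrow> x \<in> carrier A \<Longrightarrow> y \<in> carrier A \<Longrightarrow>
      x \<otimes>\<^bsub>A\<^esub> (c \<odot>\<^bsub>A\<^esub> y) = c \<odot>\<^bsub>A\<^esub> (x \<otimes>\<^bsub>A\<^esub> y)"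
    and form_closed: "\<And>x. x \<in> carrier A \<Longrightarrow> \<tau> x \<in> carrier K"
    and form_add: "\<And>x y. x \<in> carrier A \<Longrightarrow> y \<in> carrier A \<Longrightarrow> \<tau> (x \<oplus>\<^bsub>A\<^esub> y) = \<tau> x \<oplus>\<^bsub>K\<^esub> \<tau> y"
    and form_comm: "\<And>x y. x \<in> carrier A \<Longrightarrow> y \<in> carrier A \<Longrightarrow> \<tau> (x \<otimes>\<^bsub>A\<^esub> y) = \<tau> (y \<otimes>\<^bsub>A\<^esub> x)"
    and form_nondeg: "\<And>x. x \<in> carrier A \<Longrightarrow> (\<And>y. y \<in> carrier A \<Longrightarrow> \<tau> (x \<otimes>\<^bsub>A\<^esub> y) = \<zero>\<^bsub>K\<^esub>) \<Longrightarrow> x = \<zero>\<^bsub>A\<^esub>"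
    and form_repr: "\<And>\<psi>. (\<And>x. x \<in> carrier A \<Longrightarrow> \<psi> x \<in> carrier K) \<Longrightarrow>
      (\<And>x y. x \<in> carrier A \<Longrightarrow> y \<in> carrier A \<Longrightarrow> \<psi> (x \<oplus>\<^bsub>A\<^esub> y) = \<psi> x \<oplus>\<^bsub>K\<^esub> \<psi> y) \<Longrightarrow>
      (\<And>c x. c \<in> carrier K \<Longrightarrow> x \<in> carrier A \<Longrightarrow> \<psi> (c \<odot>\<^bsub>A\<^esub> x) = c \<otimes>\<^bsub>K\<^esub> \<psi> x) \<Longrightarrow>
      \<exists>a\<in>carrier A. \<forall>y\<in>carrier A. \<tau> (a \<otimes>\<^bsub>A\<^esub> y) = \<psi> y"
begin

sublocale K: field K by (rule field_K)
sublocale AR: ring A by (rule ring_A)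
sublocale KA: module K A by (rule module_A)

lemma abK [simp]: "abelian_group K" by (rule K.is_abelian_group)

definition scal :: "('a, 'm) module \<Rightarrow> 'k \<Rightarrow> 'm \<Rightarrow> 'm" where
  "scal M c x = (c \<odot>\<^bsub>A\<^esub> \<one>\<^bsub>A\<^esub>) \<odot>\<^bsub>M\<^esub> x"

lemma kap [simp]:
  "c \<in> carrier K \<Longrightarrow> c \<odot>\<^bsub>A\<^esub> \<one>\<^bsub>A\<^esub> \<in> carrier A"
  "c \<in> carrier K \<Longrightarrow> a \<in> carrier A \<Longrightarrow> (c \<odot>\<^bsub>A\<^esub> \<one>\<^bsub>A\<^esub>) \<otimes>\<^bsub>A\<^esub> a = c \<odot>\<^bsub>A\<^esub> a"
  "c \<in> carrier K \<Longrightarrow> a \<in> carrier A \<Longrightarrow> a \<otimes>\<^bsub>A\<^esub> (c \<odot>\<^bsub>A\<^esub> \<one>\<^bsub>A\<^esub>) = c \<odot>\<^bsub>A\<^esub> a"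
  by (simp_all add: smult_mult mult_smult KA.smult_closed)

lemma scal_rules:
  assumes "rmod M" "c \<in> carrier K" "x \<in> carrier M"
  shows "scal M c x \<in> carrier M"
    and "y \<in> carrier M \<Longrightarrow> scal M c (x \<oplus>\<^bsub>M\<^esub> y) = scal M c x \<oplus>\<^bsub>M\<^esub> scal M c y"
    and "d \<in> carrier K \<Longrightarrow> scal M (c \<oplus>\<^bsub>K\<^esub> d) x = scal M c x \<oplus>\<^bsub>M\<^esub> scal M d x"
    and "d \<in> carrier K \<Longrightarrow> scal M (c \<otimes>\<^bsub>K\<^esub> d) x = scal M c (scal M d x)"
    and "scal M \<one>\<^bsub>K\<^esub> x = x"
    and "a \<in> carrier A \<Longrightarrow> scal M c (a \<odot>\<^bsub>M\<^esub> x) = a \<odot>\<^bsub>M\<^esub> scal M c x"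
    and "a \<in> carrier A \<Longrightarrow> scal M c (a \<odot>\<^bsub>M\<^esub> x) = (c \<odot>\<^bsub>A\<^esub> a) \<odot>\<^bsub>M\<^esub> x"
  using assms rmod_smult[OF assms(1,3)]
  by (simp_all add: scal_def KA.smult_l_distr KA.smult_assoc1 K.m_comm KA.smult_closed)

lemma scal_hom:
  assumes "rmod M" "rmod N" "f \<in> hom M N" "c \<in> carrier K"
  shows "x \<in> carrier M \<Longrightarrow> f (scal M c x) = scal N c (f x)"
    and "(\<lambda>x. scal N c (f x)) \<in> hom M N"
proof -
  note fr = hom_rules[OF assms(1-3)]
  show "x \<in> carrier M \<Longrightarrow> f (scal M c x) = scal N c (f x)" using assms by (simp add: scal_def fr)
  show "(\<lambda>x. scal N c (f x)) \<in> hom M N"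
    using assms fr by (intro homI) (auto simp: scal_rules)
qed

section \<open>Traces of endomorphisms of projective modules\<close>

lemma form_zero: "\<tau> \<zero>\<^bsub>A\<^esub> = \<zero>\<^bsub>K\<^esub>"
  using form_add[of "\<zero>\<^bsub>A\<^esub>" "\<zero>\<^bsub>A\<^esub>"] form_closed[of "\<zero>\<^bsub>A\<^esub>"] by simp

lemma form_eq:
  assumes "x \<in> carrier A" "x' \<in> carrier A" "\<And>y. y \<in> carrier A \<Longrightarrow> \<tau> (x \<otimes>\<^bsub>A\<^esub> y) = \<tau> (x' \<otimes>\<^bsub>A\<^esub> y)"
  shows "x = x'"
proof -
  have "x \<oplus>\<^bsub>A\<^esub> \<ominus>\<^bsub>A\<^esub> x' = \<zero>\<^bsub>A\<^esub>"
  proof (rule form_nondeg)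
    fix y assume y: "y \<in> carrier A"
    have "\<tau> (x \<otimes>\<^bsub>A\<^esub> y) \<oplus>\<^bsub>K\<^esub> \<tau> (\<ominus>\<^bsub>A\<^esub> x' \<otimes>\<^bsub>A\<^esub> y) = \<tau> (x' \<otimes>\<^bsub>A\<^esub> y \<oplus>\<^bsub>A\<^esub> \<ominus>\<^bsub>A\<^esub> x' \<otimes>\<^bsub>A\<^esub> y)"
      using assms y by (simp add: form_add)
    also have "\<dots> = \<tau> ((x' \<oplus>\<^bsub>A\<^esub> \<ominus>\<^bsub>A\<^esub> x') \<otimes>\<^bsub>A\<^esub> y)" using assms y by (simp only: AR.l_distr AR.a_inv_closed)
    finally show "\<tau> ((x \<oplus>\<^bsub>A\<^esub> \<ominus>\<^bsub>A\<^esub> x') \<otimes>\<^bsub>A\<^esub> y) = \<zero>\<^bsub>K\<^esub>"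
      using assms y by (simp add: AR.l_distr form_add form_zero AR.r_neg)
  qed (use assms in simp)
  then show ?thesis using assms by (metis AR.minus_minus AR.minus_equality AR.a_comm AR.a_inv_closed)
qed

text \<open>The Hattori-Stallings trace followed by \<tau>, which vanishes on commutators and so has
  a well-defined value on it.\<close>

definition tr :: "nat \<Rightarrow> (nat \<Rightarrow> 'm) \<Rightarrow> (nat \<Rightarrow> 'm \<Rightarrow> 'a) \<Rightarrow> ('m \<Rightarrow> 'm) \<Rightarrow> 'k" where
  "tr n e \<epsilon> f = msum K (\<lambda>j. \<tau> (\<epsilon> j (f (e j)))) n"

lemma form_msum:
  assumes "\<And>j. j < n \<Longrightarrow> f j \<in> carrier A"
  shows "\<tau> (msum reg f n) = msum K (\<lambda>j. \<tau> (f j)) n"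
  using assms by (intro msum_additive) (auto simp: form_zero form_add intro: rmod_ab)

lemma form_expand:
  assumes "rmod N" "dual_basis N n e \<epsilon>" "\<theta> \<in> hom N reg" "y \<in> carrier N"
  shows "\<tau> (\<theta> y) = msum K (\<lambda>j. \<tau> (\<theta> (e j) \<otimes>\<^bsub>A\<^esub> \<epsilon> j y)) n"
proof -
  note d = dual_basisD[OF assms(2,1)] and t = hom_rules[OF assms(1) rmod_reg assms(3)]
  have "\<theta> y = \<theta> (msum N (\<lambda>j. \<epsilon> j y \<odot>\<^bsub>N\<^esub> e j) n)" using d(4)[OF assms(4)] by simp
  also have "\<dots> = msum reg (\<lambda>j. \<theta> (\<epsilon> j y \<odot>\<^bsub>N\<^esub> e j)) n"
    using assms d by (intro hom_msum) auto
  also have "\<dots> = msum reg (\<lambda>j. \<theta> (e j) \<otimes>\<^bsub>A\<^esub> \<epsilon> j y) n"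
    using assms d t by (intro msum_cong) auto
  finally show ?thesis using d t assms(4) by (simp add: form_msum)
qed

text \<open>Expanding in the dual basis of the intermediate module turns both traces into the same
  double sum of values of \<tau> on products, up to the order of the factors; symmetry of \<tau>
  exchanges them.\<close>

lemma tr_comm:
  assumes "rmod M" "rmod N" "dual_basis M n e \<epsilon>" "dual_basis N n' e' \<epsilon>'"
    and u: "u \<in> hom M N" and g: "g \<in> hom N M"
  shows "tr n e \<epsilon> (\<lambda>x. g (u x)) = tr n' e' \<epsilon>' (\<lambda>x. u (g x))"
proof -
  note d = dual_basisD[OF assms(3,1)] and d' = dual_basisD[OF assms(4,2)]
  note ur = hom_rules[OF assms(1,2) u] and gr = hom_rules[OF assms(2,1) g]
  have "tr n e \<epsilon> (\<lambda>x. g (u x)) = msum K (\<lambda>j. msum K (\<lambda>l. \<tau> (\<epsilon> j (g (e' l)) \<otimes>\<^bsub>A\<^esub> \<epsilon>' l (u (e j)))) n') n"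
    unfolding tr_def
    using d ur assms by (intro msum_cong form_expand[where \<theta> = "\<lambda>x. \<epsilon> j (g x)" for j]) (auto intro: hom_comp[OF g])
  also have "\<dots> = msum K (\<lambda>l. msum K (\<lambda>j. \<tau> (\<epsilon> j (g (e' l)) \<otimes>\<^bsub>A\<^esub> \<epsilon>' l (u (e j)))) n) n'"
    using d d' ur gr by (intro msum_swap) (auto intro!: form_closed)
  also have "\<dots> = msum K (\<lambda>l. msum K (\<lambda>j. \<tau> (\<epsilon>' l (u (e j)) \<otimes>\<^bsub>A\<^esub> \<epsilon> j (g (e' l)))) n) n'"
    using d d' ur gr by (intro msum_cong form_comm) auto
  also have "\<dots> = tr n' e' \<epsilon>' (\<lambda>x. u (g x))"
    unfolding tr_def using d' gr assms
    by (intro msum_cong form_expand[where \<theta> = "\<lambda>x. \<epsilon>' l (u x)" for l, symmetric]) (auto intro: hom_comp[OF u])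
  finally show ?thesis .
qed

lemma tr_closed:
  assumes "rmod M" "dual_basis M n e \<epsilon>" "f \<in> hom M M"
  shows "tr n e \<epsilon> f \<in> carrier K"
  unfolding tr_def using dual_basisD[OF assms(2,1)] hom_rules[OF assms(1,1,3)]
  by (intro msum_closed) (auto intro!: form_closed)

lemma tr_add:
  assumes "rmod M" "dual_basis M n e \<epsilon>" "f \<in> hom M M" "g \<in> hom M M"
  shows "tr n e \<epsilon> (\<lambda>x. f x \<oplus>\<^bsub>M\<^esub> g x) = tr n e \<epsilon> f \<oplus>\<^bsub>K\<^esub> tr n e \<epsilon> g"
proof -
  note d = dual_basisD[OF assms(2,1)] and fr = hom_rules[OF assms(1,1,3)] and gr = hom_rules[OF assms(1,1,4)]
  have "tr n e \<epsilon> (\<lambda>x. f x \<oplus>\<^bsub>M\<^esub> g x) = msum K (\<lambda>j. \<tau> (\<epsilon> j (f (e j))) \<oplus>\<^bsub>K\<^esub> \<tau> (\<epsilon> j (g (e j)))) n"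
    unfolding tr_def using d fr gr hom_rules(2)[OF assms(1) rmod_reg d(2)]
    by (intro msum_cong) (auto simp: form_add)
  then show ?thesis unfolding tr_def using d fr gr by (subst msum_add[symmetric]) (auto intro!: form_closed)
qed

lemma tr_cong:
  assumes "rmod M" "dual_basis M n e \<epsilon>" "\<And>x. x \<in> carrier M \<Longrightarrow> f x = g x"
  shows "tr n e \<epsilon> f = tr n e \<epsilon> g"
  unfolding tr_def using dual_basisD(1)[OF assms(2,1)] assms(3) by (intro msum_cong) auto

lemma tr_zero:
  assumes "rmod M" "dual_basis M n e \<epsilon>" "\<And>x. x \<in> carrier M \<Longrightarrow> f x = \<zero>\<^bsub>M\<^esub>"
  shows "tr n e \<epsilon> f = \<zero>\<^bsub>K\<^esub>"
proof -
  note d = dual_basisD[OF assms(2,1)]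
  show ?thesis unfolding tr_def
    using d(1) assms(3) hom_rules(4)[OF assms(1) rmod_reg d(2)]
    by (intro msum_zero) (auto simp: form_zero)
qed

text \<open>Testing against the rank one maps m \<mapsto> y \<epsilon>_j(m) gives
  \<tau>(\<epsilon>_j(w y)) = 0 for all y. Replacing y by the multiples x a and using nondegeneracy
  of \<tau> makes every coordinate of w x vanish.\<close>

lemma tr_nondeg:
  assumes M: "rmod M" and N: "rmod N" and b: "dual_basis M n e \<epsilon>" and w: "w \<in> hom N M"
    and *: "\<And>h. h \<in> hom M N \<Longrightarrow> tr n e \<epsilon> (\<lambda>x. w (h x)) = \<zero>\<^bsub>K\<^esub>" and x: "x \<in> carrier N"
  shows "w x = \<zero>\<^bsub>M\<^esub>"
proof -
  note d = dual_basisD[OF b M] and wr = hom_rules[OF N M w]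
  have z: "\<tau> (\<epsilon> j (w y)) = \<zero>\<^bsub>K\<^esub>" if j: "j < n" and y: "y \<in> carrier N" for j y
  proof -
    have "(\<lambda>m. \<epsilon> j m \<odot>\<^bsub>N\<^esub> y) \<in> hom M N"
      by (rule hom_comp[OF d(2)[OF j] smult_hom[OF N y]])
    then have "\<zero>\<^bsub>K\<^esub> = tr n e \<epsilon> (\<lambda>x. w (\<epsilon> j x \<odot>\<^bsub>N\<^esub> y))" using * by simp
    also have "\<dots> = msum K (\<lambda>l. \<tau> (\<epsilon> j (e l) \<otimes>\<^bsub>A\<^esub> \<epsilon> l (w y))) n"
    proof (unfold tr_def, rule msum_cong)
      fix l assume l: "l < n"
      have "\<epsilon> l (w (\<epsilon> j (e l) \<odot>\<^bsub>N\<^esub> y)) = \<epsilon> l (w y) \<otimes>\<^bsub>A\<^esub> \<epsilon> j (e l)"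
        using d(1-3) l j y wr hom_rules(3)[OF M rmod_reg d(2)[OF l]] by simp
      then show "\<tau> (\<epsilon> l (w (\<epsilon> j (e l) \<odot>\<^bsub>N\<^esub> y))) = \<tau> (\<epsilon> j (e l) \<otimes>\<^bsub>A\<^esub> \<epsilon> l (w y))"
        using d(1,3) l j y wr by (simp add: form_comm)
    qed
    also have "\<dots> = \<tau> (\<epsilon> j (w y))" using form_expand[OF M b d(2)[OF j], of "w y"] wr y by simp
    finally show ?thesis by simp
  qed
  have "\<epsilon> j (w x) = \<zero>\<^bsub>A\<^esub>" if j: "j < n" for j
  proof (rule form_nondeg)
    fix a assume a: "a \<in> carrier A"
    have "\<epsilon> j (w (a \<odot>\<^bsub>N\<^esub> x)) = \<epsilon> j (w x) \<otimes>\<^bsub>A\<^esub> a"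
      using hom_rules(3)[OF M rmod_reg d(2)[OF j] a wr(1)[OF x]] a x by (simp add: wr)
    then show "\<tau> (\<epsilon> j (w x) \<otimes>\<^bsub>A\<^esub> a) = \<zero>\<^bsub>K\<^esub>" using z[OF j, of "a \<odot>\<^bsub>N\<^esub> x"] a x N by simp
  qed (use d(3) j x wr in auto)
  then have "msum M (\<lambda>j. \<epsilon> j (w x) \<odot>\<^bsub>M\<^esub> e j) n = \<zero>\<^bsub>M\<^esub>"
    using d(1) M by (intro msum_zero) (auto intro: rmod_ab)
  then show ?thesis using d(4)[OF wr(1)[OF x]] by simp
qed

text \<open>For projective M the trace pairing identifies the dual of Hom(M, N) with Hom(N, M). For
  fixed j and x the value of \<psi> on the rank one map m \<mapsto> x a \<epsilon>_j(m) is a linear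
  form in a, hence equals \<tau>(\<gamma>_j(x) a) for some \<gamma>_j(x) in A; uniqueness makes
  \<gamma>_j linear over A, and g is the sum of the e_j \<gamma>_j.\<close>

lemma functional_trace:
  assumes M: "rmod M" and N: "rmod N" and b: "dual_basis M n e \<epsilon>"
    and cl: "\<And>u. u \<in> hom M N \<Longrightarrow> \<psi> u \<in> carrier K"
    and add: "\<And>u v. u \<in> hom M N \<Longrightarrow> v \<in> hom M N \<Longrightarrow> \<psi> (\<lambda>x. u x \<oplus>\<^bsub>N\<^esub> v x) = \<psi> u \<oplus>\<^bsub>K\<^esub> \<psi> v"
    and sm: "\<And>c u. c \<in> carrier K \<Longrightarrow> u \<in> hom M N \<Longrightarrow> \<psi> (\<lambda>x. scal N c (u x)) = c \<otimes>\<^bsub>K\<^esub> \<psi> u"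
    and cong: "\<And>u v. u \<in> hom M N \<Longrightarrow> (\<And>x. x \<in> carrier M \<Longrightarrow> v x = u x) \<Longrightarrow> \<psi> v = \<psi> u"
  shows "\<exists>g\<in>hom N M. \<forall>u\<in>hom M N. \<psi> u = tr n e \<epsilon> (\<lambda>x. g (u x))"
proof -
  note d = dual_basisD[OF b M]
  have E: "(\<lambda>m. \<epsilon> j m \<odot>\<^bsub>N\<^esub> x) \<in> hom M N" if "j < n" "x \<in> carrier N" for j x
    by (rule hom_comp[OF d(2)[OF that(1)] smult_hom[OF N that(2)]])
  define p where "p = (\<lambda>j x. \<psi> (\<lambda>m. \<epsilon> j m \<odot>\<^bsub>N\<^esub> x))"
  have pc: "p j x \<in> carrier K" if "j < n" "x \<in> carrier N" for j x using E that cl by (simp add: p_def)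
  have pa: "p j (x \<oplus>\<^bsub>N\<^esub> y) = p j x \<oplus>\<^bsub>K\<^esub> p j y" if j: "j < n" and xy: "x \<in> carrier N" "y \<in> carrier N" for j x y
  proof -
    have "p j (x \<oplus>\<^bsub>N\<^esub> y) = \<psi> (\<lambda>m. \<epsilon> j m \<odot>\<^bsub>N\<^esub> x \<oplus>\<^bsub>N\<^esub> \<epsilon> j m \<odot>\<^bsub>N\<^esub> y)"
      unfolding p_def using j xy N d(3) by (intro cong hom_add M E) (auto simp: rmod_smult)
    then show ?thesis using add E j xy by (simp add: p_def)
  qed
  have ps: "p j (scal N c x) = c \<otimes>\<^bsub>K\<^esub> p j x" if j: "j < n" and x: "x \<in> carrier N" and c: "c \<in> carrier K" for j x c
  proof -
    have "p j (scal N c x) = \<psi> (\<lambda>m. scal N c (\<epsilon> j m \<odot>\<^bsub>N\<^esub> x))"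
      unfolding p_def using j x N d(3) c
      by (intro cong[OF scal_hom(2)[OF M N E[OF j x] c]]) (auto simp: scal_rules(6))
    then show ?thesis using sm E j x c by (simp add: p_def)
  qed
  have "\<forall>j x. \<exists>a. j < n \<longrightarrow> x \<in> carrier N \<longrightarrow> a \<in> carrier A \<and> (\<forall>y\<in>carrier A. \<tau> (a \<otimes>\<^bsub>A\<^esub> y) = p j (y \<odot>\<^bsub>N\<^esub> x))"
  proof (intro allI)
    fix j x
    show "\<exists>a. j < n \<longrightarrow> x \<in> carrier N \<longrightarrow> a \<in> carrier A \<and> (\<forall>y\<in>carrier A. \<tau> (a \<otimes>\<^bsub>A\<^esub> y) = p j (y \<odot>\<^bsub>N\<^esub> x))"
    proof (cases "j < n \<and> x \<in> carrier N")
      case True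
      have "\<exists>a\<in>carrier A. \<forall>y\<in>carrier A. \<tau> (a \<otimes>\<^bsub>A\<^esub> y) = p j (y \<odot>\<^bsub>N\<^esub> x)"
        using True N pc pa ps by (intro form_repr) (auto simp: rmod_smult(2) simp flip: scal_rules(7))
      then show ?thesis by blast
    qed auto
  qed
  then obtain \<gamma> where \<gamma>c: "\<And>j x. j < n \<Longrightarrow> x \<in> carrier N \<Longrightarrow> \<gamma> j x \<in> carrier A"
    and \<gamma>: "\<And>j x y. j < n \<Longrightarrow> x \<in> carrier N \<Longrightarrow> y \<in> carrier A \<Longrightarrow> \<tau> (\<gamma> j x \<otimes>\<^bsub>A\<^esub> y) = p j (y \<odot>\<^bsub>N\<^esub> x)"
    by metis
  have \<gamma>h: "\<gamma> j \<in> hom N reg" if j: "j < n" for j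
  proof (rule homI)
    show "\<gamma> j (x \<oplus>\<^bsub>N\<^esub> y) = \<gamma> j x \<oplus>\<^bsub>reg\<^esub> \<gamma> j y" if "x \<in> carrier N" "y \<in> carrier N" for x y
      using that j N \<gamma>c by (intro form_eq) (auto simp: \<gamma> rmod_smult(1) pa AR.l_distr form_add)
    show "\<gamma> j (a \<odot>\<^bsub>N\<^esub> x) = a \<odot>\<^bsub>reg\<^esub> \<gamma> j x" if "a \<in> carrier A" "x \<in> carrier N" for a x
      using that j N \<gamma>c by (intro form_eq) (auto simp: \<gamma> rmod_smult(3) AR.m_assoc)
  qed (use \<gamma>c j in auto)
  define g where "g = (\<lambda>x. msum M (\<lambda>j. \<gamma> j x \<odot>\<^bsub>M\<^esub> e j) n)"
  have g: "g \<in> hom N M"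
    unfolding g_def using d \<gamma>h by (intro msum_hom M N) (auto intro: hom_comp[OF _ smult_hom[OF M]])
  have "\<psi> u = tr n e \<epsilon> (\<lambda>x. g (u x))" if u: "u \<in> hom M N" for u
  proof -
    note ur = hom_rules[OF M N u]
    \<comment> \<open>The double sum is contracted twice by the dual basis: summing over l
      reassembles e_j inside u, and summing over j reassembles u from the rank one maps with values
      u(e_j).\<close>
    have "tr n e \<epsilon> (\<lambda>x. g (u x)) = msum K (\<lambda>l. msum K (\<lambda>j. p j (\<epsilon> l (e j) \<odot>\<^bsub>N\<^esub> u (e l))) n) n"
    proof (unfold tr_def, rule msum_cong)
      fix l assume l: "l < n"
      note er = hom_rules[OF M rmod_reg d(2)[OF l]]
      have "\<epsilon> l (g (u (e l))) = msum reg (\<lambda>j. \<epsilon> l (\<gamma> j (u (e l)) \<odot>\<^bsub>M\<^esub> e j)) n"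
        unfolding g_def using d(1) \<gamma>c ur l M by (intro hom_msum d(2)) auto
      also have "\<dots> = msum reg (\<lambda>j. \<epsilon> l (e j) \<otimes>\<^bsub>A\<^esub> \<gamma> j (u (e l))) n"
        using d(1) \<gamma>c ur l er by (intro msum_cong) auto
      finally have "\<tau> (\<epsilon> l (g (u (e l)))) = msum K (\<lambda>j. \<tau> (\<epsilon> l (e j) \<otimes>\<^bsub>A\<^esub> \<gamma> j (u (e l)))) n"
        using d(1,3) \<gamma>c ur l by (simp add: form_msum)
      also have "\<dots> = msum K (\<lambda>j. p j (\<epsilon> l (e j) \<odot>\<^bsub>N\<^esub> u (e l))) n"
        using d(1,3) \<gamma>c ur l by (intro msum_cong) (auto simp: form_comm[of "\<epsilon> l _"] \<gamma>)
      finally show "\<tau> (\<epsilon> l (g (u (e l)))) = \<dots>" .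
    qed
    also have "\<dots> = msum K (\<lambda>j. msum K (\<lambda>l. p j (\<epsilon> l (e j) \<odot>\<^bsub>N\<^esub> u (e l))) n) n"
      using d ur N pc by (intro msum_swap) auto
    also have "\<dots> = msum K (\<lambda>j. p j (u (e j))) n"
    proof (rule msum_cong)
      fix j assume j: "j < n"
      have p0: "p j \<zero>\<^bsub>N\<^esub> = \<zero>\<^bsub>K\<^esub>" using pa[OF j, of "\<zero>\<^bsub>N\<^esub>" "\<zero>\<^bsub>N\<^esub>"] pc[OF j, of "\<zero>\<^bsub>N\<^esub>"] N by simp
      have "p j (msum N (\<lambda>l. \<epsilon> l (e j) \<odot>\<^bsub>N\<^esub> u (e l)) n) = msum K (\<lambda>l. p j (\<epsilon> l (e j) \<odot>\<^bsub>N\<^esub> u (e l))) n"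
        using d j ur N p0 pa by (intro msum_additive) (auto intro: rmod_ab)
      moreover have "msum N (\<lambda>l. \<epsilon> l (e j) \<odot>\<^bsub>N\<^esub> u (e l)) n = u (msum M (\<lambda>l. \<epsilon> l (e j) \<odot>\<^bsub>M\<^esub> e l) n)"
        using d j ur M by (subst hom_msum[OF M N u]) (auto intro!: msum_cong)
      ultimately show "msum K (\<lambda>l. p j (\<epsilon> l (e j) \<odot>\<^bsub>N\<^esub> u (e l))) n = p j (u (e j))"
        using d(1,4) j by simp
    qed
    also have "\<dots> = \<psi> (\<lambda>x. msum N (\<lambda>j. \<epsilon> j x \<odot>\<^bsub>N\<^esub> u (e j)) n)"
    proof -
      have "msum K (\<lambda>j. p j (u (e j))) k = \<psi> (\<lambda>x. msum N (\<lambda>j. \<epsilon> j x \<odot>\<^bsub>N\<^esub> u (e j)) k)" if "k \<le> n" for k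
        using that
      proof (induction k)
        case 0
        have z: "(\<lambda>x. \<zero>\<^bsub>N\<^esub>) \<in> hom M N" using N by (rule hom_zero)
        show ?case using add[OF z z] cl[OF z] N by simp
      next
        case (Suc k)
        have "(\<lambda>x. msum N (\<lambda>j. \<epsilon> j x \<odot>\<^bsub>N\<^esub> u (e j)) k) \<in> hom M N"
          using Suc d(1) ur by (intro msum_hom M N E) auto
        then show ?case using Suc add E[of k "u (e k)"] d(1) ur by (simp add: p_def)
      qed
      then show ?thesis by simp
    qed
    also have "\<dots> = \<psi> u"
    proof (rule cong[OF u])
      fix x assume x: "x \<in> carrier M"
      have "u (msum M (\<lambda>l. \<epsilon> l x \<odot>\<^bsub>M\<^esub> e l) n) = msum N (\<lambda>j. \<epsilon> j x \<odot>\<^bsub>N\<^esub> u (e j)) n"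
        using d x ur M by (subst hom_msum[OF M N u]) (auto intro!: msum_cong)
      then show "msum N (\<lambda>j. \<epsilon> j x \<odot>\<^bsub>N\<^esub> u (e j)) n = u x" using d(4)[OF x] by simp
    qed
    finally show ?thesis by simp
  qed
  then show ?thesis using g by blast
qed

text \<open>The product over all degrees of the spaces of module maps, as a vector space over K to
  which \<open>separating_functional\<close> applies. The members are extensional, so that equality
  of elements is equality of functions.\<close>

definition hom_space :: "('a, 'm) cplx \<Rightarrow> ('a, 'n) cplx \<Rightarrow> ('k, int \<Rightarrow> 'm \<Rightarrow> 'n) module" where
  "hom_space Y X =
     \<lparr>carrier = {u. \<forall>n. u n \<in> hom (Ob Y n) (Ob X n) \<and> u n \<in> extensional (carrier (Ob Y n))},
      mult = undefined, one = undefined,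
      zero = (\<lambda>n. \<lambda>x\<in>carrier (Ob Y n). \<zero>\<^bsub>Ob X n\<^esub>),
      add = (\<lambda>u v n. \<lambda>x\<in>carrier (Ob Y n). u n x \<oplus>\<^bsub>Ob X n\<^esub> v n x),
      smult = (\<lambda>c u n. \<lambda>x\<in>carrier (Ob Y n). scal (Ob X n) c (u n x))\<rparr>"

lemma hom_space_simps [simp]:
  "\<zero>\<^bsub>hom_space Y X\<^esub> = (\<lambda>n. \<lambda>x\<in>carrier (Ob Y n). \<zero>\<^bsub>Ob X n\<^esub>)"
  "u \<oplus>\<^bsub>hom_space Y X\<^esub> v = (\<lambda>n. \<lambda>x\<in>carrier (Ob Y n). u n x \<oplus>\<^bsub>Ob X n\<^esub> v n x)"
  "c \<odot>\<^bsub>hom_space Y X\<^esub> u = (\<lambda>n. \<lambda>x\<in>carrier (Ob Y n). scal (Ob X n) c (u n x))"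
  by (simp_all add: hom_space_def)

lemma restrict_hom: "rmod M \<Longrightarrow> f \<in> hom M N \<Longrightarrow> restrict f (carrier M) \<in> hom M N"
  by (rule hom_cong) auto

lemma hom_spaceI:
  assumes "cx Y" "\<And>n. u n \<in> hom (Ob Y n) (Ob X n)"
  shows "(\<lambda>n. restrict (u n) (carrier (Ob Y n))) \<in> carrier (hom_space Y X)"
  using assms by (auto simp: hom_space_def restrict_hom)

lemma hom_spaceD:
  assumes "u \<in> carrier (hom_space Y X)"
  shows "u n \<in> hom (Ob Y n) (Ob X n)" and "restrict (u n) (carrier (Ob Y n)) = u n"
  using assms by (auto simp: hom_space_def extensional_restrict)

lemma hom_space_module:
  assumes c: "cx Y" "cx X"
  shows "module K (hom_space Y X)"
proof -
  have uc: "u n x \<in> carrier (Ob X n)" if "u \<in> carrier (hom_space Y X)" "x \<in> carrier (Ob Y n)" for u n x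
    using hom_rules(1)[OF cx_rmod[OF c(1)] cx_rmod[OF c(2)] hom_spaceD(1)[OF that(1)] that(2)] .
  have e: "(\<lambda>n. restrict (u n) (carrier (Ob Y n))) = u" if "u \<in> carrier (hom_space Y X)" for u
    using hom_spaceD(2)[OF that] by simp
  have neg: "\<exists>v\<in>carrier (hom_space Y X). v \<oplus>\<^bsub>hom_space Y X\<^esub> u = \<zero>\<^bsub>hom_space Y X\<^esub>"
    if u: "u \<in> carrier (hom_space Y X)" for u
  proof (rule bexI)
    show "(\<lambda>n. \<lambda>x\<in>carrier (Ob Y n). \<ominus>\<^bsub>Ob X n\<^esub> u n x) \<in> carrier (hom_space Y X)"
      using c hom_spaceD(1)[OF u] by (intro hom_spaceI hom_neg) auto
    show "(\<lambda>n. \<lambda>x\<in>carrier (Ob Y n). \<ominus>\<^bsub>Ob X n\<^esub> u n x) \<oplus>\<^bsub>hom_space Y X\<^esub> u = \<zero>\<^bsub>hom_space Y X\<^esub>"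
      using c uc[OF u] by (auto intro!: restrict_ext)
  qed
  have ag: "abelian_group (hom_space Y X)"
  proof (rule abelian_groupI)
    show "\<zero>\<^bsub>hom_space Y X\<^esub> \<in> carrier (hom_space Y X)" using c by (simp add: hom_spaceI hom_zero)
    show "u \<oplus>\<^bsub>hom_space Y X\<^esub> v \<in> carrier (hom_space Y X)"
      if "u \<in> carrier (hom_space Y X)" "v \<in> carrier (hom_space Y X)" for u v
      using c that by (simp add: hom_spaceI hom_add hom_spaceD)
    show "\<zero>\<^bsub>hom_space Y X\<^esub> \<oplus>\<^bsub>hom_space Y X\<^esub> u = u" if "u \<in> carrier (hom_space Y X)" for u
      using c uc[OF that] e[OF that] by (simp cong: restrict_cong)
  qed (use c uc neg in \<open>simp_all add: rmod_ac cong: restrict_cong\<close>)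
  show ?thesis
  proof (rule moduleI)
    show "cring K" ..
    show "a \<odot>\<^bsub>hom_space Y X\<^esub> u \<in> carrier (hom_space Y X)"
      if "a \<in> carrier K" "u \<in> carrier (hom_space Y X)" for a u
      using c that by (simp add: hom_spaceI scal_hom hom_spaceD)
    show "\<one>\<^bsub>K\<^esub> \<odot>\<^bsub>hom_space Y X\<^esub> u = u" if "u \<in> carrier (hom_space Y X)" for u
      using c uc[OF that] e[OF that] by (simp add: scal_rules(5)[of _ "\<one>\<^bsub>K\<^esub>"] cong: restrict_cong)
  qed (use c uc ag in \<open>simp_all add: scal_rules(1-4) cong: restrict_cong\<close>)
qed

lemma null_smult:
  assumes "null Y X u" "cx Y" "cx X" "c \<in> carrier K"
  shows "null Y X (\<lambda>n x. scal (Ob X n) c (u n x))"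
  using assms(1-3)
proof (rule nullE)
  fix h assume h: "\<And>n. h n \<in> hom (Ob Y n) (Ob X (n - 1))"
    and hc: "\<And>n m x. m = n - 1 \<Longrightarrow> x \<in> carrier (Ob Y n) \<Longrightarrow> h n x \<in> carrier (Ob X m)"
    and e: "\<And>n x. x \<in> carrier (Ob Y n) \<Longrightarrow>
      u n x = Diff X (n - 1) (h n x) \<oplus>\<^bsub>Ob X n\<^esub> h (n + 1) (Diff Y n x)"
  have dh: "Diff X (n - 1) \<in> hom (Ob X (n - 1)) (Ob X n)" for n
    using diff_hom[OF assms(3), of "n - 1"] by simp
  show ?thesis
  proof (rule nullI[of _ _ "\<lambda>n x. scal (Ob X (n - 1)) c (h n x)"])
    fix n show "(\<lambda>x. scal (Ob X (n - 1)) c (h n x)) \<in> hom (Ob Y n) (Ob X (n - 1))"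
      using assms h by (intro scal_hom) auto
    fix x assume x: "x \<in> carrier (Ob Y n)"
    show "scal (Ob X n) c (u n x) = Diff X (n - 1) (scal (Ob X (n - 1)) c (h n x)) \<oplus>\<^bsub>Ob X n\<^esub>
        scal (Ob X (n + 1 - 1)) c (h (n + 1) (Diff Y n x))"
      using x assms e[OF x] scal_hom(1)[OF _ _ dh[of n], of c "h n x"]
      by (simp add: scal_rules(2) hc diff_pred diff_rules)
  qed (use assms in auto)
qed

lemma null_cong:
  assumes "null Y X u" "cx Y" "cx X" "\<And>n x. x \<in> carrier (Ob Y n) \<Longrightarrow> v n x = u n x"
  shows "null Y X v"
  using assms(1-3)
proof (rule nullE)
  fix h assume h: "\<And>n. h n \<in> hom (Ob Y n) (Ob X (n - 1))"
    and e: "\<And>n x. x \<in> carrier (Ob Y n) \<Longrightarrow>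
      u n x = Diff X (n - 1) (h n x) \<oplus>\<^bsub>Ob X n\<^esub> h (n + 1) (Diff Y n x)"
  show ?thesis using assms h e by (intro nullI[of _ _ h]) auto
qed

text \<open>A chain map \<open>f: Y \<rightarrow> X\<close> that is not null-homotopic is detected by a functional vanishing on the
  null-homotopic maps.  In terms of the trace pairing the functional is a family of maps
  \<open>X\<^sup>n \<rightarrow> Y\<^sup>n\<close>, which is a chain map up to the signs \<open>(-1)\<^sup>n\<close>; if that chain map is null-homotopic,
  its pairing with \<open>f\<close> telescopes to zero.\<close>

theorem HZ_dual:
  fixes X :: "('a, 'm) cplx" and Y :: "('a, 'n) cplx"
  assumes kX: "kb X" and kY: "kb Y" and XY: "HZ X Y"
  shows "HZ Y X"
  unfolding HZ_def
proof (rule ballI, rule ccontr)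
  fix f assume f: "f \<in> cm Y X" and nn: "\<not> null Y X f"
  have c: "cx X" "cx Y" using kX kY by auto
  note fr = cm_rules[OF c(2,1) f]
  let ?V = "hom_space Y X"
  define B where "B = {u \<in> carrier ?V. null Y X u}"
  define fV where "fV = (\<lambda>n. restrict (f n) (carrier (Ob Y n)))"
  have fV: "fV \<in> carrier ?V" unfolding fV_def using c f by (intro hom_spaceI cm_hom)
  interpret V: module K ?V by (rule hom_space_module[OF c(2,1)])
  have uc: "u n x \<in> carrier (Ob X n)" if "u \<in> carrier ?V" "x \<in> carrier (Ob Y n)" for u n x
    using hom_rules(1)[OF cx_rmod[OF c(2)] cx_rmod[OF c(1)] hom_spaceD(1)[OF that(1)] that(2)] .
  have B0: "\<zero>\<^bsub>?V\<^esub> \<in> B"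
  proof -
    have "null Y X \<zero>\<^bsub>?V\<^esub>"
      using c by (intro nullI[of _ _ "\<lambda>n x. \<zero>\<^bsub>Ob X (n - 1)\<^esub>"]) (auto simp: hom_zero diff_pred)
    then show ?thesis using V.zero_closed unfolding B_def by blast
  qed
  have Ba: "u \<oplus>\<^bsub>?V\<^esub> v \<in> B" if "u \<in> B" "v \<in> B" for u v
  proof -
    have "null Y X (add_map X u v)" using that c by (intro null_add) (auto simp: B_def)
    then have "null Y X (u \<oplus>\<^bsub>?V\<^esub> v)" using c by (rule_tac null_cong) (auto simp: add_map_def)
    then show ?thesis using that V.a_closed[of u v] by (auto simp: B_def simp del: hom_space_simps)
  qed
  have Bs: "a \<odot>\<^bsub>?V\<^esub> u \<in> B" if "a \<in> carrier K" "u \<in> B" for a u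
  proof -
    have "null Y X (\<lambda>n x. scal (Ob X n) a (u n x))" using that c by (intro null_smult) (auto simp: B_def)
    then have "null Y X (a \<odot>\<^bsub>?V\<^esub> u)" using c by (rule_tac null_cong) auto
    then show ?thesis using that V.smult_closed[of a u] by (auto simp: B_def simp del: hom_space_simps)
  qed
  have "fV \<notin> B"
  proof
    assume "fV \<in> B"
    then have "null Y X f" using c by (rule_tac null_cong[of Y X fV]) (auto simp: B_def fV_def)
    then show False using nn by simp
  qed
  then obtain \<phi> where \<phi>c: "\<phi> \<in> carrier ?V \<rightarrow> carrier K"
    and \<phi>a: "\<And>u v. u \<in> carrier ?V \<Longrightarrow> v \<in> carrier ?V \<Longrightarrow> \<phi> (u \<oplus>\<^bsub>?V\<^esub> v) = \<phi> u \<oplus>\<^bsub>K\<^esub> \<phi> v"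
    and \<phi>s: "\<And>a u. a \<in> carrier K \<Longrightarrow> u \<in> carrier ?V \<Longrightarrow> \<phi> (a \<odot>\<^bsub>?V\<^esub> u) = a \<otimes>\<^bsub>K\<^esub> \<phi> u"
    and \<phi>B: "\<And>u. u \<in> B \<Longrightarrow> \<phi> u = \<zero>\<^bsub>K\<^esub>" and \<phi>f: "\<phi> fV = \<one>\<^bsub>K\<^esub>"
    using V.separating_functional[OF field_K _ B0 Ba Bs fV] by (auto simp: B_def)

  \<comment> \<open>The family concentrated in degree \<open>n\<close>. A functional on the product
    is studied through its restrictions to single degrees, each of which is a trace by
    \<open>functional_trace\<close>.\<close>
  define sing where "sing = (\<lambda>n v m. restrict (if m = n then v else (\<lambda>x. \<zero>\<^bsub>Ob X m\<^esub>)) (carrier (Ob Y m)))"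
  have sing: "sing n v \<in> carrier ?V" if "v \<in> hom (Ob Y n) (Ob X n)" for n v
    unfolding sing_def using that c by (intro hom_spaceI) (auto simp: hom_zero)
  have "\<forall>n. \<exists>N e \<epsilon>. dual_basis (Ob Y n) N e \<epsilon>" using kb_fgp[OF kY] by (simp add: fgp_iff)
  then obtain N e \<epsilon> where b: "\<And>n. dual_basis (Ob Y n) (N n) (e n) (\<epsilon> n)" by metis
  define t where "t = (\<lambda>n. tr (N n) (e n) (\<epsilon> n))"
  have tcomm: "t n (\<lambda>x. v (u x)) = t m (\<lambda>x. u (v x))"
    if "u \<in> hom (Ob Y n) (Ob Y m)" "v \<in> hom (Ob Y m) (Ob Y n)" for n m u v
    unfolding t_def by (rule tr_comm[OF cx_rmod[OF c(2)] cx_rmod[OF c(2)] b b that])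
  have tcl: "t n w \<in> carrier K" if "w \<in> hom (Ob Y n) (Ob Y n)" for n w
    unfolding t_def using tr_closed[OF cx_rmod[OF c(2)] b that] .
  have tadd: "t n (\<lambda>x. w x \<oplus>\<^bsub>Ob Y n\<^esub> w' x) = t n w \<oplus>\<^bsub>K\<^esub> t n w'"
    if "w \<in> hom (Ob Y n) (Ob Y n)" "w' \<in> hom (Ob Y n) (Ob Y n)" for n w w'
    unfolding t_def using tr_add[OF cx_rmod[OF c(2)] b that] .
  have tcong: "t n w = t n w'" if "\<And>x. x \<in> carrier (Ob Y n) \<Longrightarrow> w x = w' x" for n w w'
    unfolding t_def by (rule tr_cong[OF cx_rmod[OF c(2)] b that])
  have tzero: "t n w = \<zero>\<^bsub>K\<^esub>" if "\<And>x. x \<in> carrier (Ob Y n) \<Longrightarrow> w x = \<zero>\<^bsub>Ob Y n\<^esub>" for n w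
    unfolding t_def by (rule tr_zero[OF cx_rmod[OF c(2)] b that])

  have "\<exists>g\<in>hom (Ob X n) (Ob Y n). \<forall>u\<in>hom (Ob Y n) (Ob X n). \<phi> (sing n u) = t n (\<lambda>x. g (u x))" for n
    unfolding t_def
  proof (rule functional_trace[OF cx_rmod[OF c(2)] cx_rmod[OF c(1)] b])
    fix u v assume u: "u \<in> hom (Ob Y n) (Ob X n)"
    show "\<phi> (sing n u) \<in> carrier K" using \<phi>c sing[OF u] by auto
    show "\<phi> (sing n (\<lambda>x. scal (Ob X n) a (u x))) = a \<otimes>\<^bsub>K\<^esub> \<phi> (sing n u)" if a: "a \<in> carrier K" for a
    proof -
      have z: "scal (Ob X m) a \<zero>\<^bsub>Ob X m\<^esub> = \<zero>\<^bsub>Ob X m\<^esub>" for m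
        using a c by (simp add: scal_def)
      have "a \<odot>\<^bsub>?V\<^esub> sing n u = sing n (\<lambda>x. scal (Ob X n) a (u x))"
        by (auto simp: sing_def z intro!: restrict_ext)
      then show ?thesis using \<phi>s[OF a sing[OF u]] by simp
    qed
    show "\<phi> (sing n v) = \<phi> (sing n u)" if "\<And>x. x \<in> carrier (Ob Y n) \<Longrightarrow> v x = u x"
    proof -
      have "sing n v = sing n u" unfolding sing_def
        by (rule ext, rule restrict_ext) (use that in auto)
      then show ?thesis by simp
    qed
    assume v: "v \<in> hom (Ob Y n) (Ob X n)"
    have "sing n u \<oplus>\<^bsub>?V\<^esub> sing n v = sing n (\<lambda>x. u x \<oplus>\<^bsub>Ob X n\<^esub> v x)"
      using c by (auto simp: sing_def intro!: restrict_ext)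
    then show "\<phi> (sing n (\<lambda>x. u x \<oplus>\<^bsub>Ob X n\<^esub> v x)) = \<phi> (sing n u) \<oplus>\<^bsub>K\<^esub> \<phi> (sing n v)"
      using \<phi>a[OF sing[OF u] sing[OF v]] by simp
  qed
  then obtain g where g: "\<And>n. g n \<in> hom (Ob X n) (Ob Y n)"
    and \<phi>g: "\<And>n u. u \<in> hom (Ob Y n) (Ob X n) \<Longrightarrow> \<phi> (sing n u) = t n (\<lambda>x. g n (u x))"
    by metis
  note gr = hom_rules[OF cx_rmod[OF c(1)] cx_rmod[OF c(2)] g]

  \<comment> \<open>The families tested here are d h in degree \<open>n + 1\<close> plus h d in
    degree \<open>n\<close>. They are null-homotopic, with a homotopy living in degree
    \<open>n + 1\<close> alone, so \<phi> kills them. Moving d around the trace collects both terms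
    as the trace of (g d + d g) h, and \<open>h\<close> is arbitrary.\<close>
  have anti: "g (n + 1) (Diff X n x) \<oplus>\<^bsub>Ob Y (n + 1)\<^esub> Diff Y n (g n x) = \<zero>\<^bsub>Ob Y (n + 1)\<^esub>"
    if x: "x \<in> carrier (Ob X n)" for n x
  proof (rule tr_nondeg[OF cx_rmod[OF c(2)] cx_rmod[OF c(1)] b[of "n + 1"] _ _ x])
    show "(\<lambda>x. g (n + 1) (Diff X n x) \<oplus>\<^bsub>Ob Y (n + 1)\<^esub> Diff Y n (g n x)) \<in> hom (Ob X n) (Ob Y (n + 1))"
      using c by (intro hom_add hom_comp[OF diff_hom g] hom_comp[OF g diff_hom]) auto
    fix h assume h: "h \<in> hom (Ob Y (n + 1)) (Ob X n)"
    note hr = hom_rules[OF cx_rmod[OF c(2)] cx_rmod[OF c(1)] h]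
    have 1: "(\<lambda>x. Diff X n (h x)) \<in> hom (Ob Y (n + 1)) (Ob X (n + 1))"
      and 2: "(\<lambda>x. h (Diff Y n x)) \<in> hom (Ob Y n) (Ob X n)"
      using c by (auto intro: hom_comp[OF h diff_hom] hom_comp[OF diff_hom h])
    define H where "H = (\<lambda>m. if m = n + 1 then h else (\<lambda>x. \<zero>\<^bsub>Ob X (m - 1)\<^esub>))"
    let ?u = "sing (n + 1) (\<lambda>x. Diff X n (h x)) \<oplus>\<^bsub>?V\<^esub> sing n (\<lambda>x. h (Diff Y n x))"
    have "null Y X ?u"
    proof (rule nullI[of _ _ H])
      show "H m \<in> hom (Ob Y m) (Ob X (m - 1))" for m using h c by (auto simp: H_def hom_zero)
      show "?u m x = Diff X (m - 1) (H m x) \<oplus>\<^bsub>Ob X m\<^esub> H (m + 1) (Diff Y m x)"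
        if "x \<in> carrier (Ob Y m)" for m x
        using that c by (auto simp: sing_def H_def hr diff_rules diff_pred)
    qed (use c in auto)
    moreover have "?u \<in> carrier ?V" by (rule V.a_closed[OF sing[OF 1] sing[OF 2]])
    ultimately have "\<phi> ?u = \<zero>\<^bsub>K\<^esub>" by (intro \<phi>B) (simp add: B_def del: hom_space_simps)
    then have "t (n + 1) (\<lambda>x. g (n + 1) (Diff X n (h x))) \<oplus>\<^bsub>K\<^esub> t n (\<lambda>x. g n (h (Diff Y n x))) = \<zero>\<^bsub>K\<^esub>"
      using \<phi>a[OF sing[OF 1] sing[OF 2]] \<phi>g[OF 1] \<phi>g[OF 2] by simp
    moreover have "t n (\<lambda>x. g n (h (Diff Y n x))) = t (n + 1) (\<lambda>x. Diff Y n (g n (h x)))"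
      by (rule tcomm[OF diff_hom[OF c(2), of n] hom_comp[OF h g]])
    ultimately have "t (n + 1) (\<lambda>x. g (n + 1) (Diff X n (h x)) \<oplus>\<^bsub>Ob Y (n + 1)\<^esub> Diff Y n (g n (h x))) = \<zero>\<^bsub>K\<^esub>"
      using c by (subst tadd) (auto intro: hom_comp[OF 1 g] hom_comp[OF hom_comp[OF h g] diff_hom])
    then show "tr (N (n + 1)) (e (n + 1)) (\<epsilon> (n + 1)) (\<lambda>x. g (n + 1) (Diff X n (h x)) \<oplus>\<^bsub>Ob Y (n + 1)\<^esub> Diff Y n (g n (h x))) = \<zero>\<^bsub>K\<^esub>"
      by (simp add: t_def)
  qed

  \<comment> \<open>The maps \<open>g n\<close> anticommute with the differentials; the alternating
    sign makes them a chain map.\<close>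
  define g' where "g' = (\<lambda>n x. if even n then g n x else \<ominus>\<^bsub>Ob Y n\<^esub> g n x)"
  have "g' \<in> cm X Y"
  proof (rule cmI)
    show "g' n \<in> hom (Ob X n) (Ob Y n)" for n
      using g c hom_neg[OF _ _ g[of n]] by (cases "even n") (auto simp: g'_def)
    fix n x assume x: "x \<in> carrier (Ob X n)"
    have "g (n + 1) (Diff X n x) = \<ominus>\<^bsub>Ob Y (n + 1)\<^esub> Diff Y n (g n x)"
      using anti[OF x] x c by (intro rmod_minus_unique) (auto simp: gr diff_rules)
    then show "g' (n + 1) (Diff X n x) = Diff Y n (g' n x)"
      using x c by (auto simp: g'_def gr diff_rules)
  qed
  then have "null X Y g'" by (rule HZD[OF XY])
  then show False using c
  proof (rule nullE)
    fix h assume h: "\<And>n. h n \<in> hom (Ob X n) (Ob Y (n - 1))"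
      and hc: "\<And>n m x. m = n - 1 \<Longrightarrow> x \<in> carrier (Ob X n) \<Longrightarrow> h n x \<in> carrier (Ob Y m)"
      and h0: "\<And>n. h n \<zero>\<^bsub>Ob X n\<^esub> = \<zero>\<^bsub>Ob Y (n - 1)\<^esub>"
      and e: "\<And>n x. x \<in> carrier (Ob X n) \<Longrightarrow>
        g' n x = Diff Y (n - 1) (h n x) \<oplus>\<^bsub>Ob Y n\<^esub> h (n + 1) (Diff X n x)"
    have h1: "h (n + 1) \<in> hom (Ob X (n + 1)) (Ob Y n)" for n using h[of "n + 1"] by simp
    have dY: "Diff Y (n - 1) \<in> hom (Ob Y (n - 1)) (Ob Y n)" for n using diff_hom[OF c(2), of "n - 1"] by simp
    \<comment> \<open>The trace of g' f in degree \<open>n\<close> is that of d h f plus that of h f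
      d. Moving d around the trace turns the second into \<open>q (n + 1)\<close>, so degree
      \<open>n\<close> contributes (-1)^n (q n + q (n + 1)) to \<phi>(f), and the alternating sum
      telescopes.\<close>
    define q where "q = (\<lambda>n. t n (\<lambda>x. Diff Y (n - 1) (h n (f n x))))"
    define sg where "sg = (\<lambda>n z. if even (n::int) then z else \<ominus>\<^bsub>K\<^esub> z)"
    have m1: "(\<lambda>x. Diff Y (n - 1) (h n (f n x))) \<in> hom (Ob Y n) (Ob Y n)" for n
      by (rule hom_comp[OF hom_comp[OF cm_hom[OF f] h] dY])
    have m2: "(\<lambda>x. h (n + 1) (f (n + 1) (Diff Y n x))) \<in> hom (Ob Y n) (Ob Y n)" for n
      by (rule hom_comp[OF hom_comp[OF diff_hom[OF c(2)] cm_hom[OF f]] h1])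
    have qc: "q n \<in> carrier K" for n unfolding q_def by (rule tcl[OF m1])
    have q2: "q (n + 1) = t n (\<lambda>x. h (n + 1) (f (n + 1) (Diff Y n x)))" for n
      unfolding q_def using tcomm[OF diff_hom[OF c(2), of n] hom_comp[OF cm_hom[OF f] h1]] by simp
    have tg: "t n (\<lambda>x. g n (f n x)) = sg n (q n \<oplus>\<^bsub>K\<^esub> q (n + 1))" for n
    proof -
      have gf: "g' n (f n x) = Diff Y (n - 1) (h n (f n x)) \<oplus>\<^bsub>Ob Y n\<^esub> h (n + 1) (f (n + 1) (Diff Y n x))"
        if "x \<in> carrier (Ob Y n)" for x
        using that e[of "f n x" n] by (simp add: fr)
      have s: "t n (\<lambda>x. g' n (f n x)) = q n \<oplus>\<^bsub>K\<^esub> q (n + 1)"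
        unfolding q2 unfolding q_def by (subst tadd[OF m1 m2, symmetric]) (rule tcong, rule gf)
      show ?thesis
      proof (cases "even n")
        case True
        then show ?thesis using s by (simp add: sg_def g'_def)
      next
        case False
        have gh: "(\<lambda>x. g n (f n x)) \<in> hom (Ob Y n) (Ob Y n)" by (rule hom_comp[OF cm_hom[OF f] g])
        have ngh: "(\<lambda>x. \<ominus>\<^bsub>Ob Y n\<^esub> g n (f n x)) \<in> hom (Ob Y n) (Ob Y n)" using c gh by (simp add: hom_neg)
        have "t n (\<lambda>x. g n (f n x) \<oplus>\<^bsub>Ob Y n\<^esub> \<ominus>\<^bsub>Ob Y n\<^esub> g n (f n x)) = \<zero>\<^bsub>K\<^esub>"
          using c by (intro tzero) (simp add: gr fr)
        then have "t n (\<lambda>x. g n (f n x)) \<oplus>\<^bsub>K\<^esub> t n (\<lambda>x. g' n (f n x)) = \<zero>\<^bsub>K\<^esub>"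
          using tadd[OF gh ngh] False by (simp add: g'_def)
        then show ?thesis using False s K.minus_equality[of "t n (\<lambda>x. g n (f n x))"] tcl[OF gh] qc
          by (simp add: sg_def)
      qed
    qed
    obtain a b where ab: "\<And>n. n < a \<or> b < n \<Longrightarrow> carrier (Ob Y n) = {\<zero>\<^bsub>Ob Y n\<^esub>}"
      using kb_bounds[OF kY] by blast
    have q0: "q n = \<zero>\<^bsub>K\<^esub>" if "carrier (Ob Y n) = {\<zero>\<^bsub>Ob Y n\<^esub>}" for n
      unfolding q_def using that hom_rules(1)[OF cx_rmod[OF c(2)] cx_rmod[OF c(2)] m1[of n]] by (intro tzero) auto
    \<comment> \<open>Partial sums of \<open>f\<close> over degrees. They start at
      \<open>a - 1\<close>, where \<open>Y\<close> is zero, so that the boundary term of the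
      telescoping sum vanishes at the lower end.\<close>
    define F where "F = (\<lambda>k::nat. \<lambda>m. restrict (if a - 1 \<le> m \<and> m < a - 1 + int k then f m else (\<lambda>x. \<zero>\<^bsub>Ob X m\<^esub>)) (carrier (Ob Y m)))"
    have F: "F k \<in> carrier ?V" for k
      unfolding F_def using c f by (intro hom_spaceI) (auto simp: hom_zero cm_hom)
    have tele: "\<ominus>\<^bsub>K\<^esub> sg n (q n) \<oplus>\<^bsub>K\<^esub> sg n (q n \<oplus>\<^bsub>K\<^esub> q (n + 1)) = \<ominus>\<^bsub>K\<^esub> sg (n + 1) (q (n + 1))" for n
      using qc by (cases "even n") (simp_all add: sg_def K.minus_add K.r_neg1 K.r_neg2)
    have "\<phi> (F k) = \<ominus>\<^bsub>K\<^esub> sg (a - 1 + int k) (q (a - 1 + int k))" for k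
    proof (induction k)
      case 0
      have "F 0 = \<zero>\<^bsub>?V\<^esub>" unfolding F_def hom_space_simps
        by (rule ext, rule restrict_ext) auto
      then have "\<phi> (F 0) = \<zero>\<^bsub>K\<^esub>" using \<phi>B[OF B0] by simp
      then show ?case using q0[OF ab, of "a - 1"] by (simp add: sg_def)
    next
      case (Suc k)
      let ?n = "a - 1 + int k"
      have "F (Suc k) = F k \<oplus>\<^bsub>?V\<^esub> sing ?n (f ?n)"
        unfolding F_def sing_def hom_space_simps
        by (rule ext, rule restrict_ext) (use c in \<open>auto simp: fr\<close>)
      then have "\<phi> (F (Suc k)) = \<phi> (F k) \<oplus>\<^bsub>K\<^esub> t ?n (\<lambda>x. g ?n (f ?n x))"
        using \<phi>a[OF F sing[OF cm_hom[OF f]], of k ?n] \<phi>g[OF cm_hom[OF f], of ?n] by simp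
      also have "\<dots> = \<ominus>\<^bsub>K\<^esub> sg ?n (q ?n) \<oplus>\<^bsub>K\<^esub> sg ?n (q ?n \<oplus>\<^bsub>K\<^esub> q (?n + 1))"
        by (simp add: Suc tg)
      also have "\<dots> = \<ominus>\<^bsub>K\<^esub> sg (?n + 1) (q (?n + 1))"
        by (rule tele)
      finally show ?case by (simp add: ac_simps)
    qed
    note \<phi>F = this
    \<comment> \<open>Chosen so that the sum runs through degree \<open>b\<close> and the remaining
      term \<open>q (b + 1)\<close> vanishes, unless the range is empty already.\<close>
    define k where "k = nat (b + 2 - a)"
    have "fV = F k"
    proof (rule ext, unfold fV_def F_def, rule restrict_ext)
      fix m x assume x: "x \<in> carrier (Ob Y m)"
      show "f m x = (if a - 1 \<le> m \<and> m < a - 1 + int k then f m else (\<lambda>x. \<zero>\<^bsub>Ob X m\<^esub>)) x"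
      proof (cases "a - 1 \<le> m \<and> m < a - 1 + int k")
        case False
        then have "m < a \<or> b < m" by (auto simp: k_def split: if_splits)
        then have "x = \<zero>\<^bsub>Ob Y m\<^esub>" using ab[of m] x by auto
        then show ?thesis using False fr(4)[of m] by simp
      qed simp
    qed
    moreover have "q (a - 1 + int k) = \<zero>\<^bsub>K\<^esub>"
      by (rule q0[OF ab]) (auto simp: k_def)
    ultimately have "\<phi> fV = \<zero>\<^bsub>K\<^esub>" using \<phi>F[of k] by (simp add: sg_def)
    then show False using \<phi>f by simp
  qed
qed

lemma VZ_dual: "kb X \<Longrightarrow> kb Y \<Longrightarrow> VZ X Y i \<Longrightarrow> VZ Y X (- i)"
proof -
  assume k: "kb X" "kb Y" and "VZ X Y i"
  then have "HZ (reindex i Y) X" unfolding VZ_def by (rule_tac HZ_dual) auto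
  then show ?thesis
    using HZ_reindex[of "reindex i Y" X "- i"] k by (simp add: VZ_def)
qed

end

section \<open>Additive closures\<close>

definition dsum_map :: "(int \<Rightarrow> 'm \<Rightarrow> 'p) \<Rightarrow> (int \<Rightarrow> 'n \<Rightarrow> 'q) \<Rightarrow> int \<Rightarrow> 'm \<times> 'n \<Rightarrow> 'p \<times> 'q" where
  "dsum_map f g = (\<lambda>n (x, y). (f n x, g n y))"

definition cpower_map :: "nat \<Rightarrow> (int \<Rightarrow> 'm \<Rightarrow> 'n) \<Rightarrow> int \<Rightarrow> (nat \<Rightarrow> 'm) \<Rightarrow> nat \<Rightarrow> 'n" where
  "cpower_map m f = (\<lambda>n u. \<lambda>i\<in>{..<m}. f n (u i))"

definition cpower_in :: "nat \<Rightarrow> nat \<Rightarrow> ('a, 'm) cplx \<Rightarrow> int \<Rightarrow> 'm \<Rightarrow> nat \<Rightarrow> 'm" where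
  "cpower_in m k X = (\<lambda>n x. \<lambda>i\<in>{..<m}. if i = k then x else \<zero>\<^bsub>Ob X n\<^esub>)"

lemma cpower_simps [simp]:
  "Ob (cpower X m) n = mod_power (Ob X n) m"
  "Diff (cpower X m) n u = (\<lambda>i\<in>{..<m}. Diff X n (u i))"
  by (simp_all add: cpower_def)

context complexes_over
begin

section \<open>Finite powers and direct sums of complexes\<close>

lemma power_hom:
  assumes "rmod M" "\<And>i. i < m \<Longrightarrow> (\<lambda>x. f x i) \<in> hom L M" "\<And>x. f x = restrict (f x) {..<m}"
  shows "f \<in> hom L (mod_power M m)"
proof (rule homI)
  fix x assume x: "x \<in> carrier L"
  have "\<And>i. i < m \<Longrightarrow> f x i \<in> carrier M" using assms(2) x by (auto simp: rm_hom_def Pi_iff)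
  then show "f x \<in> carrier (mod_power M m)" by (subst assms(3)) (auto simp: restrict_PiE_iff)
  show "f (a \<odot>\<^bsub>L\<^esub> x) = a \<odot>\<^bsub>mod_power M m\<^esub> f x" if "a \<in> carrier A" for a
    using assms(2) that x by (subst assms(3)) (auto simp: rm_hom_def intro!: restrict_ext)
  show "f (x \<oplus>\<^bsub>L\<^esub> y) = f x \<oplus>\<^bsub>mod_power M m\<^esub> f y" if "y \<in> carrier L" for y
    using assms(2) that x by (subst assms(3)) (auto simp: rm_hom_def intro!: restrict_ext)
qed

lemma proj_hom: "i < m \<Longrightarrow> (\<lambda>u. u i) \<in> hom (mod_power M m) M"
  by (intro homI) (auto simp: PiE_iff)

lemma cx_cpower [simp]:
  assumes "cx X" shows "cx (cpower X m)"
proof (rule cxI)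
  show "Diff (cpower X m) n \<in> hom (Ob (cpower X m) n) (Ob (cpower X m) (n + 1))" for n
    using assms hom_comp[OF proj_hom diff_hom[OF assms]] by (auto intro!: power_hom cong: restrict_cong)
  show "Diff (cpower X m) (n + 1) (Diff (cpower X m) n x) = \<zero>\<^bsub>Ob (cpower X m) (n + 1 + 1)\<^esub>"
    if "x \<in> carrier (Ob (cpower X m) n)" for n x
    using that assms by (auto simp: diff_rules PiE_iff intro!: restrict_ext)
qed (use assms in simp)

lemma cpower_maps:
  assumes "cx X" "k < m"
  shows "(\<lambda>n u. u k) \<in> cm (cpower X m) X" and "cpower_in m k X \<in> cm X (cpower X m)"
proof -
  show "(\<lambda>n u. u k) \<in> cm (cpower X m) X" using assms by (intro cmI) (auto simp: proj_hom)
  show "cpower_in m k X \<in> cm X (cpower X m)"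
  proof (rule cmI)
    show "cpower_in m k X n \<in> hom (Ob X n) (Ob (cpower X m) n)" for n
    proof -
      have "(\<lambda>x. cpower_in m k X n x i) \<in> hom (Ob X n) (Ob X n)" if "i < m" for i
        using that assms by (cases "i = k") (simp_all add: cpower_in_def hom_id hom_zero)
      then show ?thesis using assms unfolding cpower_simps by (intro power_hom) (auto simp: cpower_in_def)
    qed
  qed (use assms in \<open>auto simp: cpower_in_def diff_rules intro!: restrict_ext\<close>)
qed

lemma cm_cpower_map:
  assumes "cx X" "cx Y" "f \<in> cm X Y" shows "cpower_map m f \<in> cm (cpower X m) (cpower Y m)"
proof (rule cmI)
  show "cpower_map m f n \<in> hom (Ob (cpower X m) n) (Ob (cpower Y m) n)" for n
    using assms hom_comp[OF proj_hom cm_hom[OF assms(3)]]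
    by (auto simp: cpower_map_def intro!: power_hom cong: restrict_cong)
qed (use assms in \<open>auto simp: cpower_map_def cm_rules PiE_iff intro!: restrict_ext\<close>)

lemma cm_dsum_map:
  assumes "f \<in> cm X X'" "g \<in> cm Y Y'"
  shows "dsum_map f g \<in> cm (dsum X Y) (dsum X' Y')"
proof (rule cmI)
  have e: "dsum_map f g n = (\<lambda>p. (f n (fst p), g n (snd p)))" for n by (auto simp: dsum_map_def)
  show "dsum_map f g n \<in> hom (Ob (dsum X Y) n) (Ob (dsum X' Y') n)" for n
    unfolding e using assms by (auto intro!: hom_pair hom_comp[OF hom_fst] hom_comp[OF hom_snd] cm_hom)
qed (use assms in \<open>auto simp: dsum_map_def chain_map_def\<close>)

lemma cyc_dsum: "cyc (dsum X Y) n (x, y) \<longleftrightarrow> cyc X n x \<and> cyc Y n y"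
  by (auto simp: cyc_def)

lemma cob_dsum: "cob (dsum X Y) n (x, y) (x', y') \<longleftrightarrow> cob X n x x' \<and> cob Y n y y'"
  by (force simp: cob_def)

lemma qis_dsum:
  assumes "qis X X' f" "qis Y Y' g" "cx X" "cx X'" "cx Y" "cx Y'"
  shows "qis (dsum X Y) (dsum X' Y') (dsum_map f g)"
proof (rule qisI)
  note F = qisD[OF assms(1,3,4)] and G = qisD[OF assms(2,5,6)]
  show "dsum_map f g \<in> cm (dsum X Y) (dsum X' Y')" by (rule cm_dsum_map[OF F(1) G(1)])
  show "cob (dsum X Y) n p \<zero>\<^bsub>Ob (dsum X Y) n\<^esub>"
    if "cyc (dsum X Y) n p" "cob (dsum X' Y') n (dsum_map f g n p) \<zero>\<^bsub>Ob (dsum X' Y') n\<^esub>" for n p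
    using that F(2) G(2) by (cases p) (simp add: dsum_map_def cyc_dsum cob_dsum)
  show "\<exists>p. cyc (dsum X Y) n p \<and> cob (dsum X' Y') n y (dsum_map f g n p)" if y: "cyc (dsum X' Y') n y" for n y
  proof -
    obtain y1 y2 where yy: "y = (y1, y2)" by (cases y)
    obtain x1 x2 where "cyc X n x1" "cob X' n y1 (f n x1)" "cyc Y n x2" "cob Y' n y2 (g n x2)"
      using y yy F(3)[of n y1] G(3)[of n y2] by (auto simp: cyc_dsum)
    then show ?thesis unfolding yy by (intro exI[of _ "(x1, x2)"]) (simp add: dsum_map_def cyc_dsum cob_dsum)
  qed
qed (use assms in auto)

lemma cyc_cpower:
  "cyc (cpower X m) n u \<longleftrightarrow> u \<in> extensional {..<m} \<and> (\<forall>i<m. cyc X n (u i))"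
proof
  assume c: "cyc (cpower X m) n u"
  have "(\<lambda>i\<in>{..<m}. Diff X n (u i)) = (\<lambda>i\<in>{..<m}. \<zero>\<^bsub>Ob X (n + 1)\<^esub>)" using c by (simp add: cyc_def)
  from fun_cong[OF this] have "Diff X n (u i) = \<zero>\<^bsub>Ob X (n + 1)\<^esub>" if "i < m" for i
    using that by (metis lessThan_iff restrict_apply')
  then show "u \<in> extensional {..<m} \<and> (\<forall>i<m. cyc X n (u i))" using c by (auto simp: cyc_def PiE_iff)
qed (auto simp: cyc_def PiE_iff intro!: restrict_ext)

lemma cob_cpower:
  assumes "u \<in> extensional {..<m}"
  shows "cob (cpower X m) n u v \<longleftrightarrow> (\<forall>i<m. cob X n (u i) (v i))"
proof
  assume "cob (cpower X m) n u v"
  then obtain w where w: "w \<in> {..<m} \<rightarrow>\<^sub>E carrier (Ob X (n - 1))"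
    "u = (\<lambda>i\<in>{..<m}. (\<lambda>i\<in>{..<m}. Diff X (n - 1) (w i)) i \<oplus>\<^bsub>Ob X n\<^esub> v i)"
    by (auto simp: cob_def)
  then show "\<forall>i<m. cob X n (u i) (v i)" by (auto simp: cob_def PiE_iff)
next
  assume "\<forall>i<m. cob X n (u i) (v i)"
  then obtain w where w: "\<And>i. i < m \<Longrightarrow> w i \<in> carrier (Ob X (n - 1))" "\<And>i. i < m \<Longrightarrow> u i = Diff X (n - 1) (w i) \<oplus>\<^bsub>Ob X n\<^esub> v i"
    unfolding cob_def Bex_def by metis
  have "u = (\<lambda>i\<in>{..<m}. (\<lambda>i\<in>{..<m}. Diff X (n - 1) ((\<lambda>i\<in>{..<m}. w i) i)) i \<oplus>\<^bsub>Ob X n\<^esub> v i)"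
    using w(2) assms by (auto simp: extensional_def)
  then show "cob (cpower X m) n u v" unfolding cob_def
    using w(1) by (intro bexI[of _ "\<lambda>i\<in>{..<m}. w i"]) auto
qed

lemma qis_cpower:
  assumes "qis X Y f" "cx X" "cx Y"
  shows "qis (cpower X m) (cpower Y m) (cpower_map m f)"
proof (rule qisI)
  note F = qisD[OF assms]
  show "cpower_map m f \<in> cm (cpower X m) (cpower Y m)" by (rule cm_cpower_map[OF assms(2,3) F(1)])
  show "cob (cpower X m) n u \<zero>\<^bsub>Ob (cpower X m) n\<^esub>"
    if "cyc (cpower X m) n u" "cob (cpower Y m) n (cpower_map m f n u) \<zero>\<^bsub>Ob (cpower Y m) n\<^esub>" for n u
    using that F(2) by (auto simp: cpower_map_def cyc_cpower cob_cpower)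
  show "\<exists>u. cyc (cpower X m) n u \<and> cob (cpower Y m) n v (cpower_map m f n u)" if v: "cyc (cpower Y m) n v" for n v
  proof -
    have "\<forall>i. \<exists>x. i < m \<longrightarrow> cyc X n x \<and> cob Y n (v i) (f n x)" using v F(3) by (auto simp: cyc_cpower)
    then obtain u where "\<And>i. i < m \<Longrightarrow> cyc X n (u i)" "\<And>i. i < m \<Longrightarrow> cob Y n (v i) (f n (u i))" by metis
    then show ?thesis using v
      by (intro exI[of _ "restrict u {..<m}"]) (auto simp: cpower_map_def cyc_cpower cob_cpower)
  qed
qed (use assms in auto)

lemma add_map_zero:
  assumes "cx X" "cx Y" "f \<in> cm X Y"
  shows "hty X Y (add_map Y (zero_map Y) f) f" "hty X Y (add_map Y f (zero_map Y)) f"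
proof -
  show "hty X Y (add_map Y (zero_map Y) f) f"
    by (rule hty_eq[OF assms(1,2) cm_add[OF assms(1,2) cm_zero[OF assms(1,2)] assms(3)]])
      (use assms in \<open>simp add: add_map_def zero_map_def cm_rules\<close>)
  show "hty X Y (add_map Y f (zero_map Y)) f"
    by (rule hty_eq[OF assms(1,2) cm_add[OF assms cm_zero[OF assms(1,2)]]])
      (use assms in \<open>simp add: add_map_def zero_map_def cm_rules\<close>)
qed

text \<open>The ideal of maps factoring through \<open>add (U \<oplus> V)\<close>: \<open>X\<close> lies in \<open>add (U \<oplus> V)\<close> iff
  the ideal contains the identity of \<open>X\<close>.\<close>

inductive via :: "('a, 'p) cplx \<Rightarrow> ('a, 'q) cplx \<Rightarrow> ('a, 'm) cplx \<Rightarrow> ('a, 'n) cplx \<Rightarrow> (int \<Rightarrow> 'm \<Rightarrow> 'n) \<Rightarrow> bool"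
  for U V X Y where
  via_zero: "via U V X Y (zero_map Y)"
| via_left: "via U V X Y f \<Longrightarrow> i \<in> cm X U \<Longrightarrow> p \<in> cm U Y \<Longrightarrow> via U V X Y (add_map Y f (comp_map p i))"
| via_right: "via U V X Y f \<Longrightarrow> i \<in> cm X V \<Longrightarrow> p \<in> cm V Y \<Longrightarrow> via U V X Y (add_map Y f (comp_map p i))"
| via_hty: "via U V X Y f \<Longrightarrow> g \<in> cm X Y \<Longrightarrow> hty X Y f g \<Longrightarrow> via U V X Y g"

lemma via_cm:
  assumes "via U V X Y f" "cx X" "cx Y" shows "f \<in> cm X Y"
  using assms(1) by induction (auto intro: cm_zero cm_add cm_comp assms(2,3))

lemma via_add:
  assumes g: "via U V X Y g" and f: "via U V X Y f" and c: "cx X" "cx Y"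
  shows "via U V X Y (add_map Y f g)"
  using g
proof induction
  case via_zero
  have fc: "f \<in> cm X Y" using via_cm f c by blast
  have "hty X Y f (add_map Y f (zero_map Y))"
    using c fc by (intro hty_eq) (auto simp: add_map_def zero_map_def cm_rules)
  then show ?case using c fc by (rule_tac via_hty[OF f]) (auto intro: cm_add cm_zero)
next
  case (via_left g i p)
  have e: "add_map Y f (add_map Y g (comp_map p i)) \<in> cm X Y"
    and e': "add_map Y (add_map Y f g) (comp_map p i) \<in> cm X Y"
    using via_left via_cm f c by (auto intro!: cm_add cm_comp)
  have gc: "g \<in> cm X Y" "f \<in> cm X Y" "comp_map p i \<in> cm X Y" using via_left via_cm f c by (auto intro: cm_comp)
  have "hty X Y (add_map Y (add_map Y f g) (comp_map p i)) (add_map Y f (add_map Y g (comp_map p i)))"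
    using c e' gc by (intro hty_eq) (auto simp: add_map_def cm_rules rmod_ac(1))
  then show ?case by (rule via.via_hty[OF via.via_left[OF via_left(4,2,3)] e])
next
  case (via_right g i p)
  have e: "add_map Y f (add_map Y g (comp_map p i)) \<in> cm X Y"
    and e': "add_map Y (add_map Y f g) (comp_map p i) \<in> cm X Y"
    using via_right via_cm f c by (auto intro!: cm_add cm_comp)
  have gc: "g \<in> cm X Y" "f \<in> cm X Y" "comp_map p i \<in> cm X Y" using via_right via_cm f c by (auto intro: cm_comp)
  have "hty X Y (add_map Y (add_map Y f g) (comp_map p i)) (add_map Y f (add_map Y g (comp_map p i)))"
    using c e' gc by (intro hty_eq) (auto simp: add_map_def cm_rules rmod_ac(1))
  then show ?case by (rule via.via_hty[OF via.via_right[OF via_right(4,2,3)] e])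
next
  case (via_hty g g')
  have fc: "f \<in> cm X Y" "g \<in> cm X Y" using via_cm f c via_hty by blast+
  have "hty X Y (add_map Y f g) (add_map Y f g')"
    using fc via_hty c by (intro hty_add hty_refl)
  then show ?case using via_hty fc c by (intro via.via_hty[OF via_hty(4)]) (auto intro: cm_add)
qed

lemma via_comp_left:
  assumes "cx X" "cx Y" "i \<in> cm X U" "p \<in> cm U Y" shows "via U V X Y (comp_map p i)"
  using via_left[OF via_zero assms(3,4)] add_map_zero(1)[OF assms(1,2) cm_comp[OF assms(3,4)]] cm_comp[OF assms(3,4)]
  by (rule_tac via_hty)

lemma via_comp_right:
  assumes "cx X" "cx Y" "i \<in> cm X V" "p \<in> cm V Y" shows "via U V X Y (comp_map p i)"
  using via_right[OF via_zero assms(3,4)] add_map_zero(1)[OF assms(1,2) cm_comp[OF assms(3,4)]] cm_comp[OF assms(3,4)]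
  by (rule_tac via_hty)

lemma via_comp:
  assumes f: "via U V X Y f" and u: "u \<in> cm W X" and v: "v \<in> cm Y Z" and c: "cx X" "cx Y" "cx W" "cx Z"
  shows "via U V W Z (comp_map v (comp_map f u))"
proof -
  note vr = cm_rules[OF c(2,4) v] and ur = cm_rules[OF c(3,1) u]
  have vz: "comp_map v (comp_map (add_map Y f g) u)
      = comp_map v (add_map Y (comp_map f u) (comp_map g u))" for f g
    by (simp add: comp_map_def add_map_def)
  have va: "hty W Z (add_map Z (comp_map v (comp_map f u)) (comp_map v (comp_map g u))) (comp_map v (comp_map (add_map Y f g) u))"
    and vc: "comp_map v (comp_map (add_map Y f g) u) \<in> cm W Z"
    if "f \<in> cm X Y" "g \<in> cm X Y" for f g
  proof -
    have "add_map Z (comp_map v (comp_map f u)) (comp_map v (comp_map g u)) \<in> cm W Z"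
      using that u v c by (intro cm_add cm_comp[OF cm_comp[OF u]])
    then show "hty W Z (add_map Z (comp_map v (comp_map f u)) (comp_map v (comp_map g u))) (comp_map v (comp_map (add_map Y f g) u))"
      using that c by (intro hty_eq) (auto simp: comp_map_def add_map_def vr ur cm_rules)
    show "comp_map v (comp_map (add_map Y f g) u) \<in> cm W Z"
      using that c v by (intro cm_comp[OF cm_comp[OF u] v] cm_add)
  qed
  show ?thesis using f
  proof induction
    case via_zero
    have "comp_map v (comp_map (zero_map Y) u) = (zero_map Z)"
      using vr(4) by (simp add: comp_map_def zero_map_def fun_eq_iff)
    then show ?case using via.via_zero by simp
  next
    case (via_left f i p)
    have "via U V W Z (comp_map (comp_map v p) (comp_map i u))"
      using via_left u v c by (intro via_comp_left cm_comp)
    then have "via U V W Z (add_map Z (comp_map v (comp_map f u)) (comp_map v (comp_map (comp_map p i) u)))"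
      using via_left c by (intro via_add) (auto simp: comp_assoc)
    then show ?case using via_left via_cm[OF via_left(1) c(1,2)] cm_comp[OF via_left(2,3)]
      by (rule_tac via_hty[OF _ vc va])
  next
    case (via_right f i p)
    have "via U V W Z (comp_map (comp_map v p) (comp_map i u))"
      using via_right u v c by (intro via_comp_right cm_comp)
    then have "via U V W Z (add_map Z (comp_map v (comp_map f u)) (comp_map v (comp_map (comp_map p i) u)))"
      using via_right c by (intro via_add) (auto simp: comp_assoc)
    then show ?case using via_right via_cm[OF via_right(1) c(1,2)] cm_comp[OF via_right(2,3)]
      by (rule_tac via_hty[OF _ vc va])
  next
    case (via_hty f g)
    have "hty W Y (comp_map f u) (comp_map g u)"
      using via_hty c u by (intro hty_comp_right)
    then have "hty W Z (comp_map v (comp_map f u)) (comp_map v (comp_map g u))"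
      using via_hty c u v by (intro hty_comp_left[OF _ v]) (auto intro: cm_comp)
    then show ?case using via_hty c u v
      by (intro via.via_hty[OF via_hty(4)]) (auto intro: cm_comp)
  qed
qed

text \<open>Transitivity of additive closures: a factorization through U or V is refined by
  inserting the identity of U or V, itself a sum of maps through U' and V'.\<close>

lemma via_trans:
  assumes f: "via U V X Y f" and U: "via U' V' U U id_map" and V: "via U' V' V V id_map"
    and c: "cx X" "cx Y" "cx U" "cx V"
  shows "via U' V' X Y f"
  using f
proof induction
  case (via_left f i p)
  have "via U' V' X Y (comp_map p (comp_map id_map i))" using via_left U c by (intro via_comp)
  then show ?case using via_left c by (intro via_add) auto
next
  case (via_right f i p)
  have "via U' V' X Y (comp_map p (comp_map id_map i))" using via_right V c by (intro via_comp)
  then show ?case using via_right c by (intro via_add) auto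
qed (auto intro: via.intros)

lemma via_null:
  assumes f: "via U V X Y f" and c: "cx X" "cx Y" "cx U" "cx V"
    and H: "HZ U Y \<and> HZ V Y \<or> HZ X U \<and> HZ X V"
  shows "null X Y f"
  using f
proof induction
  case via_zero
  show ?case using c by (intro hty_refl cm_zero)
next
  case (via_left f i p)
  have "null X Y (comp_map p i)"
    using H via_left c null_comp_left[of X U i p Y] null_comp_right[of U Y p i X] by (auto dest: HZD)
  then show ?case using via_left c by (intro null_add)
next
  case (via_right f i p)
  have "null X Y (comp_map p i)"
    using H via_right c null_comp_left[of X V i p Y] null_comp_right[of V Y p i X] by (auto dest: HZD)
  then show ?case using via_right c by (intro null_add)
next
  case (via_hty f g)
  have "hty X Y g f" by (rule hty_sym[OF via_hty(3) c(1,2) via_hty(2)])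
  then show ?case using via_hty(4) c by (rule_tac null_hty)
qed

lemma VZ_via_left:
  assumes "via U V X X id_map" "VZ U Y i" "VZ V Y i" and c: "cx X" "cx Y" "cx U" "cx V"
  shows "VZ X Y i"
  unfolding VZ_def HZ_def
proof
  fix f assume f: "f \<in> cm X (reindex i Y)"
  have "via U V X (reindex i Y) (comp_map f (comp_map id_map id_map))"
    using assms f by (intro via_comp[OF assms(1) cm_id f]) auto
  then show "null X (reindex i Y) f"
    using assms by (intro via_null[of U V]) (auto simp: VZ_def)
qed

text \<open>The ideal argument in \<open>VZ_via_right\<close> composes with the identity of the
  target, so the target must be \<open>X\<close> itself and the shift has to move to the
  source.\<close>

lemma VZ_flip: "cx X \<Longrightarrow> cx Y \<Longrightarrow> VZ X Y i \<longleftrightarrow> HZ (reindex (- i) X) Y"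
  using HZ_reindex[of X "reindex i Y" "- i"] by (simp add: VZ_def)

lemma VZ_via_right:
  assumes "via U V X X id_map" "VZ W U i" "VZ W V i" and c: "cx X" "cx W" "cx U" "cx V"
  shows "VZ W X i"
  unfolding VZ_flip[OF c(2,1)] HZ_def
proof
  fix f assume f: "f \<in> cm (reindex (- i) W) X"
  have "via U V (reindex (- i) W) X (comp_map id_map (comp_map id_map f))"
    using assms f by (intro via_comp[OF assms(1) f cm_id]) auto
  then show "null (reindex (- i) W) X f"
    using assms by (intro via_null[of U V]) (auto simp: VZ_flip)
qed

lemma via_ret:
  assumes "ret X U" "cx X" "cx U" shows "via U V X X id_map"
  using assms by (auto simp: ret_def intro: via_hty via_comp_left cm_id)

lemma via_dsum:
  assumes "cx X" "cx Y"
  shows "via X Y (dsum X Y) (dsum X Y) id_map"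
proof -
  note m = dsum_maps[OF assms]
  have "via X Y (dsum X Y) (dsum X Y) (add_map (dsum X Y) (comp_map (inl_map Y) fst_map) (comp_map (inr_map X) snd_map))"
    using assms m by (intro via_add via_comp_left via_comp_right cx_dsum)
  moreover have "hty (dsum X Y) (dsum X Y) (add_map (dsum X Y) (comp_map (inl_map Y) fst_map) (comp_map (inr_map X) snd_map)) id_map"
    using assms m
    by (intro hty_eq cm_add cm_comp cx_dsum)
      (auto simp: add_map_def comp_map_def inl_map_def inr_map_def fst_map_def snd_map_def id_map_def)
  ultimately show ?thesis by (rule_tac via_hty[OF _ cm_id])
qed

lemma ret_dsum:
  assumes "cx X" "cx Y"
  shows "ret X (dsum X Y)" "ret Y (dsum X Y)"
  using dsum_maps[OF assms] assms
  by (auto intro: retI[of _ "inl_map Y" _ fst_map] retI[of _ "inr_map X" _ snd_map]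
    simp: inl_map_def inr_map_def fst_map_def snd_map_def)

text \<open>The roof from Q + X' to P^m is unwound with K-projectivity. The inclusion of Q lifts to
  a map \<open>u\<close> into the apex, and the identity of Q is recovered from \<open>u\<close>. On
  P^m the image of \<open>u\<close> is a sum of maps through the coordinates; each coordinate
  inclusion lifts to the apex because P is K-projective, and cancelling the quasi-isomorphism
  \<open>b\<close> shows that \<open>u\<close> itself is a sum of maps through P.\<close>

lemma in_add_via:
  fixes P :: "('a, 'n) cplx" and Q :: "('a, 'm) cplx"
  assumes Q: "kb Q" and P: "kb P" and a: "in_add A P Q"
  shows "via P P Q Q id_map"
proof -
  obtain m and X' :: "('a, 'm) cplx" where X': "cx X'" "derived_iso A (dsum Q X') (cpower P m)"
    using a by (auto simp: in_add_def)
  then obtain Z :: "('a, 'm \<times> 'm) cplx" and s b where Z: "cx Z" "qis Z (dsum Q X') s" "qis Z (cpower P m) b"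
    by (metis derived_isoE)
  have c: "cx Q" "cx P" "cx (dsum Q X')" "cx (cpower P m)" using Q P X' by auto
  note sc = qisD(1)[OF Z(2,1) c(3)] and bc = qisD(1)[OF Z(3,1) c(4)]
  note br = cm_rules[OF Z(1) c(4) bc]
  obtain u where u: "u \<in> cm Q Z" "hty Q (dsum Q X') (inl_map X') (comp_map s u)"
    using qis_lift[OF Q Z(2,1) c(3) dsum_maps(1)[OF c(1) X'(1)]] by blast
  note ur = cm_rules[OF c(1) Z(1) u(1)]
  have buc: "comp_map b u \<in> cm Q (cpower P m)" by (rule cm_comp[OF u(1) bc])
  have but: "b n (u n x) i \<in> carrier (Ob P n)" if "x \<in> carrier (Ob Q n)" "i < m" for n x i
    using br(1)[OF ur(1)[OF that(1)]] that(2) by (auto simp: PiE_iff)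
  \<comment> \<open>\<open>T k\<close> is the composite of \<open>u\<close> and \<open>b\<close>
    with all coordinates from \<open>k\<close> on replaced by zero; it is zero for
    \<open>k = 0\<close> and the whole composite for \<open>k = m\<close>.\<close>
  define T where "T = (\<lambda>k::nat. \<lambda>n x. \<lambda>i\<in>{..<m}. if i < k then b n (u n x) i else \<zero>\<^bsub>Ob P n\<^esub>)"
  have ij: "comp_map (cpower_in m k P) (comp_map (\<lambda>n v. v k) (comp_map b u)) \<in> cm Q (cpower P m)" if "k < m" for k
    by (rule cm_comp[OF cm_comp[OF buc cpower_maps(1)[OF c(2) that]] cpower_maps(2)[OF c(2) that]])
  have T: "T k \<in> cm Q (cpower P m)" if "k \<le> m" for k
    using that
  proof (induction k)
    case 0
    have "T 0 = zero_map (cpower P m)" by (auto simp: T_def zero_map_def)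
    then show ?case using c by (simp add: cm_zero)
  next
    case (Suc k)
    have *: "add_map (cpower P m) (T k) (comp_map (cpower_in m k P) (comp_map (\<lambda>n v. v k) (comp_map b u))) \<in> cm Q (cpower P m)"
      using Suc ij c by (intro cm_add) auto
    have **: "T (Suc k) n x = add_map (cpower P m) (T k) (comp_map (cpower_in m k P) (comp_map (\<lambda>n v. v k) (comp_map b u))) n x"
      if "x \<in> carrier (Ob Q n)" for n x
      using but[OF that] c Suc unfolding T_def add_map_def comp_map_def cpower_in_def cpower_simps mod_power_simps
      by (intro restrict_ext) auto
    have dx: "Diff Q n x \<in> carrier (Ob Q (n + 1))" if "x \<in> carrier (Ob Q n)" for n x
      using that c by (simp add: diff_rules)
    show ?case
      using * cm_hom[OF *] hom_cong[OF cm_hom[OF *] **] c dx by (intro cmI) (auto simp: ** chain_map_def)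
  qed
  \<comment> \<open>The truncations are lifted along \<open>b\<close> one coordinate at a time,
    staying in the ideal of P.\<close>
  have "\<exists>w. via P P Q Z w \<and> hty Q (cpower P m) (comp_map b w) (T k)" if "k \<le> m" for k
    using that
  proof (induction k)
    case 0
    have "comp_map b (zero_map Z) = T 0" using br(4) by (auto simp: T_def comp_map_def zero_map_def)
    then show ?case using via_zero[of P P Q Z] hty_refl[OF c(1,4) T[of 0]] by (intro exI[of _ "zero_map Z"]) auto
  next
    case (Suc k)
    then obtain w where w: "via P P Q Z w" "hty Q (cpower P m) (comp_map b w) (T k)" by auto
    have k: "k < m" using Suc by simp
    note cp = cpower_maps[OF c(2) k]
    obtain v where v: "v \<in> cm P Z" "hty P (cpower P m) (cpower_in m k P) (comp_map b v)"
      using qis_lift[OF P Z(3,1) c(4) cp(2)] by blast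
    have v2: "hty P (cpower P m) (comp_map b v) (cpower_in m k P)"
      by (rule hty_sym[OF v(2) c(2,4) cm_comp[OF v(1) bc]])
    define r where "r = comp_map (\<lambda>n v. v k) (comp_map b u)"
    have r: "r \<in> cm Q P" unfolding r_def by (rule cm_comp[OF buc cp(1)])
    have wc: "w \<in> cm Q Z" by (rule via_cm[OF w(1) c(1) Z(1)])
    have vr: "comp_map v r \<in> cm Q Z" by (rule cm_comp[OF r v(1)])
    have 1: "via P P Q Z (add_map Z w (comp_map v r))" by (rule via_left[OF w(1) r v(1)])
    have wv: "add_map Z w (comp_map v r) \<in> cm Q Z" using wc vr c Z by (intro cm_add)
    have 2: "hty Q (cpower P m) (comp_map b (add_map Z w (comp_map v r))) (add_map (cpower P m) (comp_map b w) (comp_map (comp_map b v) r))"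
    proof (rule hty_eq[OF c(1,4) cm_comp[OF wv bc]])
      fix n x assume x: "x \<in> carrier (Ob Q n)"
      show "comp_map b (add_map Z w (comp_map v r)) n x = add_map (cpower P m) (comp_map b w) (comp_map (comp_map b v) r) n x"
        using br(2)[of "w n x" n "v n (r n x)"] cm_rules(1)[OF c(1) Z(1) wc x] cm_rules(1)[OF c(1) Z(1) vr x]
        by (simp add: comp_map_def add_map_def)
    qed
    have 3: "hty Q (cpower P m) (add_map (cpower P m) (comp_map b w) (comp_map (comp_map b v) r)) (add_map (cpower P m) (T k) (comp_map (cpower_in m k P) r))"
      using w(2) T[of k] k c r cp by (intro hty_add hty_comp_right[OF v2 r] cm_comp[OF r cp(2)]) auto
    have 4: "hty Q (cpower P m) (add_map (cpower P m) (T k) (comp_map (cpower_in m k P) r)) (T (Suc k))"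
    proof (rule hty_eq[OF c(1,4)])
      show "add_map (cpower P m) (T k) (comp_map (cpower_in m k P) r) \<in> cm Q (cpower P m)"
        using T[of k] k c cm_comp[OF r cp(2)] by (intro cm_add) auto
      fix n x assume x: "x \<in> carrier (Ob Q n)"
      show "add_map (cpower P m) (T k) (comp_map (cpower_in m k P) r) n x = T (Suc k) n x"
        using but[OF x] c unfolding T_def add_map_def comp_map_def cpower_in_def cpower_simps mod_power_simps r_def
        by (intro restrict_ext) auto
    qed
    have 5: "add_map (cpower P m) (T k) (comp_map (cpower_in m k P) r) \<in> cm Q (cpower P m)"
      using T[of k] k c cm_comp[OF r cp(2)] by (intro cm_add) auto
    have "hty Q (cpower P m) (comp_map b (add_map Z w (comp_map v r))) (T (Suc k))"
      by (rule hty_trans[OF 2 hty_trans[OF 3 4 c(1,4)] c(1,4)]) (use T Suc in auto)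
    then show ?case using 1 by blast
  qed
  then obtain w where w: "via P P Q Z w" "hty Q (cpower P m) (comp_map b w) (T m)" by blast
  have "hty Q (cpower P m) (T m) (comp_map b u)"
  proof (rule hty_eq[OF c(1,4) T])
    fix n x assume "x \<in> carrier (Ob Q n)"
    then have "b n (u n x) \<in> {..<m} \<rightarrow>\<^sub>E carrier (Ob P n)" using br(1)[OF ur(1)] by simp
    then show "T m n x = comp_map b u n x"
      by (auto simp: T_def comp_map_def PiE_iff extensional_def)
  qed simp
  then have "hty Q (cpower P m) (comp_map b w) (comp_map b u)"
    by (rule hty_trans[OF w(2) _ c(1,4) buc])
  then have "hty Q Z w u"
    by (rule qis_hty_cancel[OF Q Z(3,1) c(4) via_cm[OF w(1) c(1) Z(1)] u(1)])
  then have "via P P Q Z u" by (rule via_hty[OF w(1) u(1)])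
  then have 1: "via P P Q Q (comp_map (comp_map fst_map s) (comp_map u id_map))"
    using c Z by (intro via_comp[OF _ cm_id cm_comp[OF sc dsum_maps(3)[OF c(1) X'(1)]]])
  have "hty Q Q (comp_map fst_map (inl_map X')) (comp_map fst_map (comp_map s u))"
    using c X' by (intro hty_comp_left[OF u(2) dsum_maps(3)] cm_comp[OF u(1) sc])
  moreover have "comp_map fst_map (inl_map X') = (id_map :: int \<Rightarrow> 'm \<Rightarrow> 'm)"
    by (simp add: comp_map_def fst_map_def inl_map_def id_map_def)
  ultimately have "hty Q Q (comp_map fst_map (comp_map s u)) id_map"
    using c X' by (intro hty_sym[of Q Q id_map]) (auto intro: cm_comp[OF cm_comp[OF u(1) sc] dsum_maps(3)])
  then show ?thesis using 1 by (intro via_hty[OF _ cm_id]) (auto simp: comp_assoc)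
qed

section \<open>Maps of cones and complements of retracts\<close>

lemma cob_zero_iff: "cx X \<Longrightarrow> cob X n x \<zero>\<^bsub>Ob X n\<^esub> \<longleftrightarrow> (\<exists>w\<in>carrier (Ob X (n - 1)). x = Diff X (n - 1) w)"
  unfolding cob_def by (auto simp: diff_pred)

text \<open>The square commutes up to a homotopy \<open>k\<close> only, which enters the map of
  cones off the diagonal: (z, y) \<mapsto> (z, k z + q y). The proof is the five lemma carried out
  on cocycles. It transfers a cone over some \<open>\<Delta> n\<close> to the model of
  \<open>\<Delta> n\<close>.\<close>

lemma qis_cone_map:
  assumes q: "qis Y Y' q" and a: "a \<in> cm C Y" and a': "a' \<in> cm C Y'"
    and h: "hty C Y' (comp_map q a) a'" and c: "cx C" "cx Y" "cx Y'"
  obtains F where "qis (cone C Y a) (cone C Y' a') F"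
  using h c(1,3)
proof (rule htyE)
  fix k assume k: "\<And>n. k n \<in> hom (Ob C n) (Ob Y' (n - 1))"
    and kr: "\<And>n m x. m = n - 1 \<Longrightarrow> x \<in> carrier (Ob C n) \<Longrightarrow> k n x \<in> carrier (Ob Y' m)"
      "\<And>n. k n \<zero>\<^bsub>Ob C n\<^esub> = \<zero>\<^bsub>Ob Y' (n - 1)\<^esub>"
      "\<And>n x. x \<in> carrier (Ob C n) \<Longrightarrow> k n (\<ominus>\<^bsub>Ob C n\<^esub> x) = \<ominus>\<^bsub>Ob Y' (n - 1)\<^esub> k n x"
    and e0: "\<And>n x. x \<in> carrier (Ob C n) \<Longrightarrow> comp_map q a n x =
      a' n x \<oplus>\<^bsub>Ob Y' n\<^esub> (Diff Y' (n - 1) (k n x) \<oplus>\<^bsub>Ob Y' n\<^esub> k (n + 1) (Diff C n x))"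
  note qc = qisD(1)[OF q c(2,3)]
  note qr = cm_rules[OF c(2,3) qc] and ar = cm_rules[OF c(1,2) a] and ar' = cm_rules[OF c(1,3) a']
  note dC = diff_rules[OF c(1)] and dY = diff_rules[OF c(2)] and dY' = diff_rules[OF c(3)]
  have kk: "k (n + 1) \<in> hom (Ob C (n + 1)) (Ob Y' n)" for n using k[of "n + 1"] by simp
  have k2: "k (n + 1) (\<ominus>\<^bsub>Ob C (n + 1)\<^esub> x) = \<ominus>\<^bsub>Ob Y' n\<^esub> k (n + 1) x" if "x \<in> carrier (Ob C (n + 1))" for n x
    using kr(3)[OF that] by simp
  have e: "q (n + 1) (a (n + 1) x) = a' (n + 1) x \<oplus>\<^bsub>Ob Y' (n + 1)\<^esub> (Diff Y' n (k (n + 1) x) \<oplus>\<^bsub>Ob Y' (n + 1)\<^esub> k (n + 1 + 1) (Diff C (n + 1) x))"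
    if "x \<in> carrier (Ob C (n + 1))" for n x using e0[OF that] by (simp add: comp_map_def)
  define F where "F = (\<lambda>n p. (fst p, k (n + 1) (fst p) \<oplus>\<^bsub>Ob Y' n\<^esub> q n (snd p)))"
  have F: "F \<in> cm (cone C Y a) (cone C Y' a')"
  proof (rule cmI)
    show "F n \<in> hom (Ob (cone C Y a) n) (Ob (cone C Y' a') n)" for n
      unfolding F_def complex_simps using c kk by (intro hom_pair hom_fst hom_case cm_hom[OF qc]) auto
    fix n p assume "p \<in> carrier (Ob (cone C Y a) n)"
    then obtain z y where p: "p = (z, y)" "z \<in> carrier (Ob C (n + 1))" "y \<in> carrier (Ob Y n)" by auto
    have "k (n + 1 + 1) (\<ominus>\<^bsub>Ob C (n + 1 + 1)\<^esub> Diff C (n + 1) z) \<oplus>\<^bsub>Ob Y' (n + 1)\<^esub> q (n + 1) (a (n + 1) z \<oplus>\<^bsub>Ob Y (n + 1)\<^esub> Diff Y n y)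
      = a' (n + 1) z \<oplus>\<^bsub>Ob Y' (n + 1)\<^esub> Diff Y' n (k (n + 1) z \<oplus>\<^bsub>Ob Y' n\<^esub> q n y)"
      apply (rule int_vectors[of "Ob Y' (n + 1)" "a' (n + 1) z" "Diff Y' n (k (n + 1) z)" "k (n + 1 + 1) (Diff C (n + 1) z)" "Diff Y' n (q n y)" "\<zero>\<^bsub>Ob Y' (n + 1)\<^esub>" "\<zero>\<^bsub>Ob Y' (n + 1)\<^esub>"])
      using p c e[OF p(2)] k2[of "Diff C (n + 1) z" "n + 1"]
      by (simp_all add: kr(1) qr ar ar' dC dY dY')
    then show "F (n + 1) (Diff (cone C Y a) n p) = Diff (cone C Y' a') n (F n p)"
      by (simp add: F_def p(1))
  qed
  have cc: "cx (cone C Y a)" "cx (cone C Y' a')" using c a a' by auto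
  have "qis (cone C Y a) (cone C Y' a') F"
  proof (rule qisI[OF cc F])
    fix n p assume p: "cyc (cone C Y a) n p" and b: "cob (cone C Y' a') n (F n p) \<zero>\<^bsub>Ob (cone C Y' a') n\<^esub>"
    obtain z y where zy: "p = (z, y)" "z \<in> carrier (Ob C (n + 1))" "y \<in> carrier (Ob Y n)" using cycD(1)[OF p] by auto
    have p2: "a (n + 1) z \<oplus>\<^bsub>Ob Y (n + 1)\<^esub> Diff Y n y = \<zero>\<^bsub>Ob Y (n + 1)\<^esub>" using cycD(2)[OF p] zy by simp
    obtain z' y' where zy': "z' \<in> carrier (Ob C n)" "y' \<in> carrier (Ob Y' (n - 1))"
      and d1: "z = \<ominus>\<^bsub>Ob C (n + 1)\<^esub> Diff C n z'"
      and d2: "k (n + 1) z \<oplus>\<^bsub>Ob Y' n\<^esub> q n y = a' n z' \<oplus>\<^bsub>Ob Y' n\<^esub> Diff Y' (n - 1) y'"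
      using b zy unfolding cob_zero_iff[OF cc(2)] by (auto simp: F_def)
    \<comment> \<open>Subtracting the boundary of (z', 0) from (z, y) leaves (0, y1). The homotopy
      equation shows that q y1 is a boundary, and \<open>q\<close> reflects this.\<close>
    define y1 where "y1 = y \<oplus>\<^bsub>Ob Y n\<^esub> \<ominus>\<^bsub>Ob Y n\<^esub> a n z'"
    have y1c: "y1 \<in> carrier (Ob Y n)" using zy zy' c by (simp add: y1_def ar)
    have az: "a (n + 1) z = \<ominus>\<^bsub>Ob Y (n + 1)\<^esub> Diff Y n (a n z')" using zy' by (simp add: d1 ar dC)
    have "Diff Y n y1 = a (n + 1) z \<oplus>\<^bsub>Ob Y (n + 1)\<^esub> Diff Y n y"
      using zy zy' c by (simp add: y1_def az dY ar rmod_ac(2))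
    then have y1: "cyc Y n y1" using p2 y1c by (simp add: cyc_def)
    have kz: "k (n + 1) z = \<ominus>\<^bsub>Ob Y' n\<^esub> k (n + 1) (Diff C n z')"
      unfolding d1 using zy' by (intro k2) (simp add: dC)
    have qa: "q n (a n z') = a' n z' \<oplus>\<^bsub>Ob Y' n\<^esub> (Diff Y' (n - 1) (k n z') \<oplus>\<^bsub>Ob Y' n\<^esub> k (n + 1) (Diff C n z'))"
      using e0[OF zy'(1)] by (simp add: comp_map_def)
    have kc: "k (n + 1) (Diff C n z') \<in> carrier (Ob Y' n)" "k n z' \<in> carrier (Ob Y' (n - 1))"
      using zy' by (auto simp: kr(1) dC)
    have qy: "q n y = k (n + 1) (Diff C n z') \<oplus>\<^bsub>Ob Y' n\<^esub> (a' n z' \<oplus>\<^bsub>Ob Y' n\<^esub> Diff Y' (n - 1) y')"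
    proof -
      have "q n y = k (n + 1) (Diff C n z') \<oplus>\<^bsub>Ob Y' n\<^esub> (k (n + 1) z \<oplus>\<^bsub>Ob Y' n\<^esub> q n y)"
        using zy zy' c kc unfolding kz by (simp add: qr flip: rmod_ac(1))
      then show ?thesis by (simp only: d2)
    qed
    have "q n y1 = Diff Y' (n - 1) (y' \<oplus>\<^bsub>Ob Y' (n - 1)\<^esub> \<ominus>\<^bsub>Ob Y' (n - 1)\<^esub> k n z')"
      apply (rule int_vectors[of "Ob Y' n" "a' n z'" "Diff Y' (n - 1) (k n z')" "k (n + 1) (Diff C n z')" "Diff Y' (n - 1) y'" "\<zero>\<^bsub>Ob Y' n\<^esub>" "\<zero>\<^bsub>Ob Y' n\<^esub>"])
      using zy zy' c kc by (simp_all add: y1_def qr ar ar' qa qy diff_pred)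
    then have "cob Y' n (q n y1) \<zero>\<^bsub>Ob Y' n\<^esub>"
      unfolding cob_zero_iff[OF c(3)] using zy' kc c
      by (intro bexI[of _ "y' \<oplus>\<^bsub>Ob Y' (n - 1)\<^esub> \<ominus>\<^bsub>Ob Y' (n - 1)\<^esub> k n z'"]) auto
    then obtain v where v: "v \<in> carrier (Ob Y (n - 1))" "y1 = Diff Y (n - 1) v"
      using qisD(2)[OF q c(2,3) y1] unfolding cob_zero_iff[OF c(2)] by blast
    have "y = a n z' \<oplus>\<^bsub>Ob Y n\<^esub> y1"
      unfolding y1_def apply (rule int_vectors[of "Ob Y n" y "a n z'" y y y y])
      using zy zy' c by (simp_all add: ar)
    then show "cob (cone C Y a) n p \<zero>\<^bsub>Ob (cone C Y a) n\<^esub>"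
      unfolding cob_zero_iff[OF cc(1)] using zy zy' v d1 by (intro bexI[of _ "(z', v)"]) auto
  next
    fix n p assume p: "cyc (cone C Y' a') n p"
    obtain z y where zy: "p = (z, y)" "z \<in> carrier (Ob C (n + 1))" "y \<in> carrier (Ob Y' n)" using cycD(1)[OF p] by auto
    have p1: "\<ominus>\<^bsub>Ob C (n + 1 + 1)\<^esub> Diff C (n + 1) z = \<zero>\<^bsub>Ob C (n + 1 + 1)\<^esub>"
      and p2: "a' (n + 1) z \<oplus>\<^bsub>Ob Y' (n + 1)\<^esub> Diff Y' n y = \<zero>\<^bsub>Ob Y' (n + 1)\<^esub>" using cycD(2)[OF p] zy by auto
    have "Diff C (n + 1) z = \<ominus>\<^bsub>Ob C (n + 1 + 1)\<^esub> (\<ominus>\<^bsub>Ob C (n + 1 + 1)\<^esub> Diff C (n + 1) z)"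
      using zy c dC(1)[OF refl zy(2)] by simp
    then have dz: "Diff C (n + 1) z = \<zero>\<^bsub>Ob C (n + 1 + 1)\<^esub>" using p1 c by simp
    have kz: "k (n + 1) z \<in> carrier (Ob Y' n)" using kr(1)[OF _ zy(2), of n] by simp
    have a'z: "a' (n + 1) z = \<ominus>\<^bsub>Ob Y' (n + 1)\<^esub> Diff Y' n y"
      using p2 zy c by (intro rmod_minus_unique) (auto simp: ar' dY')
    have k0: "k (n + 1 + 1) (Diff C (n + 1) z) = \<zero>\<^bsub>Ob Y' (n + 1)\<^esub>" unfolding dz using kr(2)[of "n + 1 + 1"] by (simp add: add.commute)
    have qaz: "q (n + 1) (a (n + 1) z) = Diff Y' n (\<ominus>\<^bsub>Ob Y' n\<^esub> y \<oplus>\<^bsub>Ob Y' n\<^esub> k (n + 1) z)"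
      using e[OF zy(2)] zy kz c unfolding k0 a'z by (simp add: dY')
    have cz: "cyc Y (n + 1) (a (n + 1) z)" using zy dz ar(6)[of "n + 1 + 1" "n + 1" z] by (simp add: cyc_def ar)
    have "cob Y' (n + 1) (q (n + 1) (a (n + 1) z)) \<zero>\<^bsub>Ob Y' (n + 1)\<^esub>"
      unfolding cob_zero_iff[OF c(3)] qaz using zy kz c
      by (intro bexI[of _ "\<ominus>\<^bsub>Ob Y' n\<^esub> y \<oplus>\<^bsub>Ob Y' n\<^esub> k (n + 1) z"]) auto
    then obtain y0 where y0: "y0 \<in> carrier (Ob Y n)" "a (n + 1) z = Diff Y n y0"
      using qisD(2)[OF q c(2,3) cz] unfolding cob_zero_iff[OF c(2)] by auto
    \<comment> \<open>The pair (z, -y0) is a cocycle of the source cone over the same z;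
      \<open>w\<close> is the difference between y and the second component of its image, so it is a
      cocycle and can be corrected through \<open>q\<close>.\<close>
    define w where "w = y \<oplus>\<^bsub>Ob Y' n\<^esub> (q n y0 \<oplus>\<^bsub>Ob Y' n\<^esub> \<ominus>\<^bsub>Ob Y' n\<^esub> k (n + 1) z)"
    have wc: "w \<in> carrier (Ob Y' n)" using zy y0 kz c by (simp add: w_def qr)
    have "Diff Y' n (q n y0) = \<ominus>\<^bsub>Ob Y' (n + 1)\<^esub> Diff Y' n y \<oplus>\<^bsub>Ob Y' (n + 1)\<^esub> Diff Y' n (k (n + 1) z)"
      using qaz y0 zy kz c qr(6)[OF refl y0(1)] by (simp add: dY')
    then have "Diff Y' n w = Diff Y' n y \<oplus>\<^bsub>Ob Y' (n + 1)\<^esub> ((\<ominus>\<^bsub>Ob Y' (n + 1)\<^esub> Diff Y' n y \<oplus>\<^bsub>Ob Y' (n + 1)\<^esub> Diff Y' n (k (n + 1) z)) \<oplus>\<^bsub>Ob Y' (n + 1)\<^esub> \<ominus>\<^bsub>Ob Y' (n + 1)\<^esub> Diff Y' n (k (n + 1) z))"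
      using y0 zy kz c by (simp add: w_def dY' qr(1))
    also have "\<dots> = \<zero>\<^bsub>Ob Y' (n + 1)\<^esub>" using zy kz c dY'(1)[OF refl kz] dY'(1)[OF refl zy(3)] by (simp add: rmod_ac(1))
    finally have "cyc Y' n w" using wc by (simp add: cyc_def)
    then obtain y1 where y1: "cyc Y n y1" "cob Y' n w (q n y1)" using qisD(3)[OF q c(2,3)] by blast
    then obtain v where v: "v \<in> carrier (Ob Y' (n - 1))" "w = Diff Y' (n - 1) v \<oplus>\<^bsub>Ob Y' n\<^esub> q n y1" by (auto simp: cob_def)
    let ?y = "y1 \<oplus>\<^bsub>Ob Y n\<^esub> \<ominus>\<^bsub>Ob Y n\<^esub> y0"
    have yc: "y1 \<in> carrier (Ob Y n)" using y1 by (simp add: cycD)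
    have "y = w \<oplus>\<^bsub>Ob Y' n\<^esub> (k (n + 1) z \<oplus>\<^bsub>Ob Y' n\<^esub> \<ominus>\<^bsub>Ob Y' n\<^esub> q n y0)"
      unfolding w_def apply (rule int_vectors[of "Ob Y' n" y "q n y0" "k (n + 1) z" y y y])
      using zy y0 kz c by (simp_all add: qr)
    then have y: "y = Diff Y' (n - 1) v \<oplus>\<^bsub>Ob Y' n\<^esub> (k (n + 1) z \<oplus>\<^bsub>Ob Y' n\<^esub> q n ?y)"
      unfolding v(2) using v zy y0 kz c yc by (simp add: rmod_ac qr diff_pred)
    have "cyc (cone C Y a) n (z, ?y)"
      using zy y0 yc c y1 dz dY(1)[OF refl y0(1)] by (simp add: cyc_def dY)
    moreover have "cob (cone C Y' a') n p (F n (z, ?y))"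
      unfolding cob_def using v zy c y ar'(4)[of n]
      by (intro bexI[of _ "(\<zero>\<^bsub>Ob C n\<^esub>, v)"]) (auto simp: F_def dC(4) diff_pred)
    ultimately show "\<exists>x. cyc (cone C Y a) n x \<and> cob (cone C Y' a') n p (F n x)" by blast
  qed
  then show thesis by (rule that)
qed

text \<open>A complement of a homotopy retract X of W is the cone of i. The map 1 - i p kills i up
  to homotopy and hence extends over the cone; together with i it gives the map from X + cone(i) to
  W.\<close>

lemma retract_complement:
  assumes i: "i \<in> cm X W" and p: "p \<in> cm W X" and pi: "hty X X (comp_map p i) id_map"
    and c: "cx X" "cx W"
  obtains F where "qis (dsum X (cone X W i)) W F"
proof -
  let ?K = "cone X W i"
  have cK: "cx ?K" using c i by simp
  note \<iota> = cone_in_cm[OF c i]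
  note ir = cm_rules[OF c i] and pr = cm_rules[OF c(2,1) p]
  define j where "j = add_map W id_map (neg_map W (comp_map i p))"
  have ip: "comp_map i p \<in> cm W W" by (rule cm_comp[OF p i])
  have j: "j \<in> cm W W" unfolding j_def using c ip by (intro cm_add cm_neg cm_id)
  have ji: "null X W (comp_map j i)"
  proof -
    have ipi: "comp_map i (comp_map p i) \<in> cm X W" by (rule cm_comp[OF cm_comp[OF i p] i])
    have "hty X W i (comp_map i (comp_map p i))"
      using hty_sym[OF hty_comp_left[OF pi i c(1,1,2) cm_id] c] i ipi
      by (metis c comp_id(1) hty_comp_left[OF pi i c(1,1,2) cm_id] hty_sym)
    then have "null X W (add_map W i (neg_map W (comp_map i (comp_map p i))))"
      using hty_iff_null[OF c i ipi] by simp
    moreover have "comp_map j i = add_map W i (neg_map W (comp_map i (comp_map p i)))"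
      by (simp add: j_def comp_map_def add_map_def neg_map_def id_map_def)
    ultimately show ?thesis by simp
  qed
  obtain J where J: "J \<in> cm ?K W" "hty W W (comp_map J (cone_in X)) j"
    using cone_extend[OF c i c(2) j ji] by blast
  note Jr = cm_rules[OF cK c(2) J(1)]
  define F where "F = add_map W (comp_map i fst_map) (comp_map J snd_map)"
  have F: "F \<in> cm (dsum X ?K) W"
    unfolding F_def using c cK dsum_maps[OF c(1) cK] by (intro cm_add cm_comp[OF _ i] cm_comp[OF _ J(1)]) auto
  have Fe: "F n (x, k) = i n x \<oplus>\<^bsub>Ob W n\<^esub> J n k" for n x k
    by (simp add: F_def add_map_def comp_map_def fst_map_def snd_map_def)
  have je: "j n w = w \<oplus>\<^bsub>Ob W n\<^esub> \<ominus>\<^bsub>Ob W n\<^esub> i n (p n w)" for n w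
    by (simp add: j_def add_map_def neg_map_def id_map_def comp_map_def)
  have Jj: "cob W n (J n (cone_in X n w)) (j n w)" if "cyc W n w" for n w
    using cob_hty[OF J(2) c(2,2) j that] by (simp add: comp_map_def)
  have pip: "cob X n (p n (i n x)) x" if "cyc X n x" for n x
    using cob_hty[OF pi c(1,1) cm_id that] by (simp add: comp_map_def id_map_def)
  have "qis (dsum X ?K) W F"
  proof (rule qisI[OF _ c(2) F])
    show "cx (dsum X ?K)" using c cK by simp
    fix n w assume w: "cyc W n w"
    have wc: "w \<in> carrier (Ob W n)" using w by (rule cycD)
    have ipw: "i n (p n w) \<in> carrier (Ob W n)" using wc by (simp add: ir pr)
    have "cob W n (F n (p n w, cone_in X n w)) (i n (p n w) \<oplus>\<^bsub>Ob W n\<^esub> j n w)"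
      unfolding Fe using c wc ipw Jj[OF w] by (intro cob_add cob_refl) (auto simp: je)
    moreover have "i n (p n w) \<oplus>\<^bsub>Ob W n\<^esub> j n w = w"
      unfolding je apply (rule int_vectors[of "Ob W n" w "i n (p n w)" w w w w])
      using c wc ipw by simp_all
    ultimately have "cob W n w (F n (p n w, cone_in X n w))"
      using c wc by (rule_tac cob_sym[OF c(2)]) (auto intro!: cm_rules(1)[OF _ c(2) F] simp: pr cone_in_def c cK)
    moreover have "cyc (dsum X ?K) n (p n w, cone_in X n w)"
      unfolding cyc_dsum using cyc_map[OF c(2,1) p w] cyc_map[OF c(2) cK \<iota> w] by simp
    ultimately show "\<exists>x. cyc (dsum X ?K) n x \<and> cob W n w (F n x)" by blast
  next
    fix n y assume y: "cyc (dsum X ?K) n y" and b: "cob W n (F n y) \<zero>\<^bsub>Ob W n\<^esub>"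
    obtain x k where xk: "y = (x, k)" by (cases y)
    obtain z w where zw: "k = (z, w)" by (cases k)
    have x: "cyc X n x" and k: "cyc ?K n k" using y unfolding xk cyc_dsum by auto
    have zc: "z \<in> carrier (Ob X (n + 1))" and wc: "w \<in> carrier (Ob W n)" using cycD(1)[OF k] zw by auto
    have k1: "\<ominus>\<^bsub>Ob X (n + 1 + 1)\<^esub> Diff X (n + 1) z = \<zero>\<^bsub>Ob X (n + 1 + 1)\<^esub>"
      and k2: "i (n + 1) z \<oplus>\<^bsub>Ob W (n + 1)\<^esub> Diff W n w = \<zero>\<^bsub>Ob W (n + 1)\<^esub>" using cycD(2)[OF k] zw by auto
    have "Diff X (n + 1) z = \<ominus>\<^bsub>Ob X (n + 1 + 1)\<^esub> (\<ominus>\<^bsub>Ob X (n + 1 + 1)\<^esub> Diff X (n + 1) z)"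
      using zc c diff_rules(1)[OF c(1) refl zc] by simp
    then have z: "cyc X (n + 1) z" using k1 c zc by (simp add: cyc_def)
    have iz: "i (n + 1) z = Diff W n (\<ominus>\<^bsub>Ob W n\<^esub> w)"
      using k2 zc wc c rmod_minus_unique[of "Ob W (n + 1)" "i (n + 1) z" "Diff W n w"] by (simp add: ir diff_rules)
    have "cob W (n + 1) (i (n + 1) z) \<zero>\<^bsub>Ob W (n + 1)\<^esub>"
      unfolding cob_zero_iff[OF c(2)] iz using wc c by (intro bexI[of _ "\<ominus>\<^bsub>Ob W n\<^esub> w"]) auto
    then have "cob X (n + 1) (p (n + 1) (i (n + 1) z)) \<zero>\<^bsub>Ob X (n + 1)\<^esub>" by (rule cob_map_zero[OF c(2,1) p])
    then have "cob X (n + 1) z \<zero>\<^bsub>Ob X (n + 1)\<^esub>"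
      using cob_trans[OF c(1) _ cob_sym[OF c(1) zc pip[OF z]]] c by simp
    then obtain v where v: "v \<in> carrier (Ob X n)" "z = Diff X n v" unfolding cob_zero_iff[OF c(1)] by auto
    \<comment> \<open>Since z = d v, adding the boundary of (v, 0) removes the first component: the
      cocycle (z, w) is cohomologous to (0, w1).\<close>
    define w1 where "w1 = w \<oplus>\<^bsub>Ob W n\<^esub> i n v"
    have w1c: "w1 \<in> carrier (Ob W n)" using wc v c by (simp add: w1_def ir)
    have "Diff W n w1 = i (n + 1) z \<oplus>\<^bsub>Ob W (n + 1)\<^esub> Diff W n w"
      using wc v c by (simp add: w1_def ir diff_rules rmod_ac(2))
    then have w1: "cyc W n w1" using k2 w1c by (simp add: cyc_def)
    have "cob ?K n (cone_in X n w1) k"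
      unfolding cob_def using v wc c diff_pred(4)[OF c(2)]
      by (intro bexI[of _ "(v, \<zero>\<^bsub>Ob W (n - 1)\<^esub>)"])
        (auto simp: zw cone_in_def w1_def diff_rules ir rmod_ac(2))
    then have kw: "cob ?K n k (cone_in X n w1)" using cob_sym[OF cK cycD(1)[OF k]] by blast
    have \<iota>w: "cone_in X n w1 \<in> carrier (Ob ?K n)" using w1c c by (simp add: cone_in_def)
    have ipw: "i n (p n w1) \<in> carrier (Ob W n)" "p n w1 \<in> carrier (Ob X n)" using w1c by (auto simp: ir pr)
    have xc: "x \<in> carrier (Ob X n)" "i n x \<in> carrier (Ob W n)" "p n (i n x) \<in> carrier (Ob X n)" using cycD(1)[OF x] by (auto simp: ir pr)
    have jw: "j n w1 \<in> carrier (Ob W n)" using w1c ipw c by (simp add: je)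
    have "cob W n (J n k) (j n w1)"
      using cob_trans[OF c(2) jw cob_map[OF cK c(2) J(1) \<iota>w kw] Jj[OF w1]] .
    then have "cob W n (F n y) (i n x \<oplus>\<^bsub>Ob W n\<^esub> j n w1)"
      unfolding xk Fe using c xc jw by (intro cob_add cob_refl) auto
    then have 0: "cob W n (i n x \<oplus>\<^bsub>Ob W n\<^esub> j n w1) \<zero>\<^bsub>Ob W n\<^esub>"
      using b c xc jw k cm_rules(1)[OF _ c(2) F, of y n] cycD(1)[OF y] cK
      by (rule_tac cob_trans[OF c(2) _ cob_sym[OF c(2)]]) auto
    \<comment> \<open>Applying p separates the summands. As p i is homotopic to the identity, p
      kills j w1 in cohomology, so the class of x vanishes and then that of j w1. Thus w1 is
      cohomologous to i p w1, which dies in the cone of i.\<close>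
    have "cob X n (p n (i n x \<oplus>\<^bsub>Ob W n\<^esub> j n w1)) \<zero>\<^bsub>Ob X n\<^esub>" by (rule cob_map_zero[OF c(2,1) p 0])
    moreover have "p n (i n x \<oplus>\<^bsub>Ob W n\<^esub> j n w1) = p n (i n x) \<oplus>\<^bsub>Ob X n\<^esub> (p n w1 \<oplus>\<^bsub>Ob X n\<^esub> \<ominus>\<^bsub>Ob X n\<^esub> p n (i n (p n w1)))"
      using xc jw w1c ipw c by (simp add: je pr)
    moreover have "cob X n (p n w1 \<oplus>\<^bsub>Ob X n\<^esub> \<ominus>\<^bsub>Ob X n\<^esub> p n (i n (p n w1))) \<zero>\<^bsub>Ob X n\<^esub>"
      using c ipw pip[OF cyc_map[OF c(2,1) p w1]]
      by (subst cob_diff_iff[OF c(1)]) (auto simp: pr intro: cob_sym)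
    moreover have "cob X n (p n (i n x) \<oplus>\<^bsub>Ob X n\<^esub> s) (p n (i n x))" if "cob X n s \<zero>\<^bsub>Ob X n\<^esub>" for s
      using cob_add[OF c(1) xc(3) _ cob_refl[OF c(1) xc(3)] that] c xc by simp
    ultimately have "cob X n (p n (i n x)) \<zero>\<^bsub>Ob X n\<^esub>"
      using cob_trans[OF c(1) rmod_simps(1)[OF cx_rmod[OF c(1)]] cob_sym[OF c(1) xc(3)]] by metis
    then have x0: "cob X n x \<zero>\<^bsub>Ob X n\<^esub>"
      using cob_trans[OF c(1) _ cob_sym[OF c(1) xc(1) pip[OF x]]] c by simp
    have ix: "cob W n (i n x) \<zero>\<^bsub>Ob W n\<^esub>" by (rule cob_map_zero[OF c i x0])
    have "cob W n (j n w1) \<zero>\<^bsub>Ob W n\<^esub>"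
    proof -
      have "cob W n (i n x \<oplus>\<^bsub>Ob W n\<^esub> j n w1) (\<zero>\<^bsub>Ob W n\<^esub> \<oplus>\<^bsub>Ob W n\<^esub> j n w1)"
        using ix c jw by (intro cob_add cob_refl) auto
      then have "cob W n (i n x \<oplus>\<^bsub>Ob W n\<^esub> j n w1) (j n w1)" using c jw by simp
      from cob_trans[OF c(2) rmod_simps(1)[OF cx_rmod[OF c(2)]] cob_sym[OF c(2) jw this] 0] show ?thesis .
    qed
    then have "cob W n w1 (i n (p n w1))" unfolding je using cob_diff_iff[OF c(2) w1c ipw(1)] by simp
    then have 1: "cob ?K n (cone_in X n w1) (cone_in X n (i n (p n w1)))" by (rule cob_map[OF c(2) cK \<iota> ipw(1)])
    have z0: "zero_map ?K n u = \<zero>\<^bsub>Ob ?K n\<^esub>" for u :: "'c" and n by (simp add: zero_map_def)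
    have "cob ?K n (cone_in X n (i n (p n w1))) \<zero>\<^bsub>Ob ?K n\<^esub>"
      using cob_hty[OF cone_in_null[OF c i] c(1) cK cm_zero[OF c(1) cK] cyc_map[OF c(2,1) p w1]]
      by (simp add: comp_map_def zero_map_def)
    then have "cob ?K n k \<zero>\<^bsub>Ob ?K n\<^esub>"
      using cob_trans[OF cK _ kw cob_trans[OF cK _ 1]] cx_rmod[OF cK, of n] rmod_simps(1) by blast
    then show "cob (dsum X ?K) n y \<zero>\<^bsub>Ob (dsum X ?K) n\<^esub>"
      unfolding xk complex_simps(1) mod_dsum_simps(3) cob_dsum using x0 by simp
  qed
  then show thesis by (rule that)
qed

text \<open>Each summand of a map in the ideal adds one coordinate to the power through which the
  map factors. This returns from the ideal to the powers that \<open>in_add\<close> speaks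
  of.\<close>

lemma via_factor:
  fixes U :: "('a, 'u) cplx"
  assumes f: "via U U X Y f" and c: "cx U" "cx X" "cx Y"
  shows "\<exists>m. \<exists>i\<in>cm X (cpower U m). \<exists>p\<in>cm (cpower U m) Y. hty X Y f (comp_map p i)"
proof -
  have step: "\<exists>m. \<exists>i'\<in>cm X (cpower U m). \<exists>p'\<in>cm (cpower U m) Y. hty X Y (add_map Y f (comp_map p i)) (comp_map p' i')"
    if IH: "\<exists>m. \<exists>i\<in>cm X (cpower U m). \<exists>p\<in>cm (cpower U m) Y. hty X Y f (comp_map p i)"
      and i: "i \<in> cm X U" and p: "p \<in> cm U Y" for f i p
  proof -
    obtain m I P where I: "I \<in> cm X (cpower U m)" and P: "P \<in> cm (cpower U m) Y" and h: "hty X Y f (comp_map P I)"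
      using IH by blast
    have cp: "cx (cpower U m)" "cx (cpower U (Suc m))" using c by auto
    note Ir = cm_rules[OF c(2) cp(1) I] and ir = cm_rules[OF c(2,1) i] and pr = cm_rules[OF c(1,3) p] and Pr = cm_rules[OF cp(1) c(3) P]
    define I' where "I' = (\<lambda>n x. \<lambda>l\<in>{..<Suc m}. if l < m then I n x l else i n x)"
    define r where "r = (\<lambda>(n::int) u. \<lambda>l\<in>{..<m}. (u l :: 'u))"
    have Ic: "I n x l \<in> carrier (Ob U n)" if "x \<in> carrier (Ob X n)" "l < m" for n x l
      using Ir(1)[OF that(1)] that(2) by (auto simp: PiE_iff)
    have I': "I' \<in> cm X (cpower U (Suc m))"
    proof (rule cmI)
      fix n
      have "(\<lambda>x. I' n x l) \<in> hom (Ob X n) (Ob U n)" if "l < Suc m" for l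
      proof (cases "l < m")
        case True
        then have "(\<lambda>x. I n x l) \<in> hom (Ob X n) (Ob U n)"
          using hom_comp[OF cm_hom[OF I, of n, unfolded cpower_simps] proj_hom] by simp
        then show ?thesis using True by (simp add: I'_def)
      next
        case False
        then show ?thesis using that cm_hom[OF i] by (simp add: I'_def)
      qed
      then show "I' n \<in> hom (Ob X n) (Ob (cpower U (Suc m)) n)"
        unfolding cpower_simps using c by (intro power_hom) (auto simp: I'_def)
      fix x assume x: "x \<in> carrier (Ob X n)"
      have "I (n + 1) (Diff X n x) = (\<lambda>l\<in>{..<m}. Diff U n (I n x l))" using Ir(6)[OF refl x] by simp
      then show "I' (n + 1) (Diff X n x) = Diff (cpower U (Suc m)) n (I' n x)"
        using x by (auto simp: I'_def ir intro!: restrict_ext)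
    qed
    have r: "r \<in> cm (cpower U (Suc m)) (cpower U m)"
    proof (rule cmI)
      show "r n \<in> hom (Ob (cpower U (Suc m)) n) (Ob (cpower U m) n)" for n
        unfolding r_def cpower_simps using c by (intro power_hom) (auto intro!: proj_hom cong: restrict_cong)
    qed (simp add: r_def cong: restrict_cong)
    define P' where "P' = add_map Y (comp_map P r) (comp_map p (\<lambda>n u. u m))"
    have P': "P' \<in> cm (cpower U (Suc m)) Y"
      unfolding P'_def using c cpower_maps(1)[OF c(1), of m "Suc m"] by (intro cm_add cm_comp[OF r P] cm_comp[OF _ p]) auto
    have PI: "comp_map P I \<in> cm X Y" "comp_map p i \<in> cm X Y" using I P i p by (auto intro: cm_comp)
    have "hty X Y (add_map Y f (comp_map p i)) (add_map Y (comp_map P I) (comp_map p i))"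
      using h PI c by (intro hty_add hty_refl) auto
    moreover have "hty X Y (add_map Y (comp_map P I) (comp_map p i)) (comp_map P' I')"
    proof (rule hty_eq[OF c(2,3) cm_add[OF c(2,3) PI]])
      fix n x assume x: "x \<in> carrier (Ob X n)"
      have "(\<lambda>l\<in>{..<m}. I' n x l) = I n x"
        using Ir(1)[OF x] by (auto simp: I'_def PiE_iff extensional_def)
      then show "add_map Y (comp_map P I) (comp_map p i) n x = comp_map P' I' n x"
        by (simp add: P'_def add_map_def comp_map_def r_def) (simp add: I'_def)
    qed
    ultimately have "hty X Y (add_map Y f (comp_map p i)) (comp_map P' I')"
      using c cm_comp[OF I' P'] by (rule_tac hty_trans)
    then show ?thesis using I' P' by blast
  qed
  show ?thesis using f
  proof induction
    case via_zero
    show ?case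
    proof (intro exI[of _ 0] bexI)
      show "zero_map (cpower U 0) \<in> cm X (cpower U 0)" "zero_map Y \<in> cm (cpower U 0) Y"
        using c by (auto intro: cm_zero)
      show "hty X Y (zero_map Y) (comp_map (zero_map Y) (zero_map (cpower U 0)))"
        using c by (intro hty_eq cm_zero) (auto simp: comp_map_def zero_map_def)
    qed
  next
    case (via_hty f g)
    then obtain m i p where *: "i \<in> cm X (cpower U m)" "p \<in> cm (cpower U m) Y" "hty X Y f (comp_map p i)" by blast
    have "hty X Y g f" by (rule hty_sym[OF via_hty(3) c(2,3) via_hty(2)])
    then have "hty X Y g (comp_map p i)" by (rule hty_trans[OF _ *(3) c(2,3) cm_comp[OF *(1,2)]])
    then show ?case using * by blast
  qed (use step in blast)+
qed

end

text \<open>Codes tuples of length \<open>m\<close> as single elements, one pairing per coordinate.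
  Only extensional functions, the possible elements of a power, have to be told apart.\<close>

lemma inj_on_powers:
  assumes "inj (J :: 'w \<times> 'w \<Rightarrow> 'w)"
  shows "\<exists>e :: (nat \<Rightarrow> 'w) \<Rightarrow> 'w. inj_on e ({..<m} \<rightarrow>\<^sub>E UNIV)"
proof (induction m)
  case 0
  show ?case by (intro exI[of _ undefined]) (auto simp: inj_on_def)
next
  case (Suc m)
  then obtain e :: "(nat \<Rightarrow> 'w) \<Rightarrow> 'w" where e: "inj_on e ({..<m} \<rightarrow>\<^sub>E UNIV)" by blast
  have "inj_on (\<lambda>u. J (e (restrict u {..<m}), u m)) ({..<Suc m} \<rightarrow>\<^sub>E UNIV)"
  proof (rule inj_onI)
    fix u v assume uv: "u \<in> {..<Suc m} \<rightarrow>\<^sub>E UNIV" "v \<in> {..<Suc m} \<rightarrow>\<^sub>E UNIV"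
      and "J (e (restrict u {..<m}), u m) = J (e (restrict v {..<m}), v m)"
    then have 1: "e (restrict u {..<m}) = e (restrict v {..<m})" "u m = v m"
      using assms by (auto dest: injD)
    have 2: "restrict u {..<m} = restrict v {..<m}" by (rule inj_onD[OF e]) (use 1(1) in auto)
    show "u = v"
    proof (rule PiE_ext[OF uv])
      fix l assume "l \<in> {..<Suc m}"
      then show "u l = v l" using 1(2) fun_cong[OF 2, of l] by (cases "l = m") auto
    qed
  qed
  then show ?case by blast
qed

context complexes_over
begin

text \<open>The identity factors through a power of \<open>T\<close>, so X is a homotopy retract of
  it, and the cone of the inclusion is the complement. That cone consists of pairs of an element and
  a tuple, while \<open>in_add\<close> wants the complement on the element type of X; hence the
  coding by \<open>J\<close> and \<open>e\<close>.\<close>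

lemma via_in_add:
  fixes X T \<Theta> :: "('a, 'w) cplx" and J :: "'w \<times> 'w \<Rightarrow> 'w"
  assumes J: "inj J" and v: "via T T X X id_map" and q: "qis T \<Theta> q" and c: "cx X" "cx T" "cx \<Theta>"
  shows "in_add A \<Theta> X"
proof -
  obtain m i p where i: "i \<in> cm X (cpower T m)" and p: "p \<in> cm (cpower T m) X" and h: "hty X X id_map (comp_map p i)"
    using via_factor[OF v c(2,1,1)] by blast
  have cp: "cx (cpower T m)" "cx (cpower \<Theta> m)" using c by auto
  have h': "hty X X (comp_map p i) id_map" by (rule hty_sym[OF h c(1,1) cm_comp[OF i p]])
  let ?K = "cone X (cpower T m) i"
  have cK: "cx ?K" using c cp i by simp
  obtain F where F: "qis (dsum X ?K) (cpower T m) F"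
    using retract_complement[OF i p h' c(1) cp(1)] by blast
  obtain e :: "(nat \<Rightarrow> 'w) \<Rightarrow> 'w" where e: "inj_on e ({..<m} \<rightarrow>\<^sub>E UNIV)"
    using inj_on_powers[OF J] by blast
  define k where "k = (\<lambda>(x, u). J (x, e u))"
  have k: "inj_on k (carrier (Ob ?K n))" for n
  proof (rule inj_onI)
    fix a b assume ab: "a \<in> carrier (Ob ?K n)" "b \<in> carrier (Ob ?K n)" "k a = k b"
    obtain x u y v where xu: "a = (x, u)" "b = (y, v)" by (cases a, cases b)
    have "x = y" "e u = e v" using ab(3) J by (auto simp: k_def xu dest: injD)
    moreover have "u = v" by (rule inj_onD[OF e]) (use ab xu \<open>e u = e v\<close> in \<open>auto simp: PiE_iff\<close>)
    ultimately show "a = b" using xu by simp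
  qed
  let ?X' = "push k ?K"
  have cX': "cx ?X'" by (rule cx_push[OF cK k])
  have 1: "qis (dsum X ?X') (dsum X ?K) (dsum_map id_map (unpush k ?K))"
    using c cK cX' qis_push(2)[OF cK k] by (intro qis_dsum qis_id)
  have 2: "qis (cpower T m) (cpower \<Theta> m) (cpower_map m q)" by (rule qis_cpower[OF q c(2,3)])
  have "qis (dsum X ?X') (cpower \<Theta> m) (comp_map (cpower_map m q) (comp_map F (dsum_map id_map (unpush k ?K))))"
    using c cp cK cX' by (intro qis_comp[OF qis_comp[OF 1 F] 2]) auto
  then have "derived_iso A (dsum X ?X') (cpower \<Theta> m)" using c cX' by (intro derived_isoI) auto
  then show ?thesis unfolding in_add_def using c cX' by blast
qed

end

section \<open>The approximation sequence\<close>

text \<open>\<open>R n\<close> is a model of \<open>\<Delta>\<^sub>n(P,A)\<close> in \<open>K\<^sup>b(proj A)\<close>, obtained as a cone of \<open>\<gamma> n: Q n \<rightarrow> R n\<close>.\<close>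

locale approximation = symmetric_form A K \<tau>
  for A :: "('k, 'a, 'ax) module_scheme" and K :: "('k, 'kx) ring_scheme" and \<tau> :: "'a \<Rightarrow> 'k" +
  fixes P :: "('a, 'u) cplx" and r :: nat and s :: int and a0 :: "'a \<Rightarrow> 'u" and J :: "'u \<times> 'u \<Rightarrow> 'u"
    and R Q :: "nat \<Rightarrow> ('a, 'u) cplx" and \<gamma> :: "nat \<Rightarrow> int \<Rightarrow> 'u \<Rightarrow> 'u"
  assumes kb_P: "kb P" and P_self: "\<And>i. i \<noteq> 0 \<Longrightarrow> VZ P P i"
    and P_range: "\<And>i. s < i \<or> i < s - int r \<Longrightarrow> cohomology_zero P i"
    and a0: "inj_on a0 (carrier A)" and J: "inj J"
    and R_0: "R 0 = push a0 (stalk reg)"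
    and kb_Q: "\<And>n. kb (Q n)"
    and Q_add: "\<And>n. via (shift (int n + s - int r) P) (shift (int n + s - int r) P) (Q n) (Q n) id_map"
    and \<gamma>: "\<And>n. \<gamma> n \<in> cm (Q n) (R n)"
    and \<gamma>_lift: "\<And>n u. u \<in> cm (shift (int n + s - int r) P) (R n) \<Longrightarrow>
      \<exists>v\<in>cm (shift (int n + s - int r) P) (Q n). hty (shift (int n + s - int r) P) (R n) u (comp_map (\<gamma> n) v)"
    and R_Suc: "\<And>n. R (Suc n) = push J (cone (Q n) (R n) (\<gamma> n))"
begin

text \<open>The same twist n + s - r occurs in the triangle from \<Delta>_n to \<Delta>_{n+1}, whose
  first term is P_{n+1}[n + s - r], and in the second summand of \<Theta>_n. \<open>Q n\<close> lies
  in add P[c n], so \<open>Q\<close> is indexed one lower than P_n and already carries the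
  shift.\<close>

definition c :: "nat \<Rightarrow> int" where "c n = int n + s - int r"
definition PS :: "nat \<Rightarrow> ('a, 'u) cplx" where "PS n = shift (c n) P"

lemma c_Suc: "c (Suc n) = c n + 1" by (simp add: c_def)

lemma kb_PS [simp]: "kb (PS n)" using kb_P by (simp add: PS_def)
lemma cx_P [simp]: "cx P" using kb_P by simp
lemma cx_PS [simp]: "cx (PS n)" using kb_PS by (rule kb_cx)
lemma cx_Q [simp]: "cx (Q n)" using kb_Q by (rule kb_cx)

lemma stalk_inj: "inj_on a0 (carrier (Ob (stalk reg) n))"
  by (rule inj_on_subset[OF a0]) (simp add: stalk_def zero_module_def)

lemma J_inj: "inj_on J B" by (rule inj_on_subset[OF J]) simp

lemma kb_R [simp]: "kb (R n)"
proof (induction n)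
  case 0
  show ?case unfolding R_0 using stalk_inj fgp_reg by (intro kb_push kb_stalk)
next
  case (Suc n)
  then show ?case unfolding R_Suc using kb_Q \<gamma> by (intro kb_push kb_cone J_inj)
qed

lemma cx_R [simp]: "cx (R n)" using kb_R by (rule kb_cx)

lemma cx_RC [simp]: "cx (cone (Q n) (R n) (\<gamma> n))" using \<gamma> by simp

section \<open>Hom between P and the models\<close>

lemma VZ_R_0: "cx Y \<Longrightarrow> VZ (R 0) Y i \<longleftrightarrow> cohomology_zero Y i"
  using ret_push[OF _ stalk_inj] VZ_ret_left[of "R 0" "stalk reg" Y i] VZ_ret_left[of "stalk reg" "R 0" Y i]
    VZ_regular_iff[of Y i] cx_R[of 0] by (auto simp: R_0)

lemma VZ_R_Suc: "cx X \<Longrightarrow> VZ X (R (Suc n)) i \<longleftrightarrow> VZ X (cone (Q n) (R n) (\<gamma> n)) i"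
  using ret_push[OF cx_RC J_inj, of n] VZ_ret_right[of "R (Suc n)" "cone (Q n) (R n) (\<gamma> n)" X i]
    VZ_ret_right[of "cone (Q n) (R n) (\<gamma> n)" "R (Suc n)" X i] cx_R[of "Suc n"] by (auto simp: R_Suc)

lemma VZ_Q:
  assumes "cx X" "VZ X P (i + c n)" shows "VZ X (Q n) i"
proof -
  have "VZ X (PS n) i" using assms by (simp add: PS_def VZ_shift_right)
  then show ?thesis using assms(1) Q_add[of n]
    by (rule_tac VZ_via_right[of "PS n" "PS n"]) (auto simp: PS_def c_def)
qed

text \<open>For \<open>n = 0\<close> duality turns Hom(P, A[i]) into the cohomology of P in degree
  -i, which leaves the degrees from -s to r - s = - c 0. Each step removes the top degree - c n; the
  new triangle disturbs no degree other than - c (Suc n), because P has no self-extensions. The last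
  conjunct allows for the time when - c n has dropped below -s.\<close>

lemma VZ_P_R: "- c n < i \<or> i < - s \<and> i < - c n \<Longrightarrow> VZ P (R n) i"
proof (induction n arbitrary: i)
  case 0
  then have "cohomology_zero P (- i)" by (intro P_range) (auto simp: c_def)
  then have "VZ (R 0) P (- i)" by (simp add: VZ_R_0)
  then show ?case using VZ_dual[OF kb_R kb_P, of 0 "- i"] by simp
next
  case (Suc n)
  have Q: "VZ P (Q n) (i + 1)"
    using Suc by (intro VZ_Q P_self) (auto simp: c_Suc)
  show ?case
  proof (cases "i = - c n")
    case True
    \<comment> \<open>In degree - c n the group Hom(P, \<open>R n\<close>) may survive. The lifting
      property makes the map induced by \<open>\<gamma> n\<close> onto it, and Hom from P to the
      next term of the triangle vanishes, so nothing is left on the cone.\<close>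
    have "HZ (PS n) (shift 1 (Q n))"
      using Q True by (simp add: HZ_shift PS_def VZ_shift_left)
    then have "HZ (PS n) (cone (Q n) (R n) (\<gamma> n))"
      using \<gamma>_lift[of _ n] \<gamma> by (intro HZ_cone_target_lift) (auto simp: PS_def c_def)
    then have "VZ P (cone (Q n) (R n) (\<gamma> n)) (- c n)"
      by (simp add: HZ_VZ PS_def VZ_shift_left)
    then show ?thesis using True by (simp add: VZ_R_Suc)
  next
    case False
    then have "VZ P (R n) i" using Suc by (auto simp: c_Suc)
    then show ?thesis using Q \<gamma> by (simp add: VZ_R_Suc VZ_cone_target)
  qed
qed

text \<open>For these \<open>n\<close> the top degree - c n has come down to -s or below, so the two
  ranges of \<open>VZ_P_R\<close> leave out just this one degree.\<close>

lemma VZ_P_R_late: "r \<le> n \<Longrightarrow> i \<noteq> - c n \<Longrightarrow> VZ P (R n) i"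
  by (intro VZ_P_R) (auto simp: c_def)

lemma VZ_R_P_late: "r \<le> n \<Longrightarrow> i \<noteq> c n \<Longrightarrow> VZ (R n) P i"
  using VZ_dual[OF kb_P kb_R VZ_P_R_late, of n "- i"] by simp

text \<open>In the second argument \<open>R n\<close> can be dismantled down to \<open>R 0\<close>.
  For m < n the groups Hom(R n, Q m[-i]) and Hom(R n, Q m[1 - i]) are controlled by Hom(R n, P[j])
  with j at most c m + 1 - i < c n, where it vanishes. Finally \<open>R 0\<close> is a copy of A and
  duality turns maps into it into cohomology.\<close>

lemma VZ_R_R_iff:
  assumes n: "r \<le> n" and i: "0 < i"
  shows "VZ (R n) (R n) (- i) \<longleftrightarrow> cohomology_zero (R n) i"
proof -
  have *: "VZ (R n) (R m) (- i) \<longleftrightarrow> VZ (R n) (R 0) (- i)" if "m \<le> n" for m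
    using that
  proof (induction m)
    case (Suc m)
    have "VZ (R n) (Q m) (- i)" "VZ (R n) (Q m) (- i + 1)"
      using Suc n i by (auto intro!: VZ_Q VZ_R_P_late simp: c_def)
    then have "VZ (R n) (R (Suc m)) (- i) \<longleftrightarrow> VZ (R n) (R m) (- i)"
      using VZ_cone_target[OF cx_Q cx_R \<gamma> cx_R] VZ_cone_middle[OF cx_Q cx_R \<gamma> cx_R]
      by (auto simp: VZ_R_Suc)
    then show ?case using Suc by simp
  qed simp
  have "VZ (R n) (R n) (- i) \<longleftrightarrow> VZ (R n) (R 0) (- i)" by (rule *[OF order_refl])
  also have "\<dots> \<longleftrightarrow> VZ (R 0) (R n) i"
    using VZ_dual[OF kb_R[of n] kb_R[of 0], of "- i"] VZ_dual[OF kb_R[of 0] kb_R[of n], of i] by auto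
  also have "\<dots> \<longleftrightarrow> cohomology_zero (R n) i" by (simp add: VZ_R_0)
  finally show ?thesis .
qed

text \<open>The triangle adds to H^i only a contribution of H^{i+1}(Q n), that is, of cohomology of
  P in degree i + 1 + c n, which exceeds s once \<open>n\<close> is at least
  \<open>r\<close>.\<close>

lemma cohomology_R:
  assumes "\<And>i. 0 < i \<Longrightarrow> cohomology_zero (R r) i" and n: "r \<le> n" and i: "0 < i"
  shows "cohomology_zero (R n) i"
  using n i
proof (induction n arbitrary: i rule: dec_induct)
  case base
  then show ?case using assms(1) by simp
next
  case (step n)
  have "VZ (R 0) P (i + 1 + c n)" using step by (subst VZ_R_0) (auto simp: c_def intro: P_range)
  then have "VZ (R 0) (Q n) (i + 1)" by (intro VZ_Q) auto
  moreover have "VZ (R 0) (R n) i" using step by (simp add: VZ_R_0)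
  ultimately have "VZ (R 0) (R (Suc n)) i"
    using \<gamma> by (simp add: VZ_R_Suc VZ_cone_target)
  then show ?case by (simp add: VZ_R_0)
qed

section \<open>Self-orthogonality of the models of \<Theta>_n\<close>

definition TR :: "nat \<Rightarrow> ('a, 'u \<times> 'u) cplx" where "TR n = dsum (R n) (PS n)"

lemma kb_TR [simp]: "kb (TR n)" by (simp add: TR_def)

text \<open>Negative degrees of Hom(R n, R n) are given by \<open>VZ_R_R_iff\<close>, positive ones
  follow by duality. In the mixed terms the twist of \<open>PS n\<close> moves the one degree left
  open by the late vanishing lemmas to 0.\<close>

lemma TR_self:
  assumes "\<And>i. 0 < i \<Longrightarrow> cohomology_zero (R r) i" and n: "r \<le> n" and i: "i \<noteq> 0"
  shows "VZ (TR n) (TR n) i"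
proof -
  have RR: "VZ (R n) (R n) i"
  proof (cases "0 < i")
    case True
    then show ?thesis
      using VZ_R_R_iff[OF n True] cohomology_R[OF assms(1) n True] VZ_dual[OF kb_R kb_R, of n n "- i"] by auto
  next
    case False
    then have "0 < - i" using i by simp
    then show ?thesis using VZ_R_R_iff[OF n, of "- i"] cohomology_R[OF assms(1) n, of "- i"] by auto
  qed
  have "VZ (PS n) (R n) i" "VZ (R n) (PS n) i" "VZ (PS n) (PS n) i"
    using n i by (auto simp: PS_def VZ_shift_left VZ_shift_right intro!: VZ_P_R_late VZ_R_P_late P_self)
  then show ?thesis unfolding TR_def using RR
    by (intro VZ_via_left[OF via_dsum] VZ_via_right[OF via_dsum] cx_dsum cx_R cx_PS)
qed

text \<open>\<open>R r\<close> is a retract of \<open>TR r\<close>, so vanishing in degree -i for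
  the sum restricts to it and is read as cohomology in degree i.\<close>

lemma TR_self_imp:
  assumes "\<And>i. i \<noteq> 0 \<Longrightarrow> VZ (TR r) (TR r) i" and i: "0 < i"
  shows "cohomology_zero (R r) i"
proof -
  have "ret (R r) (TR r)" unfolding TR_def by (intro ret_dsum) auto
  moreover have "VZ (TR r) (TR r) (- i)" using assms by simp
  ultimately have "VZ (R r) (R r) (- i)"
    using VZ_ret_left[of "R r" "TR r" "TR r" "- i"] VZ_ret_right[of "R r" "TR r" "R r" "- i"] by auto
  then show ?thesis using VZ_R_R_iff[of r i] i by simp
qed

end

section \<open>Generation\<close>

context complexes_over
begin

lemma via_same_right: "via U U X Y f \<Longrightarrow> via W U X Y f"
  by (induction rule: via.induct) (auto intro: via.intros)

lemma via_id_trans: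
  assumes "via U U X X id_map" "via V V U U id_map" "cx U" "cx V" "cx X"
  shows "via V V X X id_map"
  using assms by (intro via_trans[OF assms(1,2,2)])

lemma via_reindex:
  assumes v: "via U V X Y f" and c: "cx X" "cx Y"
  shows "via (reindex k U) (reindex k V) (reindex k X) (reindex k Y) (shift_map k f)"
  using v
proof induction
  case via_zero
  have "shift_map k (zero_map Y) = (zero_map (reindex k Y) :: int \<Rightarrow> 'd \<Rightarrow> 'e)" by (simp add: shift_map_def zero_map_def)
  then show ?case using via.via_zero by simp
next
  case (via_left f i p)
  have "shift_map k (add_map Y f (comp_map p i)) = add_map (reindex k Y) (shift_map k f) (comp_map (shift_map k p) (shift_map k i))"
    by (simp add: shift_map_def add_map_def comp_map_def)
  then show ?case using via.via_left[OF via_left(4) cm_shift_map[OF via_left(2)] cm_shift_map[OF via_left(3)]] by simp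
next
  case (via_right f i p)
  have "shift_map k (add_map Y f (comp_map p i)) = add_map (reindex k Y) (shift_map k f) (comp_map (shift_map k p) (shift_map k i))"
    by (simp add: shift_map_def add_map_def comp_map_def)
  then show ?case using via.via_right[OF via_right(4) cm_shift_map[OF via_right(2)] cm_shift_map[OF via_right(3)]] by simp
next
  case (via_hty f g)
  note fc = via_cm[OF via_hty(1) c]
  have "null (reindex k X) (reindex k Y) (shift_map k (add_map Y f (neg_map Y g)))"
    using via_hty fc c hty_iff_null[OF c fc via_hty(2)] by (intro null_reindex) auto
  moreover have "shift_map k (add_map Y f (neg_map Y g)) = add_map (reindex k Y) (shift_map k f) (neg_map (reindex k Y) (shift_map k g))"
    by (simp add: shift_map_def add_map_def neg_map_def)
  ultimately have "hty (reindex k X) (reindex k Y) (shift_map k f) (shift_map k g)"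
    using c fc via_hty(2) by (subst hty_iff_null) (auto intro: cm_shift_map)
  then show ?case using via_hty(2) by (rule_tac via.via_hty[OF via_hty(4)]) (auto intro: cm_shift_map)
qed

lemma via_shift:
  assumes v: "via U U X X id_map" and c: "cx U" "cx X"
  shows "via (shift k U) (shift k U) (shift k X) (shift k X) id_map"
proof -
  have "shift_map k id_map = (id_map :: int \<Rightarrow> 'b \<Rightarrow> 'b)" "shift_map k id_map = (id_map :: int \<Rightarrow> 'c \<Rightarrow> 'c)"
    by (simp_all add: shift_map_def id_map_def)
  then have 1: "via (reindex k U) (reindex k U) (reindex k X) (reindex k X) id_map"
    using via_reindex[OF v c(2,2), of k] by simp
  have 2: "via (shift k U) (shift k U) (reindex k U) (reindex k U) id_map"
    and 3: "via (reindex k X) (reindex k X) (shift k X) (shift k X) id_map"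
    using c ret_shift by (auto intro!: via_ret)
  show ?thesis using c by (intro via_id_trans[OF via_id_trans[OF 3 1] 2]) auto
qed

text \<open>Lifting along \<open>\<alpha>\<close> extends from \<open>U\<close> to all of \<open>add U\<close>.\<close>

lemma lift_via:
  assumes h: "via U U X Y h" and c: "cx U" "cx X" "cx Y" "cx C" "cx Z"
    and \<alpha>: "\<alpha> \<in> cm C Z" and \<beta>: "\<beta> \<in> cm Y Z"
    and lift: "\<And>f. f \<in> cm U Z \<Longrightarrow> \<exists>v\<in>cm U C. hty U Z f (comp_map \<alpha> v)"
  shows "\<exists>v\<in>cm X C. hty X Z (comp_map \<beta> h) (comp_map \<alpha> v)"
proof -
  note \<alpha>r = cm_rules[OF c(4,5) \<alpha>] and \<beta>r = cm_rules[OF c(3,5) \<beta>]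
  have step: "\<exists>v\<in>cm X C. hty X Z (comp_map \<beta> (add_map Y h (comp_map p i))) (comp_map \<alpha> v)"
    if hc: "h \<in> cm X Y" and IH: "\<exists>v\<in>cm X C. hty X Z (comp_map \<beta> h) (comp_map \<alpha> v)"
      and i: "i \<in> cm X U" and p: "p \<in> cm U Y" for h i p
  proof -
    obtain v where v: "v \<in> cm X C" "hty X Z (comp_map \<beta> h) (comp_map \<alpha> v)" using IH by blast
    obtain w where w: "w \<in> cm U C" "hty U Z (comp_map \<beta> p) (comp_map \<alpha> w)"
      using lift[OF cm_comp[OF p \<beta>]] by blast
    have wi: "comp_map w i \<in> cm X C" "comp_map p i \<in> cm X Y" using i w p by (auto intro: cm_comp)
    have "hty X Z (comp_map (comp_map \<beta> p) i) (comp_map (comp_map \<alpha> w) i)"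
      using c by (intro hty_comp_right[OF w(2) i]) auto
    then have 1: "hty X Z (add_map Z (comp_map \<beta> h) (comp_map (comp_map \<beta> p) i)) (add_map Z (comp_map \<alpha> v) (comp_map (comp_map \<alpha> w) i))"
      using c v i w \<alpha> by (intro hty_add) (auto intro: cm_comp[OF _ \<alpha>] cm_comp[OF i cm_comp[OF w(1) \<alpha>]])
    have 2: "hty X Z (comp_map \<beta> (add_map Y h (comp_map p i))) (add_map Z (comp_map \<beta> h) (comp_map (comp_map \<beta> p) i))"
    proof (rule hty_eq[OF c(2,5)])
      show "comp_map \<beta> (add_map Y h (comp_map p i)) \<in> cm X Z"
        using c hc wi by (intro cm_comp[OF _ \<beta>] cm_add) auto
      fix n x assume x: "x \<in> carrier (Ob X n)"
      show "comp_map \<beta> (add_map Y h (comp_map p i)) n x = add_map Z (comp_map \<beta> h) (comp_map (comp_map \<beta> p) i) n x"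
        using cm_rules(1)[OF c(2,3) hc x] cm_rules(1)[OF c(2,3) wi(2) x] by (simp add: comp_map_def add_map_def \<beta>r)
    qed
    have 3: "hty X Z (add_map Z (comp_map \<alpha> v) (comp_map (comp_map \<alpha> w) i)) (comp_map \<alpha> (add_map C v (comp_map w i)))"
    proof (rule hty_eq[OF c(2,5)])
      show "add_map Z (comp_map \<alpha> v) (comp_map (comp_map \<alpha> w) i) \<in> cm X Z"
        using c v by (intro cm_add cm_comp[OF _ \<alpha>] cm_comp[OF i cm_comp[OF w(1) \<alpha>]]) auto
      fix n x assume x: "x \<in> carrier (Ob X n)"
      show "add_map Z (comp_map \<alpha> v) (comp_map (comp_map \<alpha> w) i) n x = comp_map \<alpha> (add_map C v (comp_map w i)) n x"
        using cm_rules(1)[OF c(2,4) v(1) x] cm_rules(1)[OF c(2,4) wi(1) x] by (simp add: comp_map_def add_map_def \<alpha>r)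
    qed
    have vw: "add_map C v (comp_map w i) \<in> cm X C" using v wi c by (intro cm_add) auto
    have 4: "add_map Z (comp_map \<alpha> v) (comp_map (comp_map \<alpha> w) i) \<in> cm X Z"
      using c v by (intro cm_add cm_comp[OF _ \<alpha>] cm_comp[OF i cm_comp[OF w(1) \<alpha>]]) auto
    have "hty X Z (comp_map \<beta> (add_map Y h (comp_map p i))) (comp_map \<alpha> (add_map C v (comp_map w i)))"
      by (rule hty_trans[OF 2 hty_trans[OF 1 3 c(2,5)] c(2,5)]) (rule cm_comp[OF vw \<alpha>])+
    then show ?thesis using vw by blast
  qed
  show ?thesis using h
  proof induction
    case via_zero
    have "comp_map \<beta> (zero_map Y) = comp_map \<alpha> (zero_map C :: int \<Rightarrow> 'c \<Rightarrow> 'e)"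
      using \<alpha>r(4) \<beta>r(4) by (simp add: comp_map_def zero_map_def)
    then show ?case using c \<alpha> by (intro bexI[of _ "zero_map C"]) (auto intro!: hty_refl cm_comp[OF _ \<alpha>] cm_zero)
  next
    case (via_hty f g)
    then obtain v where v: "v \<in> cm X C" "hty X Z (comp_map \<beta> f) (comp_map \<alpha> v)" by blast
    note fc = via_cm[OF via_hty(1) c(2,3)]
    have "hty X Z (comp_map \<beta> g) (comp_map \<beta> f)"
      by (rule hty_comp_left[OF hty_sym[OF via_hty(3) c(2,3) via_hty(2)] \<beta> c(2,3,5) fc])
    then have "hty X Z (comp_map \<beta> g) (comp_map \<alpha> v)"
      by (rule hty_trans[OF _ v(2) c(2,5) cm_comp[OF v(1) \<alpha>]])
    then show ?case using v by blast
  qed (use step via_cm c in blast)+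
qed

text \<open>Rotation of the triangle C \<rightarrow> X \<rightarrow> E: X is the cone of E[-1]
  \<rightarrow> C. The rules of \<open>tri_generated\<close> produce cones, so this is how X is
  recovered from C and E. The third vertex appears as \<open>E'\<close>, on the element type of
  X.\<close>

lemma cone_rotation:
  fixes X C :: "('a, 'w) cplx" and J :: "'w \<times> 'w \<Rightarrow> 'w"
  assumes c: "cx C" "cx X" and \<alpha>: "\<alpha> \<in> cm C X" and J: "inj J"
  defines "E \<equiv> cone C X \<alpha>" and "E' \<equiv> push J (cone C X \<alpha>)"
  obtains \<delta> f where "\<delta> \<in> cm (shift (-1) E') C" "qis X (cone (shift (-1) E') C \<delta>) f"
proof -
  have Ji: "inj_on J B" for B by (rule inj_on_subset[OF J]) simp
  have cE: "cx E" unfolding E_def using c \<alpha> by simp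
  have E': "E' = push J E" by (simp add: E_def E'_def)
  have cE': "cx E'" unfolding E' using cE Ji by simp
  note pu = push_maps[OF cE Ji, folded E']
  note dX = diff_rules[OF c(2)] and dC = diff_rules[OF c(1)] and \<alpha>r = cm_rules[OF c \<alpha>]
  define un where "un = unpush J E"
  have un: "un \<in> cm E' E" using pu(2) by (simp add: un_def)
  have Jc: "(\<lambda>n. J) \<in> cm E E'" by (rule pu(1))
  have unJ: "un n (J x) = x" if "x \<in> carrier (Ob E n)" for n x using pu(3)[OF that] by (simp add: un_def)
  have Jun: "J (un n y) = y" if "y \<in> carrier (Ob E' n)" for n y using pu(4)[OF that] by (simp add: un_def)
  note ur = cm_rules[OF cE' cE un] and Jr = cm_rules[OF cE cE' Jc]
  define \<delta> where "\<delta> = comp_map fst_map (shift_map (-1) un)"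
  have \<delta>: "\<delta> \<in> cm (shift (-1) E') C"
    unfolding \<delta>_def using cm_comp[OF cm_shift_map_shift[OF cE' cE un] cone_out_cm'[OF c \<alpha>, folded E_def]] .
  let ?S = "shift (-1) E'" and ?N = "cone (shift (-1) E') C \<delta>"
  have cN: "cx ?N" using c cE' \<delta> by simp
  have ObE: "Ob E n = mod_dsum (Ob C (n + 1)) (Ob X n)" for n by (simp add: E_def)
  have ObN: "Ob ?N n = mod_dsum (Ob E' n) (Ob C n)" for n by simp
  have dS: "\<ominus>\<^bsub>Ob E' (n + 1)\<^esub> Diff ?S (n + 1) e = Diff E' n e" if "e \<in> carrier (Ob E' n)" for n e
    using that cE' diff_rules(1)[OF cE' refl that] by (simp add: shift_diff add.commute)
  have dN: "Diff ?N n (e, x) = (Diff E' n e, fst (un n e) \<oplus>\<^bsub>Ob C (n + 1)\<^esub> Diff C n x)"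
    if "e \<in> carrier (Ob E' n)" for n e x
    using dS[OF that] by (simp add: \<delta>_def comp_map_def fst_map_def shift_map_def add.commute)
  have dE: "Diff E' n (J (z, x)) = J (\<ominus>\<^bsub>Ob C (n + 1 + 1)\<^esub> Diff C (n + 1) z, \<alpha> (n + 1) z \<oplus>\<^bsub>Ob X (n + 1)\<^esub> Diff X n x)"
    if "z \<in> carrier (Ob C (n + 1))" "x \<in> carrier (Ob X n)" for n z x
    using Jr(6)[of "n + 1" n "(z, x)"] that by (simp add: ObE E_def)
  have rep: "\<exists>z\<in>carrier (Ob C (n + 1)). \<exists>x\<in>carrier (Ob X n). e = J (z, x)" if "e \<in> carrier (Ob E' n)" for n e
    using ur(1)[OF that] Jun[OF that] ObE by (metis mem_Sigma_iff mod_dsum_simps(1) surj_pair)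
  \<comment> \<open>The map f includes X into E and then into the cone. Its inverse sends ((z, x),
    y) to x - \<alpha> y, where the correction cancels the term \<alpha> z in the differential of
    E.\<close>
  define f where "f = (\<lambda>n x. (J (\<zero>\<^bsub>Ob C (n + 1)\<^esub>, x), \<zero>\<^bsub>Ob C n\<^esub>))"
  define g where "g = (\<lambda>n p. snd (un n (fst p)) \<oplus>\<^bsub>Ob X n\<^esub> \<ominus>\<^bsub>Ob X n\<^esub> \<alpha> n (snd p))"
  have f: "f \<in> cm X ?N"
  proof (rule cmI)
    fix n
    have "(\<lambda>x. (\<zero>\<^bsub>Ob C (n + 1)\<^esub>, x)) \<in> hom (Ob X n) (Ob E n)"
      unfolding ObE using c by (intro hom_pair hom_zero hom_id) auto
    from hom_comp[OF this cm_hom[OF Jc]] show "f n \<in> hom (Ob X n) (Ob ?N n)"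
      unfolding ObN f_def using c by (intro hom_pair hom_zero) auto
    fix x assume x: "x \<in> carrier (Ob X n)"
    have Jx: "J (\<zero>\<^bsub>Ob C (n + 1)\<^esub>, x) \<in> carrier (Ob E' n)" using Jr(1)[of "(\<zero>\<^bsub>Ob C (n + 1)\<^esub>, x)" n] x c by (simp add: ObE)
    show "f (n + 1) (Diff X n x) = Diff ?N n (f n x)"
      unfolding f_def dN[OF Jx] using x c by (simp add: dE dC dX \<alpha>r unJ ObE)
  qed
  have g: "g \<in> cm ?N X"
  proof (rule cmI)
    fix n
    have "(\<lambda>e. snd (un n e)) \<in> hom (Ob E' n) (Ob X n)"
      using hom_comp[OF cm_hom[OF un, of n, unfolded ObE] hom_snd] .
    then show "g n \<in> hom (Ob ?N n) (Ob X n)"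
      unfolding ObN g_def using c cE'
      by (intro hom_add hom_neg hom_comp[OF hom_fst] hom_comp[OF hom_snd] cm_hom[OF \<alpha>]) auto
    fix p assume "p \<in> carrier (Ob ?N n)"
    then obtain z x y where p: "p = (J (z, x), y)" "z \<in> carrier (Ob C (n + 1))" "x \<in> carrier (Ob X n)" "y \<in> carrier (Ob C n)"
      using rep[of "fst p" n] by (auto simp: ObN)
    have Jx: "J (z, x) \<in> carrier (Ob E' n)" using Jr(1)[of "(z, x)" n] p by (simp add: ObE)
    have u1: "un n (J (z, x)) = (z, x)" using p by (simp add: unJ ObE)
    have u2: "un (n + 1) (J (\<ominus>\<^bsub>Ob C (n + 1 + 1)\<^esub> Diff C (n + 1) z, \<alpha> (n + 1) z \<oplus>\<^bsub>Ob X (n + 1)\<^esub> Diff X n x))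
      = (\<ominus>\<^bsub>Ob C (n + 1 + 1)\<^esub> Diff C (n + 1) z, \<alpha> (n + 1) z \<oplus>\<^bsub>Ob X (n + 1)\<^esub> Diff X n x)"
      using p c by (intro unJ) (simp add: ObE dC dX \<alpha>r)
    show "g (n + 1) (Diff ?N n p) = Diff X n (g n p)"
      unfolding p(1) dN[OF Jx] dE[OF p(2,3)] g_def fst_conv snd_conv u1 u2
      apply (rule int_vectors[of "Ob X (n + 1)" "\<alpha> (n + 1) z" "Diff X n x" "\<alpha> (n + 1) (Diff C n y)" "\<zero>\<^bsub>Ob X (n + 1)\<^esub>" "\<zero>\<^bsub>Ob X (n + 1)\<^esub>" "\<zero>\<^bsub>Ob X (n + 1)\<^esub>"])
      using p c by (simp_all add: dX dC \<alpha>r)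
  qed
  have gf: "hty X X (comp_map g f) id_map"
  proof (rule hty_eq[OF c(2,2) cm_comp[OF f g]])
    fix n x assume "x \<in> carrier (Ob X n)"
    then show "comp_map g f n x = id_map n x"
      using c by (simp add: comp_map_def id_map_def f_def g_def unJ ObE \<alpha>r)
  qed
  have fg: "hty ?N ?N id_map (comp_map f g)"
  \<comment> \<open>The homotopy carries the summand C of the cone back to the summand C[1] of E:
    ((z, x), y) \<mapsto> ((y, 0), 0).\<close>
  proof (rule htyI[of "\<lambda>n p. (J (snd p, \<zero>\<^bsub>Ob X (n - 1)\<^esub>), \<zero>\<^bsub>Ob C (n - 1)\<^esub>)"])
    fix n
    have "(\<lambda>y. (y, \<zero>\<^bsub>Ob X (n - 1)\<^esub>)) \<in> hom (Ob C n) (Ob E (n - 1))"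
      using c by (simp add: ObE hom_pair hom_id hom_zero)
    from hom_comp[OF hom_comp[OF hom_snd this] cm_hom[OF Jc]]
    show "(\<lambda>p. (J (snd p, \<zero>\<^bsub>Ob X (n - 1)\<^esub>), \<zero>\<^bsub>Ob C (n - 1)\<^esub>)) \<in> hom (Ob ?N n) (Ob ?N (n - 1))"
      unfolding ObN using c by (intro hom_pair hom_zero) auto
    fix p assume "p \<in> carrier (Ob ?N n)"
    then obtain z x y where p: "p = (J (z, x), y)" "z \<in> carrier (Ob C (n + 1))" "x \<in> carrier (Ob X n)" "y \<in> carrier (Ob C n)"
      using rep[of "fst p" n] by (auto simp: ObN)
    have Jx: "J (z, x) \<in> carrier (Ob E' n)" using Jr(1)[of "(z, x)" n] p by (simp add: ObE)
    have u1: "un n (J (z, x)) = (z, x)" using p by (simp add: unJ ObE)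
    have Jy: "J (y, \<zero>\<^bsub>Ob X (n - 1)\<^esub>) \<in> carrier (Ob E' (n - 1))"
      using Jr(1)[of "(y, \<zero>\<^bsub>Ob X (n - 1)\<^esub>)" "n - 1"] p c by (simp add: ObE)
    have uy: "un (n - 1) (J (y, \<zero>\<^bsub>Ob X (n - 1)\<^esub>)) = (y, \<zero>\<^bsub>Ob X (n - 1)\<^esub>)" using p c by (simp add: unJ ObE)
    have dNy: "Diff ?N (n - 1) (J (y, \<zero>\<^bsub>Ob X (n - 1)\<^esub>), \<zero>\<^bsub>Ob C (n - 1)\<^esub>) = (J (\<ominus>\<^bsub>Ob C (n + 1)\<^esub> Diff C n y, \<alpha> n y), y)"
      unfolding dN[OF Jy] uy using dE[of y "n - 1" "\<zero>\<^bsub>Ob X (n - 1)\<^esub>"] p c by (simp add: diff_pred \<alpha>r)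
    have Jadd: "J (a, b) \<oplus>\<^bsub>Ob E' n\<^esub> J (a', b') = J (a \<oplus>\<^bsub>Ob C (n + 1)\<^esub> a', b \<oplus>\<^bsub>Ob X n\<^esub> b')"
      if "a \<in> carrier (Ob C (n + 1))" "a' \<in> carrier (Ob C (n + 1))" "b \<in> carrier (Ob X n)" "b' \<in> carrier (Ob X n)" for a a' b b'
      using Jr(2)[of "(a, b)" n "(a', b')"] that by (simp add: ObE)
    have dNp: "Diff ?N n p = (Diff E' n (J (z, x)), z \<oplus>\<^bsub>Ob C (n + 1)\<^esub> Diff C n y)"
      unfolding p(1) dN[OF Jx] u1 by simp
    have fgp: "comp_map f g n p = (J (\<zero>\<^bsub>Ob C (n + 1)\<^esub>, x \<oplus>\<^bsub>Ob X n\<^esub> \<ominus>\<^bsub>Ob X n\<^esub> \<alpha> n y), \<zero>\<^bsub>Ob C n\<^esub>)"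
      by (simp add: comp_map_def f_def g_def p(1) u1)
    have e1: "(x \<oplus>\<^bsub>Ob X n\<^esub> \<ominus>\<^bsub>Ob X n\<^esub> \<alpha> n y) \<oplus>\<^bsub>Ob X n\<^esub> \<alpha> n y = x"
      using p c by (simp add: rmod_ac(1) \<alpha>r)
    have e2: "\<ominus>\<^bsub>Ob C (n + 1)\<^esub> Diff C n y \<oplus>\<^bsub>Ob C (n + 1)\<^esub> (z \<oplus>\<^bsub>Ob C (n + 1)\<^esub> Diff C n y) = z"
      apply (rule int_vectors[of "Ob C (n + 1)" "Diff C n y" z z z z z])
      using p c by (simp_all add: dC)
    show "id_map n p = comp_map f g n p \<oplus>\<^bsub>Ob ?N n\<^esub>
        (Diff ?N (n - 1) (J (snd p, \<zero>\<^bsub>Ob X (n - 1)\<^esub>), \<zero>\<^bsub>Ob C (n - 1)\<^esub>) \<oplus>\<^bsub>Ob ?N n\<^esub>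
         (J (snd (Diff ?N n p), \<zero>\<^bsub>Ob X (n + 1 - 1)\<^esub>), \<zero>\<^bsub>Ob C (n + 1 - 1)\<^esub>))"
      unfolding fgp dNp unfolding p(1) snd_conv dNy ObN
      using p c e1 e2 by (simp add: id_map_def Jadd dC dX \<alpha>r)
  qed
  have "hty ?N ?N (comp_map f g) id_map" by (rule hty_sym[OF fg cN cN cm_comp[OF g f]])
  then have "qis X ?N f" by (rule qis_homotopy_equiv[OF f g c(2) cN gf])
  then show thesis by (rule that[OF \<delta>])
qed

section \<open>Generated triangulated subcategories\<close>

lemma tri_qis: "tri_generated A S X \<Longrightarrow> cx X \<Longrightarrow> cx Y \<Longrightarrow> qis X Y f \<Longrightarrow> tri_generated A S Y"
  by (rule tri_generated.iso[OF _ _ derived_isoI])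

text \<open>Shifting forth and back negates an odd shift's differential twice, which restores it on
  carriers only. The identity is thus an isomorphism of two formally different complexes.\<close>

lemma tri_shift_iff:
  assumes "cx X" shows "tri_generated A S (shift k X) \<longleftrightarrow> tri_generated A S X"
proof
  assume "tri_generated A S (shift k X)"
  then have "tri_generated A S (shift (- k) (shift k X))" by (rule tri_generated.shift)
  moreover have "qis (shift (- k) (shift k X)) X id_map"
  proof (rule qis_iso[of id_map _ _ id_map])
    have d: "Diff (shift (- k) (shift k X)) n x = Diff X n x" if "x \<in> carrier (Ob X n)" for n x
      using that assms diff_rules(1)[OF assms refl that] by (simp add: shift_diff)
    show "id_map \<in> cm (shift (- k) (shift k X)) X" "id_map \<in> cm X (shift (- k) (shift k X))"
      by (auto intro!: cmI simp: id_map_def hom_id d)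
  qed (use assms in \<open>auto simp: id_map_def\<close>)
  ultimately show "tri_generated A S X" using assms by (rule_tac tri_qis) auto
qed (rule tri_generated.shift)

lemma tri_rotation:
  fixes X C :: "('a, 'w) cplx" and J :: "'w \<times> 'w \<Rightarrow> 'w"
  assumes "cx C" "cx X" "\<alpha> \<in> cm C X" "inj J"
    and "tri_generated A S C" "tri_generated A S (push J (cone C X \<alpha>))"
  shows "tri_generated A S X"
proof -
  obtain \<delta> f where d: "\<delta> \<in> cm (shift (-1) (push J (cone C X \<alpha>))) C"
    and f: "qis X (cone (shift (-1) (push J (cone C X \<alpha>))) C \<delta>) f"
    using cone_rotation[OF assms(1-4)] by blast
  show ?thesis
    by (rule tri_generated.cone[OF tri_generated.shift[OF assms(6)] assms(5) d assms(2) derived_isoI[OF f assms(2)]])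
qed

text \<open>Splitting off the lowest term: a complex concentrated in degrees at least \<open>a\<close> is the cone of a
  map from \<open>X\<^sup>a[-a-1]\<close> to the part of \<open>X\<close> in degrees greater than \<open>a\<close>.\<close>

lemma tri_bounded:
  fixes X :: "('a, 'w) cplx"
  assumes zero: "\<And>X :: ('a, 'w) cplx. kb X \<Longrightarrow> zero_complex X \<Longrightarrow> tri_generated A S X"
    and stalks: "\<And>M :: ('a, 'w) module. fgp M \<Longrightarrow> tri_generated A S (stalk M)"
    and X: "kb X"
  shows "tri_generated A S X"
proof -
  have "tri_generated A S X"
    if "kb X" "\<And>n. n < a \<or> a + int k \<le> n \<Longrightarrow> carrier (Ob X n) = {\<zero>\<^bsub>Ob X n\<^esub>}" for a k and X :: "('a, 'w) cplx"
    using that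
  proof (induction k arbitrary: a X)
    case 0
    have "n < a \<or> a + int 0 \<le> n" for n by auto
    then have "zero_complex X" using 0(2) by (simp add: zero_complex_def)
    then show ?case using zero 0 by blast
  next
    case (Suc k)
    have c: "cx X" using Suc by simp
    note d = diff_rules[OF c]
    \<comment> \<open>Brutal truncation to the degrees greater than \<open>a\<close>. It has one
      degree fewer to account for, which drives the induction on \<open>k\<close>.\<close>
    define T where "T = \<lparr>Ob = (\<lambda>n. if a < n then Ob X n else zero_module (Ob X n)),
      Diff = (\<lambda>n x. if a < n then Diff X n x else \<zero>\<^bsub>Ob X (n + 1)\<^esub>)\<rparr>"
    have zm: "carrier (zero_module M) = {\<zero>\<^bsub>M\<^esub>}" "\<zero>\<^bsub>zero_module M\<^esub> = \<zero>\<^bsub>M\<^esub>" "x \<oplus>\<^bsub>zero_module M\<^esub> y = x \<oplus>\<^bsub>M\<^esub> y"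
      "b \<odot>\<^bsub>zero_module M\<^esub> x = b \<odot>\<^bsub>M\<^esub> x" for M :: "('a, 'w) module" and x y b by (auto simp: zero_module_def)
    have ObT: "Ob T n = (if a < n then Ob X n else zero_module (Ob X n))" for n by (simp add: T_def)
    have dT: "Diff T n x = (if a < n then Diff X n x else \<zero>\<^bsub>Ob X (n + 1)\<^esub>)" for n x by (simp add: T_def)
    have cT: "cx T"
    proof (rule cxI)
      show "rmod (Ob T n)" for n using c by (simp add: ObT)
      show "Diff T n \<in> hom (Ob T n) (Ob T (n + 1))" for n
      proof (cases "a < n")
        case True
        then have "Diff T n = Diff X n" by (auto simp: dT)
        then show ?thesis using True diff_hom[OF c] by (simp add: ObT)
      next
        case False
        then show ?thesis using c by (auto intro!: homI simp: ObT dT zm)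
      qed
    qed (use c in \<open>auto simp: ObT dT d zm\<close>)
    have fT: "fgp (Ob T n)" for n
      using kb_fgp[OF Suc(2)] c by (auto simp: ObT zm intro!: fgp_zero)
    have zT: "carrier (Ob T n) = {\<zero>\<^bsub>Ob T n\<^esub>}" if "n < a + 1 \<or> (a + 1) + int k \<le> n" for n
      using that Suc(3)[of n] by (auto simp: ObT zm)
    have kT: "kb T" using zT by (intro kbI[OF cT fT, of "a + 1" "a + 1 + int k"]) auto
    have tT: "tri_generated A S T" using Suc(1)[OF kT zT] by blast
    let ?M = "Ob X a"
    \<comment> \<open>The lowest term is placed in degree \<open>a + 1\<close>, so that the cone
      puts it back into degree \<open>a\<close>; the attaching map is then the differential of
      \<open>X\<close> out of that degree.\<close>
    define W where "W = shift (- (a + 1)) (stalk (Ob X a))"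
    have fM: "fgp ?M" using kb_fgp[OF Suc(2)] by simp
    have cS: "cx W" unfolding W_def using fgp_rmod[OF fM] by simp
    have tS: "tri_generated A S W" unfolding W_def by (rule tri_generated.shift[OF stalks[OF fM]])
    have ObS: "Ob W n = (if n = a + 1 then ?M else zero_module ?M)" for n by (simp add: W_def stalk_def)
    have zneg: "\<ominus>\<^bsub>zero_module ?M\<^esub> \<zero>\<^bsub>?M\<^esub> = \<zero>\<^bsub>?M\<^esub>" "\<ominus>\<^bsub>?M\<^esub> \<zero>\<^bsub>?M\<^esub> = \<zero>\<^bsub>?M\<^esub>"
      using rmod_simps(9)[OF rmod_zero_module[OF fgp_rmod[OF fM]]] fgp_rmod[OF fM] by (simp_all add: zm)
    have dS: "Diff W n x = \<zero>\<^bsub>?M\<^esub>" for n x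
      by (auto simp: W_def shift_diff stalk_def zneg)
    define f where "f = (\<lambda>n x. if n = a + 1 then Diff X a x else \<zero>\<^bsub>Ob X n\<^esub>)"
    have f: "f \<in> cm W T"
    proof (rule cmI)
      fix n
      show "f n \<in> hom (Ob W n) (Ob T n)"
      proof (cases "n = a + 1")
        case True
        then have "f n = Diff X a" by (auto simp: f_def)
        then show ?thesis unfolding ObS ObT using True diff_hom[OF c, of a] by simp
      next
        case False
        then show ?thesis unfolding ObS ObT using c by (auto intro!: homI simp: f_def zm)
      qed
      fix x assume x: "x \<in> carrier (Ob W n)"
      show "f (n + 1) (Diff W n x) = Diff T n (f n x)"
        using x c unfolding ObS dS by (auto simp: f_def dT d split: if_splits)
    qed
    define K where "K = cone W T f"
    have cK: "cx K" unfolding K_def using cS cT f by simp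
    have ObK: "Ob K n = mod_dsum (if n = a then ?M else zero_module ?M) (Ob T n)" for n
      by (simp add: K_def ObS)
    have dK: "Diff K n (x, y) = (\<zero>\<^bsub>?M\<^esub>, f (n + 1) x \<oplus>\<^bsub>Ob T (n + 1)\<^esub> Diff T n y)" for n x y
    proof -
      have "\<ominus>\<^bsub>Ob W (n + 1 + 1)\<^esub> \<zero>\<^bsub>?M\<^esub> = \<zero>\<^bsub>?M\<^esub>"
        unfolding ObS by (simp add: zneg)
      then show ?thesis unfolding K_def cone_diff dS by simp
    qed
    define F where "F = (\<lambda>n x. if n = a then (x, \<zero>\<^bsub>Ob X n\<^esub>) else (\<zero>\<^bsub>?M\<^esub>, x))"
    define G where "G = (\<lambda>(n::int) p. if n = a then fst p else (snd p :: 'w))"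
    have low: "x = \<zero>\<^bsub>Ob X n\<^esub>" if "x \<in> carrier (Ob X n)" "n < a" for n x using that Suc(3)[of n] by auto
    have F: "F \<in> cm X K"
    proof (rule cmI)
      fix n
      show "F n \<in> hom (Ob X n) (Ob K n)"
      proof (cases "n = a")
        case True
        then show ?thesis unfolding ObK ObT F_def using c by (auto intro!: homI simp: zm)
      next
        case False
        then show ?thesis unfolding ObK ObT F_def using c low fgp_rmod[OF fM] by (auto intro!: homI simp: zm)
      qed
      fix x assume x: "x \<in> carrier (Ob X n)"
      show "F (n + 1) (Diff X n x) = Diff K n (F n x)"
      proof (cases "n = a")
        case True
        then show ?thesis using x c by (simp add: F_def dK f_def ObT dT d)
      next
        case False
        have dx: "Diff X n x \<in> carrier (Ob X (n + 1))" using x c by (simp add: d)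
        show ?thesis
        proof (cases "a < n")
          case True
          then show ?thesis using x c dx by (simp add: F_def dK f_def ObT dT d)
        next
          case F: False
          then have n: "n < a" using False by simp
          have x0: "x = \<zero>\<^bsub>Ob X n\<^esub>" using low[OF x n] .
          show ?thesis
          proof (cases "n + 1 = a")
            case True
            then have na: "n = a - 1" by simp
            show ?thesis using c diff_pred(4)[OF c, of a] unfolding x0 na
              by (simp add: F_def dK f_def ObT dT d zm)
          next
            case False
            then show ?thesis using c n unfolding x0
              by (simp add: F_def dK f_def ObT dT d zm)
          qed
        qed
      qed
    qed
    have G: "G \<in> cm K X"
    proof (rule cmI)
      fix n
      show "G n \<in> hom (Ob K n) (Ob X n)"
        unfolding ObK ObT G_def using c by (auto simp: rm_hom_def zm mod_dsum_def)
      fix p assume "p \<in> carrier (Ob K n)"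
      then obtain x y where p: "p = (x, y)" "x \<in> carrier (if n = a then ?M else zero_module ?M)" "y \<in> carrier (Ob T n)"
        unfolding ObK by auto
      show "G (n + 1) (Diff K n p) = Diff X n (G n p)"
      proof (cases "n = a")
        case True
        then show ?thesis using p c unfolding p(1) dK by (simp add: G_def f_def dT d ObT zm)
      next
        case False
        then show ?thesis
        proof (cases "a < n")
          case True
          then show ?thesis using p c False unfolding p(1) dK by (simp add: G_def f_def dT d ObT zm)
        next
          case F: False
          then have y0: "y = \<zero>\<^bsub>Ob X n\<^esub>" "x = \<zero>\<^bsub>?M\<^esub>" using p(2,3) False by (auto simp: ObT zm)
          show ?thesis
          proof (cases "n + 1 = a")
            case True
            then have na: "n = a - 1" by simp
            show ?thesis using c diff_pred(4)[OF c, of a] unfolding p(1) dK y0 na by (simp add: G_def)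
          next
            case nF: False
            then show ?thesis using c False F unfolding p(1) dK y0 by (simp add: G_def f_def dT d ObT zm)
          qed
        qed
      qed
    qed
    have "qis X K F"
    proof (rule qis_iso[OF F G c cK])
      show "G n (F n x) = x" for n x by (simp add: F_def G_def)
      fix n p assume "p \<in> carrier (Ob K n)"
      then show "F n (G n p) = p" unfolding ObK ObT by (auto simp: F_def G_def zm split: if_splits)
    qed
    then show ?case unfolding K_def by (rule tri_generated.cone[OF tS tT f c derived_isoI[OF _ c]])
  qed
  note * = this
  obtain a b where ab: "\<And>n. n < a \<or> b < n \<Longrightarrow> carrier (Ob X n) = {\<zero>\<^bsub>Ob X n\<^esub>}"
    using kb_bounds[OF X] by blast
  show ?thesis by (rule *[OF X, of a "nat (b + 1 - a)"]) (rule ab, auto split: if_splits)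
qed

end

context approximation
begin

section \<open>Approximations by shifts of add P\<close>

lemma cm_pair: "f \<in> cm X Y \<Longrightarrow> g \<in> cm X Z \<Longrightarrow> (\<lambda>n x. (f n x, g n x)) \<in> cm X (dsum Y Z)"
  by (auto simp: chain_map_def intro!: hom_pair)

text \<open>Covers of two maps combine to a cover of their sum: the sources are added, and the pair
  of lifts is a lift of the sum. \<open>J'\<close> brings the direct sum back to the element type in
  use.\<close>

lemma cover_sum:
  fixes C1 C2 :: "('a, 'w) cplx" and J' :: "'w \<times> 'w \<Rightarrow> 'w"
  assumes J': "inj J'" and k: "kb C1" "kb C2" and v: "via U U C1 C1 id_map" "via U U C2 C2 id_map"
    and \<alpha>: "\<alpha>1 \<in> cm C1 Y" "\<alpha>2 \<in> cm C2 Y" and c: "cx U" "cx X" "cx Y" and h: "h1 \<in> cm X Y" "h2 \<in> cm X Y"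
    and l1: "\<And>f. f \<in> cm U X \<Longrightarrow> \<exists>v\<in>cm U C1. hty U Y (comp_map h1 f) (comp_map \<alpha>1 v)"
    and l2: "\<And>f. f \<in> cm U X \<Longrightarrow> \<exists>v\<in>cm U C2. hty U Y (comp_map h2 f) (comp_map \<alpha>2 v)"
  shows "\<exists>(C :: ('a, 'w) cplx) \<alpha>. kb C \<and> via U U C C id_map \<and> \<alpha> \<in> cm C Y \<and>
    (\<forall>f\<in>cm U X. \<exists>v\<in>cm U C. hty U Y (comp_map (add_map Y h1 h2) f) (comp_map \<alpha> v))"
proof -
  have Ji: "inj_on J' B" for B by (rule inj_on_subset[OF J']) simp
  have cc: "cx C1" "cx C2" "cx (dsum C1 C2)" using k by auto
  let ?D = "dsum C1 C2" and ?C = "push J' (dsum C1 C2)"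
  have kC: "kb ?C" using k Ji by (intro kb_push kb_dsum)
  note pm = push_maps[OF cc(3) Ji] and dm = dsum_maps[OF cc(1,2)]
  have cC: "cx ?C" using kC by simp
  have vD: "via U U ?D ?D id_map"
    using c cc by (intro via_trans[OF via_dsum[OF cc(1,2)] v])
  have vC: "via U U ?C ?C id_map"
    by (rule via_id_trans[OF via_ret[OF ret_push(2)[OF cc(3) Ji] cC cc(3)] vD cc(3) c(1) cC])
  define \<beta> where "\<beta> = add_map Y (comp_map \<alpha>1 fst_map) (comp_map \<alpha>2 snd_map)"
  have \<beta>: "\<beta> \<in> cm ?D Y" unfolding \<beta>_def using cc c by (intro cm_add cm_comp[OF dm(3) \<alpha>(1)] cm_comp[OF dm(4) \<alpha>(2)])
  define \<alpha> where "\<alpha> = comp_map \<beta> (unpush J' ?D)"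
  have \<alpha>c: "\<alpha> \<in> cm ?C Y" unfolding \<alpha>_def by (rule cm_comp[OF pm(2) \<beta>])
  have "\<exists>v\<in>cm U ?C. hty U Y (comp_map (add_map Y h1 h2) f) (comp_map \<alpha> v)" if f: "f \<in> cm U X" for f
  proof -
    obtain v1 v2 where v1: "v1 \<in> cm U C1" "hty U Y (comp_map h1 f) (comp_map \<alpha>1 v1)"
      and v2: "v2 \<in> cm U C2" "hty U Y (comp_map h2 f) (comp_map \<alpha>2 v2)" using l1[OF f] l2[OF f] by blast
    define w where "w = (\<lambda>n x. (v1 n x, v2 n x))"
    have w: "w \<in> cm U ?D" unfolding w_def by (rule cm_pair[OF v1(1) v2(1)])
    have Jw: "comp_map (\<lambda>n. J') w \<in> cm U ?C" by (rule cm_comp[OF w pm(1)])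
    have 1: "hty U Y (add_map Y (comp_map h1 f) (comp_map h2 f)) (add_map Y (comp_map \<alpha>1 v1) (comp_map \<alpha>2 v2))"
      using v1 v2 c \<alpha> by (intro hty_add) (auto intro: cm_comp)
    have "hty U Y (comp_map \<alpha> (comp_map (\<lambda>n. J') w)) (add_map Y (comp_map \<alpha>1 v1) (comp_map \<alpha>2 v2))"
    proof (rule hty_eq[OF c(1,3) cm_comp[OF Jw \<alpha>c]])
      fix n x assume x: "x \<in> carrier (Ob U n)"
      have "unpush J' ?D n (J' (w n x)) = w n x" by (rule pm(3)[OF cm_rules(1)[OF c(1) cc(3) w x]])
      then show "comp_map \<alpha> (comp_map (\<lambda>n. J') w) n x = add_map Y (comp_map \<alpha>1 v1) (comp_map \<alpha>2 v2) n x"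
        by (simp add: \<alpha>_def \<beta>_def comp_map_def add_map_def w_def fst_map_def snd_map_def)
    qed
    then have 2: "hty U Y (add_map Y (comp_map \<alpha>1 v1) (comp_map \<alpha>2 v2)) (comp_map \<alpha> (comp_map (\<lambda>n. J') w))"
      using c v1 v2 \<alpha> by (rule_tac hty_sym) (auto intro!: cm_add intro: cm_comp)
    have 3: "comp_map (add_map Y h1 h2) f = add_map Y (comp_map h1 f) (comp_map h2 f)"
      by (simp add: comp_map_def add_map_def)
    show ?thesis unfolding 3 using hty_trans[OF 1 2 c(1,3) cm_comp[OF Jw \<alpha>c]] Jw by blast
  qed
  then show ?thesis using kC vC \<alpha>c by blast
qed

text \<open>For the identity of X the map \<alpha> is a right approximation of X by add P[c n]. The
  statement is about a general member of the ideal because the proof follows the generation of the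
  ideal: a summand through \<open>R n\<close> is covered by means of \<open>\<gamma> n\<close>, one
  through \<open>PS n\<close> by \<open>PS n\<close> itself. \<open>E0\<close> brings these sources
  to the element type of Y.\<close>

lemma cover:
  fixes X :: "('a, 'v) cplx" and Y :: "('a, 'w) cplx" and J' :: "'w \<times> 'w \<Rightarrow> 'w" and E0 :: "'u \<Rightarrow> 'w"
  assumes J': "inj J'" and E0: "inj E0" and h: "via (R n) (PS n) X Y h" and c: "cx X" "cx Y"
  shows "\<exists>(C :: ('a, 'w) cplx) \<alpha>. kb C \<and> via (PS n) (PS n) C C id_map \<and> \<alpha> \<in> cm C Y \<and>
    (\<forall>f\<in>cm (PS n) X. \<exists>v\<in>cm (PS n) C. hty (PS n) Y (comp_map h f) (comp_map \<alpha> v))"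
proof -
  have Ei: "inj_on E0 B" for B by (rule inj_on_subset[OF E0]) simp
  let ?P = "push E0 (PS n)" and ?Q = "push E0 (Q n)"
  have kP: "kb ?P" "kb ?Q" using kb_Q Ei by (auto intro!: kb_push)
  have cP: "cx ?P" "cx ?Q" using kP by auto
  have vP: "via (PS n) (PS n) ?P ?P id_map"
    using ret_push(2)[OF cx_PS Ei] cP by (intro via_ret) auto
  have "via (PS n) (PS n) (Q n) (Q n) id_map" using Q_add by (simp add: PS_def c_def)
  then have vQ: "via (PS n) (PS n) ?Q ?Q id_map"
    by (rule via_id_trans[OF via_ret[OF ret_push(2)[OF cx_Q Ei] cP(2) cx_Q] _ cx_Q cx_PS cP(2)])
  note pP = push_maps[OF cx_PS[of n] Ei] and pQ = push_maps[OF cx_Q[of n] Ei]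
  show ?thesis using h
  proof induction
    case via_zero
    have "hty (PS n) Y (comp_map (zero_map Y) f) (comp_map (zero_map Y) (zero_map ?P))" if "f \<in> cm (PS n) X" for f
      using c hty_refl[OF cx_PS c(2) cm_zero[OF cx_PS c(2)], of n] by (simp add: comp_map_def zero_map_def)
    then show ?case using kP(1) vP cm_zero[OF cP(1) c(2)] cm_zero[OF cx_PS[of n] cP(1)] by blast
  next
    case (via_left f i p)
    let ?\<alpha> = "comp_map p (comp_map (\<gamma> n) (unpush E0 (Q n)))"
    have \<alpha>: "?\<alpha> \<in> cm ?Q Y" by (rule cm_comp[OF cm_comp[OF pQ(2) \<gamma>] via_left(3)])
    have l: "\<exists>v\<in>cm (PS n) ?Q. hty (PS n) Y (comp_map (comp_map p i) g) (comp_map ?\<alpha> v)" if g: "g \<in> cm (PS n) X" for g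
    proof -
      have ig: "comp_map i g \<in> cm (PS n) (R n)" by (rule cm_comp[OF g via_left(2)])
      obtain v where v: "v \<in> cm (PS n) (Q n)" "hty (PS n) (R n) (comp_map i g) (comp_map (\<gamma> n) v)"
        using \<gamma>_lift[of "comp_map i g" n] ig by (auto simp: PS_def c_def)
      have Ev: "comp_map (\<lambda>n. E0) v \<in> cm (PS n) ?Q" by (rule cm_comp[OF v(1) pQ(1)])
      have 1: "hty (PS n) Y (comp_map p (comp_map i g)) (comp_map p (comp_map (\<gamma> n) v))"
        using c by (intro hty_comp_left[OF v(2) via_left(3)] cm_comp[OF v(1) \<gamma>]) auto
      have 2: "hty (PS n) Y (comp_map p (comp_map (\<gamma> n) v)) (comp_map ?\<alpha> (comp_map (\<lambda>n. E0) v))"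
      proof (rule hty_eq[OF cx_PS c(2) cm_comp[OF cm_comp[OF v(1) \<gamma>] via_left(3)]])
        fix k x assume x: "x \<in> carrier (Ob (PS n) k)"
        show "comp_map p (comp_map (\<gamma> n) v) k x = comp_map ?\<alpha> (comp_map (\<lambda>n. E0) v) k x"
          using pQ(3)[OF cm_rules(1)[OF cx_PS cx_Q v(1) x]] by (simp add: comp_map_def)
      qed
      have 3: "hty (PS n) Y (comp_map p (comp_map i g)) (comp_map ?\<alpha> (comp_map (\<lambda>n. E0) v))"
        by (rule hty_trans[OF 1 2 cx_PS c(2) cm_comp[OF Ev \<alpha>]])
      show ?thesis unfolding comp_assoc[of p i g, symmetric] using 3 Ev by blast
    qed
    obtain C \<alpha>' where C: "kb (C :: ('a, 'w) cplx)" "via (PS n) (PS n) C C id_map" "\<alpha>' \<in> cm C Y"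
      "\<And>g. g \<in> cm (PS n) X \<Longrightarrow> \<exists>v\<in>cm (PS n) C. hty (PS n) Y (comp_map f g) (comp_map \<alpha>' v)"
      using via_left(4) by blast
    show ?case
      by (rule cover_sum[OF J' C(1) kP(2) C(2) vQ C(3) \<alpha> cx_PS c via_cm[OF via_left(1) c] cm_comp[OF via_left(2,3)] C(4) l])
  next
    case (via_right f i p)
    let ?\<alpha> = "comp_map p (unpush E0 (PS n))"
    have \<alpha>: "?\<alpha> \<in> cm ?P Y" by (rule cm_comp[OF pP(2) via_right(3)])
    have l: "\<exists>v\<in>cm (PS n) ?P. hty (PS n) Y (comp_map (comp_map p i) g) (comp_map ?\<alpha> v)" if g: "g \<in> cm (PS n) X" for g
    proof -
      have ig: "comp_map i g \<in> cm (PS n) (PS n)" by (rule cm_comp[OF g via_right(2)])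
      have Ev: "comp_map (\<lambda>n. E0) (comp_map i g) \<in> cm (PS n) ?P" by (rule cm_comp[OF ig pP(1)])
      have "hty (PS n) Y (comp_map p (comp_map i g)) (comp_map ?\<alpha> (comp_map (\<lambda>n. E0) (comp_map i g)))"
      proof (rule hty_eq[OF cx_PS c(2) cm_comp[OF ig via_right(3)]])
        fix k x assume x: "x \<in> carrier (Ob (PS n) k)"
        show "comp_map p (comp_map i g) k x = comp_map ?\<alpha> (comp_map (\<lambda>n. E0) (comp_map i g)) k x"
          using pP(3)[OF cm_rules(1)[OF cx_PS cx_PS ig x]] by (simp add: comp_map_def)
      qed
      then show ?thesis unfolding comp_assoc[of p i g, symmetric] using Ev by blast
    qed
    obtain C \<alpha>' where C: "kb (C :: ('a, 'w) cplx)" "via (PS n) (PS n) C C id_map" "\<alpha>' \<in> cm C Y"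
      "\<And>g. g \<in> cm (PS n) X \<Longrightarrow> \<exists>v\<in>cm (PS n) C. hty (PS n) Y (comp_map f g) (comp_map \<alpha>' v)"
      using via_right(4) by blast
    show ?case
      by (rule cover_sum[OF J' C(1) kP(1) C(2) vP C(3) \<alpha> cx_PS c via_cm[OF via_right(1) c] cm_comp[OF via_right(2,3)] C(4) l])
  next
    case (via_hty f g)
    obtain C \<alpha> where C: "kb (C :: ('a, 'w) cplx)" "via (PS n) (PS n) C C id_map" "\<alpha> \<in> cm C Y"
      and l: "\<And>u. u \<in> cm (PS n) X \<Longrightarrow> \<exists>v\<in>cm (PS n) C. hty (PS n) Y (comp_map f u) (comp_map \<alpha> v)"
      using via_hty(4) by blast
    have "\<exists>v\<in>cm (PS n) C. hty (PS n) Y (comp_map g u) (comp_map \<alpha> v)" if u: "u \<in> cm (PS n) X" for u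
    proof -
      obtain v where v: "v \<in> cm (PS n) C" "hty (PS n) Y (comp_map f u) (comp_map \<alpha> v)" using l[OF u] by blast
      have "hty (PS n) Y (comp_map g u) (comp_map f u)"
        by (rule hty_comp_right[OF hty_sym[OF via_hty(3) c via_hty(2)] u cx_PS c])
      then show ?thesis using hty_trans[OF _ v(2) cx_PS c(2) cm_comp[OF v(1) C(3)]] v(1) by blast
    qed
    then show ?case using C by blast
  qed
qed

text \<open>The second map of the triangle, from the model of \<Delta>_n to that of
  \<Delta>_{n+1}.\<close>

definition \<kappa> :: "nat \<Rightarrow> int \<Rightarrow> 'u \<Rightarrow> 'u" where
  "\<kappa> n = comp_map (\<lambda>m. J) (cone_in (Q n))"

lemma \<kappa>: "\<kappa> n \<in> cm (R n) (R (Suc n))"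
  unfolding \<kappa>_def R_Suc by (rule cm_comp[OF cone_in_cm[OF cx_Q cx_R \<gamma>] push_maps(1)[OF cx_RC J_inj]])

lemma \<kappa>_null: "null (Q n) (R (Suc n)) (comp_map (\<kappa> n) (\<gamma> n))"
  unfolding \<kappa>_def comp_assoc[symmetric] R_Suc
  using null_comp_left[OF cone_in_null[OF cx_Q cx_R \<gamma>] push_maps(1)[OF cx_RC J_inj] cx_Q cx_RC] cx_R[of "Suc n"]
  by (simp add: R_Suc)

lemma \<kappa>_extend:
  assumes "cx V" "j \<in> cm (R n) V" "null (Q n) V (comp_map j (\<gamma> n))"
  obtains I where "I \<in> cm (R (Suc n)) V" "hty (R n) V (comp_map I (\<kappa> n)) j"
proof -
  obtain I where I: "I \<in> cm (cone (Q n) (R n) (\<gamma> n)) V" "hty (R n) V (comp_map I (cone_in (Q n))) j"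
    using cone_extend[OF cx_Q cx_R \<gamma> assms] by blast
  note pm = push_maps[OF cx_RC[of n] J_inj, folded R_Suc]
  let ?I = "comp_map I (unpush J (cone (Q n) (R n) (\<gamma> n)))"
  have I': "?I \<in> cm (R (Suc n)) V" by (rule cm_comp[OF pm(2) I(1)])
  note ci = cone_in_cm[OF cx_Q cx_R \<gamma>, of n]
  have "hty (R n) V (comp_map ?I (\<kappa> n)) (comp_map I (cone_in (Q n)))"
  proof (rule hty_eq[OF cx_R assms(1) cm_comp[OF \<kappa> I']])
    fix k x assume x: "x \<in> carrier (Ob (R n) k)"
    show "comp_map ?I (\<kappa> n) k x = comp_map I (cone_in (Q n)) k x"
      using pm(3)[OF cm_rules(1)[OF cx_R cx_RC ci x]] by (simp add: comp_map_def \<kappa>_def)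
  qed
  then have "hty (R n) V (comp_map ?I (\<kappa> n)) j" by (rule hty_trans[OF _ I(2) cx_R assms(1,2)])
  then show thesis by (rule that[OF I'])
qed

text \<open>An endomorphism of \<open>X\<close> in the ideal of \<open>\<Delta>\<^sub>n\<close> and \<open>P[n+s-r]\<close> extends along \<open>X \<rightarrow> E\<close>, where \<open>E\<close> is
  the cone of the approximation, to one in the ideal of \<open>\<Delta>\<^sub>n\<^sub>+\<^sub>1\<close>; for the identity of \<open>X\<close> the extension
  differs from the identity of \<open>E\<close> by a map factoring through \<open>E \<rightarrow> C[1]\<close>.\<close>

lemma approximation_step:
  fixes X C :: "('a, 'w) cplx"
  assumes k: "kb X" "kb C" and vX: "via (R n) (PS n) X X id_map" and vC: "via (PS n) (PS n) C C id_map"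
    and \<alpha>: "\<alpha> \<in> cm C X" and lift: "\<And>f. f \<in> cm (PS n) X \<Longrightarrow> \<exists>v\<in>cm (PS n) C. hty (PS n) X f (comp_map \<alpha> v)"
  shows "via (R (Suc n)) (PS (Suc n)) (cone C X \<alpha>) (cone C X \<alpha>) id_map"
proof -
  let ?E = "cone C X \<alpha>"
  have c: "cx C" "cx X" "cx ?E" using k \<alpha> by auto
  define \<iota> where "\<iota> = (cone_in C :: int \<Rightarrow> 'w \<Rightarrow> 'w \<times> 'w)"
  have \<iota>: "\<iota> \<in> cm X ?E" unfolding \<iota>_def by (rule cone_in_cm[OF c(1,2) \<alpha>])
  note \<iota>r = cm_rules[OF c(2,3) \<iota>]
  have \<iota>\<alpha>: "null C ?E (comp_map \<iota> \<alpha>)" unfolding \<iota>_def by (rule cone_in_null[OF c(1,2) \<alpha>])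
  have \<iota>add: "hty X ?E (comp_map \<iota> (add_map X f g)) (add_map ?E (comp_map \<iota> f) (comp_map \<iota> g))"
    if "f \<in> cm X X" "g \<in> cm X X" for f g
    by (rule hty_eq[OF c(2,3) cm_comp[OF cm_add[OF c(2,2) that] \<iota>]])
      (simp add: comp_map_def add_map_def \<iota>r cm_rules[OF c(2,2) that(1)] cm_rules[OF c(2,2) that(2)])
  have QS: "via (PS n) (PS n) (Q n) (Q n) id_map" using Q_add by (simp add: PS_def c_def)
  have ext: "\<exists>H. via (R (Suc n)) (PS (Suc n)) ?E ?E H \<and> hty X ?E (comp_map H \<iota>) (comp_map \<iota> h)"
    if "via (R n) (PS n) X X h" for h
    using that
  proof induction
    case via_zero
    have "comp_map (zero_map ?E) \<iota> = comp_map \<iota> (zero_map X :: int \<Rightarrow> 'w \<Rightarrow> 'w)"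
      using \<iota>r(4) by (simp add: comp_map_def zero_map_def)
    then show ?case using c
      by (intro exI[of _ "zero_map ?E"]) (auto intro!: via.via_zero hty_refl cm_comp[OF _ \<iota>] cm_zero)
  next
    \<comment> \<open>A summand through \<open>R n\<close> extends from both sides. As C lies in add
      P[c n], the composite of \<alpha> and i lifts through \<open>\<gamma> n\<close>; so i followed
      by \<open>\<kappa> n\<close> kills \<alpha> and extends to I from E to
      \<open>R (Suc n)\<close>. As \<open>Q n\<close> lies there too, p after
      \<open>\<gamma> n\<close> lifts through \<alpha>; so p followed by \<iota> extends to P' from
      \<open>R (Suc n)\<close> to E. The composite of I and P' is the new summand.\<close>
    case (via_left f i p)
    obtain H where H: "via (R (Suc n)) (PS (Suc n)) ?E ?E H" "hty X ?E (comp_map H \<iota>) (comp_map \<iota> f)" using via_left(4) by blast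
    obtain a where a: "a \<in> cm C (Q n)" "hty C (R n) (comp_map (comp_map i \<alpha>) id_map) (comp_map (\<gamma> n) a)"
      using lift_via[OF vC cx_PS c(1,1) cx_Q cx_R \<gamma> cm_comp[OF \<alpha> via_left(2)]] \<gamma>_lift[of _ n] by (auto simp: PS_def c_def)
    have "hty C (R (Suc n)) (comp_map (\<kappa> n) (comp_map i \<alpha>)) (comp_map (\<kappa> n) (comp_map (\<gamma> n) a))"
      using a c by (intro hty_comp_left[OF _ \<kappa>] cm_comp[OF a(1) \<gamma>]) auto
    moreover have "null C (R (Suc n)) (comp_map (comp_map (\<kappa> n) (\<gamma> n)) a)"
      using c by (intro null_comp_right[OF \<kappa>_null a(1)]) auto
    ultimately have "null C (R (Suc n)) (comp_map (comp_map (\<kappa> n) i) \<alpha>)"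
      using c by (auto simp: comp_assoc intro: null_hty)
    then obtain I where I: "I \<in> cm ?E (R (Suc n))" "hty X (R (Suc n)) (comp_map I \<iota>) (comp_map (\<kappa> n) i)"
      using cone_extend[OF c(1,2) \<alpha> cx_R cm_comp[OF via_left(2) \<kappa>]] unfolding \<iota>_def by blast
    obtain b where b: "b \<in> cm (Q n) C" "hty (Q n) X (comp_map (comp_map p (\<gamma> n)) id_map) (comp_map \<alpha> b)"
      using lift_via[OF QS cx_PS cx_Q cx_Q c(1,2) \<alpha> cm_comp[OF \<gamma> via_left(3)] lift] by auto
    have "hty (Q n) ?E (comp_map \<iota> (comp_map p (\<gamma> n))) (comp_map \<iota> (comp_map \<alpha> b))"
      using b c by (intro hty_comp_left[OF _ \<iota>] cm_comp[OF b(1) \<alpha>]) auto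
    moreover have "null (Q n) ?E (comp_map (comp_map \<iota> \<alpha>) b)"
      using c by (intro null_comp_right[OF \<iota>\<alpha> b(1)]) auto
    ultimately have "null (Q n) ?E (comp_map (comp_map \<iota> p) (\<gamma> n))"
      using c by (auto simp: comp_assoc intro: null_hty)
    then obtain P' where P': "P' \<in> cm (R (Suc n)) ?E" "hty (R n) ?E (comp_map P' (\<kappa> n)) (comp_map \<iota> p)"
      using \<kappa>_extend[OF c(3) cm_comp[OF via_left(3) \<iota>]] by blast
    note fc = via_cm[OF via_left(1) c(2,2)] and Hc = via_cm[OF H(1) c(3,3)]
    have PI: "comp_map P' I \<in> cm ?E ?E" by (rule cm_comp[OF I(1) P'(1)])
    have pi: "comp_map p i \<in> cm X X" by (rule cm_comp[OF via_left(2,3)])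
    have 1: "hty X ?E (comp_map P' (comp_map I \<iota>)) (comp_map P' (comp_map (\<kappa> n) i))"
      using c by (intro hty_comp_left[OF I(2) P'(1)] cm_comp[OF via_left(2) \<kappa>]) auto
    have 2: "hty X ?E (comp_map (comp_map P' (\<kappa> n)) i) (comp_map (comp_map \<iota> p) i)"
      using c by (intro hty_comp_right[OF P'(2) via_left(2)]) auto
    have ip: "comp_map \<iota> (comp_map p i) \<in> cm X ?E" by (rule cm_comp[OF pi \<iota>])
    have 3: "hty X ?E (comp_map (comp_map P' I) \<iota>) (comp_map \<iota> (comp_map p i))"
      using hty_trans[OF 1 _ c(2,3) ip] 2 by (simp add: comp_assoc)
    have 4: "hty X ?E (add_map ?E (comp_map H \<iota>) (comp_map (comp_map P' I) \<iota>)) (add_map ?E (comp_map \<iota> f) (comp_map \<iota> (comp_map p i)))"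
      by (rule hty_add[OF H(2) 3 c(2,3) cm_comp[OF fc \<iota>] ip])
    have 5: "hty X ?E (add_map ?E (comp_map \<iota> f) (comp_map \<iota> (comp_map p i))) (comp_map \<iota> (add_map X f (comp_map p i)))"
      by (rule hty_sym[OF \<iota>add[OF fc pi] c(2,3)]) (rule cm_add[OF c(2,3) cm_comp[OF fc \<iota>] ip])
    have "comp_map (add_map ?E H (comp_map P' I)) \<iota> = add_map ?E (comp_map H \<iota>) (comp_map (comp_map P' I) \<iota>)"
      by (simp add: comp_map_def add_map_def)
    moreover have "hty X ?E (add_map ?E (comp_map H \<iota>) (comp_map (comp_map P' I) \<iota>)) (comp_map \<iota> (add_map X f (comp_map p i)))"
      by (rule hty_trans[OF 4 5 c(2,3) cm_comp[OF cm_add[OF c(2,2) fc pi] \<iota>]])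
    ultimately show ?case using via.via_left[OF H(1) I(1) P'(1)] by auto
  next
    \<comment> \<open>A map from \<open>PS n\<close> to X lifts through \<alpha> and therefore dies
      in E. The summand contributes nothing there and \<open>H\<close> can be kept.\<close>
    case (via_right f i p)
    obtain H where H: "via (R (Suc n)) (PS (Suc n)) ?E ?E H" "hty X ?E (comp_map H \<iota>) (comp_map \<iota> f)" using via_right(4) by blast
    obtain v where v: "v \<in> cm (PS n) C" "hty (PS n) X p (comp_map \<alpha> v)" using lift[OF via_right(3)] by blast
    note fc = via_cm[OF via_right(1) c(2,2)]
    have pi: "comp_map p i \<in> cm X X" by (rule cm_comp[OF via_right(2,3)])
    have ip: "comp_map \<iota> (comp_map p i) \<in> cm X ?E" by (rule cm_comp[OF pi \<iota>])
    have "hty (PS n) ?E (comp_map \<iota> p) (comp_map \<iota> (comp_map \<alpha> v))"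
      using c by (intro hty_comp_left[OF v(2) \<iota>] cm_comp[OF v(1) \<alpha>]) auto
    moreover have "null (PS n) ?E (comp_map (comp_map \<iota> \<alpha>) v)"
      using c by (intro null_comp_right[OF \<iota>\<alpha> v(1)]) auto
    ultimately have "null (PS n) ?E (comp_map \<iota> p)" using c by (auto simp: comp_assoc intro: null_hty)
    then have n: "null X ?E (comp_map \<iota> (comp_map p i))"
      using null_comp_right[OF _ via_right(2) c(2) cx_PS c(3), of "comp_map \<iota> p"] by (simp add: comp_assoc)
    have "hty X ?E (add_map ?E (comp_map \<iota> f) (comp_map \<iota> (comp_map p i))) (add_map ?E (comp_map \<iota> f) (zero_map ?E))"
      using c by (intro hty_add[OF hty_refl n] cm_comp[OF fc \<iota>] cm_zero) auto
    then have "hty X ?E (add_map ?E (comp_map \<iota> f) (comp_map \<iota> (comp_map p i))) (comp_map \<iota> f)"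
      by (rule hty_trans[OF _ add_map_zero(2)[OF c(2,3) cm_comp[OF fc \<iota>]] c(2,3) cm_comp[OF fc \<iota>]])
    then have "hty X ?E (comp_map \<iota> (add_map X f (comp_map p i))) (comp_map \<iota> f)"
      by (rule hty_trans[OF \<iota>add[OF fc pi] _ c(2,3) cm_comp[OF fc \<iota>]])
    then have "hty X ?E (comp_map \<iota> f) (comp_map \<iota> (add_map X f (comp_map p i)))"
      by (rule hty_sym[OF _ c(2,3) cm_comp[OF fc \<iota>]])
    then have "hty X ?E (comp_map H \<iota>) (comp_map \<iota> (add_map X f (comp_map p i)))"
      by (rule hty_trans[OF H(2) _ c(2,3) cm_comp[OF cm_add[OF c(2,2) fc pi] \<iota>]])
    then show ?case using H(1) by blast
  next
    case (via_hty f g)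
    obtain H where H: "via (R (Suc n)) (PS (Suc n)) ?E ?E H" "hty X ?E (comp_map H \<iota>) (comp_map \<iota> f)" using via_hty(4) by blast
    have "hty X ?E (comp_map \<iota> f) (comp_map \<iota> g)" by (rule hty_comp_left[OF via_hty(3) \<iota> c(2,2,3) via_hty(2)])
    then have "hty X ?E (comp_map H \<iota>) (comp_map \<iota> g)" by (rule hty_trans[OF H(2) _ c(2,3) cm_comp[OF via_hty(2) \<iota>]])
    then show ?case using H(1) by blast
  qed
  obtain H where H: "via (R (Suc n)) (PS (Suc n)) ?E ?E H" "hty X ?E (comp_map H \<iota>) \<iota>"
    using ext[OF vX] by auto
  note Hc = via_cm[OF H(1) c(3,3)] and Hr = cm_rules[OF c(3,3) via_cm[OF H(1) c(3,3)]]
  define D where "D = add_map ?E id_map (neg_map ?E H)"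
  have D: "D \<in> cm ?E ?E" unfolding D_def using c Hc by (intro cm_add cm_neg cm_id)
  have "hty X ?E \<iota> (comp_map H \<iota>)" by (rule hty_sym[OF H(2) c(2,3) \<iota>])
  then have "null X ?E (add_map ?E \<iota> (neg_map ?E (comp_map H \<iota>)))"
    using hty_iff_null[OF c(2,3) \<iota> cm_comp[OF \<iota> Hc]] by simp
  moreover have "comp_map D \<iota> = add_map ?E \<iota> (neg_map ?E (comp_map H \<iota>))"
    by (simp add: D_def comp_map_def add_map_def neg_map_def id_map_def)
  ultimately have "null X ?E (comp_map D \<iota>)" by simp
  then obtain G where G: "G \<in> cm (shift 1 C) ?E" "hty ?E ?E D (comp_map G fst_map)"
    using cone_factor[OF c(1,2) \<alpha> c(3) D] unfolding \<iota>_def by blast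
  have \<delta>: "fst_map \<in> cm ?E (shift 1 C)" by (rule cone_out_cm[OF c(1,2) \<alpha>])
  have cS: "cx (shift 1 C)" using c by simp
  \<comment> \<open>The object P[c n][1] agrees with P[c n + 1] only up to signs, so the comparison
    goes through the unsigned shift.\<close>
  have PP: "via (PS (Suc n)) (PS (Suc n)) (shift 1 (PS n)) (shift 1 (PS n)) id_map"
  proof -
    have 1: "ret (shift 1 (PS n)) (reindex 1 (PS n))" by (rule ret_shift(1)[OF cx_PS])
    have 2: "ret (reindex 1 (PS n)) (reindex (1 + c n) P)" unfolding PS_def by (rule ret_shift_reindex(1)[OF cx_P])
    have 3: "ret (reindex (1 + c n) P) (PS (Suc n))" unfolding PS_def c_Suc using ret_shift(2)[OF cx_P, of "1 + c n"] by (simp add: add.commute)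
    show ?thesis
      by (rule via_id_trans[OF via_id_trans[OF via_ret[OF 1] via_ret[OF 2]] via_ret[OF 3]]) auto
  qed
  have "via (PS (Suc n)) (PS (Suc n)) (shift 1 C) (shift 1 C) id_map"
    by (rule via_id_trans[OF via_shift[OF vC cx_PS c(1)] PP]) (use cS in auto)
  then have "via (PS (Suc n)) (PS (Suc n)) ?E ?E (comp_map G (comp_map id_map fst_map))"
    by (rule via_comp[OF _ \<delta> G(1) cS cS c(3,3)])
  then have "via (R (Suc n)) (PS (Suc n)) ?E ?E (comp_map G fst_map)"
    by (rule_tac via_same_right) simp
  moreover have "hty ?E ?E (comp_map G fst_map) D" by (rule hty_sym[OF G(2) c(3,3) cm_comp[OF \<delta> G(1)]])
  ultimately have "via (R (Suc n)) (PS (Suc n)) ?E ?E D" using D by (rule_tac via_hty)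
  then have "via (R (Suc n)) (PS (Suc n)) ?E ?E (add_map ?E D H)" by (rule via_add[OF H(1) _ c(3,3)])
  moreover have "hty ?E ?E (add_map ?E D H) id_map"
  proof (rule hty_eq[OF c(3,3) cm_add[OF c(3,3) D Hc]])
    fix k x assume x: "x \<in> carrier (Ob ?E k)"
    show "add_map ?E D H k x = id_map k x"
      using x cx_rmod[OF c(3), of k] Hr(1)[OF x] rmod_simps(5)[OF cx_rmod[OF c(3)] x] rmod_simps(3,7)[OF cx_rmod[OF c(3)] Hr(1)[OF x]]
      unfolding D_def add_map_def neg_map_def id_map_def by (metis rmod_ac(1))
  qed
  ultimately show ?thesis by (rule_tac via_hty[OF _ cm_id])
qed

text \<open>Descending induction from \<open>N\<close>. The approximation C \<rightarrow> X leads
  from level \<open>n\<close> to its cone at level \<open>n + 1\<close>, and rotating the triangle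
  returns to X once C and the cone are generated.\<close>

lemma generation:
  fixes X :: "('a, 'w) cplx" and J' :: "'w \<times> 'w \<Rightarrow> 'w" and E0 :: "'u \<Rightarrow> 'w"
  assumes J': "inj J'" and E0: "inj E0"
    and base: "\<And>X :: ('a, 'w) cplx. kb X \<Longrightarrow> via (R N) (PS N) X X id_map \<Longrightarrow> tri_generated A S X"
    and X: "kb X" "via (R n) (PS n) X X id_map" "n \<le> N"
  shows "tri_generated A S X"
  using X(3,1,2)
proof (induction n arbitrary: X rule: inc_induct)
  case base
  then show ?case by (rule assms(3))
next
  case (step n)
  have Ji: "inj_on J' B" for B by (rule inj_on_subset[OF J']) simp
  have cX: "cx X" using step by simp
  obtain C \<alpha> where C: "kb (C :: ('a, 'w) cplx)" "via (PS n) (PS n) C C id_map" "\<alpha> \<in> cm C X"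
    and l: "\<And>f. f \<in> cm (PS n) X \<Longrightarrow> \<exists>v\<in>cm (PS n) C. hty (PS n) X (comp_map id_map f) (comp_map \<alpha> v)"
    using cover[OF J' E0 step(5) cX cX] by blast
  have cC: "cx C" using C by simp
  have v1: "via (R (Suc n)) (PS (Suc n)) (cone C X \<alpha>) (cone C X \<alpha>) id_map"
    using l by (intro approximation_step[OF step(4) C(1) step(5) C(2,3)]) auto
  moreover have cE: "cx (cone C X \<alpha>)" using cC cX C(3) by simp
  moreover have kE: "kb (push J' (cone C X \<alpha>))" using C step(4) Ji by (intro kb_push kb_cone)
  moreover have cpE: "cx (push J' (cone C X \<alpha>))" using kE by simp
  ultimately have "via (R (Suc n)) (PS (Suc n)) (push J' (cone C X \<alpha>)) (push J' (cone C X \<alpha>)) id_map"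
    using via_trans[OF via_ret[OF ret_push(2)[OF cE Ji] cpE cE] v1 v1 cpE cpE cE cE] by blast
  then have tE: "tri_generated A S (push J' (cone C X \<alpha>))" using step(3) kE by blast
  \<comment> \<open>C lies in add P[c n], whereas the hypothesis at level \<open>N\<close> speaks of
    P[c N]. The shift by the difference moves one to the other, and a generated subcategory is
    stable under shifts.\<close>
  let ?d = "c N - c n"
  have "via (PS N) (PS N) (shift ?d (PS n)) (shift ?d (PS n)) id_map"
  proof -
    have 1: "ret (shift ?d (PS n)) (reindex ?d (PS n))" by (rule ret_shift(1)[OF cx_PS])
    have 2: "ret (reindex ?d (PS n)) (reindex (?d + c n) P)" unfolding PS_def by (rule ret_shift_reindex(1)[OF cx_P])
    have 3: "ret (reindex (?d + c n) P) (PS N)" unfolding PS_def using ret_shift(2)[OF cx_P, of "?d + c n"] by simp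
    show ?thesis
      by (rule via_id_trans[OF via_id_trans[OF via_ret[OF 1] via_ret[OF 2]] via_ret[OF 3]]) auto
  qed
  then have "via (PS N) (PS N) (shift ?d C) (shift ?d C) id_map"
    using cC by (rule_tac via_id_trans[OF via_shift[OF C(2) cx_PS cC]]) auto
  then have "via (R N) (PS N) (shift ?d C) (shift ?d C) id_map" by (rule via_same_right)
  then have "tri_generated A S (shift ?d C)" using C(1) by (rule_tac assms(3)) auto
  then have tC: "tri_generated A S C" using tri_shift_iff[OF cC] by blast
  show ?case by (rule tri_rotation[OF cC cX C(3) J' tC tE])
qed

text \<open>A dual basis writes the identity of M as a sum of maps through A, and \<open>R 0\<close>
  is a copy of A. The induction runs over the partial sums.\<close>

lemma via_stalk:
  fixes M :: "('a, 'w) module"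
  assumes "fgp M"
  shows "via (R 0) (PS 0) (stalk M) (stalk M) id_map"
proof -
  obtain n e \<epsilon> where M: "rmod M" and d: "dual_basis M n e \<epsilon>" using assms by (auto simp: fgp_iff)
  note dd = dual_basisD[OF d M]
  have c: "cx (stalk M)" "cx (stalk reg)" using M by auto
  have st: "(\<lambda>n. f) \<in> cm (stalk L) (stalk L')" if "f \<in> hom L L'" "rmod L" "rmod L'" for f L L'
    using that hom_rules(4)[OF that(2,3,1)]
    by (intro cmI) (auto simp: stalk_def zero_module_def intro!: homI simp: hom_rules[OF that(2,3,1)])
  have "via (stalk reg) (stalk reg) (stalk M) (stalk M) (\<lambda>m x. msum M (\<lambda>j. \<epsilon> j x \<odot>\<^bsub>M\<^esub> e j) k)" if "k \<le> n" for k
    using that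
  proof (induction k)
    case 0
    have "(\<lambda>m x. msum M (\<lambda>j. \<epsilon> j x \<odot>\<^bsub>M\<^esub> e j) 0) = (zero_map (stalk M) :: int \<Rightarrow> 'w \<Rightarrow> 'w)"
      by (auto simp: zero_map_def stalk_def zero_module_def)
    then show ?case using via_zero by metis
  next
    case (Suc k)
    have i: "(\<lambda>m. \<epsilon> k) \<in> cm (stalk M) (stalk reg)" and p: "(\<lambda>m a. a \<odot>\<^bsub>M\<^esub> e k) \<in> cm (stalk reg) (stalk M)"
      using dd(1,2)[of k] Suc M by (auto intro!: st smult_hom)
    have "(\<lambda>m x. msum M (\<lambda>j. \<epsilon> j x \<odot>\<^bsub>M\<^esub> e j) (Suc k)) = add_map (stalk M) (\<lambda>m x. msum M (\<lambda>j. \<epsilon> j x \<odot>\<^bsub>M\<^esub> e j) k) (comp_map (\<lambda>m a. a \<odot>\<^bsub>M\<^esub> e k) (\<lambda>m. \<epsilon> k))"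
      by (auto simp: add_map_def comp_map_def stalk_def zero_module_def)
    then show ?case using via_left[OF Suc.IH i p] Suc by simp
  qed
  then have v: "via (stalk reg) (stalk reg) (stalk M) (stalk M) (\<lambda>m x. msum M (\<lambda>j. \<epsilon> j x \<odot>\<^bsub>M\<^esub> e j) n)" by blast
  have "hty (stalk M) (stalk M) (\<lambda>m x. msum M (\<lambda>j. \<epsilon> j x \<odot>\<^bsub>M\<^esub> e j) n) id_map"
  proof (rule hty_eq[OF c(1,1) via_cm[OF v c(1,1)]])
    fix m x assume "x \<in> carrier (Ob (stalk M) m)"
    then have "x \<in> carrier M" using M by (auto simp: stalk_def zero_module_def split: if_splits)
    then show "msum M (\<lambda>j. \<epsilon> j x \<odot>\<^bsub>M\<^esub> e j) n = id_map m x" by (simp add: id_map_def dd(4))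
  qed
  then have 1: "via (stalk reg) (stalk reg) (stalk M) (stalk M) id_map" by (rule via_hty[OF v cm_id])
  have "ret (stalk reg) (R 0)" unfolding R_0 by (rule ret_push(1)[OF c(2) stalk_inj])
  then have 2: "via (R 0) (PS 0) (stalk reg) (stalk reg) id_map" using c(2) cx_R by (rule via_ret)
  show ?thesis by (rule via_trans[OF 1 2 2]) (use c in auto)
qed

text \<open>Stalks of projectives start at level 0 of \<open>generation\<close>;
  \<open>tri_bounded\<close> assembles every complex in K^b(proj A) from them.\<close>

lemma tri_perfect:
  fixes X :: "('a, 'w) cplx" and J' :: "'w \<times> 'w \<Rightarrow> 'w" and E0 :: "'u \<Rightarrow> 'w"
  assumes J': "inj J'" and E0: "inj E0"
    and base: "\<And>X :: ('a, 'w) cplx. kb X \<Longrightarrow> via (R N) (PS N) X X id_map \<Longrightarrow> tri_generated A S X"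
    and X: "perfect A X"
  shows "tri_generated A S X"
proof -
  obtain Y :: "('a, 'w) cplx" where Y: "kb Y" "derived_iso A Y X" and cX: "cx X" using X by (auto simp: perfect_def)
  have "tri_generated A S Y"
  proof (rule tri_bounded[OF _ _ Y(1)])
    fix M :: "('a, 'w) module" assume M: "fgp M"
    then show "tri_generated A S (stalk M)"
      using generation[where n = 0 and N = N and S = S, OF J' E0 base kb_stalk[OF M] via_stalk[OF M]] by simp
  next
    fix Z :: "('a, 'w) cplx" assume Z: "kb Z" "zero_complex Z"
    have cZ: "cx Z" using Z by simp
    have "hty Z Z (zero_map Z) id_map"
      using Z(2) cZ by (intro hty_eq cm_zero) (auto simp: zero_complex_def zero_map_def id_map_def)
    then have "via (R N) (PS N) Z Z id_map" by (rule via_hty[OF via_zero cm_id])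
    then show "tri_generated A S Z" using base Z by blast
  qed
  then show ?thesis by (rule tri_generated.iso[OF _ cX Y(2)])
qed

end

section \<open>Runs of the construction\<close>

context approximation
begin

lemma partial_tilting_iff:
  fixes \<Theta> :: "('a, 'u \<times> 'u) cplx"
  assumes q: "qis (TR n) \<Theta> q" and c: "cx \<Theta>"
  shows "partial_tilting A \<Theta> \<longleftrightarrow> (\<forall>i. i \<noteq> 0 \<longrightarrow> VZ (TR n) (TR n) i)"
proof -
  have cT: "cx (TR n)" using kb_TR by (rule kb_cx)
  have "perfect A \<Theta>" using c kb_TR[of n] derived_isoI[OF q cT] unfolding perfect_def by blast
  moreover have "homD_zero A \<Theta> (shift i \<Theta>) \<longleftrightarrow> VZ (TR n) (TR n) i" for i
    using homD_zero_iff[OF kb_TR[of n] q c, of "shift i \<Theta>"] HZ_shift[OF cT c, of i] VZ_qis[OF kb_TR[of n] q cT c, of i] c by simp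
  ultimately show ?thesis by (simp add: partial_tilting_def)
qed

text \<open>Generation is automatic: the two summands of the model \<open>TR n\<close> generate by
  \<open>tri_perfect\<close>, so being tilting reduces to self-orthogonality. The diagonal embedding
  and the pairing on pairs are needed since \<Theta>_n lives on pairs.\<close>

lemma tilting_iff:
  fixes \<Theta> :: "('a, 'u \<times> 'u) cplx" and J' :: "('u \<times> 'u) \<times> ('u \<times> 'u) \<Rightarrow> 'u \<times> 'u" and E0 :: "'u \<Rightarrow> 'u \<times> 'u"
  assumes J': "inj J'" and E0: "inj E0" and q: "qis (TR n) \<Theta> q" and c: "cx \<Theta>"
  shows "tilting A \<Theta> \<longleftrightarrow> (\<forall>i. i \<noteq> 0 \<longrightarrow> VZ (TR n) (TR n) i)"
proof -
  have cT: "cx (TR n)" using kb_TR by (rule kb_cx)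
  have base: "tri_generated A (in_add A \<Theta>) X" if X: "kb X" "via (R n) (PS n) X X id_map" for X :: "('a, 'u \<times> 'u) cplx"
  proof -
    have cX: "cx X" using X by simp
    have r: "ret (R n) (TR n)" "ret (PS n) (TR n)" unfolding TR_def using ret_dsum[OF cx_R cx_PS] by auto
    have "via (TR n) (TR n) X X id_map"
      by (rule via_trans[OF X(2) via_ret[OF r(1) cx_R cT] via_ret[OF r(2) cx_PS cT] cX cX cx_R cx_PS])
    then show ?thesis using via_in_add[OF J' _ q cX cT c] cX by (blast intro: tri_generated.base)
  qed
  have "tri_generated A (in_add A \<Theta>) X" if "perfect A X" for X :: "('a, 'u \<times> 'u) cplx"
    by (rule tri_perfect[OF J' E0 base that])
  then show ?thesis using partial_tilting_iff[OF q c] by (auto simp: tilting_def)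
qed

end

context complexes_over
begin

text \<open>Chain maps see differentials on carriers only. This makes the sets literally equal for a
  complex and its shift forth and back, whose differential is negated twice when the shift is
  odd.\<close>

lemma cm_cong:
  assumes "Ob X = Ob X'" "Ob Y = Ob Y'"
    and "\<And>n x. x \<in> carrier (Ob X n) \<Longrightarrow> Diff X n x = Diff X' n x"
    and "\<And>n x. x \<in> carrier (Ob Y n) \<Longrightarrow> Diff Y n x = Diff Y' n x"
  shows "cm X Y = cm X' Y'"
proof -
  have "f n x \<in> carrier (Ob Y' n)" if "f n \<in> hom (Ob X' n) (Ob Y' n)" "x \<in> carrier (Ob X' n)" for f n x
    using that by (auto simp: rm_hom_def)
  then show ?thesis using assms unfolding chain_map_def by (intro Collect_cong) (metis (no_types, lifting))
qed

lemma hty_cong: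
  assumes "Ob X = Ob X'" "Ob Y = Ob Y'"
    and "\<And>n x. x \<in> carrier (Ob X n) \<Longrightarrow> Diff X n x = Diff X' n x"
    and "\<And>n x. x \<in> carrier (Ob Y n) \<Longrightarrow> Diff Y n x = Diff Y' n x"
  shows "hty X Y f g \<longleftrightarrow> hty X' Y' f g"
proof -
  have "h n x \<in> carrier (Ob Y' (n - 1))" if "h n \<in> hom (Ob X' n) (Ob Y' (n - 1))" "x \<in> carrier (Ob X' n)" for h n x
    using that by (auto simp: rm_hom_def)
  then show ?thesis using assms unfolding homotopic_def by (metis (no_types, lifting))
qed

lemma shift_shift_Ob: "Ob (shift k (shift (- k) X)) = Ob X" "Ob (shift (- k) (shift k X)) = Ob X"
  by (simp_all add: shift_def)

lemma shift_shift_Diff: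
  assumes "cx X" "x \<in> carrier (Ob X n)"
  shows "Diff (shift k (shift (- k) X)) n x = Diff X n x" "Diff (shift (- k) (shift k X)) n x = Diff X n x"
  using rmod_simps(8)[OF cx_rmod[OF assms(1)] diff_rules(1)[OF assms(1) refl assms(2)]]
  by (simp_all add: shift_def)

text \<open>For odd \<open>k\<close> both differentials change sign, hence so must the
  homotopy.\<close>

lemma hty_shift_map:
  assumes f: "hty X Y f g" and c: "cx X" "cx Y"
  shows "hty (shift k X) (shift k Y) (shift_map k f) (shift_map k g)"
  using f c
proof (rule htyE)
  fix h assume h: "\<And>n. h n \<in> hom (Ob X n) (Ob Y (n - 1))"
    and hc: "\<And>n m x. m = n - 1 \<Longrightarrow> x \<in> carrier (Ob X n) \<Longrightarrow> h n x \<in> carrier (Ob Y m)"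
    and hm: "\<And>n x. x \<in> carrier (Ob X n) \<Longrightarrow> h n (\<ominus>\<^bsub>Ob X n\<^esub> x) = \<ominus>\<^bsub>Ob Y (n - 1)\<^esub> h n x"
    and e: "\<And>n x. x \<in> carrier (Ob X n) \<Longrightarrow>
      f n x = g n x \<oplus>\<^bsub>Ob Y n\<^esub> (Diff Y (n - 1) (h n x) \<oplus>\<^bsub>Ob Y n\<^esub> h (n + 1) (Diff X n x))"
  let ?h = "\<lambda>n x. if even k then h (n + k) x else \<ominus>\<^bsub>Ob Y (n + k - 1)\<^esub> h (n + k) x"
  show ?thesis
  proof (rule htyI[of ?h])
    have i: "n - 1 + k = n + k - 1" for n by simp
    show "?h n \<in> hom (Ob (shift k X) n) (Ob (shift k Y) (n - 1))" for n
      using h[of "n + k"] hom_neg[OF cx_rmod[OF c(1)] cx_rmod[OF c(2)] h[of "n + k"]]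
      by (cases "even k") (simp_all add: shift_def i)
    fix n x assume "x \<in> carrier (Ob (shift k X) n)"
    then have x: "x \<in> carrier (Ob X (n + k))" by (simp add: shift_def)
    have hx: "h (n + k) x \<in> carrier (Ob Y (n + k - 1))" by (rule hc[OF refl x])
    have dx: "Diff X (n + k) x \<in> carrier (Ob X (n + k + 1))" by (rule diff_rules(1)[OF c(1) refl x])
    have hdx: "h (n + k + 1) (Diff X (n + k) x) \<in> carrier (Ob Y (n + k))" using hc[OF _ dx] by simp
    have dm: "Diff Y (n + k - 1) (\<ominus>\<^bsub>Ob Y (n + k - 1)\<^esub> h (n + k) x) = \<ominus>\<^bsub>Ob Y (n + k)\<^esub> Diff Y (n + k - 1) (h (n + k) x)"
      using hom_rules(5)[OF cx_rmod[OF c(2)] cx_rmod[OF c(2)] reindex_diff_hom[OF c(2), of 0 "n + k - 1", simplified] hx] by simp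
    have dhx: "Diff Y (n + k - 1) (h (n + k) x) \<in> carrier (Ob Y (n + k))" using diff_rules(1)[OF c(2) _ hx] by simp
    have j: "n + 1 + k = n + k + 1" by simp
    show "shift_map k f n x = shift_map k g n x \<oplus>\<^bsub>Ob (shift k Y) n\<^esub>
        (Diff (shift k Y) (n - 1) (?h n x) \<oplus>\<^bsub>Ob (shift k Y) n\<^esub> ?h (n + 1) (Diff (shift k X) n x))"
      using e[OF x] dm rmod_simps(8)[OF cx_rmod[OF c(2)] dhx] rmod_simps(8)[OF cx_rmod[OF c(2)] hdx] hm[OF dx]
      by (auto simp: shift_def shift_map_def i j)
  qed
qed

text \<open>The construction approximates \<Delta>_n[-k] by add P, the sequence of models
  approximates \<Delta>_n by add P[k]. The shift by k translates the lifting property from one to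
  the other.\<close>

lemma shift_lift:
  fixes Y :: "('a, 'n) cplx"
  assumes c: "cx P" "cx Q" "cx Y" and g: "g \<in> cm Q (shift (- k) Y)"
    and l: "\<And>u. u \<in> cm P (shift (- k) Y) \<Longrightarrow> \<exists>v\<in>cm P Q. hty P (shift (- k) Y) u (comp_map g v)"
  shows "shift_map k g \<in> cm (shift k Q) Y"
    and "u \<in> cm (shift k P) Y \<Longrightarrow> \<exists>v\<in>cm (shift k P) (shift k Q). hty (shift k P) Y u (comp_map (shift_map k g) v)"
proof -
  have cmY: "cm W (shift k (shift (- k) Y)) = cm W Y" for W :: "('a, 'w) cplx"
    by (rule cm_cong) (auto simp: shift_shift_Ob shift_shift_Diff c)
  have htY: "hty (shift k P) (shift k (shift (- k) Y)) u w \<longleftrightarrow> hty (shift k P) Y u w" for u w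
    by (rule hty_cong) (auto simp: shift_shift_Ob shift_shift_Diff c)
  show "shift_map k g \<in> cm (shift k Q) Y"
    using cm_shift_map_shift[OF c(2) _ g, of k] cmY c by auto
  assume u: "u \<in> cm (shift k P) Y"
  have "cm (shift (- k) (shift k P)) (shift (- k) Y) = cm P (shift (- k) Y)"
    by (rule cm_cong) (auto simp: shift_shift_Ob shift_shift_Diff c)
  then have "shift_map (- k) u \<in> cm P (shift (- k) Y)"
    using cm_shift_map_shift[OF _ c(3) u, of "- k"] c by auto
  then obtain v where v: "v \<in> cm P Q" "hty P (shift (- k) Y) (shift_map (- k) u) (comp_map g v)" using l by blast
  have "hty (shift k P) Y (shift_map k (shift_map (- k) u)) (shift_map k (comp_map g v))"
    using hty_shift_map[OF v(2) c(1), of k] htY c by auto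
  moreover have "shift_map k (shift_map (- k) u) = u" "shift_map k (comp_map g v) = comp_map (shift_map k g) (shift_map k v)"
    by (simp_all add: shift_map_def comp_map_def)
  ultimately show "\<exists>v\<in>cm (shift k P) (shift k Q). hty (shift k P) Y u (comp_map (shift_map k g) v)"
    using cm_shift_map_shift[OF c(1,2) v(1), of k] by (intro bexI[of _ "shift_map k v"]) auto
qed

text \<open>Translates surjectivity on homotopy classes to representatives. Since
  \<open>homK_map\<close> is a union over a class, the lift found may be another representative than
  the one first chosen; if the target group is zero, the zero map is a lift.\<close>

lemma homK_lift:
  assumes c: "cx P" "cx Q" "cx T" and g: "g \<in> cm Q T"
    and s: "carrier (homK_module A P T) = {\<zero>\<^bsub>homK_module A P T\<^esub>} \<or>
      homK_map A P T g ` carrier (homK_module A P Q) = carrier (homK_module A P T)"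
    and u: "u \<in> cm P T"
  shows "\<exists>v\<in>cm P Q. hty P T u (comp_map g v)"
proof -
  have uu: "u \<in> homotopy_class A P T u" using u hty_refl[OF c(1,3) u] by (simp add: homotopy_class_def)
  have hu: "homotopy_class A P T u \<in> carrier (homK_module A P T)" using u by (simp add: homK_module_def)
  from s show ?thesis
  proof
    assume "carrier (homK_module A P T) = {\<zero>\<^bsub>homK_module A P T\<^esub>}"
    then have "homotopy_class A P T u = homotopy_class A P T (zero_map T)" using hu by (simp add: homK_module_def)
    then have "hty P T (zero_map T) u" using uu by (auto simp: homotopy_class_def)
    then have "hty P T u (zero_map T)" by (rule hty_sym[OF _ c(1,3) u])
    moreover have "comp_map g (zero_map Q) = (zero_map T :: int \<Rightarrow> 'b \<Rightarrow> 'd)"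
      using cm_rules(4)[OF c(2,3) g] by (simp add: comp_map_def zero_map_def)
    ultimately show ?thesis using cm_zero[OF c(1,2)] by metis
  next
    have homK_class: "\<exists>v\<in>cm P Q. C = homotopy_class A P Q v" if "C \<in> carrier (homK_module A P Q)" for C
      using that by (auto simp: homK_module_def)
    assume "homK_map A P T g ` carrier (homK_module A P Q) = carrier (homK_module A P T)"
    then obtain v where v: "v \<in> cm P Q" "homotopy_class A P T u = homK_map A P T g (homotopy_class A P Q v)"
      using hu by (metis (no_types, lifting) imageE homK_class)
    then obtain w where w: "w \<in> cm P Q" "hty P T (comp_map g w) u"
      using uu by (auto simp: homK_map_def homotopy_class_def)
    then show ?thesis using hty_sym[OF w(2) c(1,3) u] by blast
  qed
qed

text \<open>A roof between D and Y is straightened by K-projectivity of X: the quasi-isomorphism to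
  Y lifts to the apex and continues to D. Thus a derived isomorphism becomes an actual
  quasi-isomorphism out of a model.\<close>

lemma derived_iso_lift:
  fixes D :: "('a, 'n) cplx"
  assumes k: "kb X" and q: "qis X Y F" and d: "derived_iso A D Y" and c: "cx D" "cx Y"
  obtains q' where "qis X D q'"
proof -
  obtain Z :: "('a, 'n) cplx" and s f where Z: "cx Z" "qis Z D s" "qis Z Y f" using derived_isoE[OF d] by metis
  have cX: "cx X" using k by simp
  note Fc = qisD(1)[OF q cX c(2)] and fc = qisD(1)[OF Z(3,1) c(2)]
  obtain l where l: "l \<in> cm X Z" "hty X Y F (comp_map f l)" using qis_lift[OF k Z(3,1) c(2) Fc] by blast
  have "qis X Y (comp_map f l)" by (rule qis_hty[OF q l(2) cm_comp[OF l(1) fc] cX c(2)])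
  then have "qis X Z l" by (rule qis_cancel_left[OF Z(3) _ l(1) cX Z(1) c(2)])
  then have "qis X D (comp_map s l)" by (rule qis_comp[OF _ Z(2) cX Z(1) c(1)])
  then show thesis by (rule that)
qed

text \<open>The approximating map lifts along the quasi-isomorphism of the current model, and the
  cone of the lift is a model of the next complex. Cancelling \<open>q\<close> transfers the lifting
  property from D to R.\<close>

lemma resolution_step:
  fixes R C D D' :: "('a, 'u) cplx" and J :: "'u \<times> 'u \<Rightarrow> 'u"
  assumes J: "inj J" and k: "kb R" "kb C" and q: "qis R D q" and c: "cx D" "cx D'" "cx S" and S: "kb S"
    and G: "G \<in> cm C D" and l: "\<And>u. u \<in> cm S D \<Longrightarrow> \<exists>v\<in>cm S C. hty S D u (comp_map G v)"
    and d: "derived_iso A D' (cone C D G)"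
  obtains \<gamma> q' where "\<gamma> \<in> cm C R" "\<And>u. u \<in> cm S R \<Longrightarrow> \<exists>v\<in>cm S C. hty S R u (comp_map \<gamma> v)"
    "qis (push J (cone C R \<gamma>)) D' q'"
proof -
  have cc: "cx R" "cx C" using k by auto
  note qc = qisD(1)[OF q cc(1) c(1)]
  obtain \<gamma> where \<gamma>: "\<gamma> \<in> cm C R" "hty C D G (comp_map q \<gamma>)" using qis_lift[OF k(2) q cc(1) c(1) G] by blast
  have h: "hty C D (comp_map q \<gamma>) G" by (rule hty_sym[OF \<gamma>(2) cc(2) c(1) cm_comp[OF \<gamma>(1) qc]])
  have lift: "\<exists>v\<in>cm S C. hty S R u (comp_map \<gamma> v)" if u: "u \<in> cm S R" for u
  proof -
    obtain v where v: "v \<in> cm S C" "hty S D (comp_map q u) (comp_map G v)" using l[OF cm_comp[OF u qc]] by blast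
    have gv: "comp_map \<gamma> v \<in> cm S R" by (rule cm_comp[OF v(1) \<gamma>(1)])
    have "hty S D (comp_map G v) (comp_map (comp_map q \<gamma>) v)"
      by (rule hty_comp_right[OF \<gamma>(2) v(1) c(3) cc(2) c(1)])
    then have "hty S D (comp_map G v) (comp_map q (comp_map \<gamma> v))" by (simp add: comp_assoc)
    then have "hty S D (comp_map q u) (comp_map q (comp_map \<gamma> v))"
      by (rule hty_trans[OF v(2) _ c(3,1) cm_comp[OF gv qc]])
    then have "hty S R u (comp_map \<gamma> v)" by (rule qis_hty_cancel[OF S q cc(1) c(1) u gv])
    then show ?thesis using v(1) by blast
  qed
  have kC: "kb (cone C R \<gamma>)" using k \<gamma>(1) by (intro kb_cone)
  have cC: "cx (cone C R \<gamma>)" "cx (cone C D G)" using kC G cc c by auto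
  have Ji: "inj_on J B" for B by (rule inj_on_subset[OF J]) simp
  obtain F where "qis (cone C R \<gamma>) (cone C D G) F" using qis_cone_map[OF q \<gamma>(1) G h cc(2,1) c(1)] by blast
  then have F: "qis (push J (cone C R \<gamma>)) (cone C D G) (comp_map F (unpush J (cone C R \<gamma>)))"
    using cC kb_cx[OF kb_push[OF kC Ji]] by (rule_tac qis_comp[OF qis_push(2)[OF cC(1) Ji]]) auto
  obtain q' where "qis (push J (cone C R \<gamma>)) D' q'"
    using derived_iso_lift[OF kb_push[OF kC Ji] F d c(2) cC(2)] by blast
  then show thesis using that[OF \<gamma>(1) lift] by blast
qed

text \<open>The models cannot be chosen independently: the next map \<open>\<gamma>\<close> is a
  lift along the quasi-isomorphism chosen with the present model. So the dependent choice carries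
  pairs of a model and its quasi-isomorphism.\<close>

lemma resolution_sequence:
  fixes \<Delta> C S :: "nat \<Rightarrow> ('a, 'u) cplx" and J :: "'u \<times> 'u \<Rightarrow> 'u"
  assumes J: "inj J" and k: "kb R0" "\<And>n. kb (C n)" "\<And>n. kb (S n)" and c: "\<And>n. cx (\<Delta> n)"
    and q0: "qis R0 (\<Delta> 0) q0" and G: "\<And>n. G n \<in> cm (C n) (\<Delta> n)"
    and l: "\<And>n u. u \<in> cm (S n) (\<Delta> n) \<Longrightarrow> \<exists>v\<in>cm (S n) (C n). hty (S n) (\<Delta> n) u (comp_map (G n) v)"
    and d: "\<And>n. derived_iso A (\<Delta> (Suc n)) (cone (C n) (\<Delta> n) (G n))"
  obtains R \<gamma> q where "R 0 = R0" "\<And>n. qis (R n) (\<Delta> n) (q n)" "\<And>n. \<gamma> n \<in> cm (C n) (R n)"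
    "\<And>n u. u \<in> cm (S n) (R n) \<Longrightarrow> \<exists>v\<in>cm (S n) (C n). hty (S n) (R n) u (comp_map (\<gamma> n) v)"
    "\<And>n. R (Suc n) = push J (cone (C n) (R n) (\<gamma> n))"
proof -
  let ?P = "\<lambda>n x. kb (fst x) \<and> qis (fst x) (\<Delta> n) (snd x) \<and> (n = 0 \<longrightarrow> fst x = R0)"
  let ?G = "\<lambda>n R \<gamma>. \<gamma> \<in> cm (C n) R \<and> (\<forall>u\<in>cm (S n) R. \<exists>v\<in>cm (S n) (C n). hty (S n) R u (comp_map \<gamma> v))"
  let ?Q = "\<lambda>n x y. \<exists>\<gamma>. ?G n (fst x) \<gamma> \<and> fst y = push J (cone (C n) (fst x) \<gamma>)"
  have Ji: "inj_on J B" for B by (rule inj_on_subset[OF J]) simp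
  have "\<exists>f. \<forall>n. ?P n (f n) \<and> ?Q n (f n) (f (Suc n))"
  proof (rule dependent_nat_choice)
    show "\<exists>x. ?P 0 x" using k(1) q0 by (intro exI[of _ "(R0, q0)"]) simp
    fix x n assume P: "?P n x"
    obtain \<gamma> q' where g: "\<gamma> \<in> cm (C n) (fst x)"
      "\<And>u. u \<in> cm (S n) (fst x) \<Longrightarrow> \<exists>v\<in>cm (S n) (C n). hty (S n) (fst x) u (comp_map \<gamma> v)"
      "qis (push J (cone (C n) (fst x) \<gamma>)) (\<Delta> (Suc n)) q'"
      using P by (rule_tac resolution_step[OF J _ k(2) _ c c kb_cx[OF k(3)] k(3) G l d, of "fst x" n "snd x"]) auto
    have "kb (push J (cone (C n) (fst x) \<gamma>))" using P k g(1) Ji by (intro kb_push kb_cone) auto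
    then show "\<exists>y. ?P (Suc n) y \<and> ?Q n x y"
      using g by (intro exI[of _ "(push J (cone (C n) (fst x) \<gamma>), q')"]) auto
  qed
  then obtain f where f: "\<And>n. ?P n (f n)" "\<And>n. ?Q n (f n) (f (Suc n))" by blast
  obtain \<gamma> where "\<And>n. ?G n (fst (f n)) (\<gamma> n) \<and> fst (f (Suc n)) = push J (cone (C n) (fst (f n)) (\<gamma> n))"
    using f(2) by metis
  then show thesis using f(1) by (intro that[of "\<lambda>n. fst (f n)" "\<lambda>n. snd (f n)" \<gamma>]) auto
qed

end

text \<open>The form is \<open>\<tau> y = \<phi> 1 y\<close>; bilinearity of \<open>\<phi>\<close> gives \<open>\<phi> a y = \<tau> (a y) = \<tau> (y a)\<close>.\<close>

lemma symmetric_algebra_form: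
  fixes K :: "('k, 'kx) ring_scheme" and A :: "('k, 'a, 'ax) module_scheme"
  assumes f: "fin_dim_algebra K A" and s: "symmetric_algebra K A"
  obtains \<tau> where "symmetric_form A K \<tau>"
proof -
  have fK: "field K" and rA: "ring A" and mA: "module K A"
    and sm: "\<forall>c\<in>carrier K. \<forall>x\<in>carrier A. \<forall>y\<in>carrier A.
        (c \<odot>\<^bsub>A\<^esub> x) \<otimes>\<^bsub>A\<^esub> y = c \<odot>\<^bsub>A\<^esub> (x \<otimes>\<^bsub>A\<^esub> y) \<and> x \<otimes>\<^bsub>A\<^esub> (c \<odot>\<^bsub>A\<^esub> y) = c \<odot>\<^bsub>A\<^esub> (x \<otimes>\<^bsub>A\<^esub> y)"
    using f by (auto simp: fin_dim_algebra_def)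
  interpret K: field K by fact
  interpret A: ring A by fact
  interpret M: module K A by fact
  obtain \<phi> where b: "bij_betw \<phi> (carrier A) (linear_forms K A)"
    and ad: "\<And>x y z. x \<in> carrier A \<Longrightarrow> y \<in> carrier A \<Longrightarrow> z \<in> carrier A \<Longrightarrow> \<phi> (x \<oplus>\<^bsub>A\<^esub> y) z = \<phi> x z \<oplus>\<^bsub>K\<^esub> \<phi> y z"
    and bi: "\<And>a x b y. a \<in> carrier A \<Longrightarrow> x \<in> carrier A \<Longrightarrow> b \<in> carrier A \<Longrightarrow> y \<in> carrier A \<Longrightarrow>
      \<phi> (a \<otimes>\<^bsub>A\<^esub> x \<otimes>\<^bsub>A\<^esub> b) y = \<phi> x (b \<otimes>\<^bsub>A\<^esub> y \<otimes>\<^bsub>A\<^esub> a)"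
    using s by (auto simp: symmetric_algebra_def)
  have lf: "\<phi> x \<in> linear_forms K A" if "x \<in> carrier A" for x using b that by (auto simp: bij_betw_def)
  have \<phi>c: "\<phi> x y \<in> carrier K" if "x \<in> carrier A" "y \<in> carrier A" for x y
    using lf[OF that(1)] that by (auto simp: linear_forms_def)
  let ?\<tau> = "\<phi> \<one>\<^bsub>A\<^esub>"
  have 1: "\<phi> a y = ?\<tau> (y \<otimes>\<^bsub>A\<^esub> a)" "\<phi> a y = ?\<tau> (a \<otimes>\<^bsub>A\<^esub> y)" if "a \<in> carrier A" "y \<in> carrier A" for a y
    using bi[of a "\<one>\<^bsub>A\<^esub>" "\<one>\<^bsub>A\<^esub>" y] bi[of "\<one>\<^bsub>A\<^esub>" "\<one>\<^bsub>A\<^esub>" a y] that by simp_all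
  have z: "\<phi> \<zero>\<^bsub>A\<^esub> y = \<zero>\<^bsub>K\<^esub>" if "y \<in> carrier A" for y
    using ad[of "\<zero>\<^bsub>A\<^esub>" "\<zero>\<^bsub>A\<^esub>" y] \<phi>c[of "\<zero>\<^bsub>A\<^esub>" y] that K.add.r_cancel_one'[of "\<phi> \<zero>\<^bsub>A\<^esub> y" "\<phi> \<zero>\<^bsub>A\<^esub> y"] by simp
  have "symmetric_form A K ?\<tau>"
  proof (unfold_locales)
    show "x \<in> carrier A \<Longrightarrow> ?\<tau> x \<in> carrier K" for x by (rule \<phi>c) auto
    show "x \<in> carrier A \<Longrightarrow> y \<in> carrier A \<Longrightarrow> ?\<tau> (x \<oplus>\<^bsub>A\<^esub> y) = ?\<tau> x \<oplus>\<^bsub>K\<^esub> ?\<tau> y" for x y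
      using lf[of "\<one>\<^bsub>A\<^esub>"] by (simp add: linear_forms_def)
    show "x \<in> carrier A \<Longrightarrow> y \<in> carrier A \<Longrightarrow> ?\<tau> (x \<otimes>\<^bsub>A\<^esub> y) = ?\<tau> (y \<otimes>\<^bsub>A\<^esub> x)" for x y
      using 1 by metis
    show "x = \<zero>\<^bsub>A\<^esub>" if x: "x \<in> carrier A" and n: "\<And>y. y \<in> carrier A \<Longrightarrow> ?\<tau> (x \<otimes>\<^bsub>A\<^esub> y) = \<zero>\<^bsub>K\<^esub>" for x
    proof (rule inj_onD[OF bij_betw_imp_inj_on[OF b]])
      show "\<phi> x = \<phi> \<zero>\<^bsub>A\<^esub>"
      proof (rule extensionalityI)
        show "\<phi> x \<in> extensional (carrier A)" "\<phi> \<zero>\<^bsub>A\<^esub> \<in> extensional (carrier A)"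
          using lf[OF x] lf[of "\<zero>\<^bsub>A\<^esub>"] by (auto simp: linear_forms_def PiE_def)
        show "\<phi> x y = \<phi> \<zero>\<^bsub>A\<^esub> y" if "y \<in> carrier A" for y
          unfolding 1(2)[OF x that] n[OF that] z[OF that] ..
      qed
    qed (use x in auto)
    fix \<psi> assume \<psi>: "\<And>x. x \<in> carrier A \<Longrightarrow> \<psi> x \<in> carrier K"
      "\<And>x y. x \<in> carrier A \<Longrightarrow> y \<in> carrier A \<Longrightarrow> \<psi> (x \<oplus>\<^bsub>A\<^esub> y) = \<psi> x \<oplus>\<^bsub>K\<^esub> \<psi> y"
      "\<And>c x. c \<in> carrier K \<Longrightarrow> x \<in> carrier A \<Longrightarrow> \<psi> (c \<odot>\<^bsub>A\<^esub> x) = c \<otimes>\<^bsub>K\<^esub> \<psi> x"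
    have "restrict \<psi> (carrier A) \<in> linear_forms K A"
      using \<psi> module.smult_closed[OF mA] by (auto simp: linear_forms_def)
    then obtain a where a: "a \<in> carrier A" "\<phi> a = restrict \<psi> (carrier A)"
      using bij_betw_imp_surj_on[OF b] by (metis (no_types, lifting) imageE)
    have "?\<tau> (a \<otimes>\<^bsub>A\<^esub> y) = \<psi> y" if "y \<in> carrier A" for y using 1(2)[OF a(1) that] a(2) that by simp
    then show "\<exists>a\<in>carrier A. \<forall>y\<in>carrier A. ?\<tau> (a \<otimes>\<^bsub>A\<^esub> y) = \<psi> y" using a(1) by blast
  qed (use fK rA mA sm in auto)
  then show thesis by (rule that)
qed

lemma infinite_pairing:
  assumes "infinite (UNIV :: 'u set)"
  obtains J :: "'u \<times> 'u \<Rightarrow> 'u" where "inj J"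
proof -
  have "ordIso2 (card_of (UNIV \<times> UNIV :: ('u \<times> 'u) set)) (card_of (UNIV :: 'u set))"
    using assms by (rule card_of_Times_same_infinite)
  then obtain f :: "'u \<times> 'u \<Rightarrow> 'u" where "bij_betw f (UNIV \<times> UNIV) UNIV" using card_of_ordIso by blast
  then have "inj f" by (auto simp: bij_betw_def)
  then show thesis by (rule that)
qed

theorem theorem4p6:
  fixes K :: "('k, 'kx) ring_scheme"
    and A :: "('k, 'a, 'ax) module_scheme"
    and P :: "('a, 'u) cplx"
    and r :: nat and s :: int
    and \<Delta> Q :: "nat \<Rightarrow> ('a, 'u) cplx"
    and g :: "nat \<Rightarrow> int \<Rightarrow> 'u \<Rightarrow> 'u"
  assumes universe: "\<exists>\<iota> :: nat \<times> 'a \<Rightarrow> 'u. inj_on \<iota> (UNIV \<times> carrier A)"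
    and "fin_dim_algebra K A"
    and "symmetric_algebra K A"
    and "in_Kb_proj A P"
    and "partial_tilting A P"
    and "has_length P (int r + 1)"
    and "s = Max (cohomological_support P)"
    and "Delta_construction A P r s (regular_module A) \<Delta> Q g"
  shows "(\<forall>i>0. cohomology_zero (\<Delta> r) i) \<longleftrightarrow> (\<forall>n\<ge>r. tilting A (Theta P r s \<Delta> n))"
proof -
  obtain \<tau> where "symmetric_form A K \<tau>" using symmetric_algebra_form[OF assms(2,3)] .
  then interpret symmetric_form A K \<tau> .
  have kP: "kb P" and cP: "cx P" using assms(4) by auto
  obtain \<iota> :: "nat \<times> 'a \<Rightarrow> 'u" where \<iota>: "inj_on \<iota> (UNIV \<times> carrier A)" using universe by blast
  \<comment> \<open>The slice over 0 is a copy of A inside \<open>'u\<close>, on which the model of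
    \<Delta>_0 is built. The slice over the zero of A shows that \<open>'u\<close> is infinite and
    so admits a pairing.\<close>
  define a0 where "a0 a = \<iota> (0, a)" for a
  have a0: "inj_on a0 (carrier A)" using \<iota> by (auto simp: a0_def inj_on_def)
  have "inj (\<lambda>n. \<iota> (n, \<zero>\<^bsub>A\<^esub>))" using inj_onD[OF \<iota>] by (intro injI) fastforce
  then have inf: "infinite (UNIV :: 'u set)" by (metis infinite_UNIV_nat finite_imageD finite_subset subset_UNIV)
  obtain J :: "'u \<times> 'u \<Rightarrow> 'u" where J: "inj J" using infinite_pairing[OF inf] .
  have "infinite (UNIV :: ('u \<times> 'u) set)" using inf by (simp add: finite_prod)
  \<comment> \<open>\<Theta>_n is a complex on pairs, and so are the perfect complexes it has to
    generate; cones of those need a pairing of their own, and complexes on \<open>'u\<close> an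
    embedding.\<close>
  then obtain J' :: "('u \<times> 'u) \<times> ('u \<times> 'u) \<Rightarrow> 'u \<times> 'u" where J': "inj J'" by (rule infinite_pairing)
  have E0: "inj (\<lambda>x :: 'u. (x, x))" by (auto simp: inj_def)
  define c where "c n = int n + s - int r" for n
  \<comment> \<open>The target of the approximating map with index \<open>Suc n\<close>: its
    exponent r - s - (n + 1) + 1 is - c n.\<close>
  let ?T = "\<lambda>n. shift (- c n) (\<Delta> n)"
  have D0: "cx (\<Delta> 0)" "derived_iso A (\<Delta> 0) (stalk reg)"
    using assms(8) by (auto simp: Delta_construction_def)
  have i1: "int r - s - int (Suc n) + 1 = - c n" and i2: "int (Suc n) + s - int r - 1 = c n" for n by (auto simp: c_def)
  have DS: "kb (Q (Suc n)) \<and> g (Suc n) \<in> cm (Q (Suc n)) (?T n) \<and>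
      (if carrier (homK_module A P (?T n)) = {\<zero>\<^bsub>homK_module A P (?T n)\<^esub>} then zero_complex (Q (Suc n))
       else in_add A P (Q (Suc n)) \<and>
         projective_cover (end_ring A P) (homK_module A P (Q (Suc n))) (homK_module A P (?T n)) (homK_map A P (?T n) (g (Suc n)))) \<and>
      cx (\<Delta> (Suc n)) \<and> derived_iso A (\<Delta> (Suc n)) (cone (shift (c n) (Q (Suc n))) (\<Delta> n) (shift_map (c n) (g (Suc n))))" for n
  proof -
    have "let T = shift (int r - s - int (Suc n) + 1) (\<Delta> (Suc n - 1)) in
          in_Kb_proj A (Q (Suc n)) \<and>
          g (Suc n) \<in> chain_map A (Q (Suc n)) T \<and>
          (if carrier (homK_module A P T) = {\<zero>\<^bsub>homK_module A P T\<^esub>}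
           then zero_complex (Q (Suc n))
           else in_add A P (Q (Suc n)) \<and>
                projective_cover (end_ring A P) (homK_module A P (Q (Suc n))) (homK_module A P T)
                  (homK_map A P T (g (Suc n)))) \<and>
          is_complex A (\<Delta> (Suc n)) \<and>
          derived_iso A (\<Delta> (Suc n))
            (cone (shift (int (Suc n) + s - int r - 1) (Q (Suc n))) (\<Delta> (Suc n - 1))
                  (shift_map (int (Suc n) + s - int r - 1) (g (Suc n))))"
      using assms(8) unfolding Delta_construction_def by (elim conjE allE[of _ "Suc n"] impE) simp_all
    then show ?thesis unfolding Let_def i1 i2 diff_Suc_1 .
  qed
  have cD: "cx (\<Delta> n)" for n using D0 DS by (cases n) auto
  have kQ: "kb (Q (Suc n))" for n using DS by blast
  \<comment> \<open>If the Hom group vanishes, \<open>Q (Suc n)\<close> is a zero complex, and its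
    identity is the zero map, which lies in every ideal.\<close>
  have vQ: "via P P (Q (Suc n)) (Q (Suc n)) id_map" for n
  proof (cases "carrier (homK_module A P (?T n)) = {\<zero>\<^bsub>homK_module A P (?T n)\<^esub>}")
    case True
    have cQ: "cx (Q (Suc n))" using kQ by simp
    have "hty (Q (Suc n)) (Q (Suc n)) (zero_map (Q (Suc n))) id_map"
      using DS[of n] True cQ by (intro hty_eq cm_zero) (auto simp: zero_complex_def zero_map_def id_map_def)
    then show ?thesis by (rule via_hty[OF via_zero cm_id])
  next
    case False
    then show ?thesis using DS[of n] by (intro in_add_via[OF kQ kP]) auto
  qed
  have lift0: "\<exists>v\<in>cm P (Q (Suc n)). hty P (?T n) u (comp_map (g (Suc n)) v)" if "u \<in> cm P (?T n)" for n u
    using DS[of n] cD by (intro homK_lift[OF cP _ _ _ _ that]) (auto simp: projective_cover_def split: if_splits)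
  have G: "shift_map (c n) (g (Suc n)) \<in> cm (shift (c n) (Q (Suc n))) (\<Delta> n)"
    and lift: "u \<in> cm (shift (c n) P) (\<Delta> n) \<Longrightarrow> \<exists>v\<in>cm (shift (c n) P) (shift (c n) (Q (Suc n))).
      hty (shift (c n) P) (\<Delta> n) u (comp_map (shift_map (c n) (g (Suc n))) v)" for n u
    using shift_lift[OF cP kb_cx[OF kQ] cD _ lift0] DS[of n] by auto
  define R0 where "R0 = push a0 (stalk reg)"
  have inj0: "inj_on a0 (carrier (Ob (stalk reg) n))" for n
    by (rule inj_on_subset[OF a0]) (simp add: stalk_def zero_module_def)
  have cs: "cx (stalk reg)" by simp
  have k0: "kb R0" unfolding R0_def using inj0 fgp_reg by (intro kb_push kb_stalk)
  have "qis R0 (stalk reg) (unpush a0 (stalk reg))" unfolding R0_def by (rule qis_push(2)[OF cs inj0])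
  then obtain q0 where q0: "qis R0 (\<Delta> 0) q0" using derived_iso_lift[OF k0 _ D0(2,1) cs] by blast
  obtain R \<gamma> q where R: "R 0 = R0" "\<And>n. qis (R n) (\<Delta> n) (q n)" "\<And>n. \<gamma> n \<in> cm (shift (c n) (Q (Suc n))) (R n)"
    "\<And>n u. u \<in> cm (shift (c n) P) (R n) \<Longrightarrow>
      \<exists>v\<in>cm (shift (c n) P) (shift (c n) (Q (Suc n))). hty (shift (c n) P) (R n) u (comp_map (\<gamma> n) v)"
    "\<And>n. R (Suc n) = push J (cone (shift (c n) (Q (Suc n))) (R n) (\<gamma> n))"
    by (rule resolution_sequence[where C = "\<lambda>n. shift (c n) (Q (Suc n))" and S = "\<lambda>n. shift (c n) P" and \<Delta> = \<Delta>
      and G = "\<lambda>n. shift_map (c n) (g (Suc n))", OF J k0 _ _ cD q0 G lift]) (use DS kQ kP in auto)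
  \<comment> \<open>The largest degree in the support is s, so length r + 1 forces the smallest one
    to be s - r.\<close>
  have supp: "cohomology_zero P i" if "s < i \<or> i < s - int r" for i
  proof (rule ccontr)
    assume "\<not> cohomology_zero P i"
    then have "i \<in> cohomological_support P" by (simp add: cohomological_support_def)
    moreover have "finite (cohomological_support P)" "int r + 1 = s - Min (cohomological_support P) + 1"
      using assms(6,7) by (auto simp: has_length_def)
    ultimately show False using that Max_ge[of "cohomological_support P" i] Min_le[of "cohomological_support P" i] assms(7) by linarith
  qed
  have self: "VZ P P i" if "i \<noteq> 0" for i
    using assms(5) that homD_zero_iff[OF kP qis_id[OF cP] cP, of "shift i P"] HZ_shift[OF cP cP, of i] cP
    by (simp add: partial_tilting_def)
  interpret W: approximation A K \<tau> P r s a0 J R "\<lambda>n. shift (c n) (Q (Suc n))" \<gamma>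
  proof (unfold_locales, fold c_def)
    show "via (shift (c n) P) (shift (c n) P) (shift (c n) (Q (Suc n))) (shift (c n) (Q (Suc n))) id_map" for n
      by (rule via_shift[OF vQ cP kb_cx[OF kQ]])
  qed (use kP self supp a0 J R kQ in \<open>auto simp: R0_def\<close>)
  have PS: "W.PS n = shift (c n) P" for n by (simp add: W.PS_def W.c_def c_def)
  have Th: "Theta P r s \<Delta> n = dsum (\<Delta> n) (W.PS n)" for n by (simp add: Theta_def PS c_def)
  have "qis (W.TR n) (Theta P r s \<Delta> n) (dsum_map (q n) id_map)" for n
    unfolding W.TR_def Th by (rule qis_dsum[OF R(2) qis_id[OF W.cx_PS] W.cx_R cD W.cx_PS W.cx_PS])
  then have til: "tilting A (Theta P r s \<Delta> n) \<longleftrightarrow> (\<forall>i. i \<noteq> 0 \<longrightarrow> VZ (W.TR n) (W.TR n) i)" for n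
    using cD W.cx_PS by (rule_tac W.tilting_iff[OF J' E0]) (auto simp: Th)
  \<comment> \<open>Cohomology is Hom from the stalk of A, which is in K^b(proj A) and does not
    distinguish a complex from its model.\<close>
  have coh: "cohomology_zero (\<Delta> n) i \<longleftrightarrow> cohomology_zero (R n) i" for n i
    using VZ_regular_iff[OF cD] VZ_regular_iff[OF W.cx_R] VZ_qis[OF kb_stalk[OF fgp_reg] R(2) W.cx_R cD] by blast
  show ?thesis
  proof
    assume "\<forall>i>0. cohomology_zero (\<Delta> r) i"
    then show "\<forall>n\<ge>r. tilting A (Theta P r s \<Delta> n)" using W.TR_self by (auto simp: til coh)
  next
    assume "\<forall>n\<ge>r. tilting A (Theta P r s \<Delta> n)"
    then have "\<And>i. i \<noteq> 0 \<Longrightarrow> VZ (W.TR r) (W.TR r) i" by (simp add: til)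
    then show "\<forall>i>0. cohomology_zero (\<Delta> r) i" using W.TR_self_imp by (auto simp: coh)
  qed
qed

end
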